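(* Let $p$ be a prime and let $\mathcal F$ be a fusion system over a discrete $p$-toral group $S$ such that $\mathrm{Aut}_{\mathcal F}(S_0)$ is finite, and such that for each $P\le S$ and each $\varphi\in\mathrm{Hom}_{\mathcal F}(P,S_0)$ there exists $\overline\varphi\in\mathrm{Hom}_{\mathcal F}(P\cdot C_S(P)_0,S_0)$ with $\overline\varphi|_P=\varphi$. Let $\mathcal H$ be a family of subgroups of $S$ which satisfies the following: (i) $\mathcal H$ is invariant under $\mathcal F$-conjugacy. (ii) $\mathcal H$ is closed in the set of all subgroups of $S$, and $\mathcal F$ is $\mathcal H$-generated and $\mathcal H$-saturated. (iii) For all $P\in\mathcal H$ and all $Q$ with $P\le Q\le P^\bullet$, $Q\in\mathcal H$. (iv) If $P\in\mathcal F^\bullet$ is $\mathcal F$-centric and $P\notin\mathcal H$, then there is $Q\in P^{\mathcal F}$ such that $O_p(\mathrm{Out}_{\mathcal F}(Q))\cap\mathrm{Out}_S(Q)\ne1$. Then $\mathcal F$ is saturated.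
   Context: Fix a prime $p$. A discrete $p$-toral group is a group $P$ with a normal subgroup $P_0\cong(\mathbb Z/p^\infty)^r$ (finite $r\ge0$; $P_0$ is the identity component) such that $P/P_0$ is a finite $p$-group; its order is $|P|=(r,|P/P_0|)$, and orders are compared lexicographically. Write $c_g(x)=gxg^{-1}$, $\mathrm{Hom}_S(P,Q)=\{c_g\mid g\in S,\ gPg^{-1}\le Q\}$, $\mathrm{Aut}_S(P)=\mathrm{Hom}_S(P,P)$. $O_p(\Gamma)$ denotes the largest normal $p$-subgroup of $\Gamma$. A fusion system $\mathcal F$ over a discrete $p$-toral group $S$ is a category whose objects are all subgroups of $S$, with $\mathrm{Hom}_S(P,Q)\subseteq\mathrm{Hom}_{\mathcal F}(P,Q)\subseteq\mathrm{Inj}(P,Q)$ (injective homomorphisms), in which every morphism factors as an isomorphism in $\mathcal F$ followed by an inclusion. Subgroups are $\mathcal F$-conjugate if isomorphic in $\mathcal F$; $P^{\mathcal F}$ is the $\mathcal F$-conjugacy class of $P$. $\mathrm{Out}_{\mathcal F}(P)=\mathrm{Aut}_{\mathcal F}(P)/\mathrm{Inn}(P)$, $\mathrm{Out}_S(P)=\mathrm{Aut}_S(P)/\mathrm{Inn}(P)$. $P$ is $\mathcal F$-centric if $C_S(Q)=Z(Q)$ for all $Q\in P^{\mathcal F}$. $P$ is fully centralized (fully normalized) in $\mathcal F$ if $|C_S(P)|\ge|C_S(Q)|$ (resp. $|N_S(P)|\ge|N_S(Q)|$) for all $Q\in P^{\mathcal F}$. For an injective homomorphism $\varphi$ from $P$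 to $S$, $N_\varphi=\{g\in N_S(P)\mid\varphi c_g\varphi^{-1}\in\mathrm{Aut}_S(\varphi(P))\}$. $\mathcal F$ is saturated if: (I) each fully normalized $P\le S$ is fully centralized, $\mathrm{Out}_{\mathcal F}(P)$ is finite, and $\mathrm{Out}_S(P)\in\mathrm{Syl}_p(\mathrm{Out}_{\mathcal F}(P))$; (II) each $\varphi\in\mathrm{Hom}_{\mathcal F}(P,S)$ with $\varphi(P)$ fully centralized extends to some $\overline\varphi\in\mathrm{Hom}_{\mathcal F}(N_\varphi,S)$; (III) if $P_1\le P_2\le\cdots$ are subgroups of $S$ with union $P_\infty$ and $\varphi\in\mathrm{Hom}(P_\infty,S)$ satisfies $\varphi|_{P_n}\in\mathrm{Hom}_{\mathcal F}(P_n,S)$ for all $n$, then $\varphi\in\mathrm{Hom}_{\mathcal F}(P_\infty,S)$. $P\le S$ is fully automized in $\mathcal F$ if the index of $\mathrm{Aut}_S(P)$ in $\mathrm{Aut}_{\mathcal F}(P)$ is finite and prime to $p$. $P$ is receptive in $\mathcal F$ if for each $Q\le S$ and each $\varphi\in\mathrm{Iso}_{\mathcal F}(Q,P)$ there is $\overline\varphi\in\mathrm{Hom}_{\mathcal F}(N_\varphi,S)$ with $\overline\varphi|_Q=\varphi$. A family $\mathcal H$ of subgroups of $S$ is closed (in the set of all subgroups of $S$) if the union of each increasing sequence $P_1<P_2<\cdots$ in $\mathcal H$ is in $\mathcal H$. For closed $\mathcal H$: $\mathcal F$ is $\mathcal H$-closed if for each sequence $P_1<P_2<\cdots$ in $\mathcal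 H$ with union $P$, and each $\varphi\in\mathrm{Hom}(P,S)$ with $\varphi|_{P_i}\in\mathrm{Hom}_{\mathcal F}(P_i,S)$ for all $i$, we have $\varphi\in\mathrm{Hom}_{\mathcal F}(P,S)$; $\mathcal F$ is $\mathcal H$-generated if every morphism in $\mathcal F$ is a composite of restrictions of morphisms in $\mathcal F$ between subgroups in $\mathcal H$; $\mathcal F$ is $\mathcal H$-saturated if it is $\mathcal H$-closed and every subgroup in $\mathcal H$ is $\mathcal F$-conjugate to a subgroup which is fully automized and receptive. Bullet construction: set $T=S_0$, $W=\mathrm{Aut}_{\mathcal F}(T)$, and let $p^m$ be the exponent of $S/T$. For $A\le T$ let $C_W(A)$ be the subgroup of elements of $W$ fixing $A$ pointwise and $I(A)=\{t\in T\mid w(t)=t\ \forall w\in C_W(A)\}$. For $P\le S$ set $P^{[m]}=\langle g^{p^m}\mid g\in P\rangle\le T$ and $P^\bullet=P\cdot I(P^{[m]})_0$, where $(-)_0$ denotes the identity component. $\mathcal F^\bullet=\{P^\bullet\mid P\le S\}$. *)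

theory Defs
  imports
    Complex_Main
    "HOL-Computational_Algebra.Primes"
    "HOL-Algebra.Product_Groups"
    "HOL-Algebra.Group_Action"
    "HOL-Algebra.Bij"
begin

section \<open>Discrete p-toral groups\<close>

text \<open>Subgroups of \<open>G\<close> are subsets \<open>P\<close> with \<open>subgroup P G\<close>; as a group, such a \<open>P\<close> is
  \<open>G\<lparr>carrier := P\<rparr>\<close>.\<close>

text \<open>\<open>\<int>/p\<^sup>\<infinity>\<close>, realised as the group of complex roots of unity of \<open>p\<close>-power order.\<close>

definition prufer_group :: "nat \<Rightarrow> complex monoid" where
  "prufer_group p = \<lparr>carrier = {z. \<exists>n::nat. z ^ (p ^ n) = 1}, mult = (*), one = 1\<rparr>"

text \<open>Not required to be finite.\<close>

definition p_group :: "nat \<Rightarrow> ('a, 'b) monoid_scheme \<Rightarrow> bool" where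
  "p_group p G \<longleftrightarrow>
     group G \<and> (\<forall>x\<in>carrier G. \<exists>n::nat. x [^]\<^bsub>G\<^esub> (p ^ n) = \<one>\<^bsub>G\<^esub>)"

definition is_identity_component ::
    "nat \<Rightarrow> ('a, 'b) monoid_scheme \<Rightarrow> 'a set \<Rightarrow> nat \<Rightarrow> bool" where
  "is_identity_component p G T r \<longleftrightarrow>
     T \<lhd> G \<and>
     G\<lparr>carrier := T\<rparr> \<cong> product_group {..<r} (\<lambda>_. prufer_group p) \<and>
     finite (carrier (G Mod T)) \<and> p_group p (G Mod T)"

definition discrete_p_toral :: "nat \<Rightarrow> ('a, 'b) monoid_scheme \<Rightarrow> bool" where
  "discrete_p_toral p G \<longleftrightarrow> group G \<and> (\<exists>T r. is_identity_component p G T r)"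

text \<open>For prime \<open>p\<close>, the identity component and the rank of a discrete \<open>p\<close>-toral group are
  unique: \<open>T\<close> is divisible, so it is contained in every subgroup of finite index, and it has
  \<open>p\<^sup>r\<close> elements of order dividing \<open>p\<close>.\<close>

definition identity_component :: "nat \<Rightarrow> ('a, 'b) monoid_scheme \<Rightarrow> 'a set" where
  "identity_component p G = (THE T. \<exists>r. is_identity_component p G T r)"

definition toral_rank :: "nat \<Rightarrow> ('a, 'b) monoid_scheme \<Rightarrow> nat" where
  "toral_rank p G = (THE r. \<exists>T. is_identity_component p G T r)"

definition toral_order :: "nat \<Rightarrow> ('a, 'b) monoid_scheme \<Rightarrow> nat \<times> nat" where
  "toral_order p G = (toral_rank p G, order (G Mod identity_component p G))"

text \<open>The lexicographic order is written out because the type class order on pairs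
  depends on the theories imported.\<close>

definition lex_le :: "nat \<times> nat \<Rightarrow> nat \<times> nat \<Rightarrow> bool" where
  "lex_le x y \<longleftrightarrow> (x, y) \<in> (less_than <*lex*> less_than)\<^sup>="


section \<open>General group theory\<close>

definition centralizer :: "('a, 'b) monoid_scheme \<Rightarrow> 'a set \<Rightarrow> 'a set" where
  "centralizer G P = {g \<in> carrier G. \<forall>x\<in>P. g \<otimes>\<^bsub>G\<^esub> x = x \<otimes>\<^bsub>G\<^esub> g}"

definition group_exponent :: "('a, 'b) monoid_scheme \<Rightarrow> nat" where
  "group_exponent G = (LEAST n. 0 < n \<and> (\<forall>x\<in>carrier G. x [^]\<^bsub>G\<^esub> n = \<one>\<^bsub>G\<^esub>))"

text \<open>Sylow \<open>p\<close>-subgroups; meant for finite \<open>G\<close>.\<close>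

definition sylow_subgroup :: "nat \<Rightarrow> ('a, 'b) monoid_scheme \<Rightarrow> 'a set \<Rightarrow> bool" where
  "sylow_subgroup p G H \<longleftrightarrow> subgroup H G \<and> card H = p ^ multiplicity p (order G)"

text \<open>\<open>O\<^sub>p(G)\<close>, the largest normal \<open>p\<close>-subgroup (largest for inclusion).\<close>

definition p_core :: "nat \<Rightarrow> ('a, 'b) monoid_scheme \<Rightarrow> 'a set" where
  "p_core p G = (GREATEST N. N \<lhd> G \<and> p_group p (G\<lparr>carrier := N\<rparr>))"


section \<open>Fusion systems\<close>

text \<open>A homomorphism with domain \<open>P\<close> is a function that is extensional on \<open>P\<close> (\<open>undefined\<close>
  outside \<open>P\<close>), so that homomorphisms are equal iff they agree on \<open>P\<close>, and they compose by
  \<^const>\<open>compose\<close>. The codomain is not recorded in the function.\<close>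

definition Hom_grp :: "('a, 'b) monoid_scheme \<Rightarrow> 'a set \<Rightarrow> 'a set \<Rightarrow> ('a \<Rightarrow> 'a) set" where
  "Hom_grp S P Q = hom (S\<lparr>carrier := P\<rparr>) (S\<lparr>carrier := Q\<rparr>) \<inter> extensional P"

definition Inj_grp :: "('a, 'b) monoid_scheme \<Rightarrow> 'a set \<Rightarrow> 'a set \<Rightarrow> ('a \<Rightarrow> 'a) set" where
  "Inj_grp S P Q = mon (S\<lparr>carrier := P\<rparr>) (S\<lparr>carrier := Q\<rparr>) \<inter> extensional P"

definition conj_map :: "('a, 'b) monoid_scheme \<Rightarrow> 'a set \<Rightarrow> 'a \<Rightarrow> 'a \<Rightarrow> 'a" where
  "conj_map S P g = (\<lambda>x\<in>P. g \<otimes>\<^bsub>S\<^esub> x \<otimes>\<^bsub>S\<^esub> inv\<^bsub>S\<^esub> g)"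

definition Hom_S :: "('a, 'b) monoid_scheme \<Rightarrow> 'a set \<Rightarrow> 'a set \<Rightarrow> ('a \<Rightarrow> 'a) set" where
  "Hom_S S P Q = {conj_map S P g | g. g \<in> carrier S \<and> conj_map S P g ` P \<subseteq> Q}"

definition Aut_S :: "('a, 'b) monoid_scheme \<Rightarrow> 'a set \<Rightarrow> ('a \<Rightarrow> 'a) set" where
  "Aut_S S P = Hom_S S P P"

definition Inn :: "('a, 'b) monoid_scheme \<Rightarrow> 'a set \<Rightarrow> ('a \<Rightarrow> 'a) set" where
  "Inn S P = conj_map S P ` P"

text \<open>\<open>F P Q\<close> is the set of morphisms from \<open>P\<close> to \<open>Q\<close>. It is only meaningful when \<open>P\<close> and
  \<open>Q\<close> are subgroups of \<open>S\<close>.\<close>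

type_synonym 'a fusion_homs = "'a set \<Rightarrow> 'a set \<Rightarrow> ('a \<Rightarrow> 'a) set"

definition Iso_F :: "'a fusion_homs \<Rightarrow> 'a set \<Rightarrow> 'a set \<Rightarrow> ('a \<Rightarrow> 'a) set" where
  "Iso_F F P Q =
     {f \<in> F P Q. \<exists>g\<in>F Q P. compose P g f = (\<lambda>x\<in>P. x) \<and> compose Q f g = (\<lambda>y\<in>Q. y)}"

definition Aut_F :: "'a fusion_homs \<Rightarrow> 'a set \<Rightarrow> ('a \<Rightarrow> 'a) set" where
  "Aut_F F P = Iso_F F P P"

text \<open>Identities need no separate axiom: they are conjugation by \<open>\<one>\<close>. The inclusion of \<open>R\<close>
  into \<open>Q\<close> is \<open>\<lambda>x\<in>R. x\<close>.\<close>

definition fusion_system :: "nat \<Rightarrow> ('a, 'b) monoid_scheme \<Rightarrow> 'a fusion_homs \<Rightarrow> bool" where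
  "fusion_system p S F \<longleftrightarrow>
     discrete_p_toral p S \<and>
     (\<forall>P Q. subgroup P S \<longrightarrow> subgroup Q S \<longrightarrow>
        Hom_S S P Q \<subseteq> F P Q \<and> F P Q \<subseteq> Inj_grp S P Q) \<and>
     (\<forall>P Q R. subgroup P S \<longrightarrow> subgroup Q S \<longrightarrow> subgroup R S \<longrightarrow>
        (\<forall>f\<in>F P Q. \<forall>g\<in>F Q R. compose P g f \<in> F P R)) \<and>
     (\<forall>P Q. subgroup P S \<longrightarrow> subgroup Q S \<longrightarrow>
        (\<forall>f\<in>F P Q. \<exists>R. subgroup R S \<and> R \<subseteq> Q \<and>
           (\<exists>h\<in>Iso_F F P R. f = compose P (\<lambda>x\<in>R. x) h)))"

definition conj_class ::
    "('a, 'b) monoid_scheme \<Rightarrow> 'a fusion_homs \<Rightarrow> 'a set \<Rightarrow> 'a set set" where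
  "conj_class S F P = {Q. subgroup Q S \<and> Iso_F F P Q \<noteq> {}}"

text \<open>Automorphism groups carry the composition of \<^const>\<open>BijGroup\<close>. The elements of
  \<open>Out_F\<close> and \<open>Out_S\<close> are cosets of \<open>Inn\<close>, so \<open>carrier (Out_S S P)\<close> is literally a subset of
  \<open>carrier (Out_F S F P)\<close>.\<close>

definition Aut_F_group :: "'a fusion_homs \<Rightarrow> 'a set \<Rightarrow> ('a \<Rightarrow> 'a) monoid" where
  "Aut_F_group F P = (BijGroup P)\<lparr>carrier := Aut_F F P\<rparr>"

definition Aut_S_group :: "('a, 'b) monoid_scheme \<Rightarrow> 'a set \<Rightarrow> ('a \<Rightarrow> 'a) monoid" where
  "Aut_S_group S P = (BijGroup P)\<lparr>carrier := Aut_S S P\<rparr>"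

definition Out_F ::
    "('a, 'b) monoid_scheme \<Rightarrow> 'a fusion_homs \<Rightarrow> 'a set \<Rightarrow> ('a \<Rightarrow> 'a) set monoid" where
  "Out_F S F P = Aut_F_group F P Mod Inn S P"

definition Out_S :: "('a, 'b) monoid_scheme \<Rightarrow> 'a set \<Rightarrow> ('a \<Rightarrow> 'a) set monoid" where
  "Out_S S P = Aut_S_group S P Mod Inn S P"

text \<open>\<open>centralizer (S\<lparr>carrier := Q\<rparr>) Q\<close> is the centre of \<open>Q\<close>.\<close>

definition F_centric :: "('a, 'b) monoid_scheme \<Rightarrow> 'a fusion_homs \<Rightarrow> 'a set \<Rightarrow> bool" where
  "F_centric S F P \<longleftrightarrow>
     (\<forall>Q\<in>conj_class S F P. centralizer S Q = centralizer (S\<lparr>carrier := Q\<rparr>) Q)"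

definition fully_centralized ::
    "nat \<Rightarrow> ('a, 'b) monoid_scheme \<Rightarrow> 'a fusion_homs \<Rightarrow> 'a set \<Rightarrow> bool" where
  "fully_centralized p S F P \<longleftrightarrow>
     (\<forall>Q\<in>conj_class S F P.
        lex_le (toral_order p (S\<lparr>carrier := centralizer S Q\<rparr>))
               (toral_order p (S\<lparr>carrier := centralizer S P\<rparr>)))"

definition fully_normalized ::
    "nat \<Rightarrow> ('a, 'b) monoid_scheme \<Rightarrow> 'a fusion_homs \<Rightarrow> 'a set \<Rightarrow> bool" where
  "fully_normalized p S F P \<longleftrightarrow>
     (\<forall>Q\<in>conj_class S F P.
        lex_le (toral_order p (S\<lparr>carrier := normalizer S Q\<rparr>))
               (toral_order p (S\<lparr>carrier := normalizer S P\<rparr>)))"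

text \<open>\<open>N\<^sub>\<phi>\<close> for an injective homomorphism \<open>\<phi>\<close> with domain \<open>P\<close>.\<close>

definition N_ext :: "('a, 'b) monoid_scheme \<Rightarrow> 'a set \<Rightarrow> ('a \<Rightarrow> 'a) \<Rightarrow> 'a set" where
  "N_ext S P \<phi> =
     {g \<in> normalizer S P.
        (\<lambda>y\<in>\<phi> ` P. \<phi> (conj_map S P g (inv_into P \<phi> y))) \<in> Aut_S S (\<phi> ` P)}"

definition saturated :: "nat \<Rightarrow> ('a, 'b) monoid_scheme \<Rightarrow> 'a fusion_homs \<Rightarrow> bool" where
  "saturated p S F \<longleftrightarrow>
     (\<forall>P. subgroup P S \<longrightarrow> fully_normalized p S F P \<longrightarrow>
        fully_centralized p S F P \<and> finite (carrier (Out_F S F P)) \<and>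
        sylow_subgroup p (Out_F S F P) (carrier (Out_S S P))) \<and>
     (\<forall>P. subgroup P S \<longrightarrow>
        (\<forall>\<phi>\<in>F P (carrier S). fully_centralized p S F (\<phi> ` P) \<longrightarrow>
           (\<exists>\<psi>\<in>F (N_ext S P \<phi>) (carrier S). restrict \<psi> P = \<phi>))) \<and>
     (\<forall>P :: nat \<Rightarrow> 'a set. (\<forall>n. subgroup (P n) S \<and> P n \<subseteq> P (Suc n)) \<longrightarrow>
        (\<forall>\<phi>\<in>Hom_grp S (\<Union>n. P n) (carrier S).
           (\<forall>n. restrict \<phi> (P n) \<in> F (P n) (carrier S)) \<longrightarrow>
           \<phi> \<in> F (\<Union>n. P n) (carrier S)))"

definition fully_automized ::
    "nat \<Rightarrow> ('a, 'b) monoid_scheme \<Rightarrow> 'a fusion_homs \<Rightarrow> 'a set \<Rightarrow> bool" where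
  "fully_automized p S F P \<longleftrightarrow>
     finite (rcosets\<^bsub>Aut_F_group F P\<^esub> Aut_S S P) \<and>
     coprime p (card (rcosets\<^bsub>Aut_F_group F P\<^esub> Aut_S S P))"

definition receptive :: "('a, 'b) monoid_scheme \<Rightarrow> 'a fusion_homs \<Rightarrow> 'a set \<Rightarrow> bool" where
  "receptive S F P \<longleftrightarrow>
     (\<forall>Q. subgroup Q S \<longrightarrow>
        (\<forall>\<phi>\<in>Iso_F F Q P. \<exists>\<psi>\<in>F (N_ext S Q \<phi>) (carrier S). restrict \<psi> Q = \<phi>))"


section \<open>Families of subgroups\<close>

definition closed_family :: "'a set set \<Rightarrow> bool" where
  "closed_family \<H> \<longleftrightarrow>
     (\<forall>P :: nat \<Rightarrow> 'a set. (\<forall>n. P n \<in> \<H> \<and> P n \<subset> P (Suc n)) \<longrightarrow> (\<Union>n. P n) \<in> \<H>)"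

definition family_closed ::
    "('a, 'b) monoid_scheme \<Rightarrow> 'a fusion_homs \<Rightarrow> 'a set set \<Rightarrow> bool" where
  "family_closed S F \<H> \<longleftrightarrow>
     (\<forall>P :: nat \<Rightarrow> 'a set. (\<forall>n. P n \<in> \<H> \<and> P n \<subset> P (Suc n)) \<longrightarrow>
        (\<forall>\<phi>\<in>Hom_grp S (\<Union>n. P n) (carrier S).
           (\<forall>n. restrict \<phi> (P n) \<in> F (P n) (carrier S)) \<longrightarrow>
           \<phi> \<in> F (\<Union>n. P n) (carrier S)))"

text \<open>\<open>composite_of_restrictions S F \<H> P Q \<phi>\<close>: the morphism \<open>\<phi>\<close> from \<open>P\<close> to \<open>Q\<close> is a
  composite of restrictions (of both domain and codomain) of morphisms in \<open>F\<close> between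
  members of \<open>\<H>\<close>.\<close>

inductive composite_of_restrictions ::
    "('a, 'b) monoid_scheme \<Rightarrow> 'a fusion_homs \<Rightarrow> 'a set set \<Rightarrow>
     'a set \<Rightarrow> 'a set \<Rightarrow> ('a \<Rightarrow> 'a) \<Rightarrow> bool"
  for S F \<H> where
  restriction:
    "\<lbrakk>P \<in> \<H>; Q \<in> \<H>; \<phi> \<in> F P Q; subgroup P' S; subgroup Q' S; P' \<subseteq> P; Q' \<subseteq> Q; \<phi> ` P' \<subseteq> Q'\<rbrakk>
     \<Longrightarrow> composite_of_restrictions S F \<H> P' Q' (restrict \<phi> P')"
| composition:
    "\<lbrakk>composite_of_restrictions S F \<H> P Q \<phi>; composite_of_restrictions S F \<H> Q R \<psi>\<rbrakk>
     \<Longrightarrow> composite_of_restrictions S F \<H> P R (compose P \<psi> \<phi>)"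

definition family_generated ::
    "('a, 'b) monoid_scheme \<Rightarrow> 'a fusion_homs \<Rightarrow> 'a set set \<Rightarrow> bool" where
  "family_generated S F \<H> \<longleftrightarrow>
     (\<forall>P Q. subgroup P S \<longrightarrow> subgroup Q S \<longrightarrow>
        (\<forall>\<phi>\<in>F P Q. composite_of_restrictions S F \<H> P Q \<phi>))"

definition family_saturated ::
    "nat \<Rightarrow> ('a, 'b) monoid_scheme \<Rightarrow> 'a fusion_homs \<Rightarrow> 'a set set \<Rightarrow> bool" where
  "family_saturated p S F \<H> \<longleftrightarrow>
     family_closed S F \<H> \<and>
     (\<forall>P\<in>\<H>. \<exists>Q\<in>conj_class S F P. fully_automized p S F Q \<and> receptive S F Q)"


section \<open>The bullet construction\<close>

text \<open>With \<open>T = S\<^sub>0\<close> and \<open>W = Aut\<^sub>F(T)\<close>, the subgroup \<open>C\<^sub>W(A)\<close>.\<close>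

definition C_W :: "nat \<Rightarrow> ('a, 'b) monoid_scheme \<Rightarrow> 'a fusion_homs \<Rightarrow> 'a set \<Rightarrow> ('a \<Rightarrow> 'a) set"
  where "C_W p S F A = {w \<in> Aut_F F (identity_component p S). \<forall>a\<in>A. w a = a}"

definition I_T :: "nat \<Rightarrow> ('a, 'b) monoid_scheme \<Rightarrow> 'a fusion_homs \<Rightarrow> 'a set \<Rightarrow> 'a set" where
  "I_T p S F A = {t \<in> identity_component p S. \<forall>w\<in>C_W p S F A. w t = t}"

text \<open>\<open>P\<^bsup>[m]\<^esup>\<close>. The number \<open>m\<close> is only used through \<open>p\<^sup>m\<close>, the exponent of \<open>S/S\<^sub>0\<close>.\<close>

definition power_subgroup :: "nat \<Rightarrow> ('a, 'b) monoid_scheme \<Rightarrow> 'a set \<Rightarrow> 'a set" where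
  "power_subgroup p S P =
     generate S {g [^]\<^bsub>S\<^esub> group_exponent (S Mod identity_component p S) | g. g \<in> P}"

definition bullet ::
    "nat \<Rightarrow> ('a, 'b) monoid_scheme \<Rightarrow> 'a fusion_homs \<Rightarrow> 'a set \<Rightarrow> 'a set" where
  "bullet p S F P =
     P <#>\<^bsub>S\<^esub> identity_component p (S\<lparr>carrier := I_T p S F (power_subgroup p S P)\<rparr>)"

definition F_bullet :: "nat \<Rightarrow> ('a, 'b) monoid_scheme \<Rightarrow> 'a fusion_homs \<Rightarrow> 'a set set" where
  "F_bullet p S F = bullet p S F ` {P. subgroup P S}"

end

theory Submission
  imports Defs "HOL-Number_Theory.Cong" "HOL-Algebra.Multiplicative_Group" "HOL-Algebra.Sylow"
begin

text \<open>A subgroup is called \<^emph>\<open>nice\<close> if it is conjugate to a fully automized, receptive subgroup. If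
  all subgroups are nice and \<open>\<F>\<close> is continuous along unions, then \<open>\<F>\<close> is saturated.

  The extension hypothesis makes every morphism \<open>P \<rightarrow> S\<close> act on the torus \<open>P\<^sup>\<bullet>\<^sub>0\<close> like an element of the
  finite group \<open>W\<close>. Hence morphisms between members of \<open>\<H>\<close> extend uniquely to bullet subgroups, and
  by \<open>\<H>\<close>-generation all morphisms do; there are only finitely many orders of bullet subgroups. This
  gives continuity, reduces niceness of \<open>P\<close> to that of \<open>P\<^sup>\<bullet>\<close>, and allows induction on the order of
  \<open>P\<^sup>\<bullet>\<close>, from large to small.

  For \<open>P = P\<^sup>\<bullet>\<close> outside \<open>\<H>\<close>, all proper overgroups of conjugates of \<open>P\<close> are nice, and each morphism
  defined on \<open>P\<close> is a composite of morphisms that extend to proper overgroups. It follows that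
  there is a conjugate \<open>R\<close> such that every conjugate \<open>Q\<close> admits a morphism \<open>N\<^sub>S(Q) \<rightarrow> N\<^sub>S(R)\<close> taking \<open>Q\<close>
  to \<open>R\<close>. Condition (iv), or non-centricity, provides a normal \<open>p\<close>-subgroup \<open>K\<close> of \<open>Aut\<^sub>F(R)\<close>
  containing \<open>Inn(R)\<close> for which \<open>M = {g \<in> N\<^sub>S(R). c\<^sub>g \<in> K}\<close> is larger than \<open>R\<close>. Normality of \<open>K\<close> allows
  extending each automorphism of \<open>R\<close> to \<open>M\<close>, and \<open>R\<close> inherits being fully automized and receptive from
  the nice subgroup \<open>M\<close>.\<close>

section \<open>Divisible abelian p-groups of finite rank\<close>

text \<open>Two infinities shape the proof. Aut_F(P) is infinite in general, because Inn(P) is, so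
  Sylow theory is replaced by counting cosets: a p-torsion group permuting a finite set of cosets
  whose size is prime to p has an orbit of size prime to p, hence a fixed coset. The notion
  \<open>coprime_index\<close> packages this, and every conjugation of automorphisms into Aut_S(U)
  comes from it. Moreover S may have infinite ascending chains of subgroups, so the order of P
  itself cannot drive an induction. Bullet subgroups can: I(A) depends only on a subset of the
  finite group W, and the component group of P^\<bullet> is bounded, so their orders fit into a
  bounded natural number \<open>depth\<close>. Saturation is phrased by maximal orders, while the
  induction produces maps N_S(Q) -> N_S(R). The link is that an injection of discrete p-toral groups
  never lowers the order and is onto if the orders agree. Identity components are given by an
  isomorphism with a power of the Pruefer group. This is traded for divisibility and a count of the
  elements killed by p, which can be followed through subgroups and injections.\<close>

definition divisible_p_group :: "nat \<Rightarrow> nat \<Rightarrow> ('a, 'b) monoid_scheme \<Rightarrow> bool" where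
  "divisible_p_group p r G \<longleftrightarrow>
     comm_group G \<and> (\<forall>x\<in>carrier G. \<exists>n::nat. x [^]\<^bsub>G\<^esub> (p ^ n) = \<one>\<^bsub>G\<^esub>) \<and>
     (\<forall>x\<in>carrier G. \<exists>y\<in>carrier G. y [^]\<^bsub>G\<^esub> p = x) \<and>
     finite {x\<in>carrier G. x [^]\<^bsub>G\<^esub> p = \<one>\<^bsub>G\<^esub>} \<and>
     card {x\<in>carrier G. x [^]\<^bsub>G\<^esub> p = \<one>\<^bsub>G\<^esub>} = p ^ r"

lemma hom_nat_pow:
  assumes "group G" "group H" "h \<in> hom G H" "x \<in> carrier G"
  shows "h (x [^]\<^bsub>G\<^esub> (n::nat)) = h x [^]\<^bsub>H\<^esub> n"
proof -
  interpret group_hom G H h using assms by (simp add: group_hom_def group_hom_axioms_def)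
  show ?thesis using hom_nat_pow assms by simp
qed

lemma divisible_p_group_iso:
  assumes "G \<cong> H" "group H" "divisible_p_group p r G"
  shows "divisible_p_group p r H"
proof -
  obtain h where h: "h \<in> iso G H" using assms(1) by (auto simp: is_iso_def)
  have cG: "comm_group G" using assms(3) by (simp add: divisible_p_group_def)
  interpret G: comm_group G by fact
  interpret H: group H by fact
  have cH: "comm_group H" by (rule G.iso_imp_comm_group) (use assms in \<open>auto intro: H.is_monoid\<close>)
  have hh: "h \<in> hom G H" and bij: "bij_betw h (carrier G) (carrier H)" using h by (auto simp: iso_def)
  have im: "h ` carrier G = carrier H" using bij by (simp add: bij_betw_def)
  have pw: "h (x [^]\<^bsub>G\<^esub> n) = h x [^]\<^bsub>H\<^esub> n" if "x \<in> carrier G" for x and n::nat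
    by (rule hom_nat_pow) (use that hh in \<open>auto intro: G.is_group H.is_group\<close>)
  have one: "h \<one>\<^bsub>G\<^esub> = \<one>\<^bsub>H\<^esub>" using hom_one[OF hh G.is_group H.is_group] .
  have eq1: "h x [^]\<^bsub>H\<^esub> n = \<one>\<^bsub>H\<^esub> \<longleftrightarrow> x [^]\<^bsub>G\<^esub> n = \<one>\<^bsub>G\<^esub>" if "x \<in> carrier G" for x and n::nat
    using pw[OF that, of n] one inj_onD[OF bij_betw_imp_inj_on[OF bij], of "x [^]\<^bsub>G\<^esub> n" "\<one>\<^bsub>G\<^esub>"] that
    by auto
  have set: "{x\<in>carrier H. x [^]\<^bsub>H\<^esub> p = \<one>\<^bsub>H\<^esub>} = h ` {x\<in>carrier G. x [^]\<^bsub>G\<^esub> p = \<one>\<^bsub>G\<^esub>}"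
    using eq1 by (auto simp flip: im)
  have inj: "inj_on h {x\<in>carrier G. x [^]\<^bsub>G\<^esub> p = \<one>\<^bsub>G\<^esub>}"
    using bij by (auto simp: bij_betw_def inj_on_def)
  show ?thesis
    unfolding divisible_p_group_def set
  proof (intro conjI ballI)
    fix x assume "x \<in> carrier H"
    then obtain g where g: "g \<in> carrier G" "x = h g" using im by auto
    then show "\<exists>n::nat. x [^]\<^bsub>H\<^esub> (p ^ n) = \<one>\<^bsub>H\<^esub>"
      using assms(3) eq1 by (auto simp: divisible_p_group_def)
    obtain y where y: "y \<in> carrier G" "y [^]\<^bsub>G\<^esub> p = g"
      using assms(3) g by (auto simp: divisible_p_group_def)
    then have "h y [^]\<^bsub>H\<^esub> p = x" using pw[OF y(1), of p] g by simp
    then show "\<exists>y\<in>carrier H. y [^]\<^bsub>H\<^esub> p = x" using y im by auto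
  qed (use cH assms(3) inj in \<open>auto simp: divisible_p_group_def card_image\<close>)
qed

subsection \<open>The Pruefer group\<close>

lemma prufer_comm_group:
  assumes "p > 0" shows "comm_group (prufer_group p)"
proof (rule comm_groupI)
  have ex: "(z * w) ^ (p ^ (n + m)) = 1" if "z ^ (p^n) = 1" "w ^ (p^m) = 1" for z w :: complex and n m
  proof -
    have "(z * w) ^ (p ^ (n + m)) = (z ^ (p ^ n)) ^ (p ^ m) * (w ^ (p ^ m)) ^ (p ^ n)"
      by (simp add: power_mult_distrib power_add mult.commute flip: power_mult)
    then show ?thesis using that by simp
  qed
  show "x \<otimes>\<^bsub>prufer_group p\<^esub> y \<in> carrier (prufer_group p)"
    if "x \<in> carrier (prufer_group p)" "y \<in> carrier (prufer_group p)" for x y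
    using that ex unfolding prufer_group_def by (simp, blast)
  show "\<exists>y\<in>carrier (prufer_group p). y \<otimes>\<^bsub>prufer_group p\<^esub> x = \<one>\<^bsub>prufer_group p\<^esub>"
    if x: "x \<in> carrier (prufer_group p)" for x
  proof -
    obtain n where n: "x ^ (p^n) = 1" using x by (auto simp: prufer_group_def)
    have "x \<noteq> 0" using n assms by (metis neq0_conv power_0_left zero_neq_one power_eq_0_iff)
    then show ?thesis using n by (intro bexI[of _ "inverse x"]) (auto simp: prufer_group_def power_inverse)
  qed
qed (auto simp: prufer_group_def)

lemma prufer_pow: "x [^]\<^bsub>prufer_group p\<^esub> (n::nat) = x ^ n"
  by (induction n) (auto simp: prufer_group_def)

lemma product_prufer_pow:
  assumes "x \<in> carrier (product_group I (\<lambda>_. prufer_group p))"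
  shows "x [^]\<^bsub>product_group I (\<lambda>_. prufer_group p)\<^esub> (n::nat) = (\<lambda>i\<in>I. x i ^ n)"
proof (induction n)
  case 0 then show ?case by (simp add: prufer_group_def)
next
  case (Suc n)
  then show ?case by (auto simp: prufer_group_def fun_eq_iff)
qed

text \<open>Only finitely many coordinates occur, so one exponent kills them all; p-th roots exist
  coordinatewise in the complex numbers; and the tuples killed by p are the r-tuples of p-th roots
  of unity.\<close>

lemma divisible_product_prufer:
  assumes "Factorial_Ring.prime p"
  shows "divisible_p_group p r (product_group {..<r} (\<lambda>_. prufer_group p))"
proof -
  let ?G = "product_group {..<r} (\<lambda>_. prufer_group p)"
  have p: "p > 0" using assms prime_gt_0_nat by blast
  interpret P: comm_group "prufer_group p" by (rule prufer_comm_group[OF p])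
  have "group ?G" by (simp add: P.is_group)
  then interpret G: group ?G .
  have comm: "comm_group ?G"
    by (rule G.group_comm_groupI) (auto simp: prufer_group_def fun_eq_iff mult.commute)
  have set: "{x\<in>carrier ?G. x [^]\<^bsub>?G\<^esub> p = \<one>\<^bsub>?G\<^esub>} = (\<Pi>\<^sub>E i\<in>{..<r}. {z. z ^ p = 1})"
  proof (intro equalityI subsetI)
    fix x assume x: "x \<in> {x\<in>carrier ?G. x [^]\<^bsub>?G\<^esub> p = \<one>\<^bsub>?G\<^esub>}"
    then have "(\<lambda>i\<in>{..<r}. x i ^ p) = (\<lambda>i\<in>{..<r}. 1)"
      using product_prufer_pow[of x "{..<r}" p p] by (auto simp: prufer_group_def)
    then have "x i ^ p = 1" if "i < r" for i using that by (metis lessThan_iff restrict_apply')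
    then show "x \<in> (\<Pi>\<^sub>E i\<in>{..<r}. {z. z ^ p = 1})" using x by (auto simp: PiE_def)
  next
    fix x :: "nat \<Rightarrow> complex" assume x: "x \<in> (\<Pi>\<^sub>E i\<in>{..<r}. {z. z ^ p = 1})"
    have "x i ^ (p ^ 1) = 1" if "i < r" for i using x that by auto
    then have "x \<in> carrier ?G" using x by (auto simp: prufer_group_def PiE_def Pi_def intro!: exI[of _ 1])
    moreover have "(\<lambda>i\<in>{..<r}. x i ^ p) = (\<lambda>i\<in>{..<r}. 1)" using x by (auto simp: fun_eq_iff)
    ultimately show "x \<in> {x\<in>carrier ?G. x [^]\<^bsub>?G\<^esub> p = \<one>\<^bsub>?G\<^esub>}"
      using product_prufer_pow[of x "{..<r}" p p] by (auto simp: prufer_group_def)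
  qed
  show ?thesis
    unfolding divisible_p_group_def set
  proof (intro conjI ballI)
    fix x assume x: "x \<in> carrier ?G"
    then have "\<exists>n. \<forall>i<r. \<exists>m\<le>n. x i ^ (p ^ m) = 1"
    proof -
      have "\<forall>i. i < r \<longrightarrow> (\<exists>m. x i ^ (p ^ m) = 1)" using x by (auto simp: prufer_group_def PiE_def Pi_def)
      then obtain m where m: "\<forall>i<r. x i ^ (p ^ m i) = 1" by metis
      have "\<forall>i<r. m i \<le> Max (m ` {..<r})" by simp
      then show ?thesis using m by blast
    qed
    then obtain n where n: "\<forall>i<r. \<exists>m\<le>n. x i ^ (p ^ m) = 1" by blast
    have "x i ^ (p ^ n) = 1" if i: "i < r" for i
    proof -
      obtain m where m: "m \<le> n" "x i ^ (p ^ m) = 1" using n i by blast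
      have "p ^ n = p ^ m * p ^ (n - m)" using m by (simp flip: power_add)
      then show ?thesis using m by (simp add: power_mult)
    qed
    then have "(\<lambda>i\<in>{..<r}. x i ^ (p ^ n)) = \<one>\<^bsub>?G\<^esub>" by (auto simp: prufer_group_def fun_eq_iff)
    then show "\<exists>n::nat. x [^]\<^bsub>?G\<^esub> (p ^ n) = \<one>\<^bsub>?G\<^esub>" using product_prufer_pow[OF x] by metis
    have root: "\<exists>w. w ^ p = x i" if "i < r" for i
    \<comment> \<open>The coordinates are roots of unity, so 0 never occurs; giving it a root is
      quicker than excluding it, as \<open>card_nth_roots\<close> asks for a nonzero number.\<close>
    proof (cases "x i = 0")
      case True then show ?thesis using p by (intro exI[of _ 0]) (simp add: power_0_left)
    next
      case False
      have "card {z. z ^ p = x i} = p" by (rule card_nth_roots) (use False p in auto)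
      then have "{z. z ^ p = x i} \<noteq> {}" using p by (metis card.empty less_numeral_extra(3))
      then show ?thesis by blast
    qed
    then obtain w where w: "\<forall>i<r. w i ^ p = x i" by metis
    have "restrict w {..<r} \<in> carrier ?G"
    proof -
      have "\<exists>n. w i ^ (p ^ n) = 1" if "i < r" for i
      proof -
        have "x i \<in> carrier (prufer_group p)" using x that by auto
        then obtain n where "x i ^ (p ^ n) = 1" by (auto simp: prufer_group_def)
        then have "w i ^ (p ^ Suc n) = 1" using w that by (metis power_Suc power_mult)
        then show ?thesis by blast
      qed
      then show ?thesis by (auto simp: prufer_group_def)
    qed
    moreover have "(\<lambda>i\<in>{..<r}. restrict w {..<r} i ^ p) = x"
      using w x by (auto simp: fun_eq_iff PiE_def extensional_def)
    ultimately show "\<exists>y\<in>carrier ?G. y [^]\<^bsub>?G\<^esub> p = x"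
      using product_prufer_pow by metis
  qed (use comm p in \<open>auto simp: finite_PiE finite_roots_unity card_PiE card_roots_unity_eq\<close>)
qed

subsection \<open>Chains of p-th roots\<close>

text \<open>The model is b n = exp(2 pi i / p^n): each term is a p-th root of the one before, and b
  1 \<noteq> 1 forces b n to have order exactly p^n for prime p.\<close>

definition p_chain :: "nat \<Rightarrow> ('a, 'b) monoid_scheme \<Rightarrow> (nat \<Rightarrow> 'a) \<Rightarrow> bool" where
  "p_chain p G b \<longleftrightarrow> (\<forall>n. b n \<in> carrier G) \<and> b 0 = \<one>\<^bsub>G\<^esub> \<and> b 1 \<noteq> \<one>\<^bsub>G\<^esub> \<and>
     (\<forall>n. b (Suc n) [^]\<^bsub>G\<^esub> p = b n)"

definition chain_set :: "('a, 'b) monoid_scheme \<Rightarrow> (nat \<Rightarrow> 'a) \<Rightarrow> 'a set" where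
  "chain_set G b = {b n [^]\<^bsub>G\<^esub> k | n k :: nat. True}"

context comm_group begin

lemma p_chain_add:
  assumes "p_chain p G b" shows "b (n + m) [^] (p ^ m) = b n"
proof (induction m)
  case (Suc m)
  have "b (Suc (n + m)) \<in> carrier G" using assms by (auto simp: p_chain_def)
  then have "b (n + Suc m) [^] (p ^ Suc m) = (b (Suc (n + m)) [^] p) [^] (p ^ m)"
    by (simp add: nat_pow_pow)
  then show ?case using Suc assms by (simp add: p_chain_def)
qed (use assms in \<open>simp add: p_chain_def\<close>)

lemma p_chain_ord:
  assumes "p_chain p G b" "Factorial_Ring.prime p" shows "ord (b n) = p ^ n"
proof -
  have b: "b n \<in> carrier G" for n using assms by (simp add: p_chain_def)
  have "b n [^] (p ^ n) = \<one>" using p_chain_add[OF assms(1), of 0 n] assms by (simp add: p_chain_def)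
  then have "ord (b n) dvd p ^ n" using pow_eq_id b by blast
  then obtain i where i: "i \<le> n" "ord (b n) = p ^ i" using divides_primepow_nat assms(2) by blast
  have "i = n"
  proof (rule ccontr)
    assume "i \<noteq> n"
    then have "i \<le> n - 1" and n: "n = Suc (n - 1)" using i by auto
    then have "ord (b n) dvd p ^ (n - 1)" using i by (simp add: le_imp_power_dvd)
    then have "b n [^] (p ^ (n - 1)) = \<one>" using pow_eq_id b by blast
    moreover have "b (1 + (n - 1)) [^] (p ^ (n - 1)) = b 1" by (rule p_chain_add[OF assms(1)])
    ultimately show False using n assms by (simp add: p_chain_def)
  qed
  then show ?thesis using i by simp
qed

text \<open>Both sides are powers of b (n + m), which has order p^(n+m). The resulting criterion
  does not mention the group, and this is what makes the groups generated by any two chains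
  isomorphic.\<close>

lemma p_chain_eq_iff:
  assumes "p_chain p G b" "Factorial_Ring.prime p"
  shows "b n [^] (k::nat) = b m [^] (l::nat) \<longleftrightarrow> [k * p ^ m = l * p ^ n] (mod p ^ (n + m))"
proof -
  have b: "b n \<in> carrier G" for n using assms by (simp add: p_chain_def)
  let ?c = "b (n + m)"
  have 1: "b n [^] k = ?c [^] (k * p ^ m)"
    using p_chain_add[OF assms(1), of n m] b by (metis mult.commute nat_pow_pow)
  have 2: "b m [^] l = ?c [^] (l * p ^ n)"
    using p_chain_add[OF assms(1), of m n] b by (metis mult.commute add.commute nat_pow_pow)
  have "?c [^] (k * p ^ m) = ?c [^] (l * p ^ n) \<longleftrightarrow> int (ord ?c) dvd int (l * p ^ n) - int (k * p ^ m)"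
    using int_pow_eq[OF b[of "n+m"], of "int (k * p ^ m)" "int (l * p ^ n)"] b by (metis int_pow_int)
  also have "\<dots> \<longleftrightarrow> [k * p ^ m = l * p ^ n] (mod p ^ (n + m))"
    by (metis cong_iff_dvd_diff cong_int_iff cong_sym_eq p_chain_ord[OF assms])
  finally show ?thesis using 1 2 by simp
qed

lemma p_chain_mult:
  assumes "p_chain p G b"
  shows "b n [^] (k::nat) \<otimes> b m [^] (l::nat) = b (n + m) [^] (k * p ^ m + l * p ^ n)"
proof -
  have b: "b n \<in> carrier G" for n using assms by (simp add: p_chain_def)
  have 1: "b n [^] k = b (n + m) [^] (k * p ^ m)"
    using p_chain_add[OF assms(1), of n m] b by (metis mult.commute nat_pow_pow)
  have 2: "b m [^] l = b (n + m) [^] (l * p ^ n)"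
    using p_chain_add[OF assms(1), of m n] b by (metis mult.commute add.commute nat_pow_pow)
  show ?thesis using 1 2 b by (simp add: nat_pow_mult)
qed

lemma chain_set_subgroup:
  assumes "p_chain p G b" "Factorial_Ring.prime p" shows "subgroup (chain_set G b) G"
proof
  have b: "b n \<in> carrier G" for n using assms by (simp add: p_chain_def)
  show "chain_set G b \<subseteq> carrier G" using b by (auto simp: chain_set_def)
  show "x \<otimes> y \<in> chain_set G b" if "x \<in> chain_set G b" "y \<in> chain_set G b" for x y
    using that p_chain_mult[OF assms(1)] unfolding chain_set_def by blast
  have "b 0 [^] (0::nat) \<in> chain_set G b" unfolding chain_set_def by blast
  then show "\<one> \<in> chain_set G b" by simp
  show "inv x \<in> chain_set G b" if x: "x \<in> chain_set G b" for x
  proof -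
    obtain n k where x: "x = b n [^] (k::nat)" using x unfolding chain_set_def by blast
    have "b n [^] (p ^ n) = \<one>" using p_chain_ord[OF assms] pow_ord_eq_1 b by metis
    then have "(b n [^] k) [^] (p ^ n) = \<one>" using b
      by (metis nat_pow_pow mult.commute nat_pow_one)
    moreover have "p ^ n > 0" using assms(2) prime_gt_0_nat by simp
    ultimately have "inv x = x [^] (p ^ n - 1)" using x b
      by (metis (no_types, lifting) Suc_diff_1 inv_equality nat_pow_Suc nat_pow_closed)
    then have "inv x = b n [^] (k * (p ^ n - 1))" using x b by (simp add: nat_pow_pow)
    then show ?thesis unfolding chain_set_def by blast
  qed
qed

end

lemma chain_set_iso:
  assumes G: "comm_group G" and H: "comm_group H" and b: "p_chain p G b" and c: "p_chain p H c"
    and p: "Factorial_Ring.prime p"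
  shows "G\<lparr>carrier := chain_set G b\<rparr> \<cong> H\<lparr>carrier := chain_set H c\<rparr>"
proof -
  interpret G: comm_group G by fact
  interpret H: comm_group H by fact
  have eq: "b n [^]\<^bsub>G\<^esub> (k::nat) = b m [^]\<^bsub>G\<^esub> (l::nat) \<longleftrightarrow> c n [^]\<^bsub>H\<^esub> k = c m [^]\<^bsub>H\<^esub> l" for n k m l
    using G.p_chain_eq_iff[OF b p] H.p_chain_eq_iff[OF c p] by simp
  \<comment> \<open>The description is well defined because equalities among the powers are the same
    in both groups.\<close>
  define h where "h x = (THE y. \<exists>n k::nat. x = b n [^]\<^bsub>G\<^esub> k \<and> y = c n [^]\<^bsub>H\<^esub> k)" for x
  have h: "h (b n [^]\<^bsub>G\<^esub> k) = c n [^]\<^bsub>H\<^esub> k" for n and k :: nat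
    unfolding h_def by (rule the_equality) (use eq in metis)+
  have "h \<in> iso (G\<lparr>carrier := chain_set G b\<rparr>) (H\<lparr>carrier := chain_set H c\<rparr>)"
  proof (rule isoI)
    show "h \<in> hom (G\<lparr>carrier := chain_set G b\<rparr>) (H\<lparr>carrier := chain_set H c\<rparr>)"
    proof (rule homI; simp)
      fix x y
      show "x \<in> chain_set G b \<Longrightarrow> h x \<in> chain_set H c"
        unfolding chain_set_def using h by blast
      assume "x \<in> chain_set G b" "y \<in> chain_set G b"
      then show "h (x \<otimes>\<^bsub>G\<^esub> y) = h x \<otimes>\<^bsub>H\<^esub> h y"
        unfolding chain_set_def by (auto simp: G.p_chain_mult[OF b] H.p_chain_mult[OF c] h)
    qed
    show "bij_betw h (carrier (G\<lparr>carrier := chain_set G b\<rparr>)) (carrier (H\<lparr>carrier := chain_set H c\<rparr>))"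
      unfolding bij_betw_def inj_on_def
      by (auto simp: chain_set_def h eq image_iff) (metis h)+
  qed
  then show ?thesis by (rule is_isoI)
qed

lemma prufer_chain:
  assumes p: "Factorial_Ring.prime p"
  shows "p_chain p (prufer_group p) (\<lambda>n. cis (2 * pi / real (p ^ n)))"
    and "chain_set (prufer_group p) (\<lambda>n. cis (2 * pi / real (p ^ n))) = carrier (prufer_group p)"
proof -
  have p0: "p > 0" "p \<ge> 2" using p prime_gt_0_nat prime_ge_2_nat by auto
  have one: "cis (2 * pi / real (p ^ n)) ^ (p ^ n) = 1" for n
    using p0 by (simp only: Complex.DeMoivre) simp
  have ne: "cis (2 * pi / real p) \<noteq> 1"
  proof
    assume "cis (2 * pi / real p) = 1"
    then have "cos (2 * pi / real p) = 1" by (simp add: complex_eq_iff)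
    then obtain k :: int where k: "2 * pi / real p = real_of_int k * 2 * pi" by (auto simp: cos_one_2pi_int)
    have "real_of_int k * real p = 1"
    proof -
      have "2 * pi * (real_of_int k * real p) = 2 * pi * 1" using k p0 by (simp add: field_simps)
      then show ?thesis by simp
    qed
    then have "k * int p = 1" by (metis of_int_eq_1_iff of_int_mult of_int_of_nat_eq)
    then show False using p0 by (simp add: zmult_eq_1_iff)
  qed
  have step: "cis (2 * pi / real (p ^ Suc n)) ^ p = cis (2 * pi / real (p ^ n))" for n
    using p0 by (simp only: Complex.DeMoivre) (simp add: field_simps)
  show "p_chain p (prufer_group p) (\<lambda>n. cis (2 * pi / real (p ^ n)))"
    unfolding p_chain_def prufer_pow using one ne step by (auto simp: prufer_group_def)
  show "chain_set (prufer_group p) (\<lambda>n. cis (2 * pi / real (p ^ n))) = carrier (prufer_group p)"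
  proof (intro equalityI subsetI)
    fix z assume "z \<in> chain_set (prufer_group p) (\<lambda>n. cis (2 * pi / real (p ^ n)))"
    then obtain n k where "z = cis (2 * pi / real (p ^ n)) ^ k" by (auto simp: chain_set_def prufer_pow)
    then have "z ^ (p ^ n) = 1" using one[of n] by (metis mult.commute power_mult power_one)
    then show "z \<in> carrier (prufer_group p)" by (auto simp: prufer_group_def)
  next
    fix z assume "z \<in> carrier (prufer_group p)"
    then obtain n where n: "z ^ (p ^ n) = 1" by (auto simp: prufer_group_def)
    have "bij_betw (\<lambda>k. cis (2 * pi * real k / real (p ^ n))) {..<p ^ n} {z. z ^ (p ^ n) = 1}"
      by (rule bij_betw_roots_unity) (use p0 in simp)
    then have "z \<in> (\<lambda>k. cis (2 * pi * real k / real (p ^ n))) ` {..<p ^ n}"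
      using n by (simp add: bij_betw_def)
    then obtain k :: nat where k: "z = cis (2 * pi * real k / real (p ^ n))" by auto
    have "cis (2 * pi / real (p ^ n)) ^ k = z" unfolding k by (simp add: Complex.DeMoivre field_simps)
    then show "z \<in> chain_set (prufer_group p) (\<lambda>n. cis (2 * pi / real (p ^ n)))"
      unfolding chain_set_def prufer_pow by blast
  qed
qed

lemma (in group) subgroup_nat_pow_closed:
  "\<lbrakk>subgroup H G; x \<in> H\<rbrakk> \<Longrightarrow> x [^] (n::nat) \<in> H"
  by (induction n) (auto simp: subgroup.one_closed subgroup.m_closed)

lemma (in comm_group) subgroup_imp_comm_group:
  "subgroup H G \<Longrightarrow> comm_group (G\<lparr>carrier := H\<rparr>)"
  by (rule group.group_comm_groupI)
    (auto simp: subgroup_imp_group intro!: m_comm dest: subgroup.mem_carrier)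

text \<open>Repeated p-th powers lead from x into H; the last power still outside H is the one
  wanted. It serves as an element of order p modulo H.\<close>

lemma (in group) exists_order_p_power:
  fixes p :: nat
  assumes "x \<in> carrier G" "x \<notin> H" "x [^] (p ^ n :: nat) \<in> H"
  obtains k where "x [^] (p ^ k) \<notin> H" "(x [^] (p ^ k)) [^] p \<in> H"
proof -
  define m where "m = (LEAST n. x [^] (p ^ n :: nat) \<in> H)"
  have m: "x [^] (p ^ m) \<in> H" unfolding m_def by (rule LeastI) (rule assms(3))
  have "m \<noteq> 0" using m assms by (metis nat_pow_eone power_0)
  then obtain k where k: "m = Suc k" by (metis not0_implies_Suc)
  have "x [^] (p ^ k) \<notin> H" using not_less_Least[of k "\<lambda>n. x [^] (p ^ n :: nat) \<in> H"] k m_def by auto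
  moreover have "(x [^] (p ^ k)) [^] p \<in> H" using m assms k by (simp add: nat_pow_pow mult.commute)
  ultimately show ?thesis using that by blast
qed

text \<open>Divisible abelian groups are injective. By Zorn's lemma take B maximal among the
  subgroups meeting A trivially. If AB were proper, some z outside AB would have its p-th power in
  AB; divisibility of A corrects z to y with y^p in B, and adjoining y to B still meets A trivially,
  against maximality.\<close>

lemma (in comm_group) divisible_subgroup_complement:
  fixes p :: nat
  assumes p: "Factorial_Ring.prime p"
    and tors: "\<And>x. x \<in> carrier G \<Longrightarrow> \<exists>n::nat. x [^] (p ^ n) = \<one>"
    and A: "subgroup A G" and dv: "\<And>x. x \<in> A \<Longrightarrow> \<exists>y\<in>A. y [^] p = x"
  obtains B where "subgroup B G" "A \<inter> B = {\<one>}" "A <#> B = carrier G"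
proof -
  define \<B> where "\<B> = {B. subgroup B G \<and> A \<inter> B = {\<one>}}"
  have A1: "\<one> \<in> A" using A subgroup.one_closed by blast
  have AC: "A \<subseteq> carrier G" using A subgroup.subset by blast
  have "{\<one>} \<in> \<B>" using A1 by (auto simp: \<B>_def triv_subgroup)
  moreover have "\<Union>C \<in> \<B>" if C: "C \<noteq> {}" "subset.chain \<B> C" for C
  proof -
    have sub: "\<And>B. B \<in> C \<Longrightarrow> subgroup B G \<and> A \<inter> B = {\<one>}"
      using C by (auto simp: subset.chain_def \<B>_def)
    have tot: "B \<subseteq> B' \<or> B' \<subseteq> B" if "B \<in> C" "B' \<in> C" for B B'
      using C that by (auto simp: subset.chain_def)
    have "subgroup (\<Union>C) G"
    proof
      show "\<Union>C \<subseteq> carrier G" using sub subgroup.subset by blast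
      show "\<one> \<in> \<Union>C" using C sub subgroup.one_closed by blast
      show "inv x \<in> \<Union>C" if "x \<in> \<Union>C" for x
        using that sub subgroup.m_inv_closed by (metis Union_iff)
      fix x y assume "x \<in> \<Union>C" "y \<in> \<Union>C"
      then obtain B B' where "B \<in> C" "B' \<in> C" "x \<in> B" "y \<in> B'" by blast
      then obtain D where "D \<in> C" "x \<in> D" "y \<in> D" using tot by blast
      then show "x \<otimes> y \<in> \<Union>C" using sub by (meson Union_iff subgroup.m_closed)
    qed
    then show ?thesis using sub C(1) by (auto simp: \<B>_def)
  qed
  ultimately obtain B where B: "B \<in> \<B>" and max: "\<And>X. X \<in> \<B> \<Longrightarrow> B \<subseteq> X \<Longrightarrow> X = B"
    using subset_Zorn_nonempty[of \<B>] by blast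
  have sB: "subgroup B G" and AB: "A \<inter> B = {\<one>}" using B by (auto simp: \<B>_def)
  have BC: "B \<subseteq> carrier G" using sB subgroup.subset by blast
  have sAB: "subgroup (A <#> B) G" using mult_subgroups[OF A sB] .
  have AsubAB: "A \<subseteq> A <#> B"
    using sB AC subgroup.one_closed[OF sB] unfolding set_mult_def by (force simp: r_one)
  have BsubAB: "B \<subseteq> A <#> B"
    using A1 BC unfolding set_mult_def by force
  have "carrier G \<subseteq> A <#> B"
  proof (rule ccontr)
    assume "\<not> carrier G \<subseteq> A <#> B"
    then obtain x where x: "x \<in> carrier G" "x \<notin> A <#> B" by blast
    obtain n where "x [^] (p ^ n :: nat) = \<one>" using tors x by blast
    then have "x [^] (p ^ n :: nat) \<in> A <#> B" using sAB subgroup.one_closed by metis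
    then obtain k where k: "x [^] (p ^ k) \<notin> A <#> B" "(x [^] (p ^ k)) [^] p \<in> A <#> B"
      using exists_order_p_power x by metis
    define z where "z = x [^] (p ^ k)"
    have z: "z \<in> carrier G" using x by (simp add: z_def)
    obtain a b where ab: "a \<in> A" "b \<in> B" "z [^] p = a \<otimes> b" using k(2) z_def by (auto simp: set_mult_def)
    obtain a' where a': "a' \<in> A" "a' [^] p = a" using dv ab by blast
    have car: "a \<in> carrier G" "b \<in> carrier G" "a' \<in> carrier G" using ab a' AC BC by auto
    \<comment> \<open>With z^p = a b and a = a'^p this removes the A-part: y^p = b.\<close>
    define y where "y = z \<otimes> inv a'"
    have y: "y \<in> carrier G" using z car by (simp add: y_def)
    have yp: "y [^] p = b"
    proof -
      have "y [^] p = z [^] p \<otimes> inv (a' [^] p)"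
        using z car by (simp add: y_def pow_mult_distrib m_comm nat_pow_inv)
      also have "\<dots> = a \<otimes> b \<otimes> inv a" using ab a' by simp
      also have "\<dots> = b" using car by (simp add: m_comm[of a b] m_assoc)
      finally show ?thesis .
    qed
    have ynot: "y \<notin> A <#> B"
    proof
      assume "y \<in> A <#> B"
      then have "y \<otimes> a' \<in> A <#> B" using AsubAB a' subgroup.m_closed[OF sAB] by auto
      moreover have "y \<otimes> a' = z" using z car by (simp add: y_def m_assoc)
      ultimately show False using k z_def by simp
    qed
    define D where "D = {b \<otimes> y [^] (k::int) | b k. b \<in> B}"
    have "subgroup D G"
    proof
      show "D \<subseteq> carrier G" using BC y by (auto simp: D_def)
      show "\<one> \<in> D" unfolding D_def
        using subgroup.one_closed[OF sB] by (auto intro!: exI[of _ \<one>] exI[of _ "0::int"])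
      fix u assume "u \<in> D"
      then obtain c k where c: "c \<in> B" "u = c \<otimes> y [^] (k::int)" by (auto simp: D_def)
      then have cc: "c \<in> carrier G" using BC by blast
      have "inv u = inv c \<otimes> y [^] (- k)" using c y cc by (simp add: inv_mult int_pow_neg)
      then show "inv u \<in> D" using c subgroup.m_inv_closed[OF sB] unfolding D_def by blast
      fix v assume "v \<in> D"
      then obtain d l where d: "d \<in> B" "v = d \<otimes> y [^] (l::int)" by (auto simp: D_def)
      then have dc: "d \<in> carrier G" using BC by blast
      have "u \<otimes> v = (c \<otimes> d) \<otimes> y [^] (k + l)"
        using c d cc dc y by (simp add: int_pow_mult m_ac)
      then show "u \<otimes> v \<in> D" using c d subgroup.m_closed[OF sB] unfolding D_def by blast
    qed
    moreover have "A \<inter> D = {\<one>}"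
    proof (intro equalityI subsetI)
      fix w assume w: "w \<in> A \<inter> D"
      then obtain c k where c: "c \<in> B" "w = c \<otimes> y [^] (k::int)" by (auto simp: D_def)
      then have cc: "c \<in> carrier G" using BC by blast
      show "w \<in> {\<one>}"
      proof (cases "int p dvd k")
        case True
        then obtain j where j: "k = int p * j" by blast
        have "y [^] k = b [^] j" using y yp j by (metis int_pow_int int_pow_pow)
        moreover have "b [^] j \<in> B" using subgroup_int_pow_closed[OF sB] ab by blast
        ultimately have "w \<in> B" using c subgroup.m_closed[OF sB] by simp
        then show ?thesis using w AB by auto
      next
        case False
        \<comment> \<open>Here y^k = c^-1 w lies in AB, and so does y^p; since k is prime to p,
          Bezout puts y itself into AB, which is excluded.\<close>
        then have "coprime (int p) k" using p by (simp add: prime_imp_coprime)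
        then obtain s t where st: "s * int p + t * k = 1"
          using bezout_int[of "int p" k] by auto
        have yk: "y [^] k \<in> A <#> B"
        proof -
          have "y [^] k = inv c \<otimes> w" using c cc y by (simp add: m_assoc[symmetric])
          then show ?thesis using w AsubAB BsubAB c subgroup.m_closed[OF sAB, of "inv c" w] subgroup.m_inv_closed[OF sAB, of c] by auto
        qed
        have ypk: "y [^] (int p) \<in> A <#> B" using yp ab BsubAB y by (auto simp: int_pow_int)
        have "y = y [^] (s * int p + t * k)" using st y by (simp add: int_pow_1)
        also have "\<dots> = (y [^] int p) [^] s \<otimes> (y [^] k) [^] t"
          using y by (simp add: int_pow_mult int_pow_pow mult.commute)
        also have "\<dots> \<in> A <#> B"
          using yk ypk subgroup_int_pow_closed[OF sAB] subgroup.m_closed[OF sAB] by simp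
        finally show ?thesis using ynot by blast
      qed
    qed (use A1 calculation subgroup.one_closed in auto)
    ultimately have "D \<in> \<B>" by (simp add: \<B>_def)
    moreover have "B \<subseteq> D"
    proof
      fix c assume "c \<in> B"
      then show "c \<in> D" unfolding D_def using BC by (auto intro!: exI[of _ c] exI[of _ "0::int"])
    qed
    ultimately have "D = B" using max by blast
    moreover have "y \<in> D"
      unfolding D_def using y subgroup.one_closed[OF sB]
      by (auto intro!: exI[of _ \<one>] exI[of _ "1::int"] simp: int_pow_1)
    ultimately show False using ynot BsubAB by blast
  qed
  moreover have "A <#> B \<subseteq> carrier G" using sAB subgroup.subset by blast
  ultimately have "A <#> B = carrier G" by simp
  with that sB AB show ?thesis by blast
qed

lemma iso_card_torsion:
  assumes "h \<in> iso G H" "group G" "group H"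
  shows "card {x\<in>carrier H. x [^]\<^bsub>H\<^esub> (p::nat) = \<one>\<^bsub>H\<^esub>} = card {x\<in>carrier G. x [^]\<^bsub>G\<^esub> p = \<one>\<^bsub>G\<^esub>}"
proof -
  have hh: "h \<in> hom G H" and bij: "bij_betw h (carrier G) (carrier H)" using assms by (auto simp: iso_def)
  have im: "h ` carrier G = carrier H" and inj: "inj_on h (carrier G)" using bij by (auto simp: bij_betw_def)
  have eq: "h x [^]\<^bsub>H\<^esub> p = \<one>\<^bsub>H\<^esub> \<longleftrightarrow> x [^]\<^bsub>G\<^esub> p = \<one>\<^bsub>G\<^esub>" if x: "x \<in> carrier G" for x
    using hom_nat_pow[OF assms(2,3) hh x, of p] hom_one[OF hh assms(2,3)]
      inj_onD[OF inj, of "x [^]\<^bsub>G\<^esub> p" "\<one>\<^bsub>G\<^esub>"] x assms(2)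
    by (metis group.is_monoid monoid.nat_pow_closed monoid.one_closed)
  have "{x\<in>carrier H. x [^]\<^bsub>H\<^esub> p = \<one>\<^bsub>H\<^esub>} = h ` {x\<in>carrier G. x [^]\<^bsub>G\<^esub> p = \<one>\<^bsub>G\<^esub>}"
    using eq by (auto simp flip: im)
  moreover have "inj_on h {x\<in>carrier G. x [^]\<^bsub>G\<^esub> p = \<one>\<^bsub>G\<^esub>}" using inj by (auto simp: inj_on_def)
  ultimately show ?thesis by (simp add: card_image)
qed

lemma (in comm_group) iso_internal_product:
  assumes A: "subgroup A G" and B: "subgroup B G" and AB: "A \<inter> B = {\<one>}" "A <#> B = carrier G"
  shows "(\<lambda>(a,b). a \<otimes> b) \<in> iso (G\<lparr>carrier := A\<rparr> \<times>\<times> G\<lparr>carrier := B\<rparr>) G"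
proof (rule isoI)
  have AC: "\<And>a. a \<in> A \<Longrightarrow> a \<in> carrier G" and BC: "\<And>b. b \<in> B \<Longrightarrow> b \<in> carrier G"
    using A B subgroup.subset by blast+
  show "(\<lambda>(a,b). a \<otimes> b) \<in> hom (G\<lparr>carrier := A\<rparr> \<times>\<times> G\<lparr>carrier := B\<rparr>) G"
    by (rule homI) (auto simp: AC BC m_ac)
  have "a = a' \<and> b = b'" if "a \<in> A" "b \<in> B" "a' \<in> A" "b' \<in> B" "a \<otimes> b = a' \<otimes> b'" for a b a' b'
  proof -
    have "inv a' \<otimes> a = b' \<otimes> inv b"
    proof -
      have c: "a \<in> carrier G" "b \<in> carrier G" "a' \<in> carrier G" "b' \<in> carrier G" using that AC BC by auto
      have "inv a' \<otimes> (a \<otimes> b) \<otimes> inv b = inv a' \<otimes> (a' \<otimes> b') \<otimes> inv b" using that by simp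
      then show ?thesis using c by (simp add: m_assoc) (simp flip: m_assoc)
    qed
    moreover have "inv a' \<otimes> a \<in> A" "b' \<otimes> inv b \<in> B"
      using that A B by (auto simp: subgroup.m_closed subgroup.m_inv_closed)
    ultimately have "inv a' \<otimes> a = \<one>" "b' \<otimes> inv b = \<one>" using AB by auto
    then show ?thesis using that AC BC
      by (metis inv_closed inv_equality inv_inv l_inv r_inv inv_unique' m_comm)
  qed
  then have "inj_on (\<lambda>(a,b). a \<otimes> b) (A \<times> B)" by (auto simp: inj_on_def)
  moreover have "(\<lambda>(a,b). a \<otimes> b) ` (A \<times> B) = carrier G"
    unfolding AB(2)[symmetric] set_mult_def by auto
  ultimately show "bij_betw (\<lambda>(a,b). a \<otimes> b) (carrier (G\<lparr>carrier := A\<rparr> \<times>\<times> G\<lparr>carrier := B\<rparr>)) (carrier G)"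
    by (simp add: bij_betw_def)
qed

lemma product_group_Suc_iso:
  assumes "group P"
  shows "(\<lambda>(a,f). f(r := a)) \<in> iso (P \<times>\<times> product_group {..<r} (\<lambda>_. P)) (product_group {..<Suc r} (\<lambda>_. P))"
proof (rule isoI)
  show "(\<lambda>(a,f). f(r := a)) \<in> hom (P \<times>\<times> product_group {..<r} (\<lambda>_. P)) (product_group {..<Suc r} (\<lambda>_. P))"
    by (rule homI) (auto simp: fun_eq_iff PiE_def Pi_def extensional_def)
  have inj: "inj_on (\<lambda>(a,f). f(r := a)) (carrier P \<times> (\<Pi>\<^sub>E i\<in>{..<r}. carrier P))"
  proof (rule inj_onI, clarify)
    fix a f a' f' assume f: "f \<in> (\<Pi>\<^sub>E i\<in>{..<r}. carrier P)" "f' \<in> (\<Pi>\<^sub>E i\<in>{..<r}. carrier P)"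
      and eq: "f(r := a) = f'(r := a')"
    have "a = a'" using fun_cong[OF eq, of r] by simp
    moreover have "f i = f' i" for i
    proof (cases "i = r")
      case True then show ?thesis using f by (auto simp: PiE_def extensional_def)
    qed (use fun_cong[OF eq, of i] in simp)
    ultimately show "a = a' \<and> f = f'" by auto
  qed
  have "g \<in> (\<lambda>(a,f). f(r := a)) ` (carrier P \<times> (\<Pi>\<^sub>E i\<in>{..<r}. carrier P))"
    if g: "g \<in> (\<Pi>\<^sub>E i\<in>{..<Suc r}. carrier P)" for g
  proof (rule image_eqI[of _ _ "(g r, restrict g {..<r})"])
    have g': "\<forall>i<Suc r. g i \<in> carrier P" "\<forall>i. \<not> i < Suc r \<longrightarrow> g i = undefined"
      using g by (auto simp: PiE_iff extensional_def)
    then show "g = (\<lambda>(a,f). f(r := a)) (g r, restrict g {..<r})"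
      by (simp add: fun_eq_iff less_Suc_eq)
    show "(g r, restrict g {..<r}) \<in> carrier P \<times> (\<Pi>\<^sub>E i\<in>{..<r}. carrier P)"
      using g' by (simp add: PiE_iff)
  qed
  moreover have "f(r := a) \<in> (\<Pi>\<^sub>E i\<in>{..<Suc r}. carrier P)"
    if "a \<in> carrier P" "f \<in> (\<Pi>\<^sub>E i\<in>{..<r}. carrier P)" for a f
  proof -
    have "\<forall>i<r. f i \<in> carrier P" "\<forall>i. \<not> i < r \<longrightarrow> f i = undefined"
      using that(2) by (auto simp: PiE_iff extensional_def)
    then show ?thesis using that(1) by (auto simp: PiE_iff extensional_def less_Suc_eq)
  qed
  then have "(\<lambda>(a,f). f(r := a)) ` (carrier P \<times> (\<Pi>\<^sub>E i\<in>{..<r}. carrier P)) \<subseteq> (\<Pi>\<^sub>E i\<in>{..<Suc r}. carrier P)"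
    by (simp only: image_subset_iff) (simp only: split_paired_Ball_Sigma prod.case, blast)
  ultimately show "bij_betw (\<lambda>(a,f). f(r := a)) (carrier (P \<times>\<times> product_group {..<r} (\<lambda>_. P))) (carrier (product_group {..<Suc r} (\<lambda>_. P)))"
    using inj unfolding bij_betw_def by auto
qed

lemma (in comm_group) divisible_p_group_zero:
  assumes "divisible_p_group p 0 G"
  shows "carrier G = {\<one>}"
proof -
  have "x = \<one>" if x: "x \<in> carrier G" for x
  proof (rule ccontr)
    assume "x \<noteq> \<one>"
    moreover obtain n where "x [^] (p ^ n :: nat) = \<one>" using assms x by (auto simp: divisible_p_group_def)
    ultimately obtain k where k: "x [^] (p ^ k) \<notin> {\<one>}" "(x [^] (p ^ k)) [^] p \<in> {\<one>}"
      using exists_order_p_power[of x "{\<one>}" p n] x by auto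
    have "card {x\<in>carrier G. x [^] p = \<one>} = 1" using assms by (simp add: divisible_p_group_def)
    then obtain y where y: "{x\<in>carrier G. x [^] p = \<one>} = {y}" by (rule card_1_singletonE)
    have "\<one> \<in> {x\<in>carrier G. x [^] p = \<one>}" by simp
    moreover have "x [^] (p ^ k) \<in> {x\<in>carrier G. x [^] p = \<one>}" using k x by simp
    ultimately show False using y k by (metis singletonD singletonI)
  qed
  then show ?thesis by auto
qed

text \<open>An element of order p starts a chain of p-th roots, whose powers form a divisible
  subgroup A isomorphic to the Pruefer group, so A has a complement B. The rank drops by one because
  the elements killed by p split as a product, with exactly p of them in A.\<close>

lemma (in comm_group) divisible_p_group_split:
  assumes p: "Factorial_Ring.prime p" and "divisible_p_group p (Suc r) G"
  obtains A B where "subgroup A G" "subgroup B G" "A \<inter> B = {\<one>}" "A <#> B = carrier G"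
    "G\<lparr>carrier := A\<rparr> \<cong> prufer_group p" "divisible_p_group p r (G\<lparr>carrier := B\<rparr>)"
proof -
  have tors: "\<And>x. x \<in> carrier G \<Longrightarrow> \<exists>n::nat. x [^] (p ^ n) = \<one>"
    and dv: "\<And>x. x \<in> carrier G \<Longrightarrow> \<exists>y\<in>carrier G. y [^] p = x"
    and fin: "finite {x\<in>carrier G. x [^] p = \<one>}" and crd: "card {x\<in>carrier G. x [^] p = \<one>} = p ^ Suc r"
    using assms(2) by (auto simp: divisible_p_group_def)
  have p1: "p > 1" using p prime_gt_1_nat by blast
  have "\<exists>a\<in>carrier G. a [^] p = \<one> \<and> a \<noteq> \<one>"
  proof (rule ccontr)
    assume "\<not> ?thesis"
    then have "{x\<in>carrier G. x [^] p = \<one>} \<subseteq> {\<one>}" by blast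
    then have "card {x\<in>carrier G. x [^] p = \<one>} \<le> card {\<one>}" by (intro card_mono) auto
    then have "p ^ Suc r \<le> 1" using crd by simp
    then show False using p1 by (metis one_less_power zero_less_Suc not_le)
  qed
  then obtain a where a: "a \<in> carrier G" "a [^] p = \<one>" "a \<noteq> \<one>" by blast
  obtain g where g: "\<And>x. x \<in> carrier G \<Longrightarrow> g x \<in> carrier G \<and> g x [^] p = x" using dv by metis
  \<comment> \<open>b 1 = a, and each later term is a chosen p-th root; the extra term b 0 = 1 makes
    the index n match the order p^n.\<close>
  define b where "b n = (case n of 0 \<Rightarrow> \<one> | Suc k \<Rightarrow> (g ^^ k) a)" for n
  have gk: "(g ^^ k) a \<in> carrier G" for k by (induction k) (use a g in auto)
  have chain: "p_chain p G b"
    unfolding p_chain_def using gk a g by (auto simp: b_def split: nat.splits)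
  let ?A = "chain_set G b"
  have A: "subgroup ?A G" by (rule chain_set_subgroup[OF chain p])
  have bc: "b n \<in> carrier G" for n using chain by (simp add: p_chain_def)
  have dA: "\<exists>y\<in>?A. y [^] p = x" if x: "x \<in> ?A" for x
  proof -
    obtain n k where "x = b n [^] (k::nat)" using x by (auto simp: chain_set_def)
    then have "(b (Suc n) [^] k) [^] p = x" using chain bc
      by (metis mult.commute nat_pow_pow p_chain_def)
    then show ?thesis unfolding chain_set_def by blast
  qed
  obtain B where B: "subgroup B G" "?A \<inter> B = {\<one>}" "?A <#> B = carrier G"
    using divisible_subgroup_complement[OF p tors A dA] by blast
  have AC: "\<And>a. a \<in> ?A \<Longrightarrow> a \<in> carrier G" and BC: "\<And>b. b \<in> B \<Longrightarrow> b \<in> carrier G"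
    using A B subgroup.subset by blast+
  let ?P = "prufer_group p"
  have cP: "comm_group ?P" using p1 by (intro prufer_comm_group) simp
  then have gP: "group ?P" by (simp add: comm_group_def)
  have gA: "group (G\<lparr>carrier := ?A\<rparr>)" using A by (simp add: subgroup_imp_group)
  have "G\<lparr>carrier := ?A\<rparr> \<cong> ?P\<lparr>carrier := chain_set ?P (\<lambda>n. cis (2 * pi / real (p ^ n)))\<rparr>"
    by (rule chain_set_iso[OF comm_group_axioms cP chain prufer_chain(1)[OF p] p])
  then have isoA: "G\<lparr>carrier := ?A\<rparr> \<cong> ?P" unfolding prufer_chain(2)[OF p] by simp
  have cardA: "card {x\<in>?A. x [^] p = \<one>} = p"
  proof -
    obtain h where h: "h \<in> iso (G\<lparr>carrier := ?A\<rparr>) ?P" using isoA by (auto simp: is_iso_def)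
    have "{x \<in> carrier ?P. x [^]\<^bsub>?P\<^esub> p = \<one>\<^bsub>?P\<^esub>} = {z. z ^ p = 1}"
      unfolding prufer_pow by (auto simp: prufer_group_def intro: exI[of _ 1])
    then have "card {x \<in> carrier ?P. x [^]\<^bsub>?P\<^esub> p = \<one>\<^bsub>?P\<^esub>} = p"
      using p1 by (simp add: card_roots_unity_eq)
    then show ?thesis using iso_card_torsion[OF h gA gP, of p] by (simp add: nat_pow_consistent[symmetric])
  qed
  have iso: "(\<lambda>(a,b). a \<otimes> b) \<in> iso (G\<lparr>carrier := ?A\<rparr> \<times>\<times> G\<lparr>carrier := B\<rparr>) G"
    by (rule iso_internal_product[OF A B])
  have split: "(x \<otimes> y) [^] p = x [^] p \<otimes> y [^] p" if "x \<in> ?A" "y \<in> B" for x y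
    using that AC BC by (simp add: pow_mult_distrib m_comm)
  have trivial: "x [^] p = \<one> \<and> y [^] p = w" if "x \<in> ?A" "y \<in> B" "w \<in> B" "(x \<otimes> y) [^] p = w" for x y w
  proof -
    have c: "x \<in> carrier G" "y \<in> carrier G" "w \<in> carrier G" using that AC BC by auto
    have "w = x [^] p \<otimes> y [^] p" using that split by simp
    then have "x [^] p = w \<otimes> inv (y [^] p)" using c by (simp add: m_assoc)
    moreover have "w \<otimes> inv (y [^] p) \<in> B"
      using that B(1) by (simp add: subgroup.m_closed subgroup.m_inv_closed subgroup_nat_pow_closed)
    moreover have "x [^] p \<in> ?A" using that A by (simp add: subgroup_nat_pow_closed)
    ultimately have "x [^] p = \<one>" using B(2) by auto
    then show ?thesis using that split c by simp
  qed
  have "divisible_p_group p r (G\<lparr>carrier := B\<rparr>)"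
    unfolding divisible_p_group_def
  proof (intro conjI ballI)
    show "comm_group (G\<lparr>carrier := B\<rparr>)" using B(1) by (simp add: subgroup_imp_comm_group)
    fix x assume x: "x \<in> carrier (G\<lparr>carrier := B\<rparr>)"
    then show "\<exists>n::nat. x [^]\<^bsub>G\<lparr>carrier := B\<rparr>\<^esub> (p ^ n) = \<one>\<^bsub>G\<lparr>carrier := B\<rparr>\<^esub>"
      using tors BC by (simp add: nat_pow_consistent[symmetric])
    obtain y where y: "y \<in> carrier G" "y [^] p = x" using dv BC x by auto
    have "y \<in> ?A <#> B" using y B(3) by simp
    then obtain c d where "c \<in> ?A" "d \<in> B" "y = c \<otimes> d" by (auto simp: set_mult_def)
    then show "\<exists>y\<in>carrier (G\<lparr>carrier := B\<rparr>). y [^]\<^bsub>G\<lparr>carrier := B\<rparr>\<^esub> p = x"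
      using trivial[of c d x] y x by (auto simp: nat_pow_consistent[symmetric])
  next
    let ?t = "{x \<in> B. x [^] p = \<one>}"
    show "finite {x \<in> carrier (G\<lparr>carrier := B\<rparr>). x [^]\<^bsub>G\<lparr>carrier := B\<rparr>\<^esub> p = \<one>\<^bsub>G\<lparr>carrier := B\<rparr>\<^esub>}"
      using finite_subset[OF _ fin, of ?t] BC by (auto simp: nat_pow_consistent[symmetric])
    have "bij_betw (\<lambda>(a,b). a \<otimes> b) ({x\<in>?A. x [^] p = \<one>} \<times> ?t) {x\<in>carrier G. x [^] p = \<one>}"
      unfolding bij_betw_def
    proof
      show "inj_on (\<lambda>(a,b). a \<otimes> b) ({x\<in>?A. x [^] p = \<one>} \<times> ?t)"
        using iso by (auto simp: iso_def bij_betw_def inj_on_def)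
      have "\<one> \<in> B" using B(1) subgroup.one_closed by blast
      then have "x \<in> (\<lambda>(a,b). a \<otimes> b) ` ({x\<in>?A. x [^] p = \<one>} \<times> ?t)" if "x \<in> carrier G" "x [^] p = \<one>" for x
      proof -
        have "x \<in> ?A <#> B" using that B(3) by simp
        then obtain c d where cd: "c \<in> ?A" "d \<in> B" "x = c \<otimes> d" by (auto simp: set_mult_def)
        then have "c [^] p = \<one>" "d [^] p = \<one>" using trivial[of c d \<one>] that \<open>\<one> \<in> B\<close> by auto
        then show ?thesis using cd by (intro image_eqI[of _ _ "(c, d)"]) auto
      qed
      moreover have "(\<lambda>(a,b). a \<otimes> b) ` ({x\<in>?A. x [^] p = \<one>} \<times> ?t) \<subseteq> {x\<in>carrier G. x [^] p = \<one>}"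
        using split AC BC by auto
      ultimately show "(\<lambda>(a,b). a \<otimes> b) ` ({x\<in>?A. x [^] p = \<one>} \<times> ?t) = {x\<in>carrier G. x [^] p = \<one>}" by blast
    qed
    then have "p * card ?t = p ^ Suc r" using bij_betw_same_card[of "\<lambda>(a,b). a \<otimes> b" "{x\<in>?A. x [^] p = \<one>} \<times> ?t"] crd cardA
      by (simp only: card_cartesian_product)
    then show "card {x \<in> carrier (G\<lparr>carrier := B\<rparr>). x [^]\<^bsub>G\<lparr>carrier := B\<rparr>\<^esub> p = \<one>\<^bsub>G\<lparr>carrier := B\<rparr>\<^esub>} = p ^ r"
      using p1 by (simp add: nat_pow_consistent[symmetric])
  qed
  then show ?thesis using that[OF A B isoA] by blast
qed

text \<open>Peels off one Pruefer factor at a time. It allows \<open>is_identity_component\<close>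
  to be tested by divisibility and by counting elements killed by p, conditions that can be checked
  in subgroups, where no isomorphism is at hand.\<close>

theorem divisible_p_group_classification:
  fixes G :: "('a, 'b) monoid_scheme"
  assumes p: "Factorial_Ring.prime p"
  shows "divisible_p_group p r G \<Longrightarrow> G \<cong> product_group {..<r} (\<lambda>_. prufer_group p)"
proof (induction r arbitrary: G)
  case 0
  then have "comm_group G" by (simp add: divisible_p_group_def)
  then have "carrier G = {\<one>\<^bsub>G\<^esub>}" "group G"
    using comm_group.divisible_p_group_zero 0 by (auto simp: comm_group_def)
  then have "(\<lambda>_ _. undefined) \<in> iso G (product_group {..<0::nat} (\<lambda>_. prufer_group p))"
    by (intro isoI homI) (auto simp: bij_betw_def group.is_monoid)
  then show ?case by (rule is_isoI)
next
  case (Suc r)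
  have cG: "comm_group G" using Suc.prems by (simp add: divisible_p_group_def)
  then have gG: "group G" by (simp add: comm_group_def)
  let ?P = "prufer_group p"
  have gP: "group ?P" using prufer_comm_group[of p] p prime_gt_0_nat by (auto simp: comm_group_def)
  obtain A B where A: "subgroup A G" and B: "subgroup B G" "A \<inter> B = {\<one>\<^bsub>G\<^esub>}" "A <#>\<^bsub>G\<^esub> B = carrier G"
    and isoA: "G\<lparr>carrier := A\<rparr> \<cong> ?P" and dB: "divisible_p_group p r (G\<lparr>carrier := B\<rparr>)"
    using comm_group.divisible_p_group_split[OF cG p Suc.prems] by blast
  have gA: "group (G\<lparr>carrier := A\<rparr>)" using A gG by (simp add: group.subgroup_imp_group)
  have gB: "group (G\<lparr>carrier := B\<rparr>)" using B gG by (simp add: group.subgroup_imp_group)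
  have iso: "(\<lambda>(a,b). a \<otimes>\<^bsub>G\<^esub> b) \<in> iso (G\<lparr>carrier := A\<rparr> \<times>\<times> G\<lparr>carrier := B\<rparr>) G"
    by (rule comm_group.iso_internal_product[OF cG A B])
  from dB have isoB: "G\<lparr>carrier := B\<rparr> \<cong> product_group {..<r} (\<lambda>_. ?P)" by (rule Suc.IH)
  have "G\<lparr>carrier := A\<rparr> \<times>\<times> G\<lparr>carrier := B\<rparr> \<cong> ?P \<times>\<times> product_group {..<r} (\<lambda>_. ?P)"
  proof -
    obtain h k where "h \<in> iso (G\<lparr>carrier := A\<rparr>) ?P" "k \<in> iso (G\<lparr>carrier := B\<rparr>) (product_group {..<r} (\<lambda>_. ?P))"
      using isoA isoB by (auto simp: is_iso_def)
    then have "(\<lambda>(x,y). (h x, k y)) \<in> iso (G\<lparr>carrier := A\<rparr> \<times>\<times> G\<lparr>carrier := B\<rparr>) (?P \<times>\<times> product_group {..<r} (\<lambda>_. ?P))"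
      using iso_paired2[OF gA gB] by blast
    then show ?thesis by (rule is_isoI)
  qed
  moreover have "\<dots> \<cong> product_group {..<Suc r} (\<lambda>_. ?P)"
    using product_group_Suc_iso[OF gP] by (rule is_isoI)
  moreover have "G \<cong> G\<lparr>carrier := A\<rparr> \<times>\<times> G\<lparr>carrier := B\<rparr>"
    using group.iso_sym[OF DirProd_group[OF gA gB] is_isoI[OF iso]] .
  ultimately show ?case by (metis iso_trans)
qed

section \<open>Subgroups of index prime to p\<close>

text \<open>A prime q \<noteq> p dividing the order would give, inside a subgroup of order q, a
  nontrivial element whose order divides both q and a power of p.\<close>

lemma finite_p_group_order:
  assumes "group G" "finite (carrier G)" and p: "Factorial_Ring.prime p"
    and tors: "\<And>x. x \<in> carrier G \<Longrightarrow> \<exists>n::nat. x [^]\<^bsub>G\<^esub> (p ^ n) = \<one>\<^bsub>G\<^esub>"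
  shows "\<exists>k. order G = p ^ k"
proof -
  interpret group G by fact
  have pos: "order G > 0" using assms(2) by (simp add: order_gt_0_iff_finite)
  have "q = p" if q: "Factorial_Ring.prime q" "q dvd order G" for q
  proof (rule ccontr)
    assume ne: "q \<noteq> p"
    obtain m where "order G = q ^ 1 * m" using q by auto
    then obtain H where H: "subgroup H G" "card H = q ^ 1" using sylow_thm[OF q(1) is_group _ assms(2), of 1 m] by auto
    have "H \<noteq> {\<one>\<^bsub>G\<^esub>}" using H q by (auto simp: prime_nat_iff)
    then obtain x where x: "x \<in> H" "x \<noteq> \<one>\<^bsub>G\<^esub>" using H subgroup.one_closed by blast
    have xG: "x \<in> carrier G" using x H subgroup.subset by blast
    obtain n where "x [^]\<^bsub>G\<^esub> (p ^ n) = \<one>\<^bsub>G\<^esub>" using tors xG by blast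
    then have 1: "group.ord G x dvd p ^ n" using pow_eq_id xG by blast
    have "group (G\<lparr>carrier := H\<rparr>)" using H by (simp add: subgroup_imp_group)
    then have "x [^]\<^bsub>G\<lparr>carrier := H\<rparr>\<^esub> order (G\<lparr>carrier := H\<rparr>) = \<one>\<^bsub>G\<lparr>carrier := H\<rparr>\<^esub>"
      using group.pow_order_eq_1 x by fastforce
    then have "x [^]\<^bsub>G\<^esub> q = \<one>\<^bsub>G\<^esub>" using H by (simp add: order_def nat_pow_consistent[symmetric])
    then have 2: "group.ord G x dvd q" using pow_eq_id xG by blast
    have "coprime (p ^ n) q" using ne p q by (simp add: primes_coprime)
    then have "group.ord G x = 1" using 1 2 by (metis coprime_common_divisor_nat nat_dvd_1_iff_1 coprime_def)
    then show False using x xG ord_eq_1 by blast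
  qed
  then have "prime_factors (order G) \<subseteq> {p}" by (auto simp: prime_factors_dvd)
  then have "order G = p ^ multiplicity p (order G)"
    using prime_factorization_nat[OF pos]
    by (metis (no_types, lifting) prod.neutral prod.insert_if empty_iff finite.emptyI subset_singletonD
        prod.empty mult_1_right not_dvd_imp_multiplicity_0 power_0 in_prime_factors_iff p pos less_numeral_extra(3))
  then show ?thesis by blast
qed

text \<open>For a subgroup A the number of these cosets is the index of X \<inter> A in A; X is not
  asked to lie in A. A may also be a translate of a subgroup, which is how orbits of right
  multiplication are written.\<close>

definition (in group) coprime_index :: "nat \<Rightarrow> 'a set \<Rightarrow> 'a set \<Rightarrow> bool" where
  "coprime_index p X A \<longleftrightarrow> finite ((\<lambda>g. X #> g) ` A) \<and> coprime p (card ((\<lambda>g. X #> g) ` A))"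

context group begin

lemma rcos_eq_iff:
  assumes "subgroup X G" "g \<in> carrier G" "h \<in> carrier G"
  shows "X #> g = X #> h \<longleftrightarrow> g \<otimes> inv h \<in> X"
proof
  assume "X #> g = X #> h"
  then have "g \<in> X #> h" using rcos_self assms by blast
  then show "g \<otimes> inv h \<in> X" using subgroup.rcos_module_imp[OF assms(1) is_group assms(3)] by blast
next
  assume "g \<otimes> inv h \<in> X"
  then have "g \<in> X #> h" using subgroup.rcos_module_rev[OF assms(1) is_group] assms by blast
  then show "X #> g = X #> h" using repr_independence assms by metis
qed

text \<open>Y permutes the cosets X a by right multiplication, and a set of size prime to p cannot
  be a disjoint union of orbits whose sizes are all divisible by p.\<close>

lemma coprime_index_orbit:
  assumes p: "Factorial_Ring.prime p" and X: "X \<subseteq> carrier G" and Y: "subgroup Y G" and A: "A \<subseteq> carrier G"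
    and ci: "coprime_index p X A"
    and inv: "\<And>a y. a \<in> A \<Longrightarrow> y \<in> Y \<Longrightarrow> X #> (a \<otimes> y) \<in> (\<lambda>g. X #> g) ` A"
  obtains a where "a \<in> A" "coprime_index p X ((\<otimes>) a ` Y)"
proof -
  have YC: "\<And>y. y \<in> Y \<Longrightarrow> y \<in> carrier G" using Y subgroup.subset by blast
  define Ob where "Ob a = (\<lambda>g. X #> g) ` ((\<otimes>) a ` Y)" for a
  have Osub: "Ob a \<subseteq> (\<lambda>g. X #> g) ` A" if "a \<in> A" for a using inv that by (auto simp: Ob_def)
  have fin: "finite ((\<lambda>g. X #> g) ` A)" using ci by (simp add: coprime_index_def)
  have un: "\<Union> (Ob ` A) = (\<lambda>g. X #> g) ` A"
  proof
    show "\<Union> (Ob ` A) \<subseteq> (\<lambda>g. X #> g) ` A" using Osub by blast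
    have "X #> a \<in> Ob a" if "a \<in> A" for a
      unfolding Ob_def using that A subgroup.one_closed[OF Y] by (auto simp: image_iff intro!: bexI[of _ \<one>])
    then show "(\<lambda>g. X #> g) ` A \<subseteq> \<Union> (Ob ` A)" by blast
  qed
  have sub: "Ob a \<subseteq> Ob b" if ab: "a \<in> A" "b \<in> A" "Ob a \<inter> Ob b \<noteq> {}" for a b
  proof -
    have aC: "a \<in> carrier G" "b \<in> carrier G" using ab A by auto
    obtain y z where yz: "y \<in> Y" "z \<in> Y" "X #> (a \<otimes> y) = X #> (b \<otimes> z)" using ab(3) by (auto simp: Ob_def)
    have "X #> (a \<otimes> w) \<in> Ob b" if w: "w \<in> Y" for w
    proof -
      have iy: "inv y \<in> Y" using yz subgroup.m_inv_closed[OF Y] by blast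
      have u: "inv y \<otimes> w \<in> Y" using iy w subgroup.m_closed[OF Y] by blast
      have "a \<otimes> w = a \<otimes> y \<otimes> (inv y \<otimes> w)"
        using aC YC yz w by (simp add: m_assoc) (simp add: m_assoc[symmetric])
      then have "X #> (a \<otimes> w) = (X #> (a \<otimes> y)) #> (inv y \<otimes> w)"
        using coset_mult_assoc[of X "a \<otimes> y" "inv y \<otimes> w"] X aC YC yz u by simp
      also have "\<dots> = X #> (b \<otimes> z \<otimes> (inv y \<otimes> w))"
        using coset_mult_assoc[of X "b \<otimes> z" "inv y \<otimes> w"] X aC YC yz u by simp
      also have "b \<otimes> z \<otimes> (inv y \<otimes> w) = b \<otimes> (z \<otimes> (inv y \<otimes> w))" using aC YC yz u by (simp add: m_assoc)
      finally have "X #> (a \<otimes> w) = X #> (b \<otimes> (z \<otimes> (inv y \<otimes> w)))" .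
      moreover have "z \<otimes> (inv y \<otimes> w) \<in> Y" using yz u subgroup.m_closed[OF Y] by blast
      ultimately show ?thesis unfolding Ob_def by blast
    qed
    then show ?thesis unfolding Ob_def by blast
  qed
  have disj: "disjnt C D" if "C \<in> Ob ` A" "D \<in> Ob ` A" "C \<noteq> D" for C D
    using that sub unfolding disjnt_def by (metis (no_types, lifting) image_iff inf_commute subset_antisym)
  have "\<exists>a\<in>A. \<not> p dvd card (Ob a)"
  proof (rule ccontr)
    assume "\<not> ?thesis"
    then have "p dvd card (\<Union> (Ob ` A))"
      using fin un disj by (intro dvd_partition) (auto simp: disjnt_def pairwise_def)
    then have "p dvd card ((\<lambda>g. X #> g) ` A)" using un by simp
    then have "\<not> coprime p (card ((\<lambda>g. X #> g) ` A))" using p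
      by (metis coprime_absorb_left not_prime_unit)
    then show False using ci by (simp add: coprime_index_def)
  qed
  then obtain a where a: "a \<in> A" "\<not> p dvd card (Ob a)" by blast
  then have "coprime p (card (Ob a))" using p prime_imp_coprime by blast
  moreover have "finite (Ob a)" using Osub a fin finite_subset by blast
  ultimately have "coprime_index p X ((\<otimes>) a ` Y)" by (simp add: coprime_index_def Ob_def)
  then show ?thesis using that a by blast
qed

text \<open>Y is transitive on the cosets X a y, so their number is both a power of p and prime to
  p, hence 1. As Y may be infinite, orbits are counted for its image among the permutations of this
  finite set.\<close>

lemma coprime_index_p_group:
  assumes p: "Factorial_Ring.prime p" and X: "subgroup X G" and Y: "subgroup Y G" and a: "a \<in> carrier G"
    and tors: "\<And>y. y \<in> Y \<Longrightarrow> \<exists>n::nat. y [^] (p ^ n) = \<one>"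
    and ci: "coprime_index p X ((\<otimes>) a ` Y)" and y: "y \<in> Y"
  shows "a \<otimes> y \<otimes> inv a \<in> X"
proof -
  have XC: "X \<subseteq> carrier G" using X subgroup.subset by blast
  have YC: "\<And>y. y \<in> Y \<Longrightarrow> y \<in> carrier G" using Y subgroup.subset by blast
  define E where "E = (\<lambda>g. X #> g) ` ((\<otimes>) a ` Y)"
  have fin: "finite E" and cop: "coprime p (card E)" using ci by (auto simp: coprime_index_def E_def)
  have EI: "X #> (a \<otimes> u) \<in> E" if "u \<in> Y" for u using that by (auto simp: E_def)
  have act: "(X #> (a \<otimes> u)) #> v = X #> (a \<otimes> (u \<otimes> v))" if "u \<in> Y" "v \<in> Y" for u v
    using coset_mult_assoc XC a YC that by (simp add: m_assoc)
  \<comment> \<open>Right multiplication is a right action; the inverse turns it into a homomorphism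
    into \<open>BijGroup E\<close>.\<close>
  define \<phi> where "\<phi> y = (\<lambda>C\<in>E. C #> inv y)" for y
  let ?Y = "G\<lparr>carrier := Y\<rparr>"
  have gY: "group ?Y" using Y by (simp add: subgroup_imp_group)
  have YI: "\<And>y. y \<in> Y \<Longrightarrow> inv y \<in> Y" and YM: "\<And>x y. x \<in> Y \<Longrightarrow> y \<in> Y \<Longrightarrow> x \<otimes> y \<in> Y" and Y1: "\<one> \<in> Y"
    using subgroup.m_inv_closed[OF Y] subgroup.m_closed[OF Y] subgroup.one_closed[OF Y] by auto
  have \<phi>E: "\<phi> v (X #> (a \<otimes> u)) = X #> (a \<otimes> (u \<otimes> inv v))" if "u \<in> Y" "v \<in> Y" for u v
    using that EI act YI by (simp add: \<phi>_def)
  have Eex: "\<exists>u\<in>Y. C = X #> (a \<otimes> u)" if "C \<in> E" for C using that by (auto simp: E_def)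
  have comp: "\<phi> u (\<phi> v C) = \<phi> (u \<otimes> v) C" if "u \<in> Y" "v \<in> Y" "C \<in> E" for u v C
  proof -
    obtain w where w: "w \<in> Y" "C = X #> (a \<otimes> w)" using Eex \<open>C \<in> E\<close> by auto
    have "w \<otimes> inv v \<otimes> inv u = w \<otimes> inv (u \<otimes> v)" using w that YC by (simp add: inv_mult_group m_assoc)
    then show ?thesis using w that by (simp add: \<phi>E YI YM)
  qed
  have mapE: "\<phi> v C \<in> E" if "v \<in> Y" "C \<in> E" for v C
  proof -
    obtain w where w: "w \<in> Y" "C = X #> (a \<otimes> w)" using Eex \<open>C \<in> E\<close> by auto
    then show ?thesis using that by (simp add: \<phi>E EI YI YM)
  qed
  have id: "\<phi> \<one> C = C" if "C \<in> E" for C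
  proof -
    obtain w where w: "w \<in> Y" "C = X #> (a \<otimes> w)" using Eex \<open>C \<in> E\<close> by auto
    then show ?thesis using that YC by (simp add: \<phi>E Y1)
  qed
  have bij: "\<phi> v \<in> Bij E" if v: "v \<in> Y" for v
  proof -
    have "bij_betw (\<phi> v) E E"
    proof (rule bij_betw_byWitness[where f' = "\<phi> (inv v)"])
      show "\<forall>C\<in>E. \<phi> (inv v) (\<phi> v C) = C" "\<forall>C\<in>E. \<phi> v (\<phi> (inv v) C) = C"
        using comp[of "inv v" v] comp[of v "inv v"] id v YI YC by auto
    qed (use mapE v YI in auto)
    then show ?thesis by (simp add: Bij_def \<phi>_def)
  qed
  have hom: "\<phi> \<in> hom ?Y (BijGroup E)"
  proof (rule homI)
    fix u v assume "u \<in> carrier ?Y" "v \<in> carrier ?Y"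
    then have uv: "u \<in> Y" "v \<in> Y" by auto
    have "\<phi> (u \<otimes> v) = compose E (\<phi> u) (\<phi> v)"
    proof
      fix C show "\<phi> (u \<otimes> v) C = compose E (\<phi> u) (\<phi> v) C"
        using comp[OF uv] by (cases "C \<in> E") (simp_all add: compose_def, simp add: \<phi>_def)
    qed
    then show "\<phi> (u \<otimes>\<^bsub>?Y\<^esub> v) = \<phi> u \<otimes>\<^bsub>BijGroup E\<^esub> \<phi> v"
      using bij uv by (simp add: BijGroup_def)
  qed (use bij in \<open>simp add: BijGroup_def\<close>)
  interpret h: group_hom ?Y "BijGroup E" \<phi>
    using hom gY group_BijGroup by (simp add: group_hom_def group_hom_axioms_def)
  define Q where "Q = (BijGroup E)\<lparr>carrier := \<phi> ` Y\<rparr>"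
  have "subgroup (\<phi> ` Y) (BijGroup E)" using h.img_is_subgroup by simp
  then have gQ: "group Q" unfolding Q_def using group.subgroup_imp_group[OF group_BijGroup] by blast
  have "Bij E \<subseteq> E \<rightarrow>\<^sub>E E" by (auto simp: Bij_def bij_betw_def PiE_def)
  then have "finite (Bij E)" using fin finite_PiE finite_subset by metis
  then have fQ: "finite (carrier Q)" using bij by (auto simp: Q_def intro: finite_subset)
  have "\<exists>n::nat. x [^]\<^bsub>Q\<^esub> (p ^ n) = \<one>\<^bsub>Q\<^esub>" if x: "x \<in> carrier Q" for x
  proof -
    obtain v where v: "v \<in> Y" "x = \<phi> v" using x by (auto simp: Q_def)
    obtain n where "v [^] (p ^ n) = \<one>" using tors v by blast
    then have "\<phi> v [^]\<^bsub>BijGroup E\<^esub> (p ^ n) = \<one>\<^bsub>BijGroup E\<^esub>"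
      using h.hom_nat_pow[of v "p ^ n"] v h.hom_one by (simp add: nat_pow_consistent[symmetric])
    then show ?thesis using v
      by (auto simp: Q_def simp flip: monoid.nat_pow_consistent[OF group.is_monoid[OF group_BijGroup]])
  qed
  then obtain k where k: "order Q = p ^ k" using finite_p_group_order[OF gQ fQ p] by blast
  have "group_hom Q (BijGroup E) id"
    unfolding group_hom_def group_hom_axioms_def using gQ group_BijGroup bij
    by (auto simp: hom_def Q_def BijGroup_def)
  then have ga: "group_action Q E id" by (rule group_action.intro)
  have e0: "X #> (a \<otimes> \<one>) \<in> E" using EI Y1 by blast
  have orb: "orbit Q id (X #> (a \<otimes> \<one>)) = E"
  proof
    show "orbit Q id (X #> (a \<otimes> \<one>)) \<subseteq> E" using mapE e0 by (auto simp: orbit_def Q_def)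
    show "E \<subseteq> orbit Q id (X #> (a \<otimes> \<one>))"
    proof
      fix C assume "C \<in> E"
      then obtain w where w: "w \<in> Y" "C = X #> (a \<otimes> w)" using Eex by auto
      then have "\<phi> (inv w) (X #> (a \<otimes> \<one>)) = C" using YC by (simp only: \<phi>E[OF Y1 YI]) simp
      then show "C \<in> orbit Q id (X #> (a \<otimes> \<one>))" using w YI by (auto simp: orbit_def Q_def)
    qed
  qed
  have "card E * card (stabilizer Q id (X #> (a \<otimes> \<one>))) = p ^ k"
    using group_action.orbit_stabilizer_theorem[OF ga e0] orb k by simp
  then have "card E dvd p ^ k" by (metis dvd_triv_left)
  moreover have "coprime (p ^ k) (card E)" using cop by simp
  ultimately have "is_unit (card E)" using coprime_common_divisor[of "p ^ k" "card E" "card E"] by simp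
  then have "card E = 1" by simp
  then have "X #> (a \<otimes> y) = X #> (a \<otimes> \<one>)" using EI y Y1 by (metis card_1_singletonE singletonD)
  then show ?thesis using rcos_eq_iff[OF X, of "a \<otimes> y" a] a YC y by simp
qed

text \<open>Some N-orbit of cosets X a n has size prime to p. Normality gives a N = N a, so
  translation by a identifies this orbit with the cosets X n.\<close>

lemma coprime_index_normal:
  assumes p: "Factorial_Ring.prime p" and X: "subgroup X G" and H: "subgroup H G" and N: "subgroup N G" "N \<subseteq> H"
    and norm: "\<And>h n. h \<in> H \<Longrightarrow> n \<in> N \<Longrightarrow> h \<otimes> n \<otimes> inv h \<in> N"
    and ci: "coprime_index p X H"
  shows "coprime_index p X N"
proof -
  have XC: "X \<subseteq> carrier G" and HC: "H \<subseteq> carrier G" using X H subgroup.subset by blast+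
  have NC: "\<And>n. n \<in> N \<Longrightarrow> n \<in> carrier G" using N HC by blast
  obtain a where a: "a \<in> H" "coprime_index p X ((\<otimes>) a ` N)"
    using coprime_index_orbit[OF p XC N(1) HC ci] subgroup.m_closed[OF H] N(2) by blast
  have aC: "a \<in> carrier G" using a HC by blast
  have "(\<lambda>g. X #> g) ` ((\<otimes>) a ` N) = (\<lambda>C. C #> a) ` ((\<lambda>g. X #> g) ` N)"
  proof -
    have "X #> (a \<otimes> n) = (X #> (a \<otimes> n \<otimes> inv a)) #> a" if "n \<in> N" for n
      using coset_mult_assoc[of X "a \<otimes> n \<otimes> inv a" a] XC aC NC that by (simp add: m_assoc)
    moreover have "(X #> n) #> a = X #> (a \<otimes> (inv a \<otimes> n \<otimes> a))" if "n \<in> N" for n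
      using coset_mult_assoc[of X n a] XC aC NC that by (simp add: m_assoc) (simp add: m_assoc[symmetric])
    moreover have "inv a \<otimes> n \<otimes> a \<in> N" if "n \<in> N" for n
      using norm[of "inv a" n] that a aC subgroup.m_inv_closed[OF H] by simp
    ultimately show ?thesis using norm a(1) by (auto simp: image_image image_iff) metis+
  qed
  moreover have "inj_on (\<lambda>C. C #> a) ((\<lambda>g. X #> g) ` N)"
  proof (rule inj_on_inverseI[where g = "\<lambda>C. C #> inv a"])
    fix C assume "C \<in> (\<lambda>g. X #> g) ` N"
    then have "C \<subseteq> carrier G" using XC NC r_coset_subset_G by blast
    then show "(C #> a) #> inv a = C" using coset_mult_assoc aC by simp
  qed
  ultimately show ?thesis using a(2) by (simp add: coprime_index_def card_image finite_image_iff)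
qed

text \<open>Plays the role of Sylow's theorem: a p-torsion group Y inside (X \<inter> H) N is
  conjugate into X, and the conjugating element can be taken in the normal subgroup N. The product
  form of Y is what makes right multiplication by Y preserve the cosets X n, because n x = x (x^-1 n
  x).\<close>

lemma coprime_index_conjugate:
  assumes p: "Factorial_Ring.prime p" and X: "subgroup X G" and H: "subgroup H G" and N: "subgroup N G" "N \<subseteq> H"
    and norm: "\<And>h n. h \<in> H \<Longrightarrow> n \<in> N \<Longrightarrow> h \<otimes> n \<otimes> inv h \<in> N"
    and ci: "coprime_index p X H" and Y: "subgroup Y G"
    and tors: "\<And>y. y \<in> Y \<Longrightarrow> \<exists>n::nat. y [^] (p ^ n) = \<one>"
    and YXN: "\<And>y. y \<in> Y \<Longrightarrow> \<exists>x\<in>X \<inter> H. \<exists>n\<in>N. y = x \<otimes> n"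
  obtains n where "n \<in> N" "\<And>y. y \<in> Y \<Longrightarrow> n \<otimes> y \<otimes> inv n \<in> X"
proof -
  have XC: "X \<subseteq> carrier G" and HC: "H \<subseteq> carrier G" using X H subgroup.subset by blast+
  have NC: "N \<subseteq> carrier G" using N HC by blast
  have ciN: "coprime_index p X N" by (rule coprime_index_normal[OF p X H N norm ci])
  have "X #> (n \<otimes> y) \<in> (\<lambda>g. X #> g) ` N" if n: "n \<in> N" and y: "y \<in> Y" for n y
  proof -
    obtain x m where xm: "x \<in> X" "x \<in> H" "m \<in> N" "y = x \<otimes> m" using YXN y by blast
    have c: "n \<in> carrier G" "x \<in> carrier G" "m \<in> carrier G" using n xm NC XC by auto
    have "inv x \<otimes> n \<otimes> x \<in> N" using norm[of "inv x" n] n xm c subgroup.m_inv_closed[OF H] by simp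
    then have 1: "inv x \<otimes> n \<otimes> x \<otimes> m \<in> N" using xm subgroup.m_closed[OF N(1)] by blast
    have "n \<otimes> y = x \<otimes> (inv x \<otimes> n \<otimes> x \<otimes> m)" using xm c by (simp add: m_assoc) (simp add: m_assoc[symmetric])
    then have "X #> (n \<otimes> y) = (X #> x) #> (inv x \<otimes> n \<otimes> x \<otimes> m)"
      using coset_mult_assoc[OF XC c(2)] 1 NC by auto
    also have "X #> x = X" using coset_join2 X xm c by blast
    finally show ?thesis using 1 by blast
  qed
  then obtain n where n: "n \<in> N" "coprime_index p X ((\<otimes>) n ` Y)"
    using coprime_index_orbit[OF p XC Y NC ciN] by blast
  then show ?thesis using that coprime_index_p_group[OF p X Y _ tors n(2)] NC by blast
qed

end

text \<open>The map of cosets X g -> X' f(g) has fibres of equal size, since translation by h^-1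
  moves the fibre over X' f(h) to the fibre over X'. So the new number of cosets divides the old
  one.\<close>

lemma coprime_index_hom:
  assumes G: "group G" and G': "group G'" and X: "subgroup X G" and X': "subgroup X' G'" and H: "subgroup H G"
    and f: "f \<in> hom (G\<lparr>carrier := H\<rparr>) G'" and fX: "f ` (X \<inter> H) \<subseteq> X'"
    and ci: "group.coprime_index G p X H"
  shows "group.coprime_index G' p X' (f ` H)"
proof -
  interpret G: group G by fact
  interpret G': group G' by fact
  have HC: "H \<subseteq> carrier G" using H subgroup.subset by blast
  have gH: "group (G\<lparr>carrier := H\<rparr>)" using H by (simp add: G.subgroup_imp_group)
  interpret f: group_hom "G\<lparr>carrier := H\<rparr>" G' f
    using gH f by (simp add: group_hom_def group_hom_axioms_def)
  have fc: "f h \<in> carrier G'" if "h \<in> H" for h using f.hom_closed that by simp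
  have HM: "\<And>x y. x \<in> H \<Longrightarrow> y \<in> H \<Longrightarrow> x \<otimes>\<^bsub>G\<^esub> y \<in> H" and HI: "\<And>x. x \<in> H \<Longrightarrow> inv\<^bsub>G\<^esub> x \<in> H"
    using subgroup.m_closed[OF H] subgroup.m_inv_closed[OF H] by auto
  have fm: "f (g \<otimes>\<^bsub>G\<^esub> inv\<^bsub>G\<^esub> h) = f g \<otimes>\<^bsub>G'\<^esub> inv\<^bsub>G'\<^esub> f h" if "g \<in> H" "h \<in> H" for g h
  proof -
    have "inv\<^bsub>G\<lparr>carrier := H\<rparr>\<^esub> h = inv\<^bsub>G\<^esub> h" using G.m_inv_consistent H that by simp
    then show ?thesis using f.hom_mult[of g "inv\<^bsub>G\<^esub> h"] f.hom_inv[of h] that HI by simp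
  qed
  let ?E = "(\<lambda>g. X #>\<^bsub>G\<^esub> g) ` H" and ?E' = "(\<lambda>g. X' #>\<^bsub>G'\<^esub> g) ` (f ` H)"
  have fin: "finite ?E" and cop: "coprime p (card ?E)" using ci by (auto simp: G.coprime_index_def)
  define q where "q C = X' #>\<^bsub>G'\<^esub> f (SOME h. h \<in> H \<and> C = X #>\<^bsub>G\<^esub> h)" for C
  have wd: "X' #>\<^bsub>G'\<^esub> f g = X' #>\<^bsub>G'\<^esub> f h" if "g \<in> H" "h \<in> H" "X #>\<^bsub>G\<^esub> g = X #>\<^bsub>G\<^esub> h" for g h
  proof -
    have "g \<in> carrier G" "h \<in> carrier G" using that HC by auto
    then have "g \<otimes>\<^bsub>G\<^esub> inv\<^bsub>G\<^esub> h \<in> X \<inter> H" using that G.rcos_eq_iff[OF X, of g h] HM HI by auto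
    then have "f g \<otimes>\<^bsub>G'\<^esub> inv\<^bsub>G'\<^esub> f h \<in> X'" using fX fm that by auto
    then show ?thesis using G'.rcos_eq_iff[OF X', of "f g" "f h"] fc that by auto
  qed
  have q: "q (X #>\<^bsub>G\<^esub> h) = X' #>\<^bsub>G'\<^esub> f h" if h: "h \<in> H" for h
  proof -
    let ?s = "SOME g. g \<in> H \<and> X #>\<^bsub>G\<^esub> h = X #>\<^bsub>G\<^esub> g"
    have "?s \<in> H \<and> X #>\<^bsub>G\<^esub> h = X #>\<^bsub>G\<^esub> ?s" by (rule someI[of _ h]) (use h in simp)
    then show ?thesis using wd[of ?s h] h by (simp add: q_def)
  qed
  have qE: "q ` ?E = ?E'" using q by (auto simp: image_image image_iff)
  have fin': "finite ?E'" using fin qE by (metis finite_imageI)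
  define fib where "fib C = {D \<in> ?E. q D = C}" for C
  have fibc: "card (fib C) = card (fib X')" if C: "C \<in> ?E'" for C
  proof -
    obtain h where h: "h \<in> H" "C = X' #>\<^bsub>G'\<^esub> f h" using C by auto
    have hC: "h \<in> carrier G" using h HC by blast
    have XC: "X \<subseteq> carrier G" and XC': "X' \<subseteq> carrier G'" using X X' subgroup.subset by blast+
    have mv: "(X #>\<^bsub>G\<^esub> g) #>\<^bsub>G\<^esub> k = X #>\<^bsub>G\<^esub> (g \<otimes>\<^bsub>G\<^esub> k)" if "g \<in> H" "k \<in> H" for g k
      using G.coset_mult_assoc XC that HC by blast
    have crit: "q (X #>\<^bsub>G\<^esub> g) = C \<longleftrightarrow> q (X #>\<^bsub>G\<^esub> (g \<otimes>\<^bsub>G\<^esub> inv\<^bsub>G\<^esub> h)) = X'" if g: "g \<in> H" for g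
    proof -
      have "q (X #>\<^bsub>G\<^esub> g) = C \<longleftrightarrow> f g \<otimes>\<^bsub>G'\<^esub> inv\<^bsub>G'\<^esub> f h \<in> X'"
        using q[OF g] h G'.rcos_eq_iff[OF X'] fc g by metis
      also have "\<dots> \<longleftrightarrow> X' #>\<^bsub>G'\<^esub> f (g \<otimes>\<^bsub>G\<^esub> inv\<^bsub>G\<^esub> h) = X'"
        using fm[OF g h(1)] G'.coset_join1[OF _ _ X'] G'.coset_join2[OF _ X'] fc g h XC'
        by (metis HM HI)
      finally show ?thesis using q HM HI g h by simp
    qed
    have "bij_betw (\<lambda>D. D #>\<^bsub>G\<^esub> inv\<^bsub>G\<^esub> h) (fib C) (fib X')"
    proof (rule bij_betw_byWitness[where f' = "\<lambda>D. D #>\<^bsub>G\<^esub> h"])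
      have car: "D \<subseteq> carrier G" if "D \<in> ?E" for D using that XC HC G.r_coset_subset_G by blast
      show "\<forall>D\<in>fib C. (D #>\<^bsub>G\<^esub> inv\<^bsub>G\<^esub> h) #>\<^bsub>G\<^esub> h = D" "\<forall>D\<in>fib X'. (D #>\<^bsub>G\<^esub> h) #>\<^bsub>G\<^esub> inv\<^bsub>G\<^esub> h = D"
        using car hC G.coset_mult_assoc by (auto simp: fib_def)
      show "(\<lambda>D. D #>\<^bsub>G\<^esub> inv\<^bsub>G\<^esub> h) ` fib C \<subseteq> fib X'"
        using mv h HI HM crit by (auto simp: fib_def)
      have "q (X #>\<^bsub>G\<^esub> (g \<otimes>\<^bsub>G\<^esub> h)) = C" if "g \<in> H" "q (X #>\<^bsub>G\<^esub> g) = X'" for g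
      proof -
        have "g \<otimes>\<^bsub>G\<^esub> h \<otimes>\<^bsub>G\<^esub> inv\<^bsub>G\<^esub> h = g" using that hC HC by (auto simp: G.m_assoc)
        then show ?thesis using crit[of "g \<otimes>\<^bsub>G\<^esub> h"] that h HM by simp
      qed
      then show "(\<lambda>D. D #>\<^bsub>G\<^esub> h) ` fib X' \<subseteq> fib C" using mv h HM by (auto simp: fib_def)
    qed
    then show ?thesis by (rule bij_betw_same_card)
  qed
  have "card ?E = (\<Sum>C\<in>?E'. card (fib C))"
  proof -
    have "?E = (\<Union>C\<in>?E'. fib C)" using q by (auto simp: fib_def)
    then have "card ?E = card (\<Union>C\<in>?E'. fib C)" by simp
    also have "\<dots> = (\<Sum>C\<in>?E'. card (fib C))"
      by (rule card_UN_disjoint) (use fin fin' in \<open>auto simp: fib_def\<close>)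
    finally show ?thesis .
  qed
  also have "\<dots> = card ?E' * card (fib X')" using fibc by simp
  finally have "card ?E' dvd card ?E" by simp
  then have "coprime p (card ?E')" using cop coprime_divisors dvd_refl by blast
  then show ?thesis using fin' by (simp add: G'.coprime_index_def)
qed

section \<open>Discrete p-toral groups\<close>

text \<open>Only the values on H matter, so restricting a map needs no change of the
  function.\<close>

definition (in group) hom_on :: "'a set \<Rightarrow> ('a \<Rightarrow> 'a) \<Rightarrow> bool" where
  "hom_on H f \<longleftrightarrow> (\<forall>x\<in>H. f x \<in> carrier G) \<and> (\<forall>x\<in>H. \<forall>y\<in>H. f (x \<otimes> y) = f x \<otimes> f y)"

context group begin

lemma inv_cancel_left [simp]:
  "\<lbrakk>h \<in> carrier G; x \<in> carrier G\<rbrakk> \<Longrightarrow> inv h \<otimes> (h \<otimes> x) = x"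
  "\<lbrakk>h \<in> carrier G; x \<in> carrier G\<rbrakk> \<Longrightarrow> h \<otimes> (inv h \<otimes> x) = x"
  by (simp_all flip: m_assoc)

lemma hom_onD:
  assumes "hom_on H f"
  shows "x \<in> H \<Longrightarrow> f x \<in> carrier G" "x \<in> H \<Longrightarrow> y \<in> H \<Longrightarrow> f (x \<otimes> y) = f x \<otimes> f y"
  using assms by (auto simp: hom_on_def)

lemma hom_on_group_hom:
  assumes "hom_on H f" "subgroup H G" shows "group_hom (G\<lparr>carrier := H\<rparr>) G f"
  using assms by (auto simp: group_hom_def group_hom_axioms_def subgroup_imp_group is_group hom_def hom_on_def)

lemma hom_on_one: "hom_on H f \<Longrightarrow> subgroup H G \<Longrightarrow> f \<one> = \<one>"
  using group_hom.hom_one[OF hom_on_group_hom] by fastforce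

lemma hom_on_inv: "hom_on H f \<Longrightarrow> subgroup H G \<Longrightarrow> x \<in> H \<Longrightarrow> f (inv x) = inv (f x)"
  using group_hom.hom_inv[OF hom_on_group_hom, of H f x] m_inv_consistent by fastforce

lemma hom_on_pow: "hom_on H f \<Longrightarrow> subgroup H G \<Longrightarrow> x \<in> H \<Longrightarrow> f (x [^] (n::nat)) = f x [^] n"
  using group_hom.hom_nat_pow[OF hom_on_group_hom, of H f x n] by (simp add: nat_pow_consistent[symmetric])

lemma hom_on_subset: "hom_on H f \<Longrightarrow> K \<subseteq> H \<Longrightarrow> hom_on K f"
  by (auto simp: hom_on_def)

lemma hom_on_image_subgroup:
  assumes f: "hom_on H f" and H: "subgroup H G" shows "subgroup (f ` H) G"
  using group_hom.img_is_subgroup[OF hom_on_group_hom[OF f H]] by simp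

lemma hom_on_inv_into:
  assumes f: "hom_on H f" and H: "subgroup H G" and inj: "inj_on f H"
  shows "hom_on (f ` H) (inv_into H f)"
proof -
  have HC: "H \<subseteq> carrier G" using H subgroup.subset by blast
  have "inv_into H f (f x \<otimes> f y) = x \<otimes> y" if "x \<in> H" "y \<in> H" for x y
  proof -
    have "f x \<otimes> f y = f (x \<otimes> y)" using hom_onD[OF f] that by simp
    then show ?thesis using inv_into_f_f[OF inj] subgroup.m_closed[OF H that] by simp
  qed
  then show ?thesis using HC inj by (auto simp: hom_on_def inv_into_f_f)
qed

definition p_divisible :: "nat \<Rightarrow> 'a set \<Rightarrow> bool" where
  "p_divisible p D \<longleftrightarrow> (\<forall>x\<in>D. \<exists>y\<in>D. y [^] p = x)"

lemma p_divisible_pow: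
  assumes "p_divisible p D" "x \<in> D" "D \<subseteq> carrier G" obtains y where "y \<in> D" "y [^] (p ^ k :: nat) = x"
proof -
  have "\<exists>y\<in>D. y [^] (p ^ k :: nat) = x"
  proof (induction k)
    case 0 then show ?case using assms by (intro bexI[of _ x]) auto
  next
    case (Suc k)
    then obtain y where y: "y \<in> D" "y [^] (p ^ k) = x" by blast
    then obtain z where z: "z \<in> D" "z [^] p = y" using assms(1) by (auto simp: p_divisible_def)
    then have "z [^] (p ^ Suc k) = x" using y assms(3) by (auto simp: nat_pow_pow)
    then show ?case using z by blast
  qed
  then show ?thesis using that by blast
qed

lemma p_divisible_image:
  assumes "hom_on H f" "subgroup H G" "D \<subseteq> H" "p_divisible p D" shows "p_divisible p (f ` D)"
  unfolding p_divisible_def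
proof
  fix x assume "x \<in> f ` D"
  then obtain d where d: "d \<in> D" "x = f d" by blast
  then obtain e where e: "e \<in> D" "e [^] p = d" using assms(4) by (auto simp: p_divisible_def)
  then have "f e [^] p = x" using hom_on_pow[OF assms(1,2), of e p] d assms(3) by auto
  then show "\<exists>y\<in>f ` D. y [^] p = x" using e by blast
qed

text \<open>Induction on the exponent: if x is killed by p^(j+1), then x^(p^j) is killed by p, hence
  lies in C and equals v^(p^j) for some v in C; now x v^-1 is killed by p^j.\<close>

lemma divisible_socle:
  assumes C: "subgroup C G" "p_divisible p C" and C': "subgroup C' G"
    and comm: "\<And>x y. x \<in> C' \<Longrightarrow> y \<in> C \<Longrightarrow> x \<otimes> y = y \<otimes> x"
    and tors: "\<And>x. x \<in> C' \<Longrightarrow> \<exists>n::nat. x [^] (p ^ n) = \<one>"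
    and soc: "\<And>x. x \<in> C' \<Longrightarrow> x [^] p = \<one> \<Longrightarrow> x \<in> C" and CC': "C \<subseteq> C'"
  shows "C' \<subseteq> C"
proof
  have cC: "C \<subseteq> carrier G" "C' \<subseteq> carrier G" using C C' subgroup.subset by blast+
  have *: "x \<in> C' \<Longrightarrow> x [^] (p ^ j :: nat) = \<one> \<Longrightarrow> x \<in> C" for x j
  proof (induction j arbitrary: x)
    case 0 then show ?case using cC subgroup.one_closed[OF C(1)] by auto
  next
    case (Suc j)
    have xG: "x \<in> carrier G" using Suc cC by blast
    have "x [^] (p ^ j) \<in> C'" using Suc subgroup_nat_pow_closed[OF C'] by blast
    moreover have "(x [^] (p ^ j)) [^] p = \<one>" using Suc xG by (simp add: nat_pow_pow mult.commute)
    ultimately have "x [^] (p ^ j) \<in> C" by (rule soc)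
    then obtain v where v: "v \<in> C" "v [^] (p ^ j) = x [^] (p ^ j)" using p_divisible_pow[OF C(2) _ cC(1)] by blast
    have vG: "v \<in> carrier G" using v cC by blast
    have iv: "inv v \<in> C" using v subgroup.m_inv_closed[OF C(1)] by blast
    have "(x \<otimes> inv v) [^] (p ^ j) = x [^] (p ^ j) \<otimes> inv v [^] (p ^ j)"
      using pow_mult_distrib[OF comm[OF Suc.prems(1) iv]] xG vG by simp
    also have "\<dots> = \<one>" using v xG vG by (simp add: nat_pow_inv)
    finally have "x \<otimes> inv v \<in> C" using Suc iv CC' subgroup.m_closed[OF C'] by blast
    then have "x \<otimes> inv v \<otimes> v \<in> C" using v subgroup.m_closed[OF C(1)] by blast
    then show ?case using xG vG by (simp add: m_assoc)
  qed
  fix x assume "x \<in> C'" then show "x \<in> C" using * tors by blast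
qed

text \<open>Each nonempty fibre of the p-th power map on A is a translate of the finite set of
  elements killed by p.\<close>

lemma finite_p_torsion:
  assumes A: "subgroup A G" and comm: "\<And>x y. x \<in> A \<Longrightarrow> y \<in> A \<Longrightarrow> x \<otimes> y = y \<otimes> x"
    and soc: "finite {x \<in> A. x [^] p = \<one>}"
  shows "finite {x \<in> A. x [^] (p ^ k :: nat) = \<one>}"
proof (induction k)
  case 0
  have "{x \<in> A. x [^] (p ^ 0 :: nat) = \<one>} \<subseteq> {\<one>}" using subgroup.mem_carrier[OF A] by auto
  then show ?case using finite_subset by blast
next
  case (Suc k)
  have AC: "A \<subseteq> carrier G" by (rule subgroup.subset[OF A])
  have fib: "finite {x \<in> A. x [^] p = y}" for y
  proof (cases "\<exists>x0\<in>A. x0 [^] p = y")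
    case True
    then obtain x0 where x0: "x0 \<in> A" "x0 [^] p = y" by blast
    have "x \<in> (\<lambda>z. z \<otimes> x0) ` {x \<in> A. x [^] p = \<one>}" if x: "x \<in> A" "x [^] p = y" for x
    proof (rule image_eqI)
      have c: "x \<in> carrier G" "x0 \<in> carrier G" using x x0 AC by auto
      have i: "inv x0 \<in> A" using x0 subgroup.m_inv_closed[OF A] by blast
      show "x = x \<otimes> inv x0 \<otimes> x0" using c by (simp add: m_assoc)
      have "(x \<otimes> inv x0) [^] p = \<one>"
        using pow_mult_distrib[OF comm[OF x(1) i], of p] x(2) x0(2) c nat_pow_closed[OF c(1), of p] by (simp add: nat_pow_inv)
      then show "x \<otimes> inv x0 \<in> {x \<in> A. x [^] p = \<one>}" using subgroup.m_closed[OF A x(1) i] by blast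
    qed
    then have "{x \<in> A. x [^] p = y} \<subseteq> (\<lambda>z. z \<otimes> x0) ` {x \<in> A. x [^] p = \<one>}" by blast
    then show ?thesis using soc finite_surj by blast
  next
    case False
    then have "{x \<in> A. x [^] p = y} = {}" by blast
    then show ?thesis by (simp only: finite.emptyI)
  qed
  have "x [^] p \<in> {x \<in> A. x [^] (p ^ k :: nat) = \<one>}" if "x \<in> A" "x [^] (p ^ Suc k :: nat) = \<one>" for x
    using that AC subgroup_nat_pow_closed[OF A] by (auto simp: nat_pow_pow subset_iff)
  then have "{x \<in> A. x [^] (p ^ Suc k :: nat) = \<one>} \<subseteq> (\<Union>y\<in>{x \<in> A. x [^] (p ^ k :: nat) = \<one>}. {x \<in> A. x [^] p = y})"
    by blast
  then show ?case using Suc fib by (meson finite_UN finite_subset)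
qed

end

section \<open>Identity components, also of subgroups\<close>

lemma is_identity_component_iff:
  assumes "group G" and p: "Factorial_Ring.prime p"
  shows "is_identity_component p G T r \<longleftrightarrow> T \<lhd> G \<and> divisible_p_group p r (G\<lparr>carrier := T\<rparr>) \<and>
     finite (carrier (G Mod T)) \<and> p_group p (G Mod T)"
proof -
  interpret group G by fact
  have "G\<lparr>carrier := T\<rparr> \<cong> product_group {..<r} (\<lambda>_. prufer_group p) \<longleftrightarrow> divisible_p_group p r (G\<lparr>carrier := T\<rparr>)"
    if "T \<lhd> G"
  proof
    have gT: "group (G\<lparr>carrier := T\<rparr>)" using that by (simp add: normal_def subgroup_imp_group)
    assume "G\<lparr>carrier := T\<rparr> \<cong> product_group {..<r} (\<lambda>_. prufer_group p)"
    then have "product_group {..<r} (\<lambda>_. prufer_group p) \<cong> G\<lparr>carrier := T\<rparr>" using group.iso_sym[OF gT] by blast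
    then show "divisible_p_group p r (G\<lparr>carrier := T\<rparr>)"
      using divisible_p_group_iso gT divisible_product_prufer[OF p] by blast
  qed (rule divisible_p_group_classification[OF p])
  then show ?thesis unfolding is_identity_component_def by blast
qed

lemma identity_component_facts:
  fixes G (structure)
  assumes G: "group G" and p: "Factorial_Ring.prime p" and T: "is_identity_component p G T r"
  shows "subgroup T G"
    and "\<And>g x. g \<in> carrier G \<Longrightarrow> x \<in> T \<Longrightarrow> g \<otimes> x \<otimes> inv g \<in> T"
    and "\<And>x y. x \<in> T \<Longrightarrow> y \<in> T \<Longrightarrow> x \<otimes> y = y \<otimes> x"
    and "group.p_divisible G p T"
    and "\<And>x. x \<in> carrier G \<Longrightarrow> \<exists>n::nat. x [^] (p ^ n) = \<one>"
    and "finite ((\<lambda>g. T #> g) ` carrier G)"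
    and "order (G Mod T) = card ((\<lambda>g. T #> g) ` carrier G)"
    and "\<exists>k. \<forall>x\<in>carrier G. x [^] (p ^ k) \<in> T"
    and "finite {x\<in>T. x [^] p = \<one>}" and "card {x\<in>T. x [^] p = \<one>} = p ^ r"
proof -
  interpret group G by fact
  have nT: "T \<lhd> G" and dT: "divisible_p_group p r (G\<lparr>carrier := T\<rparr>)" and fin: "finite (carrier (G Mod T))"
    and pg: "p_group p (G Mod T)" using T is_identity_component_iff[OF G p] by auto
  interpret T: normal T G by fact
  show sT: "subgroup T G" by (rule T.subgroup_axioms)
  show "g \<otimes> x \<otimes> inv g \<in> T" if "g \<in> carrier G" "x \<in> T" for g x using T.inv_op_closed2 that by blast
  show "x \<otimes> y = y \<otimes> x" if "x \<in> T" "y \<in> T" for x y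
  proof -
    interpret c: comm_group "G\<lparr>carrier := T\<rparr>" using dT by (simp add: divisible_p_group_def)
    show ?thesis using c.m_comm[of x y] that by simp
  qed
  show "p_divisible p T" using dT by (simp add: divisible_p_group_def p_divisible_def nat_pow_consistent[symmetric])
  show "finite {x\<in>T. x [^] p = \<one>}" "card {x\<in>T. x [^] p = \<one>} = p ^ r"
    using dT by (simp_all add: divisible_p_group_def nat_pow_consistent[symmetric])
  have pow: "\<exists>n::nat. x [^] (p ^ n) \<in> T" if x: "x \<in> carrier G" for x
  proof -
    have "T #> x \<in> carrier (G Mod T)" using x by (simp add: carrier_FactGroup)
    then obtain n where "(T #> x) [^]\<^bsub>G Mod T\<^esub> (p ^ n :: nat) = \<one>\<^bsub>G Mod T\<^esub>" using pg by (auto simp: p_group_def)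
    then have "T #> (x [^] (p ^ n)) = T" using T.FactGroup_pow[OF x, of "p ^ n"] by simp
    then show ?thesis using coset_join1[OF _ _ sT] T.subset x by (metis nat_pow_closed)
  qed
  show "\<exists>n::nat. x [^] (p ^ n) = \<one>" if x: "x \<in> carrier G" for x
  proof -
    obtain n where n: "x [^] (p ^ n :: nat) \<in> T" using pow x by blast
    then obtain m where "(x [^] (p ^ n)) [^] (p ^ m :: nat) = \<one>"
      using dT by (auto simp: divisible_p_group_def nat_pow_consistent[symmetric])
    then have "x [^] (p ^ (n + m)) = \<one>" using x by (simp add: nat_pow_pow power_add)
    then show ?thesis by blast
  qed
  show fE: "finite ((\<lambda>g. T #> g) ` carrier G)" "order (G Mod T) = card ((\<lambda>g. T #> g) ` carrier G)"
    using fin by (simp_all add: carrier_FactGroup order_def)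
  show "\<exists>k. \<forall>x\<in>carrier G. x [^] (p ^ k) \<in> T"
  proof -
    obtain k where k: "order (G Mod T) = p ^ k"
      using finite_p_group_order[OF T.factorgroup_is_group fin p] pg by (auto simp: p_group_def)
    have "x [^] (p ^ k) \<in> T" if x: "x \<in> carrier G" for x
    proof -
      have "T #> x \<in> carrier (G Mod T)" using x by (simp add: carrier_FactGroup)
      then have "(T #> x) [^]\<^bsub>G Mod T\<^esub> (p ^ k) = \<one>\<^bsub>G Mod T\<^esub>"
        using group.pow_order_eq_1[OF T.factorgroup_is_group] k by metis
      then have "T #> (x [^] (p ^ k)) = T" using T.FactGroup_pow[OF x, of "p ^ k"] by simp
      then show ?thesis using coset_join1[OF _ _ sT] T.subset x by (metis nat_pow_closed)
    qed
    then show ?thesis by blast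
  qed
qed

text \<open>One power p^k maps the whole group into T, and every element of D is a p^k-th power of
  an element of D. This pins T down as the largest divisible subset.\<close>

lemma identity_component_largest:
  fixes G (structure)
  assumes G: "group G" and p: "Factorial_Ring.prime p" and T: "is_identity_component p G T r"
    and D: "D \<subseteq> carrier G" "group.p_divisible G p D"
  shows "D \<subseteq> T"
proof
  interpret group G by fact
  obtain k where k: "\<forall>x\<in>carrier G. x [^] (p ^ k) \<in> T" using identity_component_facts(8)[OF G p T] by blast
  fix x assume "x \<in> D"
  then obtain y where "y \<in> D" "y [^] (p ^ k) = x" using p_divisible_pow[OF D(2) _ D(1)] by blast
  then show "x \<in> T" using k D by blast
qed

lemma identity_component_eq:
  fixes G (structure)
  assumes G: "group G" and p: "Factorial_Ring.prime p" and T: "is_identity_component p G T r"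
  shows "identity_component p G = T" "toral_rank p G = r"
    "toral_order p G = (r, card ((\<lambda>g. T #> g) ` carrier G))"
proof -
  note f = identity_component_facts[OF G p]
  have uT: "T' = T" if "is_identity_component p G T' r'" for T' r'
    using identity_component_largest[OF G p T subgroup.subset[OF f(1)[OF that]] f(4)[OF that]]
      identity_component_largest[OF G p that subgroup.subset[OF f(1)[OF T]] f(4)[OF T]] by blast
  have ur: "r' = r" if "is_identity_component p G T' r'" for T' r'
  proof -
    have "p ^ r' = p ^ r" using f(10)[OF that] f(10)[OF T] uT[OF that] by simp
    then show ?thesis using p prime_gt_1_nat by simp
  qed
  show 1: "identity_component p G = T" unfolding identity_component_def
    by (rule the_equality) (use T uT in blast)+
  show 2: "toral_rank p G = r" unfolding toral_rank_def
    by (rule the_equality) (use T ur in blast)+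
  show "toral_order p G = (r, card ((\<lambda>g. T #> g) ` carrier G))"
    using 1 2 f(7)[OF T] by (simp add: toral_order_def)
qed

text \<open>For A = H \<inter> T the component is the group D of p^K-th powers in A, where K is so
  large that an element of A killed by p that has a p^K-th root in A has p^j-th roots in A for all
  j. This makes D divisible, and then A is the product of D and the finite set of elements killed by
  p^K, so D has finite index.\<close>

lemma subgroup_identity_component:
  fixes G (structure)
  assumes G: "group G" and p: "Factorial_Ring.prime p" and T: "is_identity_component p G T r" and H: "subgroup H G"
  shows "\<exists>D s. is_identity_component p (G\<lparr>carrier := H\<rparr>) D s"
proof -
  interpret group G by fact
  note f = identity_component_facts[OF G p T]
  have HC: "H \<subseteq> carrier G" using H subgroup.subset by blast
  define A where "A = H \<inter> T"
  have A: "subgroup A G" unfolding A_def using subgroups_Inter_pair H f(1) by blast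
  have AC: "A \<subseteq> carrier G" and AT: "A \<subseteq> T" and AH: "A \<subseteq> H" using HC by (auto simp: A_def)
  have pm: "(x \<otimes> y) [^] (n::nat) = x [^] n \<otimes> y [^] n" if "x \<in> A" "y \<in> A" for x y n
    using pow_mult_distrib f(3) that AT AC by blast
  have Apow: "x [^] (n::nat) \<in> A" if "x \<in> A" for x n using subgroup_nat_pow_closed[OF A that] .
  define \<Omega> where "\<Omega> k = {x\<in>A. x [^] (p ^ k :: nat) = \<one>}" for k
  have \<Omega>1: "finite {x\<in>A. x [^] p = \<one>}" by (rule finite_subset[OF _ f(9)]) (use AT in auto)
  have \<Omega>fin: "finite (\<Omega> k)" for k
    unfolding \<Omega>_def by (rule finite_p_torsion[OF A _ \<Omega>1]) (use f(3) AT in blast)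
  define V where "V k = {x\<in>A. x [^] p = \<one> \<and> (\<exists>y\<in>A. y [^] (p ^ k :: nat) = x)}" for k
  have Vfin: "finite (V k)" for k by (rule finite_subset[OF _ \<Omega>1]) (auto simp: V_def)
  have Vmono: "V (k + j) \<subseteq> V k" for k j
  proof
    fix x assume "x \<in> V (k + j)"
    then obtain y where y: "x \<in> A" "x [^] p = \<one>" "y \<in> A" "y [^] (p ^ (k + j)) = x" by (auto simp: V_def)
    have "(y [^] (p ^ j)) [^] (p ^ k) = x" using y AC by (auto simp: nat_pow_pow power_add mult.commute)
    then show "x \<in> V k" using y Apow unfolding V_def by blast
  qed
  \<comment> \<open>The sets V k are finite and decreasing, so one of least size equals all later
    ones.\<close>
  obtain K where K: "\<And>k. card (V K) \<le> card (V k)"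
    using ex_has_least_nat[of "\<lambda>_. True" _ "\<lambda>k. card (V k)"] by auto
  have VK: "V (K + j) = V K" for j
    using card_seteq[OF Vfin Vmono K] by blast
  define D where "D = (\<lambda>x. x [^] (p ^ K)) ` A"
  have DA: "D \<subseteq> A" using Apow by (auto simp: D_def)
  have D: "subgroup D G"
  proof
    show "D \<subseteq> carrier G" using DA AC by blast
    show "\<one> \<in> D" unfolding D_def using subgroup.one_closed[OF A] by (auto intro!: image_eqI[of _ _ "\<one>"])
    fix x assume "x \<in> D"
    then obtain a where a: "a \<in> A" "x = a [^] (p ^ K)" by (auto simp: D_def)
    show "inv x \<in> D" unfolding D_def using a AC subgroup.m_inv_closed[OF A]
      by (auto intro!: image_eqI[of _ _ "inv a"] simp: nat_pow_inv)
    fix y assume "y \<in> D"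
    then obtain b where b: "b \<in> A" "y = b [^] (p ^ K)" by (auto simp: D_def)
    show "x \<otimes> y \<in> D" unfolding D_def using a b pm subgroup.m_closed[OF A]
      by (auto intro!: image_eqI[of _ _ "a \<otimes> b"])
  qed
  \<comment> \<open>Induction on the exponent of x. The power u = x^(p^j) is killed by p and has a
    p^K-th root, hence by the choice of K a p^(K+j+1)-th root c. Dividing x by z = c^(p^(K+1)),
    which is the p-th power of an element of D, leaves an element killed by p^j.\<close>
  have Ddiv: "\<forall>x\<in>D. x [^] (p ^ j :: nat) = \<one> \<longrightarrow> (\<exists>y\<in>D. y [^] p = x)" for j
  proof (induction j)
    case 0
    have "\<one> [^] p = \<one>" by simp
    then show ?case using subgroup.one_closed[OF D] DA AC by (auto intro!: bexI[of _ "\<one>"])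
  next
    case (Suc j)
    show ?case
    proof (intro ballI impI)
      fix x assume x: "x \<in> D" "x [^] (p ^ Suc j) = \<one>"
      obtain a where a: "a \<in> A" "x = a [^] (p ^ K)" using x by (auto simp: D_def)
      have xA: "x \<in> A" and xC: "x \<in> carrier G" and aC: "a \<in> carrier G" using x DA AC a by auto
      define u where "u = x [^] (p ^ j)"
      have "u = (a [^] (p ^ j)) [^] (p ^ K)" using a aC by (simp add: u_def nat_pow_pow mult.commute)
      moreover have "u [^] p = \<one>" using x xC by (simp add: u_def nat_pow_pow mult.commute)
      moreover have "u \<in> A" using Apow xA by (simp add: u_def)
      ultimately have "u \<in> V K" using Apow a unfolding V_def by blast
      then have "u \<in> V (K + Suc j)" using VK by blast
      then obtain c where c: "c \<in> A" "c [^] (p ^ (K + Suc j)) = u" by (auto simp: V_def)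
      have cC: "c \<in> carrier G" using c AC by blast
      define d where "d = c [^] (p ^ K)"
      have d: "d \<in> D" using c by (auto simp: d_def D_def)
      have dA: "d \<in> A" using d DA by blast
      define z where "z = d [^] p"
      have z: "z \<in> D" using subgroup_nat_pow_closed[OF D d] by (simp add: z_def)
      have zA: "inv z \<in> A" using z DA subgroup.m_inv_closed[OF A] by blast
      have zC: "z \<in> carrier G" using z DA AC by auto
      have "z [^] (p ^ j) = u" using c cC by (simp add: z_def d_def nat_pow_pow power_add mult_ac)
      then have "(x \<otimes> inv z) [^] (p ^ j) = \<one>"
        using pm[OF xA zA] xC zC by (simp add: nat_pow_inv u_def)
      moreover have "x \<otimes> inv z \<in> D" using x z subgroup.m_closed[OF D] subgroup.m_inv_closed[OF D] by blast
      ultimately obtain y where y: "y \<in> D" "y [^] p = x \<otimes> inv z" using Suc by blast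
      have yA: "y \<in> A" using y DA by blast
      have "(y \<otimes> d) [^] p = x"
        using pm[OF yA dA, of p] y xC zC by (simp add: z_def[symmetric] m_assoc)
      moreover have "y \<otimes> d \<in> D" using y d subgroup.m_closed[OF D] by blast
      ultimately show "\<exists>y\<in>D. y [^] p = x" by blast
    qed
  qed
  have DC: "D \<subseteq> carrier G" using D subgroup.subset by blast
  have DT: "D \<subseteq> T" using DA AT by blast
  have pdD: "p_divisible p D" unfolding p_divisible_def using Ddiv f(5) DC by blast
  have gH: "group (G\<lparr>carrier := H\<rparr>)" using H by (simp add: subgroup_imp_group)
  have DH: "subgroup D (G\<lparr>carrier := H\<rparr>)" using D H DA AH by (simp add: subgroup_incl)
  have norm: "D \<lhd> G\<lparr>carrier := H\<rparr>"
  proof (rule group.normal_invI[OF gH DH])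
    fix h x assume h: "h \<in> carrier (G\<lparr>carrier := H\<rparr>)" and x: "x \<in> D"
    then have hH: "h \<in> H" and hC: "h \<in> carrier G" using HC by auto
    obtain a where a: "a \<in> A" "x = a [^] (p ^ K)" using x by (auto simp: D_def)
    have aC: "a \<in> carrier G" using a AC by blast
    have "h \<otimes> a \<otimes> inv h \<in> A"
      using f(2)[OF hC] a hH subgroup.m_closed[OF H] subgroup.m_inv_closed[OF H] by (auto simp: A_def)
    moreover have "(h \<otimes> a \<otimes> inv h) [^] (n::nat) = h \<otimes> a [^] n \<otimes> inv h" for n
    proof (induction n)
      case (Suc n)
      show ?case using Suc hC aC by (simp add: m_assoc)
    qed (use hC in simp)
    ultimately have "h \<otimes> x \<otimes> inv h \<in> D" using a unfolding D_def by (metis image_eqI)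
    then show "h \<otimes>\<^bsub>G\<lparr>carrier := H\<rparr>\<^esub> x \<otimes>\<^bsub>G\<lparr>carrier := H\<rparr>\<^esub> inv\<^bsub>G\<lparr>carrier := H\<rparr>\<^esub> h \<in> D"
      using m_inv_consistent[OF H hH] by simp
  qed
  interpret N: normal D "G\<lparr>carrier := H\<rparr>" by (rule norm)
  obtain s where s: "card {x\<in>D. x [^] p = \<one>} = p ^ s"
  proof -
    let ?U = "{x\<in>D. x [^] p = \<one>}"
    have "subgroup ?U G"
    proof
      fix x assume x: "x \<in> ?U"
      then have xC: "x \<in> carrier G" using DC by blast
      show "inv x \<in> ?U" using x xC subgroup.m_inv_closed[OF D] by (simp add: nat_pow_inv)
      fix y assume y: "y \<in> ?U"
      show "x \<otimes> y \<in> ?U" using x y pm[of x y p] DA subgroup.m_closed[OF D] by auto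
    qed (use DC subgroup.one_closed[OF D] in auto)
    then have gU: "group (G\<lparr>carrier := ?U\<rparr>)" by (simp add: subgroup_imp_group)
    have "finite ?U" by (rule finite_subset[OF _ \<Omega>1]) (use DA in auto)
    then have "\<exists>k. order (G\<lparr>carrier := ?U\<rparr>) = p ^ k"
      by (intro finite_p_group_order[OF gU _ p]) (auto simp: nat_pow_consistent[symmetric] intro: exI[of _ 1])
    then show ?thesis using that by (auto simp: order_def)
  qed
  have "divisible_p_group p s (G\<lparr>carrier := D\<rparr>)"
    unfolding divisible_p_group_def
  proof (intro conjI ballI)
    have gD: "group (G\<lparr>carrier := D\<rparr>)" using D by (simp add: subgroup_imp_group)
    show "comm_group (G\<lparr>carrier := D\<rparr>)" by (rule group.group_comm_groupI[OF gD]) (use f(3) DT in auto)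
    show "finite {x \<in> carrier (G\<lparr>carrier := D\<rparr>). x [^]\<^bsub>G\<lparr>carrier := D\<rparr>\<^esub> p = \<one>\<^bsub>G\<lparr>carrier := D\<rparr>\<^esub>}"
      by (rule finite_subset[OF _ \<Omega>1]) (use DA in \<open>auto simp: nat_pow_consistent[symmetric]\<close>)
  qed (use f(5) DC pdD s in \<open>auto simp: nat_pow_consistent[symmetric] p_divisible_def\<close>)
  moreover have "finite (carrier (G\<lparr>carrier := H\<rparr> Mod D))"
  proof -
    define rep where "rep c = (SOME h. h \<in> H \<and> T #> h = c)" for c
    have rep: "rep (T #> h) \<in> H \<and> T #> rep (T #> h) = T #> h" if "h \<in> H" for h
      unfolding rep_def by (rule someI[of _ h]) (use that in simp)
    let ?R = "(\<lambda>h. T #> h) ` H"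
    have fR: "finite ?R" by (rule finite_subset[OF _ f(6)]) (use HC in auto)
    have "D #> h \<in> (\<lambda>(w, c). D #> (w \<otimes> rep c)) ` (\<Omega> K \<times> ?R)" if h: "h \<in> H" for h
    proof -
      let ?e = "rep (T #> h)"
      have e: "?e \<in> H" "T #> h = T #> ?e" using rep h by auto
      have c: "h \<in> carrier G" "?e \<in> carrier G" using h e HC by auto
      define a where "a = h \<otimes> inv ?e"
      have "a \<in> T" using rcos_eq_iff[OF f(1) c] e(2) by (simp add: a_def)
      then have a: "a \<in> A" using h e subgroup.m_closed[OF H] subgroup.m_inv_closed[OF H] by (simp add: a_def A_def)
      have "a [^] (p ^ K) \<in> D" using a by (auto simp: D_def)
      then obtain d where d: "d \<in> D" "d [^] (p ^ K) = a [^] (p ^ K)" using p_divisible_pow[OF pdD _ DC] by blast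
      have dA: "d \<in> A" "inv d \<in> A" using d DA subgroup.m_inv_closed[OF A] by auto
      have dc: "d \<in> carrier G" "a \<in> carrier G" using dA a AC by auto
      \<comment> \<open>This gives h = d w e with d in D, w killed by p^K and e a representative of
        the coset T h, so the finitely many cosets D w e suffice.\<close>
      define w where "w = inv d \<otimes> a"
      have "w \<in> A" using dA a subgroup.m_closed[OF A] by (simp add: w_def)
      moreover have "w [^] (p ^ K) = \<one>" using pm[OF dA(2) a] d dc by (simp add: w_def nat_pow_inv)
      ultimately have w: "w \<in> \<Omega> K" by (simp add: \<Omega>_def)
      have wc: "w \<in> carrier G" using dc by (simp add: w_def)
      have "h = d \<otimes> (w \<otimes> ?e)" using c dc by (simp add: w_def a_def m_assoc[symmetric]) (simp add: m_assoc)
      then have "D #> h = (D #> d) #> (w \<otimes> ?e)" using coset_mult_assoc DC dc c wc by simp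
      also have "D #> d = D" using coset_join2[OF dc(1) D d(1)] .
      finally show ?thesis using w h by auto
    qed
    then have "(\<lambda>h. D #> h) ` H \<subseteq> (\<lambda>(w, c). D #> (w \<otimes> rep c)) ` (\<Omega> K \<times> ?R)" by blast
    moreover have "finite (\<Omega> K \<times> ?R)" using \<Omega>fin fR by blast
    ultimately have "finite ((\<lambda>h. D #> h) ` H)" using finite_surj by blast
    then show ?thesis by (simp add: carrier_FactGroup)
  qed
  moreover have "p_group p (G\<lparr>carrier := H\<rparr> Mod D)"
    unfolding p_group_def
  proof (intro conjI ballI)
    fix c assume "c \<in> carrier (G\<lparr>carrier := H\<rparr> Mod D)"
    then obtain h where h: "h \<in> H" "c = D #>\<^bsub>G\<lparr>carrier := H\<rparr>\<^esub> h" by (auto simp: carrier_FactGroup)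
    then obtain n where "h [^] (p ^ n :: nat) = \<one>" using f(5) HC by blast
    then have "h [^]\<^bsub>G\<lparr>carrier := H\<rparr>\<^esub> (p ^ n) = \<one>\<^bsub>G\<lparr>carrier := H\<rparr>\<^esub>" by (simp add: nat_pow_consistent[symmetric])
    then have "c [^]\<^bsub>G\<lparr>carrier := H\<rparr> Mod D\<^esub> (p ^ n) = D"
      using N.FactGroup_pow[of h "p ^ n"] h DC by simp
    then show "\<exists>n::nat. c [^]\<^bsub>G\<lparr>carrier := H\<rparr> Mod D\<^esub> (p ^ n) = \<one>\<^bsub>G\<lparr>carrier := H\<rparr> Mod D\<^esub>" by auto
  qed (rule N.factorgroup_is_group)
  ultimately show ?thesis using norm is_identity_component_iff[OF gH p] by auto
qed

section \<open>The ambient group S: components, orders and normalizers of its subgroups\<close>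

locale toral = group S for S :: "('a, 'b) monoid_scheme" (structure) +
  fixes p :: nat
  assumes prime_p: "Factorial_Ring.prime p" and toral_S: "discrete_p_toral p S"
begin

abbreviation conjugate :: "'a \<Rightarrow> 'a \<Rightarrow> 'a" (infixr "\<rhd>" 75) where
  "g \<rhd> x \<equiv> g \<otimes> x \<otimes> inv g"

abbreviation idc :: "'a set \<Rightarrow> 'a set" where
  "idc H \<equiv> identity_component p (S\<lparr>carrier := H\<rparr>)"

abbreviation tord :: "'a set \<Rightarrow> nat \<times> nat" where
  "tord H \<equiv> toral_order p (S\<lparr>carrier := H\<rparr>)"

definition T :: "'a set" where "T = identity_component p S"

lemma idc_carrier: "idc (carrier S) = T"
  by (simp add: T_def)

lemma subgroup_carrier: "subgroup (carrier S) S"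
  by (rule subgroup_self)

lemma idc_is_identity_component:
  assumes H: "subgroup H S"
  obtains s where "is_identity_component p (S\<lparr>carrier := H\<rparr>) (idc H) s"
    "tord H = (s, card ((\<lambda>h. idc H #> h) ` H))"
proof -
  obtain T0 r where T0: "is_identity_component p S T0 r" using toral_S by (auto simp: discrete_p_toral_def)
  obtain D s where D: "is_identity_component p (S\<lparr>carrier := H\<rparr>) D s"
    using subgroup_identity_component[OF is_group prime_p T0 H] by blast
  have gH: "group (S\<lparr>carrier := H\<rparr>)" using H by (simp add: subgroup_imp_group)
  have "idc H = D" using identity_component_eq(1)[OF gH prime_p D] .
  then show ?thesis using that[of s] D identity_component_eq(3)[OF gH prime_p D] by simp
qed

lemma p_divisible_consistent:
  assumes "subgroup H S" shows "group.p_divisible (S\<lparr>carrier := H\<rparr>) p D = p_divisible p D"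
proof -
  interpret H: group "S\<lparr>carrier := H\<rparr>" using assms by (simp add: subgroup_imp_group)
  show ?thesis by (simp add: H.p_divisible_def p_divisible_def nat_pow_consistent[symmetric])
qed

lemma idc_facts:
  assumes H: "subgroup H S"
  shows idc_subset: "idc H \<subseteq> H" and idc_subgroup: "subgroup (idc H) S"
    and idc_conj: "\<And>h x. h \<in> H \<Longrightarrow> x \<in> idc H \<Longrightarrow> h \<rhd> x \<in> idc H"
    and idc_comm: "\<And>x y. x \<in> idc H \<Longrightarrow> y \<in> idc H \<Longrightarrow> x \<otimes> y = y \<otimes> x"
    and idc_divisible: "p_divisible p (idc H)"
    and idc_finite_index: "finite ((\<lambda>h. idc H #> h) ` H)"
    and idc_finite_socle: "finite {x \<in> idc H. x [^] p = \<one>}"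
proof -
  obtain s where s: "is_identity_component p (S\<lparr>carrier := H\<rparr>) (idc H) s"
    using idc_is_identity_component[OF H] by blast
  have gH: "group (S\<lparr>carrier := H\<rparr>)" using H by (simp add: subgroup_imp_group)
  note f = identity_component_facts[OF gH prime_p s]
  show sub: "idc H \<subseteq> H" using subgroup.subset[OF f(1)] by simp
  show "subgroup (idc H) S" using incl_subgroup[OF H f(1)] .
  show "h \<rhd> x \<in> idc H" if "h \<in> H" "x \<in> idc H" for h x
    using f(2)[of h x] m_inv_consistent[OF H] that by simp
  show "x \<otimes> y = y \<otimes> x" if "x \<in> idc H" "y \<in> idc H" for x y using f(3)[of x y] that by simp
  show "p_divisible p (idc H)" using f(4) p_divisible_consistent[OF H] by simp
  show "finite ((\<lambda>h. idc H #> h) ` H)" using f(6) by simp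
  show "finite {x \<in> idc H. x [^] p = \<one>}" using f(9) by (simp add: nat_pow_consistent[symmetric])
qed

lemma idc_largest:
  assumes H: "subgroup H S" and D: "D \<subseteq> H" "p_divisible p D"
  shows "D \<subseteq> idc H"
proof -
  obtain s where s: "is_identity_component p (S\<lparr>carrier := H\<rparr>) (idc H) s"
    using idc_is_identity_component[OF H] by blast
  have gH: "group (S\<lparr>carrier := H\<rparr>)" using H by (simp add: subgroup_imp_group)
  show ?thesis using identity_component_largest[OF gH prime_p s] D p_divisible_consistent[OF H] by simp
qed

lemma tord_eq:
  assumes H: "subgroup H S"
  obtains s where "tord H = (s, card ((\<lambda>h. idc H #> h) ` H))" "card {x \<in> idc H. x [^] p = \<one>} = p ^ s"
proof -
  obtain s where s: "is_identity_component p (S\<lparr>carrier := H\<rparr>) (idc H) s"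
    "tord H = (s, card ((\<lambda>h. idc H #> h) ` H))"
    using idc_is_identity_component[OF H] by blast
  have gH: "group (S\<lparr>carrier := H\<rparr>)" using H by (simp add: subgroup_imp_group)
  show ?thesis using that s(2) identity_component_facts(10)[OF gH prime_p s(1)] by (simp add: nat_pow_consistent[symmetric])
qed

lemma idc_mono:
  assumes "subgroup H S" "subgroup K S" "H \<subseteq> K" shows "idc H \<subseteq> idc K"
  using idc_largest[OF assms(2) _ idc_divisible[OF assms(1)]] idc_subset[OF assms(1)] assms(3) by blast

lemma T_subgroup: "subgroup T S" and T_subset: "T \<subseteq> carrier S"
  and T_conj: "\<And>g x. g \<in> carrier S \<Longrightarrow> x \<in> T \<Longrightarrow> g \<rhd> x \<in> T"
  and T_comm: "\<And>x y. x \<in> T \<Longrightarrow> y \<in> T \<Longrightarrow> x \<otimes> y = y \<otimes> x"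
  and T_divisible: "p_divisible p T"
  using idc_facts[OF subgroup_carrier] unfolding idc_carrier by auto

lemma idc_T: "idc T = T"
  using idc_subset[OF T_subgroup] idc_largest[OF T_subgroup _ T_divisible] by blast

lemma idc_subset_T: "subgroup H S \<Longrightarrow> idc H \<subseteq> T"
  using idc_mono[OF _ subgroup_carrier] subgroup.subset unfolding idc_carrier by blast

lemma torsion: "x \<in> carrier S \<Longrightarrow> \<exists>n::nat. x [^] (p ^ n) = \<one>"
  and uniform_power: "\<exists>k. \<forall>x\<in>carrier S. x [^] (p ^ k) \<in> T"
proof -
  obtain s where s: "is_identity_component p (S\<lparr>carrier := carrier S\<rparr>) (idc (carrier S)) s"
    using idc_is_identity_component[OF subgroup_carrier] by blast
  note f = identity_component_facts[OF is_group prime_p s[simplified]]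
  show "x \<in> carrier S \<Longrightarrow> \<exists>n::nat. x [^] (p ^ n) = \<one>" using f(5) .
  show "\<exists>k. \<forall>x\<in>carrier S. x [^] (p ^ k) \<in> T" using f(8) by (simp add: T_def)
qed

lemma T_pow: "x \<in> T \<Longrightarrow> y \<in> T \<Longrightarrow> (x \<otimes> y) [^] (n::nat) = x [^] n \<otimes> y [^] n"
  using pow_mult_distrib[OF T_comm] T_subset by blast

lemma finite_omega: "finite {x \<in> T. x [^] (p ^ k :: nat) = \<one>}"
  using finite_p_torsion[OF T_subgroup T_comm] idc_finite_socle[OF T_subgroup] idc_T by simp

lemma idc_image:
  assumes H: "subgroup H S" and f: "hom_on H f" and inj: "inj_on f H"
  shows "idc (f ` H) = f ` idc H"
proof -
  have fH: "subgroup (f ` H) S" by (rule hom_on_image_subgroup[OF f H])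
  have 1: "f ` idc H \<subseteq> idc (f ` H)"
    using idc_largest[OF fH _ p_divisible_image[OF f H idc_subset idc_divisible]] idc_subset H by blast
  let ?g = "inv_into H f"
  have g: "hom_on (f ` H) ?g" by (rule hom_on_inv_into[OF f H inj])
  have "?g ` (f ` H) = H" using inj by (simp add: inv_into_image_cancel)
  then have "?g ` idc (f ` H) \<subseteq> idc H"
    using idc_largest[OF H _ p_divisible_image[OF g fH idc_subset idc_divisible]] idc_subset[OF fH] fH by blast
  moreover have "f (?g y) = y" if "y \<in> idc (f ` H)" for y
    using idc_subset[OF fH] that f_inv_into_f[of y f H] by blast
  ultimately have "idc (f ` H) \<subseteq> f ` idc H"
    by (intro subsetI) (metis (no_types, lifting) imageI subsetD)
  then show ?thesis using 1 by blast
qed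

text \<open>Ranks are compared by counting elements killed by p. If the ranks agree, f is onto on
  these elements, so by \<open>divisible_socle\<close> it maps the identity component of H onto that
  of K; the induced map of component groups is then injective, and counting in a finite set does the
  rest.\<close>

lemma tord_injection:
  assumes H: "subgroup H S" and K: "subgroup K S" and f: "hom_on H f" and inj: "inj_on f H" and im: "f ` H \<subseteq> K"
  shows tord_mono: "lex_le (tord H) (tord K)"
    and tord_surj: "lex_le (tord K) (tord H) \<Longrightarrow> f ` H = K"
proof -
  let ?C = "idc H" and ?D = "idc K"
  obtain s where s: "tord H = (s, card ((\<lambda>h. ?C #> h) ` H))" "card {x \<in> ?C. x [^] p = \<one>} = p ^ s"
    using tord_eq[OF H] by blast
  obtain t where t: "tord K = (t, card ((\<lambda>h. ?D #> h) ` K))" "card {x \<in> ?D. x [^] p = \<one>} = p ^ t"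
    using tord_eq[OF K] by blast
  have HC: "H \<subseteq> carrier S" and KC: "K \<subseteq> carrier S" using H K subgroup.subset by blast+
  have CH: "?C \<subseteq> H" and sC: "subgroup ?C S" using idc_subset[OF H] idc_subgroup[OF H] by auto
  have DK: "?D \<subseteq> K" and sD: "subgroup ?D S" using idc_subset[OF K] idc_subgroup[OF K] by auto
  have fH: "subgroup (f ` H) S" by (rule hom_on_image_subgroup[OF f H])
  have fCD: "f ` ?C \<subseteq> ?D" using idc_mono[OF fH K im] idc_image[OF H f inj] by simp
  let ?U = "{x \<in> ?C. x [^] p = \<one>}" and ?V = "{x \<in> ?D. x [^] p = \<one>}"
  have fU: "f ` ?U \<subseteq> ?V"
  proof clarify
    fix x assume "x \<in> ?C" "x [^] p = \<one>"
    then show "f x \<in> ?D \<and> f x [^] p = \<one>"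
      using fCD hom_on_pow[OF f H, of x p] CH hom_on_one[OF f H] by auto
  qed
  have fV: "finite ?V" by (rule idc_finite_socle[OF K])
  have injU: "inj_on f ?U" by (rule inj_on_subset[OF inj]) (use CH in auto)
  have "p ^ s \<le> p ^ t" using card_inj_on_le[OF injU fU fV] s(2) t(2) by simp
  then have st: "s \<le> t" using prime_p prime_gt_1_nat by simp
  have eq: "f ` ?C = ?D" if "s = t"
  proof -
    have "card (f ` ?U) = card ?V" using card_image[OF injU] s(2) t(2) that by simp
    then have UV: "f ` ?U = ?V" using card_subset_eq[OF fV fU] by blast
    have "?D \<subseteq> f ` ?C"
    proof (rule divisible_socle[OF _ _ sD _ _ _ fCD])
      show "subgroup (f ` ?C) S" by (rule hom_on_image_subgroup[OF hom_on_subset[OF f CH] sC])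
      show "p_divisible p (f ` ?C)" by (rule p_divisible_image[OF f H CH idc_divisible[OF H]])
      show "x \<otimes> y = y \<otimes> x" if "x \<in> ?D" "y \<in> f ` ?C" for x y using idc_comm[OF K] that fCD by blast
      show "\<exists>n::nat. x [^] (p ^ n) = \<one>" if "x \<in> ?D" for x using torsion that DK KC by blast
      show "x \<in> f ` ?C" if "x \<in> ?D" "x [^] p = \<one>" for x using UV that by blast
    qed
    then show ?thesis using fCD by blast
  qed
  let ?A = "(\<lambda>h. ?C #> h) ` H" and ?B = "(\<lambda>h. ?D #> h) ` K"
  have fB: "finite ?B" by (rule idc_finite_index[OF K])
  define q where "q c = ?D #> f (SOME h. h \<in> H \<and> ?C #> h = c)" for c
  have rep: "(SOME h'. h' \<in> H \<and> ?C #> h' = ?C #> h) \<in> H \<and> ?C #> (SOME h'. h' \<in> H \<and> ?C #> h' = ?C #> h) = ?C #> h" if "h \<in> H" for h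
    by (rule someI[of _ h]) (use that in simp)
  have fd: "f (g \<otimes> inv h) = f g \<otimes> inv (f h)" if "g \<in> H" "h \<in> H" for g h
    using hom_onD(2)[OF f that(1) subgroup.m_inv_closed[OF H that(2)]] hom_on_inv[OF f H that(2)] by simp
  have Ceq: "?C #> g = ?C #> h \<longleftrightarrow> g \<otimes> inv h \<in> ?C" if "g \<in> H" "h \<in> H" for g h
    using rcos_eq_iff[OF sC] that HC by blast
  have Deq: "?D #> f g = ?D #> f h \<longleftrightarrow> f (g \<otimes> inv h) \<in> ?D" if "g \<in> H" "h \<in> H" for g h
    using rcos_eq_iff[OF sD, of "f g" "f h"] fd that hom_onD(1)[OF f] by simp
  have q: "q (?C #> h) = ?D #> f h" if h: "h \<in> H" for h
  proof -
    let ?s = "SOME h'. h' \<in> H \<and> ?C #> h' = ?C #> h"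
    have "?s \<otimes> inv h \<in> ?C" using rep[OF h] Ceq h by blast
    then show ?thesis using Deq[of ?s h] rep[OF h] h fCD unfolding q_def by blast
  qed
  have qA: "q ` ?A \<subseteq> ?B" using q im by auto
  have qinj: "inj_on q ?A" if st': "s = t"
  proof (rule inj_onI)
    fix c d assume "c \<in> ?A" "d \<in> ?A" "q c = q d"
    then obtain g h where gh: "g \<in> H" "h \<in> H" "c = ?C #> g" "d = ?C #> h" "?D #> f g = ?D #> f h" using q by auto
    then have "f (g \<otimes> inv h) \<in> f ` ?C" using Deq eq[OF st'] by simp
    then obtain z where z: "z \<in> ?C" "f (g \<otimes> inv h) = f z" by auto
    have "g \<otimes> inv h \<in> H" using gh subgroup.m_closed[OF H] subgroup.m_inv_closed[OF H] by simp
    then have "g \<otimes> inv h = z" using inj_onD[OF inj z(2)] z(1) CH by blast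
    then show "c = d" using Ceq gh z by simp
  qed
  show "lex_le (tord H) (tord K)"
    using s(1) t(1) st card_inj_on_le[OF qinj qA fB] by (auto simp: lex_le_def)
  show "f ` H = K" if le: "lex_le (tord K) (tord H)"
  proof -
    have stq: "s = t" and cle: "card ?B \<le> card ?A" using le s(1) t(1) st by (auto simp: lex_le_def)
    have "card (q ` ?A) = card ?A" using card_image[OF qinj[OF stq]] .
    then have "q ` ?A = ?B" using card_seteq[OF fB qA] cle by simp
    have "k \<in> f ` H" if k: "k \<in> K" for k
    proof -
      have "?D #> k \<in> q ` ?A" using \<open>q ` ?A = ?B\<close> k by blast
      then obtain h where h: "h \<in> H" "?D #> k = ?D #> f h" using q by auto
      have c: "k \<in> carrier S" "f h \<in> carrier S" using k h KC hom_onD(1)[OF f] by auto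
      then have "k \<otimes> inv (f h) \<in> f ` ?C" using rcos_eq_iff[OF sD c] h(2) eq[OF stq] by simp
      then have "k \<otimes> inv (f h) \<in> f ` H" using CH by blast
      then have "k \<otimes> inv (f h) \<otimes> f h \<in> f ` H" using subgroup.m_closed[OF fH] h by blast
      then show ?thesis using c by (simp add: m_assoc)
    qed
    then show ?thesis using im by blast
  qed
qed

lemma lex_le_refl: "lex_le x x" by (simp add: lex_le_def)

text \<open>Subgroups of S may be infinite, yet by comparison of orders none is isomorphic to a
  proper subgroup of itself. Hence normalizing a subgroup can be checked by one inclusion, as in
  \<open>normalizerI\<close>.\<close>

lemma injective_endo_onto:
  assumes "subgroup H S" "hom_on H f" "inj_on f H" "f ` H \<subseteq> H" shows "f ` H = H"
  using tord_surj[OF assms(1,1,2,3,4) lex_le_refl] .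

subsection \<open>Normalizers\<close>

lemma mem_normalizer_iff:
  assumes "P \<subseteq> carrier S"
  shows "g \<in> normalizer S P \<longleftrightarrow> g \<in> carrier S \<and> (\<lambda>x. g \<rhd> x) ` P = P"
proof -
  have "g <# P #> inv g = (\<lambda>x. g \<rhd> x) ` P" by (auto simp: l_coset_def r_coset_def)
  then show ?thesis using assms by (auto simp: normalizer_def stabilizer_def)
qed

lemma conj_hom_on: "g \<in> carrier S \<Longrightarrow> P \<subseteq> carrier S \<Longrightarrow> hom_on P (\<lambda>x. g \<rhd> x)"
  by (auto simp: hom_on_def m_assoc subset_iff)

lemma conj_inj_on: "g \<in> carrier S \<Longrightarrow> P \<subseteq> carrier S \<Longrightarrow> inj_on (\<lambda>x. g \<rhd> x) P"
  by (auto simp: inj_on_def subset_iff)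

lemma normalizerI:
  assumes P: "subgroup P S" and g: "g \<in> carrier S" and "\<And>x. x \<in> P \<Longrightarrow> g \<rhd> x \<in> P"
  shows "g \<in> normalizer S P"
proof -
  have PC: "P \<subseteq> carrier S" using P subgroup.subset by blast
  have "(\<lambda>x. g \<rhd> x) ` P = P"
    by (rule injective_endo_onto[OF P conj_hom_on conj_inj_on]) (use assms PC in auto)
  then show ?thesis using mem_normalizer_iff[OF PC] g by blast
qed

lemma normalizerD:
  assumes "subgroup P S" "g \<in> normalizer S P"
  shows "g \<in> carrier S" "x \<in> P \<Longrightarrow> g \<rhd> x \<in> P"
  using assms mem_normalizer_iff[of P g] subgroup.subset by blast+

lemma normalizer_subgroup: "subgroup P S \<Longrightarrow> subgroup (normalizer S P) S"
  using normalizer_imp_subgroup subgroup.subset by blast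

lemma normalizer_contains: "subgroup P S \<Longrightarrow> P \<subseteq> normalizer S P"
  by (intro subsetI normalizerI) (auto simp: subgroup.m_closed subgroup.m_inv_closed subgroup.mem_carrier)

text \<open>The fixed-point argument for p-groups: Q acts by right multiplication on a finite set of
  cosets Q y whose number is divisible by p. It fixes the coset Q, so among the others there is an
  orbit of size prime to p, which is a single coset Q a, and then a normalizes Q. Since Q may have
  infinite index in G, a suitable set of representatives Y has to be found first.\<close>

lemma normalizer_growth:
  assumes Q: "subgroup Q S" and G: "subgroup G S" and lt: "Q \<subset> G"
  obtains g where "g \<in> G" "g \<notin> Q" "g \<in> normalizer S Q"
proof -
  have QC: "Q \<subseteq> carrier S" and GC: "G \<subseteq> carrier S" using Q G subgroup.subset by blast+
  have "\<exists>Y. subgroup Y S \<and> Y \<subseteq> G \<and> \<not> Y \<subseteq> Q \<and> finite ((\<lambda>y. Q #> y) ` Y) \<and> (\<forall>y\<in>Y. \<forall>q\<in>Q. Q #> (y \<otimes> q) \<in> (\<lambda>y. Q #> y) ` Y)"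
  \<comment> \<open>If Q contains the identity component of G, its index is finite and Y = G will
    do. Otherwise some x in this torus lies outside Q; if p^n kills x, the torus elements killed by
    p^n form a finite group that is stable under conjugation by Q.\<close>
  proof (cases "idc G \<subseteq> Q")
    case True
    have "finite ((\<lambda>y. Q #> y) ` G)"
    proof -
      have "Q #> y = Q <#> (idc G #> y)" if "y \<in> G" for y
      proof -
        have "Q <#> idc G = Q"
        proof
          show "Q <#> idc G \<subseteq> Q" using True subgroup.m_closed[OF Q] by (auto simp: set_mult_def)
          have "x = x \<otimes> \<one>" if "x \<in> Q" for x using that QC by auto
          then show "Q \<subseteq> Q <#> idc G"
            using subgroup.one_closed[OF idc_subgroup[OF G]] unfolding set_mult_def by blast
        qed
        then show ?thesis using setmult_rcos_assoc[of Q "idc G" y] QC GC that idc_subset[OF G] by auto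
      qed
      then have "(\<lambda>y. Q #> y) ` G = (\<lambda>c. Q <#> c) ` ((\<lambda>y. idc G #> y) ` G)" by (auto simp: image_image)
      then show ?thesis using idc_finite_index[OF G] by simp
    qed
    then show ?thesis using G lt subgroup.m_closed[OF G] by (intro exI[of _ G]) auto
  next
    case False
    then obtain x where x: "x \<in> idc G" "x \<notin> Q" by blast
    have CT: "idc G \<subseteq> T" and CG: "idc G \<subseteq> G" and sC: "subgroup (idc G) S"
      using idc_subset_T[OF G] idc_subset[OF G] idc_subgroup[OF G] by auto
    obtain n where n: "x [^] (p ^ n :: nat) = \<one>" using torsion x CG GC by blast
    let ?Y = "{y \<in> idc G. y [^] (p ^ n :: nat) = \<one>}"
    have sY: "subgroup ?Y S"
    proof
      fix y assume y: "y \<in> ?Y"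
      then have yC: "y \<in> carrier S" using CG GC by blast
      show "inv y \<in> ?Y" using y yC subgroup.m_inv_closed[OF sC] by (simp add: nat_pow_inv)
      fix z assume z: "z \<in> ?Y"
      then have "(y \<otimes> z) [^] (p ^ n) = \<one>" using T_pow[of y z "p ^ n"] CT y by auto
      then show "y \<otimes> z \<in> ?Y" using y z subgroup.m_closed[OF sC] by auto
    qed (use CG GC subgroup.one_closed[OF sC] in auto)
    have fY: "finite ?Y" by (rule finite_subset[OF _ finite_omega[of n]]) (use CT in auto)
    have "Q #> (y \<otimes> q) \<in> (\<lambda>y. Q #> y) ` ?Y" if y: "y \<in> ?Y" and q: "q \<in> Q" for y q
    proof -
      have c: "y \<in> carrier S" "q \<in> carrier S" and qG: "q \<in> G" using y q CG GC lt by auto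
      have iq: "inv q \<in> G" using qG subgroup.m_inv_closed[OF G] by blast
      have "inv q \<otimes> y \<otimes> q \<in> idc G" using idc_conj[OF G iq, of y] y c by simp
      moreover have "(inv q \<otimes> y \<otimes> q) [^] (p ^ n) = \<one>"
        using hom_on_pow[OF conj_hom_on[of "inv q" "carrier S"] subgroup_carrier, of y "p ^ n"] y c by simp
      moreover have "Q #> (y \<otimes> q) = Q #> (inv q \<otimes> y \<otimes> q)"
      proof -
        have "(inv q \<otimes> y \<otimes> q) \<otimes> inv (y \<otimes> q) = inv q" using c by (simp add: inv_mult_group m_assoc)
        then show ?thesis using rcos_eq_iff[OF Q, of "inv q \<otimes> y \<otimes> q" "y \<otimes> q"] c q subgroup.m_inv_closed[OF Q q] by simp
      qed
      ultimately show ?thesis by blast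
    qed
    moreover have "\<not> ?Y \<subseteq> Q" using x n by blast
    ultimately show ?thesis using sY fY CG by (intro exI[of _ ?Y]) auto
  qed
  then obtain Y where Y: "subgroup Y S" "Y \<subseteq> G" "\<not> Y \<subseteq> Q" "finite ((\<lambda>y. Q #> y) ` Y)"
    and inv: "\<And>y q. y \<in> Y \<Longrightarrow> q \<in> Q \<Longrightarrow> Q #> (y \<otimes> q) \<in> (\<lambda>y. Q #> y) ` Y" by blast
  have YC: "Y \<subseteq> carrier S" using Y GC by blast
  let ?E = "(\<lambda>y. Q #> y) ` Y" and ?A = "Y - Q"
  have tors: "\<And>y. y \<in> H \<Longrightarrow> \<exists>n::nat. y [^] (p ^ n) = \<one>" if "subgroup H S" for H
    using torsion subgroup.mem_carrier[OF that] by blast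
  \<comment> \<open>Y itself is transitive on these cosets; were their number prime to p, it would
    be 1 and Y would lie in Q.\<close>
  have dvd: "p dvd card ?E"
  proof (rule ccontr)
    assume "\<not> p dvd card ?E"
    then have "coprime_index p Q Y" using prime_imp_coprime[OF prime_p] Y(4) by (simp add: coprime_index_def)
    moreover have "(\<otimes>) \<one> ` Y = Y" using YC by (auto simp: subset_iff image_iff)
    ultimately have ci: "coprime_index p Q ((\<otimes>) \<one> ` Y)" by simp
    have "y \<in> Q" if "y \<in> Y" for y
      using coprime_index_p_group[OF prime_p Q Y(1) one_closed tors[OF Y(1)] ci that] that YC by auto
    then show False using Y(3) by blast
  qed
  have Qeq: "Q #> y = Q \<longleftrightarrow> y \<in> Q" if "y \<in> carrier S" for y
    using coset_join1[OF _ that Q] coset_join2[OF that Q] by blast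
  have EA: "(\<lambda>y. Q #> y) ` ?A = ?E - {Q}" using Qeq YC by (auto simp: subset_iff)
  have "Q \<in> ?E" using Qeq[of \<one>] subgroup.one_closed[OF Y(1)] subgroup.one_closed[OF Q] by (metis image_eqI one_closed)
  then have "card ?E = Suc (card (?E - {Q}))" using Y(4) by (metis card.remove)
  then have "\<not> p dvd card (?E - {Q})"
    using dvd prime_p by (metis dvd_diff_nat diff_Suc_1 Suc_diff_Suc dvd_add_right_iff plus_1_eq_Suc not_prime_unit add.commute)
  then have ci: "coprime_index p Q ?A"
    using prime_imp_coprime[OF prime_p] Y(4) EA by (simp add: coprime_index_def)
  have "Q #> (a \<otimes> q) \<in> (\<lambda>y. Q #> y) ` ?A" if a: "a \<in> ?A" and q: "q \<in> Q" for a q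
  proof -
    have c: "a \<in> carrier S" "q \<in> carrier S" using a q YC QC by auto
    have "Q #> (a \<otimes> q) \<noteq> Q"
    proof
      assume "Q #> (a \<otimes> q) = Q"
      then have "a \<otimes> q \<in> Q" using Qeq c by simp
      then have "a \<otimes> q \<otimes> inv q \<in> Q" using q subgroup.m_closed[OF Q] subgroup.m_inv_closed[OF Q] by blast
      then show False using a c by (simp add: m_assoc)
    qed
    then show ?thesis using inv[of a q] a q EA by auto
  qed
  then obtain a where a: "a \<in> ?A" "coprime_index p Q ((\<otimes>) a ` Q)"
    using coprime_index_orbit[OF prime_p QC Q _ ci] YC by blast
  have aC: "a \<in> carrier S" using a YC by blast
  have "a \<rhd> y \<in> Q" if "y \<in> Q" for y
    using coprime_index_p_group[OF prime_p Q Q aC tors[OF Q] a(2) that] .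
  then have "a \<in> normalizer S Q" using normalizerI[OF Q aC] by blast
  then show ?thesis using that a Y(2) by blast
qed

end

context toral begin

text \<open>A torus normalising \<open>P\<close> acts on \<open>P\<close> by inner automorphisms: the commutator map is a
  1-cocycle of the finite group \<open>P/P\<^sub>0\<close>, hence a coboundary after multiplication by its order.\<close>

lemma normalizer_idc_inner:
  assumes P: "subgroup P S" and t: "t \<in> idc (normalizer S P)"
  obtains u where "u \<in> P" "\<And>x. x \<in> P \<Longrightarrow> t \<rhd> x = u \<rhd> x"
proof -
  let ?N = "normalizer S P" and ?Q = "idc P"
  have N: "subgroup ?N S" by (rule normalizer_subgroup[OF P])
  have PC: "\<And>x. x \<in> P \<Longrightarrow> x \<in> carrier S" using P subgroup.mem_carrier by metis
  have Q: "subgroup ?Q S" and QP: "?Q \<subseteq> P" and QT: "?Q \<subseteq> T"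
    using idc_subgroup idc_subset idc_subset_T P by auto
  have DN: "idc ?N \<subseteq> ?N" and DT: "idc ?N \<subseteq> T" and D: "subgroup (idc ?N) S"
    using idc_subset idc_subset_T idc_subgroup N by auto
  have TC: "\<And>x. x \<in> T \<Longrightarrow> x \<in> carrier S" using T_subset by blast
  \<comment> \<open>The commutator of s and x. For fixed x it is a homomorphism in s on the
    divisible group \<open>idc ?N\<close>, which is why its values lie in the identity component of
    P, see \<open>cQ\<close>.\<close>
  define c where "c s x = s \<rhd> x \<otimes> inv x" for s x
  have cC: "c s x \<in> carrier S" if "s \<in> idc ?N" "x \<in> P" for s x using that DT TC PC by (auto simp: c_def)
  have cT: "c s x \<in> T" if "s \<in> idc ?N" "x \<in> P" for s x
  proof -
    have "s \<in> T" using that DT by blast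
    moreover have "x \<rhd> inv s \<in> T"
      using T_conj[of x "inv s"] \<open>s \<in> T\<close> PC[OF that(2)] subgroup.m_inv_closed[OF T_subgroup] by simp
    ultimately have "s \<otimes> (x \<rhd> inv s) \<in> T" using subgroup.m_closed[OF T_subgroup] by blast
    then show ?thesis using TC[OF \<open>s \<in> T\<close>] PC that by (simp add: c_def m_assoc)
  qed
  have cP: "c s x \<in> P" if "s \<in> idc ?N" "x \<in> P" for s x
    using normalizerD(2)[OF P, of s x] that DN subgroup.m_closed[OF P] subgroup.m_inv_closed[OF P] by (auto simp: c_def)
  have cmul: "c (s \<otimes> s') x = c s x \<otimes> c s' x" if s: "s \<in> idc ?N" "s' \<in> idc ?N" "x \<in> P" for s s' x
  proof -
    have C: "s \<in> carrier S" "s' \<in> carrier S" "x \<in> carrier S" using s DT TC PC by auto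
    have "c s x \<otimes> c s' x = c s' x \<otimes> c s x" using T_comm cT s by blast
    also have "\<dots> = c s' x \<otimes> s \<otimes> x \<otimes> inv s \<otimes> inv x" using C cC s by (simp add: c_def m_assoc)
    also have "c s' x \<otimes> s = s \<otimes> c s' x" using T_comm cT s DT by blast
    also have "s \<otimes> c s' x \<otimes> x \<otimes> inv s \<otimes> inv x = c (s \<otimes> s') x"
      using C by (simp add: c_def m_assoc inv_mult_group)
    finally show ?thesis by simp
  qed
  have cQ: "c s x \<in> ?Q" if s: "s \<in> idc ?N" and x: "x \<in> P" for s x
  proof -
    have h: "hom_on (idc ?N) (\<lambda>s. c s x)" using cC cmul x by (auto simp: hom_on_def)
    have "p_divisible p ((\<lambda>s. c s x) ` idc ?N)"
      by (rule p_divisible_image[OF h D order_refl idc_divisible[OF N]])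
    moreover have "(\<lambda>s. c s x) ` idc ?N \<subseteq> P" using cP x by blast
    ultimately have "(\<lambda>s. c s x) ` idc ?N \<subseteq> ?Q" using idc_largest[OF P] by blast
    then show ?thesis using s by blast
  qed
  have ccoc: "c s (y \<otimes> x) = c s y \<otimes> (y \<rhd> c s x)" if "s \<in> idc ?N" "x \<in> P" "y \<in> P" for s x y
  proof -
    have C: "s \<in> carrier S" "x \<in> carrier S" "y \<in> carrier S" using that DT TC PC by auto
    then show ?thesis by (simp add: c_def m_assoc inv_mult_group)
  qed
  have cinv: "c s (q \<otimes> x) = c s x" if s: "s \<in> idc ?N" "x \<in> P" "q \<in> ?Q" for s x q
  proof -
    have qP: "q \<in> P" using s QP by blast
    have C: "s \<in> carrier S" "q \<in> carrier S" "x \<in> carrier S" using s DT TC PC qP by auto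
    have "s \<otimes> q = q \<otimes> s" using T_comm s DT QT by blast
    then have "c s q = \<one>" using C by (simp add: c_def m_assoc)
    moreover have "q \<otimes> c s x = c s x \<otimes> q" using T_comm cT s QT by blast
    ultimately show ?thesis using ccoc[OF s(1,2) qP] C cC s by (simp add: m_assoc)
  qed
  let ?E = "(\<lambda>x. ?Q #> x) ` P"
  have fE: "finite ?E" by (rule idc_finite_index[OF P])
  define n where "n = card ?E"
  define rep where "rep d = (SOME x. x \<in> P \<and> ?Q #> x = d)" for d
  have rep: "rep d \<in> P \<and> ?Q #> rep d = d" if "d \<in> ?E" for d
    unfolding rep_def by (rule someI_ex) (use that in blast)
  have Qeq: "?Q #> x = ?Q #> y \<longleftrightarrow> x \<otimes> inv y \<in> ?Q" if "x \<in> P" "y \<in> P" for x y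
    using rcos_eq_iff[OF Q] PC that by simp
  have crep: "c s (rep (?Q #> x)) = c s x" if s: "s \<in> idc ?N" and x: "x \<in> P" for s x
  proof -
    let ?r = "rep (?Q #> x)"
    have r: "?r \<in> P" "?Q #> ?r = ?Q #> x" using rep x by auto
    have "?r \<otimes> inv x \<in> ?Q" using Qeq r x by simp
    then have "c s (?r \<otimes> inv x \<otimes> x) = c s x" using cinv s x by blast
    then show ?thesis using r x PC by (simp add: m_assoc)
  qed
  have key: "\<exists>u\<in>?Q. \<forall>y\<in>P. (s [^] n) \<rhd> y = u \<rhd> y" if s: "s \<in> idc ?N" for s
  proof -
    let ?M = "S\<lparr>carrier := ?Q\<rparr>"
    have gM: "group ?M" using Q by (simp add: subgroup_imp_group)
    interpret M: comm_group ?M by (rule group.group_comm_groupI[OF gM]) (use idc_comm[OF P] in auto)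
    \<comment> \<open>The cocycle is multiplied up over coset representatives, as in the proof that
      the order of a finite group kills its first cohomology: y permutes the cosets, and reindexing
      the product expresses c(s, y)^n as u (y u y^-1)^-1.\<close>
    define u where "u = finprod ?M (\<lambda>d. c s (rep d)) ?E"
    have g: "(\<lambda>d. c s (rep d)) \<in> ?E \<rightarrow> ?Q" using cQ s rep by auto
    have uQ: "u \<in> ?Q" unfolding u_def using M.finprod_closed[of _ ?E] g by simp
    have "(s [^] n) \<rhd> y = u \<rhd> y" if y: "y \<in> P" for y
    proof -
      have yC: "y \<in> carrier S" and sC: "s \<in> carrier S" using y PC s DT TC by auto
      define \<sigma> where "\<sigma> d = ?Q #> (y \<otimes> rep d)" for d
      have \<sigma>E: "\<sigma> ` ?E \<subseteq> ?E" using rep y subgroup.m_closed[OF P] by (auto simp: \<sigma>_def)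
      have \<sigma>inj: "inj_on \<sigma> ?E"
      proof (rule inj_onI)
        fix d e assume de: "d \<in> ?E" "e \<in> ?E" "\<sigma> d = \<sigma> e"
        have r: "rep d \<in> P" "rep e \<in> P" "?Q #> rep d = d" "?Q #> rep e = e" using rep de by auto
        have rC: "rep d \<in> carrier S" "rep e \<in> carrier S" using r PC by auto
        have "(y \<otimes> rep d) \<otimes> inv (y \<otimes> rep e) \<in> ?Q"
          using de(3) Qeq[of "y \<otimes> rep d" "y \<otimes> rep e"] r y subgroup.m_closed[OF P] by (simp add: \<sigma>_def)
        then have "inv y \<rhd> ((y \<otimes> rep d) \<otimes> inv (y \<otimes> rep e)) \<in> ?Q"
          using idc_conj[OF P] y subgroup.m_inv_closed[OF P] by blast
        then have "rep d \<otimes> inv (rep e) \<in> ?Q" using yC rC by (simp add: m_assoc inv_mult_group)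
        then show "d = e" using Qeq r by metis
      qed
      have \<sigma>im: "\<sigma> ` ?E = ?E" by (rule endo_inj_surj[OF fE \<sigma>E \<sigma>inj])
      have "u = finprod ?M (\<lambda>d. c s (rep d)) (\<sigma> ` ?E)" by (simp only: \<sigma>im u_def)
      also have "\<dots> = finprod ?M (\<lambda>d. c s (rep (\<sigma> d))) ?E"
        by (rule M.finprod_reindex) (use g \<sigma>im \<sigma>inj in auto)
      also have "\<dots> = finprod ?M (\<lambda>d. c s y \<otimes> (y \<rhd> c s (rep d))) ?E"
      proof (rule M.finprod_cong')
        show "(\<lambda>d. c s y \<otimes> (y \<rhd> c s (rep d))) \<in> ?E \<rightarrow> carrier ?M"
          using cQ[OF s] idc_conj[OF P y] y rep subgroup.m_closed[OF Q] by auto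
        fix d assume d: "d \<in> ?E"
        have "c s (rep (\<sigma> d)) = c s (y \<otimes> rep d)"
          unfolding \<sigma>_def using crep[OF s] rep[OF d] y subgroup.m_closed[OF P] by blast
        then show "c s (rep (\<sigma> d)) = c s y \<otimes> (y \<rhd> c s (rep d))" using ccoc[OF s _ y] rep[OF d] by simp
      qed simp
      also have "\<dots> = finprod ?M (\<lambda>d. c s y) ?E \<otimes> finprod ?M (\<lambda>d. y \<rhd> c s (rep d)) ?E"
      proof -
        have "(\<lambda>d. y \<rhd> c s (rep d)) \<in> ?E \<rightarrow> carrier ?M" using cQ[OF s] idc_conj[OF P y] rep by auto
        moreover have "(\<lambda>d. c s y) \<in> ?E \<rightarrow> carrier ?M" using cQ[OF s y] by auto
        ultimately show ?thesis using M.finprod_multf[of "\<lambda>d. c s y" ?E "\<lambda>d. y \<rhd> c s (rep d)"] by simp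
      qed
      also have "finprod ?M (\<lambda>d. c s y) ?E = c s y [^] n"
        using M.finprod_const[of "c s y" ?E] cQ[OF s y] by (simp add: n_def nat_pow_consistent[symmetric])
      also have "finprod ?M (\<lambda>d. y \<rhd> c s (rep d)) ?E = y \<rhd> u"
      proof -
        have "finprod ?M (\<lambda>d. y \<rhd> c s (rep d)) A = y \<rhd> finprod ?M (\<lambda>d. c s (rep d)) A
            \<and> finprod ?M (\<lambda>d. c s (rep d)) A \<in> ?Q" if "finite A" "A \<subseteq> ?E" for A
          using that
        proof (induction A)
          case empty
          then show ?case using yC subgroup.one_closed[OF Q] by simp
        next
          case (insert a A)
          have ga: "c s (rep a) \<in> ?Q" "(\<lambda>d. c s (rep d)) \<in> A \<rightarrow> carrier ?M" using g insert by auto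
          have gb: "y \<rhd> c s (rep a) \<in> ?Q" "(\<lambda>d. y \<rhd> c s (rep d)) \<in> A \<rightarrow> carrier ?M"
            using idc_conj[OF P y] ga by auto
          have IH: "finprod ?M (\<lambda>d. y \<rhd> c s (rep d)) A = y \<rhd> finprod ?M (\<lambda>d. c s (rep d)) A"
            "finprod ?M (\<lambda>d. c s (rep d)) A \<in> ?Q" using insert by auto
          have C: "c s (rep a) \<in> carrier S" "finprod ?M (\<lambda>d. c s (rep d)) A \<in> carrier S"
            using ga(1) IH(2) QP PC by auto
          show ?case
            using M.finprod_insert[OF insert(1,2), of "\<lambda>d. c s (rep d)"] M.finprod_insert[OF insert(1,2), of "\<lambda>d. y \<rhd> c s (rep d)"]
              ga gb IH C yC subgroup.m_closed[OF Q] by (simp add: m_assoc)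
        qed
        then show ?thesis using fE by (simp add: u_def)
      qed
      finally have eq: "u = c s y [^] n \<otimes> (y \<rhd> u)" .
      have "c (s [^] n) y = c s y [^] n"
        using hom_on_pow[of "idc ?N" "\<lambda>s. c s y" s n] D s cC cmul y by (simp add: hom_on_def)
      moreover have uC: "u \<in> carrier S" using uQ QP PC by blast
      moreover have "c s y [^] n \<in> carrier S" using cC[OF s y] by simp
      ultimately have "u \<otimes> inv (y \<rhd> u) = c (s [^] n) y" using yC
        by (metis eq inv_solve_right' m_closed inv_closed)
      then have "u \<rhd> y \<otimes> inv y = s [^] n \<otimes> y \<otimes> inv (s [^] n) \<otimes> inv y"
        using yC uC by (simp add: c_def m_assoc inv_mult_group)
      then have "u \<rhd> y = s [^] n \<otimes> y \<otimes> inv (s [^] n)"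
        using yC uC sC by (meson inv_closed m_closed nat_pow_closed right_cancel)
      then show ?thesis by simp
    qed
    then show ?thesis using uQ by blast
  qed
  obtain k where k: "n = p ^ k"
  proof -
    obtain s where s: "is_identity_component p (S\<lparr>carrier := P\<rparr>) ?Q s"
      using idc_is_identity_component[OF P] by blast
    have gP: "group (S\<lparr>carrier := P\<rparr>)" using P by (simp add: subgroup_imp_group)
    have "?Q \<lhd> S\<lparr>carrier := P\<rparr>" and fin: "finite (carrier (S\<lparr>carrier := P\<rparr> Mod ?Q))" and "p_group p (S\<lparr>carrier := P\<rparr> Mod ?Q)"
      using s is_identity_component_iff[OF gP prime_p] by auto
    then have "\<exists>k. order (S\<lparr>carrier := P\<rparr> Mod ?Q) = p ^ k"
      using finite_p_group_order[OF normal.factorgroup_is_group fin prime_p] by (auto simp: p_group_def)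
    then show ?thesis using that identity_component_facts(7)[OF gP prime_p s] by (auto simp: n_def)
  qed
  \<comment> \<open>The number n of cosets is a power of p, so divisibility writes t as s^n and
    \<open>key\<close> applies to s.\<close>
  obtain s where s: "s \<in> idc ?N" "s [^] (p ^ k) = t"
    using p_divisible_pow[OF idc_divisible[OF N] t] DT TC by blast
  then obtain u where "u \<in> ?Q" "\<forall>y\<in>P. t \<rhd> y = u \<rhd> y" using key[OF s(1)] k by auto
  then show ?thesis using that QP by blast
qed

end

section \<open>Morphisms of a fusion system\<close>

lemma BijGroup_simps [simp]:
  "carrier (BijGroup P) = Bij P" "\<one>\<^bsub>BijGroup P\<^esub> = (\<lambda>x\<in>P. x)"
  "f \<in> Bij P \<Longrightarrow> g \<in> Bij P \<Longrightarrow> f \<otimes>\<^bsub>BijGroup P\<^esub> g = compose P f g"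
  by (simp_all add: BijGroup_def)

locale fusion = toral S p for S :: "('a, 'b) monoid_scheme" (structure) and p +
  fixes F :: "'a fusion_homs"
  assumes fus: "fusion_system p S F"
begin

text \<open>Restricting to \<open>P\<close> makes \<open>mor P f\<close> depend only on the values of \<open>f\<close> on \<open>P\<close>, so that no
  extensionality bookkeeping is needed.\<close>

definition mor :: "'a set \<Rightarrow> ('a \<Rightarrow> 'a) \<Rightarrow> bool" where
  "mor P f \<longleftrightarrow> subgroup P S \<and> restrict f P \<in> F P (carrier S)"

lemma mor_subgroup: "mor P f \<Longrightarrow> subgroup P S" by (simp add: mor_def)

lemma mor_cong: "(\<And>x. x \<in> P \<Longrightarrow> f x = g x) \<Longrightarrow> mor P f = mor P g"
  unfolding mor_def by (metis restrict_ext)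

lemma F_Inj: "subgroup P S \<Longrightarrow> subgroup Q S \<Longrightarrow> F P Q \<subseteq> Inj_grp S P Q"
  and F_Hom_S: "subgroup P S \<Longrightarrow> subgroup Q S \<Longrightarrow> Hom_S S P Q \<subseteq> F P Q"
  and F_compose: "subgroup P S \<Longrightarrow> subgroup Q S \<Longrightarrow> subgroup R S \<Longrightarrow> f \<in> F P Q \<Longrightarrow> g \<in> F Q R \<Longrightarrow> compose P g f \<in> F P R"
  and F_factor: "subgroup P S \<Longrightarrow> subgroup Q S \<Longrightarrow> f \<in> F P Q \<Longrightarrow>
     \<exists>R. subgroup R S \<and> R \<subseteq> Q \<and> (\<exists>h\<in>Iso_F F P R. f = compose P (\<lambda>x\<in>R. x) h)"
  using fus unfolding fusion_system_def by meson+

lemma F_extensional: "subgroup P S \<Longrightarrow> subgroup Q S \<Longrightarrow> f \<in> F P Q \<Longrightarrow> f \<in> extensional P"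
  using F_Inj by (auto simp: Inj_grp_def)

lemma F_restrict: "subgroup P S \<Longrightarrow> subgroup Q S \<Longrightarrow> f \<in> F P Q \<Longrightarrow> restrict f P = f"
  by (simp add: F_extensional extensional_restrict)

lemma inclusion_F:
  assumes "subgroup P S" "subgroup Q S" "P \<subseteq> Q" shows "(\<lambda>x\<in>P. x) \<in> F P Q"
proof -
  have "conj_map S P \<one> = (\<lambda>x\<in>P. x)" using subgroup.mem_carrier[OF assms(1)] by (auto simp: conj_map_def fun_eq_iff)
  then have "(\<lambda>x\<in>P. x) \<in> Hom_S S P Q" using assms(3) by (auto simp: Hom_S_def intro!: exI[of _ \<one>])
  then show ?thesis using F_Hom_S assms by blast
qed

lemma mor_hom_on: "mor P f \<Longrightarrow> hom_on P f"
  and mor_inj: "mor P f \<Longrightarrow> inj_on f P"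
proof -
  assume m: "mor P f"
  then have "restrict f P \<in> Inj_grp S P (carrier S)" using F_Inj subgroup_carrier by (auto simp: mor_def)
  then have h: "restrict f P \<in> hom (S\<lparr>carrier := P\<rparr>) S" and i: "inj_on (restrict f P) P"
    by (auto simp: Inj_grp_def mon_def)
  show "inj_on f P" using i by (simp add: inj_on_restrict_eq)
  show "hom_on P f" unfolding hom_on_def using h subgroup.m_closed[OF mor_subgroup[OF m]]
    by (auto simp: hom_def Pi_def)
qed

lemma mor_image_subgroup: "mor P f \<Longrightarrow> subgroup (f ` P) S"
  using hom_on_image_subgroup mor_hom_on mor_subgroup by blast

lemma mor_one: "mor P f \<Longrightarrow> f \<one> = \<one>"
  and mor_inv_elem: "mor P f \<Longrightarrow> x \<in> P \<Longrightarrow> f (inv x) = inv (f x)"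
  and mor_mult: "mor P f \<Longrightarrow> x \<in> P \<Longrightarrow> y \<in> P \<Longrightarrow> f (x \<otimes> y) = f x \<otimes> f y"
  and mor_closed: "mor P f \<Longrightarrow> x \<in> P \<Longrightarrow> f x \<in> carrier S"
  and mor_pow: "mor P f \<Longrightarrow> x \<in> P \<Longrightarrow> f (x [^] (n::nat)) = f x [^] n"
  using hom_on_one hom_on_inv hom_onD hom_on_pow mor_hom_on mor_subgroup by metis+

lemma mor_conj_elem:
  assumes "mor P f" "x \<in> P" "y \<in> P" shows "f (x \<rhd> y) = f x \<rhd> f y"
  using assms mor_mult mor_inv_elem subgroup.m_closed subgroup.m_inv_closed mor_subgroup by metis

lemma Iso_F_image:
  assumes P: "subgroup P S" and Q: "subgroup Q S" and f: "f \<in> Iso_F F P Q"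
  shows "f ` P = Q" "f \<in> F P Q"
proof -
  show fF: "f \<in> F P Q" using f by (simp add: Iso_F_def)
  obtain g where g: "g \<in> F Q P" "compose Q f g = (\<lambda>y\<in>Q. y)" using f by (auto simp: Iso_F_def)
  have "f ` P \<subseteq> Q" using fF F_Inj[OF P Q] by (auto simp: Inj_grp_def mon_def hom_def)
  moreover have "g ` Q \<subseteq> P" using g F_Inj[OF Q P] by (auto simp: Inj_grp_def mon_def hom_def)
  moreover have "f (g y) = y" if "y \<in> Q" for y using fun_cong[OF g(2), of y] that by (simp add: compose_def)
  ultimately show "f ` P = Q" by (metis image_subset_iff imageI subsetI subset_antisym)
qed

lemma F_into_image:
  assumes P: "subgroup P S" and Q: "subgroup Q S" and f: "f \<in> F P Q"
  shows "f \<in> Iso_F F P (f ` P)" "f ` P \<subseteq> Q" "subgroup (f ` P) S"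
proof -
  obtain R h where R: "subgroup R S" "R \<subseteq> Q" and h: "h \<in> Iso_F F P R" "f = compose P (\<lambda>x\<in>R. x) h"
    using F_factor[OF P Q f] by blast
  have hR: "h ` P = R" and hF: "h \<in> F P R" using Iso_F_image[OF P R(1) h(1)] by auto
  have "f x = h x" for x
    using h(2) hR F_extensional[OF P R(1) hF] by (cases "x \<in> P") (auto simp: compose_def extensional_def)
  then have fh: "f = h" by auto
  show "f \<in> Iso_F F P (f ` P)" "f ` P \<subseteq> Q" "subgroup (f ` P) S" using fh h hR R by auto
qed

lemma F_iff:
  assumes P: "subgroup P S" and Q: "subgroup Q S"
  shows "f \<in> F P Q \<longleftrightarrow> f \<in> F P (carrier S) \<and> f ` P \<subseteq> Q"
proof
  assume f: "f \<in> F P Q"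
  have sub: "f ` P \<subseteq> Q" using F_into_image[OF P Q f] by blast
  have "compose P (\<lambda>x\<in>Q. x) f \<in> F P (carrier S)"
    using F_compose[OF P Q subgroup_carrier f inclusion_F[OF Q subgroup_carrier]] subgroup.subset[OF Q] by blast
  moreover have "compose P (\<lambda>x\<in>Q. x) f = f"
    using sub F_extensional[OF P Q f] by (auto simp: compose_def fun_eq_iff extensional_def)
  ultimately show "f \<in> F P (carrier S) \<and> f ` P \<subseteq> Q" using sub by simp
next
  assume f: "f \<in> F P (carrier S) \<and> f ` P \<subseteq> Q"
  note i = F_into_image[OF P subgroup_carrier conjunct1[OF f]]
  have "f \<in> F P (f ` P)" using Iso_F_image(2)[OF P i(3,1)] .
  then have "compose P (\<lambda>x\<in>f ` P. x) f \<in> F P Q"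
    using F_compose[OF P i(3) Q _ inclusion_F[OF i(3) Q]] f by blast
  moreover have "compose P (\<lambda>x\<in>f ` P. x) f = f"
    using extensional_arb[OF F_extensional[OF P subgroup_carrier conjunct1[OF f]]] by (auto simp: compose_def fun_eq_iff)
  ultimately show "f \<in> F P Q" by simp
qed

lemma F_mor_iff:
  assumes "subgroup P S" "subgroup Q S"
  shows "f \<in> F P Q \<longleftrightarrow> f \<in> extensional P \<and> mor P f \<and> f ` P \<subseteq> Q"
  using assms F_iff[OF assms, of f] F_restrict[OF assms(1) subgroup_carrier] F_extensional[OF assms(1) subgroup_carrier]
  by (auto simp: mor_def extensional_restrict)

lemma mor_F: "mor P f \<Longrightarrow> subgroup Q S \<Longrightarrow> f ` P \<subseteq> Q \<Longrightarrow> restrict f P \<in> F P Q"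
  using F_iff[of P Q "restrict f P"] by (auto simp: mor_def)

lemma mor_subset:
  assumes "mor P f" "subgroup Q S" "Q \<subseteq> P" shows "mor Q f"
proof -
  have P: "subgroup P S" using assms(1) by (simp add: mor_def)
  have "compose Q (restrict f P) (\<lambda>x\<in>Q. x) \<in> F Q (carrier S)"
    using F_compose[OF assms(2) P subgroup_carrier inclusion_F[OF assms(2) P assms(3)]] assms(1) by (simp add: mor_def)
  moreover have "compose Q (restrict f P) (\<lambda>x\<in>Q. x) = restrict f Q"
    using assms(3) by (auto simp: compose_def fun_eq_iff)
  ultimately show ?thesis using assms(2) by (simp add: mor_def)
qed

lemma mor_comp:
  assumes "mor P f" "mor Q g" "f ` P \<subseteq> Q" shows "mor P (\<lambda>x. g (f x))"
proof -
  have P: "subgroup P S" and Q: "subgroup Q S" using assms by (simp_all add: mor_def)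
  have "compose P (restrict g Q) (restrict f P) \<in> F P (carrier S)"
    using F_compose[OF P Q subgroup_carrier mor_F[OF assms(1) Q assms(3)]] assms(2) by (simp add: mor_def)
  moreover have "compose P (restrict g Q) (restrict f P) = restrict (\<lambda>x. g (f x)) P"
    using assms(3) by (auto simp: compose_def fun_eq_iff)
  ultimately show ?thesis using P by (simp add: mor_def)
qed

lemma mor_inv_into:
  assumes "mor P f" shows "mor (f ` P) (inv_into P f)"
proof -
  have P: "subgroup P S" and f: "restrict f P \<in> F P (carrier S)" using assms by (simp_all add: mor_def)
  have im: "restrict f P ` P = f ` P" by auto
  note i = F_into_image[OF P subgroup_carrier f, unfolded im]
  obtain g where g: "g \<in> F (f ` P) P" "compose P g (restrict f P) = (\<lambda>x\<in>P. x)"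
    using i(1) by (auto simp: Iso_F_def)
  have "g (f x) = x" if "x \<in> P" for x using fun_cong[OF g(2), of x] that by (simp add: compose_def)
  then have "g y = inv_into P f y" if "y \<in> f ` P" for y
    using that mor_inj[OF assms] by auto
  then show ?thesis using mor_cong[of "f ` P" g "inv_into P f"] g(1) F_mor_iff[OF i(3) P] by blast
qed

lemma mor_conj:
  assumes "subgroup P S" "g \<in> carrier S" shows "mor P (\<lambda>x. g \<rhd> x)"
proof -
  have "conj_map S P g ` P \<subseteq> carrier S"
    using assms subgroup.mem_carrier[OF assms(1)] by (auto simp: conj_map_def)
  then have "conj_map S P g \<in> Hom_S S P (carrier S)" using assms by (auto simp: Hom_S_def)
  then show ?thesis using F_Hom_S[OF assms(1) subgroup_carrier] assms(1) by (auto simp: mor_def conj_map_def)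
qed

lemma mor_id: "subgroup P S \<Longrightarrow> mor P (\<lambda>x. x)"
  using inclusion_F[OF _ subgroup_carrier] subgroup.subset by (auto simp: mor_def)

lemma Iso_F_iff:
  assumes P: "subgroup P S" and Q: "subgroup Q S"
  shows "f \<in> Iso_F F P Q \<longleftrightarrow> f \<in> extensional P \<and> mor P f \<and> f ` P = Q"
proof
  assume "f \<in> Iso_F F P Q"
  then show "f \<in> extensional P \<and> mor P f \<and> f ` P = Q" using Iso_F_image[OF P Q] F_mor_iff[OF P Q] by blast
next
  assume f: "f \<in> extensional P \<and> mor P f \<and> f ` P = Q"
  then have "f \<in> F P Q" using F_mor_iff[OF P Q] by blast
  then show "f \<in> Iso_F F P Q" using F_into_image(1)[OF P Q] f by blast
qed

lemma conj_class_iff: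
  assumes P: "subgroup P S"
  shows "Q \<in> conj_class S F P \<longleftrightarrow> (\<exists>f. mor P f \<and> f ` P = Q)"
proof
  assume "Q \<in> conj_class S F P"
  then show "\<exists>f. mor P f \<and> f ` P = Q" using Iso_F_iff[OF P] by (auto simp: conj_class_def)
next
  assume "\<exists>f. mor P f \<and> f ` P = Q"
  then obtain f where f: "mor P f" "f ` P = Q" by blast
  have Q: "subgroup Q S" using mor_image_subgroup f by blast
  have "restrict f P \<in> Iso_F F P Q"
    using Iso_F_iff[OF P Q] f mor_cong[of P f "restrict f P"] by auto
  then show "Q \<in> conj_class S F P" using Q by (auto simp: conj_class_def)
qed

lemma Aut_F_iff: "subgroup P S \<Longrightarrow> f \<in> Aut_F F P \<longleftrightarrow> f \<in> extensional P \<and> mor P f \<and> f ` P = P"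
  by (simp add: Aut_F_def Iso_F_iff)

lemma Aut_F_Bij: "subgroup P S \<Longrightarrow> Aut_F F P \<subseteq> Bij P"
  using mor_inj unfolding Bij_def bij_betw_def by (force simp: Aut_F_iff)

lemma restrict_Aut_F: "mor P f \<Longrightarrow> f ` P = P \<Longrightarrow> restrict f P \<in> Aut_F F P"
  using mor_cong[of P f "restrict f P"] mor_subgroup by (auto simp: Aut_F_iff)

lemma Aut_F_subgroup:
  assumes P: "subgroup P S" shows "subgroup (Aut_F F P) (BijGroup P)"
proof
  show "Aut_F F P \<subseteq> carrier (BijGroup P)" using Aut_F_Bij[OF P] by simp
  show "\<one>\<^bsub>BijGroup P\<^esub> \<in> Aut_F F P" using restrict_Aut_F[OF mor_id[OF P]] by simp
  fix f assume f: "f \<in> Aut_F F P"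
  then have fB: "f \<in> Bij P" using Aut_F_Bij[OF P] by blast
  have f': "mor P f" "f ` P = P" using f Aut_F_iff[OF P] by auto
  have "mor P (inv_into P f)" using mor_inv_into[OF f'(1)] f'(2) by simp
  moreover have "inv_into P f ` P = P" using f' mor_inj by (metis inv_into_image_cancel order_refl)
  ultimately show "inv\<^bsub>BijGroup P\<^esub> f \<in> Aut_F F P" using restrict_Aut_F inv_BijGroup[OF fB] by simp
  fix g assume g: "g \<in> Aut_F F P"
  then have gB: "g \<in> Bij P" using Aut_F_Bij[OF P] by blast
  have g': "mor P g" "g ` P = P" using g Aut_F_iff[OF P] by auto
  have "mor P (\<lambda>x. f (g x))" using mor_comp[OF g'(1) f'(1)] g'(2) by blast
  moreover have "(\<lambda>x. f (g x)) ` P = P" using f'(2) g'(2) by (metis image_image)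
  ultimately show "f \<otimes>\<^bsub>BijGroup P\<^esub> g \<in> Aut_F F P" using restrict_Aut_F fB gB by (simp add: compose_def)
qed

lemma Aut_S_iff:
  assumes P: "subgroup P S"
  shows "f \<in> Aut_S S P \<longleftrightarrow> (\<exists>g\<in>normalizer S P. f = (\<lambda>x\<in>P. g \<rhd> x))"
proof
  assume "f \<in> Aut_S S P"
  then obtain g where g: "g \<in> carrier S" "conj_map S P g ` P \<subseteq> P" "f = conj_map S P g"
    by (auto simp: Aut_S_def Hom_S_def)
  then have "g \<in> normalizer S P" by (intro normalizerI[OF P]) (auto simp: conj_map_def)
  then show "\<exists>g\<in>normalizer S P. f = (\<lambda>x\<in>P. g \<rhd> x)" using g by (auto simp: conj_map_def)
next
  assume "\<exists>g\<in>normalizer S P. f = (\<lambda>x\<in>P. g \<rhd> x)"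
  then show "f \<in> Aut_S S P" using normalizerD[OF P] by (auto simp: Aut_S_def Hom_S_def conj_map_def)
qed

lemma conj_Aut_S: "subgroup P S \<Longrightarrow> g \<in> normalizer S P \<Longrightarrow> (\<lambda>x\<in>P. g \<rhd> x) \<in> Aut_S S P"
  using Aut_S_iff by blast

lemma Aut_S_subset: assumes P: "subgroup P S" shows "Aut_S S P \<subseteq> Aut_F F P"
proof
  fix f assume "f \<in> Aut_S S P"
  then obtain g where g: "g \<in> normalizer S P" "f = (\<lambda>x\<in>P. g \<rhd> x)" using Aut_S_iff[OF P] by blast
  have "(\<lambda>x. g \<rhd> x) ` P = P" using g mem_normalizer_iff subgroup.subset[OF P] by blast
  then show "f \<in> Aut_F F P" using restrict_Aut_F[OF mor_conj[OF P]] g normalizerD[OF P g(1)] by simp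
qed

lemma conj_compose:
  assumes P: "subgroup P S" and g: "g \<in> normalizer S P" and h: "h \<in> normalizer S P"
  shows "(\<lambda>x\<in>P. g \<rhd> x) \<otimes>\<^bsub>BijGroup P\<^esub> (\<lambda>x\<in>P. h \<rhd> x) = (\<lambda>x\<in>P. (g \<otimes> h) \<rhd> x)"
proof -
  have "(\<lambda>x\<in>P. g \<rhd> x) \<in> Bij P" "(\<lambda>x\<in>P. h \<rhd> x) \<in> Bij P"
    using conj_Aut_S[OF P] g h Aut_S_subset[OF P] Aut_F_Bij[OF P] by blast+
  moreover have "g \<in> carrier S" "h \<in> carrier S" "\<And>x. x \<in> P \<Longrightarrow> h \<rhd> x \<in> P"
    using normalizerD[OF P] g h by auto
  ultimately show ?thesis using subgroup.mem_carrier[OF P]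
    by (auto simp: compose_def fun_eq_iff m_assoc inv_mult_group)
qed

lemma Aut_S_subgroup:
  assumes P: "subgroup P S" shows "subgroup (Aut_S S P) (BijGroup P)"
proof
  interpret B: group "BijGroup P" by (rule group_BijGroup)
  have N: "subgroup (normalizer S P) S" by (rule normalizer_subgroup[OF P])
  show sub: "Aut_S S P \<subseteq> carrier (BijGroup P)" using Aut_S_subset[OF P] Aut_F_Bij[OF P] by auto
  have one: "(\<lambda>x\<in>P. \<one> \<rhd> x) = \<one>\<^bsub>BijGroup P\<^esub>" using subgroup.mem_carrier[OF P] by (auto simp: fun_eq_iff)
  then show "\<one>\<^bsub>BijGroup P\<^esub> \<in> Aut_S S P" using conj_Aut_S[OF P subgroup.one_closed[OF N]] by simp
  fix f assume "f \<in> Aut_S S P"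
  then obtain g where g: "g \<in> normalizer S P" "f = (\<lambda>x\<in>P. g \<rhd> x)" using Aut_S_iff[OF P] by blast
  have gi: "inv g \<in> normalizer S P" using g subgroup.m_inv_closed[OF N] by blast
  let ?fi = "\<lambda>x\<in>P. inv g \<rhd> x"
  have gC: "g \<in> carrier S" using normalizerD[OF P g(1)] by simp
  have "?fi \<otimes>\<^bsub>BijGroup P\<^esub> f = \<one>\<^bsub>BijGroup P\<^esub>"
    unfolding g(2) conj_compose[OF P gi g(1)] using one gC by simp
  then have "inv\<^bsub>BijGroup P\<^esub> f = ?fi"
    using B.inv_equality[of ?fi f] conj_Aut_S[OF P] gi g sub by blast
  then show "inv\<^bsub>BijGroup P\<^esub> f \<in> Aut_S S P" using conj_Aut_S[OF P gi] by simp
  fix f' assume "f' \<in> Aut_S S P"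
  then obtain h where h: "h \<in> normalizer S P" "f' = (\<lambda>x\<in>P. h \<rhd> x)" using Aut_S_iff[OF P] by blast
  show "f \<otimes>\<^bsub>BijGroup P\<^esub> f' \<in> Aut_S S P"
    unfolding g(2) h(2) conj_compose[OF P g(1) h(1)]
    using conj_Aut_S[OF P] subgroup.m_closed[OF N g(1) h(1)] by blast
qed

lemma fully_automized_iff:
  "fully_automized p S F P \<longleftrightarrow> group.coprime_index (BijGroup P) p (Aut_S S P) (Aut_F F P)"
proof -
  have "rcosets\<^bsub>Aut_F_group F P\<^esub> Aut_S S P = (\<lambda>g. Aut_S S P #>\<^bsub>BijGroup P\<^esub> g) ` Aut_F F P"
    by (auto simp: RCOSETS_def Aut_F_group_def r_coset_def)
  then show ?thesis by (simp add: fully_automized_def group.coprime_index_def[OF group_BijGroup])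
qed

text \<open>An element h inducing the transported conjugation automatically normalizes f P, because
  g normalizes P; so it is enough to ask for h in S.\<close>

lemma mem_N_ext_iff:
  assumes f: "mor P f"
  shows "g \<in> N_ext S P f \<longleftrightarrow>
    g \<in> normalizer S P \<and> (\<exists>h\<in>carrier S. \<forall>x\<in>P. f (g \<rhd> x) = h \<rhd> f x)"
proof -
  have P: "subgroup P S" by (rule mor_subgroup[OF f])
  have fP: "subgroup (f ` P) S" by (rule mor_image_subgroup[OF f])
  have ii: "inv_into P f (f x) = x" if "x \<in> P" for x using mor_inj[OF f] that by simp
  show ?thesis
  proof (cases "g \<in> normalizer S P")
    case True
    have cl: "g \<rhd> x \<in> P" if "x \<in> P" for x using normalizerD[OF P True] that by blast
    let ?m = "\<lambda>y\<in>f ` P. f (conj_map S P g (inv_into P f y))"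
    have m: "?m (f x) = f (g \<rhd> x)" if "x \<in> P" for x using that ii by (simp add: conj_map_def)
    have "?m \<in> Aut_S S (f ` P) \<longleftrightarrow> (\<exists>h\<in>carrier S. \<forall>x\<in>P. f (g \<rhd> x) = h \<rhd> f x)"
    proof
      assume "?m \<in> Aut_S S (f ` P)"
      then obtain h where h: "h \<in> normalizer S (f ` P)" "?m = (\<lambda>x\<in>f ` P. h \<rhd> x)" using Aut_S_iff[OF fP] by blast
      have "f (g \<rhd> x) = h \<rhd> f x" if "x \<in> P" for x
        using fun_cong[OF h(2), of "f x"] m[OF that] that by simp
      then show "\<exists>h\<in>carrier S. \<forall>x\<in>P. f (g \<rhd> x) = h \<rhd> f x"
        using normalizerD(1)[OF fP h(1)] by blast
    next
      assume "\<exists>h\<in>carrier S. \<forall>x\<in>P. f (g \<rhd> x) = h \<rhd> f x"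
      then obtain h where h: "h \<in> carrier S" "\<And>x. x \<in> P \<Longrightarrow> f (g \<rhd> x) = h \<rhd> f x" by blast
      have hN: "h \<in> normalizer S (f ` P)"
        by (rule normalizerI[OF fP h(1)]) (use h(2) cl in \<open>force\<close>)
      have "?m = (\<lambda>x\<in>f ` P. h \<rhd> x)" using m h(2) by (auto simp: fun_eq_iff)
      then show "?m \<in> Aut_S S (f ` P)" using conj_Aut_S[OF fP hN] by simp
    qed
    then show ?thesis using True by (simp add: N_ext_def)
  qed (simp add: N_ext_def)
qed

lemma N_ext_subgroup:
  assumes f: "mor P f" shows "subgroup (N_ext S P f) S"
proof
  have P: "subgroup P S" by (rule mor_subgroup[OF f])
  have N: "subgroup (normalizer S P) S" by (rule normalizer_subgroup[OF P])
  note iff = mem_N_ext_iff[OF f]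
  show "N_ext S P f \<subseteq> carrier S" using iff normalizerD(1)[OF P] by blast
  show "\<one> \<in> N_ext S P f" unfolding iff
    using subgroup.one_closed[OF N] mor_closed[OF f] subgroup.mem_carrier[OF P] by (auto intro!: bexI[of _ \<one>])
  fix g assume "g \<in> N_ext S P f"
  then obtain h where g: "g \<in> normalizer S P" and h: "h \<in> carrier S" "\<And>x. x \<in> P \<Longrightarrow> f (g \<rhd> x) = h \<rhd> f x"
    using iff by blast
  have gC: "g \<in> carrier S" and gi: "inv g \<in> normalizer S P" using normalizerD[OF P g] subgroup.m_inv_closed[OF N g] by auto
  have "f (inv g \<rhd> x) = inv h \<rhd> f x" if x: "x \<in> P" for x
  proof -
    have y: "inv g \<rhd> x \<in> P" using normalizerD(2)[OF P gi x] .
    have xC: "x \<in> carrier S" using x subgroup.mem_carrier[OF P] by blast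
    have "g \<rhd> (inv g \<rhd> x) = x" using gC xC by (simp add: m_assoc)
    then have "f x = h \<rhd> f (inv g \<rhd> x)" using h(2)[OF y] by simp
    then show ?thesis using h(1) mor_closed[OF f y] by (simp add: m_assoc)
  qed
  then show "inv g \<in> N_ext S P f" unfolding iff using gi h(1) by blast
  fix g' assume "g' \<in> N_ext S P f"
  then obtain h' where g': "g' \<in> normalizer S P" and h': "h' \<in> carrier S" "\<And>x. x \<in> P \<Longrightarrow> f (g' \<rhd> x) = h' \<rhd> f x"
    using iff by blast
  have g'C: "g' \<in> carrier S" using normalizerD[OF P g'] by auto
  have "f ((g \<otimes> g') \<rhd> x) = (h \<otimes> h') \<rhd> f x" if x: "x \<in> P" for x
  proof -
    have xC: "x \<in> carrier S" using x subgroup.mem_carrier[OF P] by blast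
    have "(g \<otimes> g') \<rhd> x = g \<rhd> (g' \<rhd> x)"
      using gC g'C xC by (simp add: m_assoc inv_mult_group)
    then show ?thesis using h(2)[OF normalizerD(2)[OF P g' x]] h'(2)[OF x] h(1) h'(1) mor_closed[OF f x]
      by (simp add: m_assoc inv_mult_group)
  qed
  then show "g \<otimes> g' \<in> N_ext S P f" unfolding iff using subgroup.m_closed[OF N g g'] h(1) h'(1) by blast
qed

lemma receptive_extension:
  assumes R: "receptive S F P" "subgroup P S" and f: "mor V f" "f ` V = P"
    and N: "subgroup N S" "N \<subseteq> normalizer S V" "V \<subseteq> N"
    and h: "\<And>g. g \<in> N \<Longrightarrow> \<exists>h\<in>carrier S. \<forall>v\<in>V. f (g \<rhd> v) = h \<rhd> f v"
  obtains \<psi> where "mor N \<psi>" "\<And>v. v \<in> V \<Longrightarrow> \<psi> v = f v"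
proof -
  have V: "subgroup V S" by (rule mor_subgroup[OF f(1)])
  let ?f = "restrict f V"
  have mf: "mor V ?f" using f(1) mor_cong[of V f ?f] by simp
  have fi: "?f \<in> Iso_F F V P" using Iso_F_iff[OF V R(2)] mf f(2) by auto
  then obtain \<psi> where \<psi>: "\<psi> \<in> F (N_ext S V ?f) (carrier S)" "restrict \<psi> V = ?f"
    using R(1) V by (auto simp: receptive_def)
  have NE: "subgroup (N_ext S V ?f) S" by (rule N_ext_subgroup[OF mf])
  have sub: "N \<subseteq> N_ext S V ?f"
  proof
    fix g assume g: "g \<in> N"
    then have gn: "g \<in> normalizer S V" using N by blast
    show "g \<in> N_ext S V ?f" unfolding mem_N_ext_iff[OF mf]
      using gn h[OF g] normalizerD(2)[OF V gn] by simp
  qed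
  have "mor (N_ext S V ?f) \<psi>" using \<psi>(1) F_mor_iff[OF NE subgroup_carrier] by blast
  then have "mor N \<psi>" using mor_subset[OF _ N(1) sub] by blast
  moreover have "\<psi> v = f v" if "v \<in> V" for v using fun_cong[OF \<psi>(2), of v] that by simp
  ultimately show ?thesis using that by blast
qed

lemma receptiveI:
  assumes P: "subgroup P S"
    and ext: "\<And>Q f. mor Q f \<Longrightarrow> f ` Q = P \<Longrightarrow> \<exists>\<psi>. mor (N_ext S Q f) \<psi> \<and> (\<forall>x\<in>Q. \<psi> x = f x)"
  shows "receptive S F P"
  unfolding receptive_def
proof (intro allI impI ballI)
  fix Q f assume Q: "subgroup Q S" and "f \<in> Iso_F F Q P"
  then have f: "f \<in> extensional Q" "mor Q f" "f ` Q = P" using Iso_F_iff[OF Q P] by auto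
  obtain \<psi> where \<psi>: "mor (N_ext S Q f) \<psi>" "\<And>x. x \<in> Q \<Longrightarrow> \<psi> x = f x" using ext[OF f(2,3)] by blast
  let ?N = "N_ext S Q f"
  have QN: "Q \<subseteq> ?N"
  proof
    fix g assume g: "g \<in> Q"
    show "g \<in> ?N" unfolding mem_N_ext_iff[OF f(2)]
      using normalizer_contains[OF Q] g mor_conj_elem[OF f(2) g] mor_closed[OF f(2) g] by blast
  qed
  have "restrict \<psi> ?N \<in> F ?N (carrier S)" using \<psi>(1) by (simp add: mor_def)
  moreover have "restrict (restrict \<psi> ?N) Q = f"
    using QN \<psi>(2) f(1) by (auto simp: fun_eq_iff extensional_def)
  ultimately show "\<exists>\<psi>\<in>F ?N (carrier S). restrict \<psi> Q = f" by blast
qed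

end

context group begin

lemma coprime_index_translate:
  assumes X: "X \<subseteq> carrier G" and A: "A \<subseteq> carrier G" and b: "b \<in> carrier G" and ci: "coprime_index p X A"
  shows "coprime_index p X ((\<lambda>a. a \<otimes> b) ` A)"
proof -
  have "(\<lambda>g. X #> g) ` ((\<lambda>a. a \<otimes> b) ` A) = (\<lambda>C. C #> b) ` ((\<lambda>g. X #> g) ` A)"
    using coset_mult_assoc[OF X _ b] A by (auto simp: image_image intro!: image_cong)
  moreover have "inj_on (\<lambda>C. C #> b) ((\<lambda>g. X #> g) ` A)"
  proof (rule inj_on_inverseI[where g = "\<lambda>C. C #> inv b"])
    fix C assume "C \<in> (\<lambda>g. X #> g) ` A"
    then have "C \<subseteq> carrier G" using X A r_coset_subset_G by blast
    then show "(C #> b) #> inv b = C" using coset_mult_assoc b by simp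
  qed
  ultimately show ?thesis using ci by (simp add: coprime_index_def card_image finite_image_iff)
qed

lemma finite_cosets_trans:
  assumes X: "subgroup X G" and Z: "subgroup Z G" and H: "H \<subseteq> carrier G"
    and 1: "finite ((\<lambda>g. Z #> g) ` X)" and 2: "finite ((\<lambda>g. X #> g) ` H)"
  shows "finite ((\<lambda>g. Z #> g) ` H)"
proof -
  define rep where "rep c = (SOME h. h \<in> H \<and> X #> h = c)" for c
  have rep: "rep (X #> h) \<in> H \<and> X #> rep (X #> h) = X #> h" if "h \<in> H" for h
    unfolding rep_def by (rule someI[of _ h]) (use that in simp)
  have XC: "X \<subseteq> carrier G" and ZC: "Z \<subseteq> carrier G" using X Z subgroup.subset by blast+
  have "Z #> h \<in> (\<lambda>(C, D). C #> rep D) ` (((\<lambda>g. Z #> g) ` X) \<times> ((\<lambda>g. X #> g) ` H))" if h: "h \<in> H" for h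
  proof -
    let ?r = "rep (X #> h)"
    have c: "h \<in> carrier G" "?r \<in> carrier G" using rep h H by auto
    define x where "x = h \<otimes> inv ?r"
    have x: "x \<in> X" using rcos_eq_iff[OF X c] rep[OF h] by (simp add: x_def)
    have "h = x \<otimes> ?r" using c by (simp add: x_def m_assoc)
    then have "Z #> h = (Z #> x) #> ?r" using coset_mult_assoc[OF ZC _ c(2)] x XC by auto
    then show ?thesis using x h by auto
  qed
  then have "(\<lambda>g. Z #> g) ` H \<subseteq> (\<lambda>(C, D). C #> rep D) ` (((\<lambda>g. Z #> g) ` X) \<times> ((\<lambda>g. X #> g) ` H))" by blast
  then show ?thesis using 1 2 finite_surj by (metis finite_cartesian_product)
qed

end

context toral begin

lemma centralizer_iff: "g \<in> centralizer S P \<longleftrightarrow> g \<in> carrier S \<and> (\<forall>x\<in>P. g \<otimes> x = x \<otimes> g)"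
  by (simp add: centralizer_def)

lemma mem_centralizer_iff:
  assumes "P \<subseteq> carrier S"
  shows "g \<in> centralizer S P \<longleftrightarrow> g \<in> carrier S \<and> (\<forall>x\<in>P. g \<rhd> x = x)"
proof -
  have "g \<otimes> x = x \<otimes> g \<longleftrightarrow> g \<rhd> x = x" if "g \<in> carrier S" "x \<in> P" for x
    using that assms by (metis inv_solve_right' m_closed subsetD)
  then show ?thesis by (auto simp: centralizer_iff)
qed

lemma centralizer_subgroup:
  assumes "P \<subseteq> carrier S" shows "subgroup (centralizer S P) S"
proof
  fix g assume g: "g \<in> centralizer S P"
  then have gC: "g \<in> carrier S" by (simp add: centralizer_iff)
  have gx: "g \<rhd> x = x" if "x \<in> P" for x using g mem_centralizer_iff[OF assms] that by blast
  have "inv g \<rhd> x = x" if "x \<in> P" for x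
  proof -
    have xC: "x \<in> carrier S" using that assms by blast
    have "inv g \<otimes> (g \<rhd> x) \<otimes> g = x" using xC gC by (simp add: m_assoc)
    then show ?thesis using gx[OF that] gC by simp
  qed
  then show "inv g \<in> centralizer S P" using mem_centralizer_iff[OF assms] gC by blast
  fix h assume h: "h \<in> centralizer S P"
  then have hC: "h \<in> carrier S" by (simp add: centralizer_iff)
  have "g \<otimes> h \<otimes> x = x \<otimes> (g \<otimes> h)" if x: "x \<in> P" for x
  proof -
    have "g \<otimes> h \<otimes> x = g \<otimes> (x \<otimes> h)" using h x assms gC hC by (auto simp: centralizer_iff m_assoc)
    also have "\<dots> = x \<otimes> (g \<otimes> h)" using g x assms gC hC by (auto simp: centralizer_iff m_assoc[symmetric])
    finally show ?thesis .
  qed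
  then show "g \<otimes> h \<in> centralizer S P" using gC hC by (simp add: centralizer_iff)
qed (use assms in \<open>auto simp: centralizer_iff\<close>)

lemma centralizer_normalizer:
  assumes "subgroup P S" shows "centralizer S P \<subseteq> normalizer S P"
  using mem_centralizer_iff subgroup.subset[OF assms] by (auto intro!: normalizerI[OF assms])

end

section \<open>Nice subgroups and the extension of morphisms to normalizers\<close>

context fusion begin

definition good :: "'a set \<Rightarrow> bool" where
  "good P \<longleftrightarrow> subgroup P S \<and> fully_automized p S F P \<and> receptive S F P"

definition nice :: "'a set \<Rightarrow> bool" where
  "nice P \<longleftrightarrow> (\<exists>f. mor P f \<and> good (f ` P))"

definition stab :: "'a set \<Rightarrow> 'a set \<Rightarrow> ('a \<Rightarrow> 'a) set" where
  "stab U Y = {\<gamma> \<in> Aut_F F U. \<gamma> ` Y = Y}"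

text \<open>By the convention of \<open>coprime_index\<close> this says that Aut_S(U) \<inter> stab
  U Y has index prime to p in stab U Y. It depends on the position of Y: if U is fully automized, it
  holds for some Aut_F(U)-translate of a given subset, not necessarily for all of them.\<close>

definition stab_good :: "'a set \<Rightarrow> 'a set \<Rightarrow> bool" where
  "stab_good U Y \<longleftrightarrow> group.coprime_index (BijGroup U) p (Aut_S S U) (stab U Y)"

lemma bij_image_inv:
  assumes "f \<in> Bij U" "Y \<subseteq> U" "f ` Y = Z" shows "(inv\<^bsub>BijGroup U\<^esub> f) ` Z = Y"
proof -
  have inj: "inj_on f U" and ZU: "Z \<subseteq> U" using assms by (auto simp: Bij_def bij_betw_def)
  have "(inv\<^bsub>BijGroup U\<^esub> f) ` Z = inv_into U f ` Z" unfolding inv_BijGroup[OF assms(1)] using ZU by auto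
  then show ?thesis using inv_into_image_cancel[OF inj assms(2)] assms(3) by simp
qed

lemma compose_image: "Y \<subseteq> U \<Longrightarrow> compose U g f ` Y = g ` f ` Y"
  by (auto simp: compose_def image_image subset_iff image_iff)

lemma stab_subgroup:
  assumes U: "subgroup U S" and Y: "Y \<subseteq> U" shows "subgroup (stab U Y) (BijGroup U)"
proof -
  note A = Aut_F_subgroup[OF U]
  have AB: "\<And>f. f \<in> Aut_F F U \<Longrightarrow> f \<in> Bij U" using Aut_F_Bij[OF U] by blast
  show ?thesis
  proof
    show "stab U Y \<subseteq> carrier (BijGroup U)" using AB by (auto simp: stab_def)
    show "\<one>\<^bsub>BijGroup U\<^esub> \<in> stab U Y" using subgroup.one_closed[OF A] Y by (auto simp: stab_def)
    fix f assume f: "f \<in> stab U Y"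
    then have fB: "f \<in> Bij U" using AB by (auto simp: stab_def)
    show "inv\<^bsub>BijGroup U\<^esub> f \<in> stab U Y"
      using f subgroup.m_inv_closed[OF A] bij_image_inv[OF fB Y] unfolding stab_def by blast
    fix g assume g: "g \<in> stab U Y"
    then have gB: "g \<in> Bij U" using AB by (auto simp: stab_def)
    have "(f \<otimes>\<^bsub>BijGroup U\<^esub> g) ` Y = Y" using f g fB gB Y by (simp add: compose_image stab_def)
    then show "f \<otimes>\<^bsub>BijGroup U\<^esub> g \<in> stab U Y"
      using f g subgroup.m_closed[OF A] unfolding stab_def by blast
  qed
qed

lemma stab_self: "subgroup U S \<Longrightarrow> stab U U = Aut_F F U"
  unfolding stab_def using Aut_F_iff by blast

lemma good_stab_good: "good U \<Longrightarrow> stab_good U U"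
  using stab_self by (simp add: good_def stab_good_def fully_automized_iff)

lemma mor_compose_Aut:
  assumes f: "mor V f" "f ` V = U" and a: "a \<in> Aut_F F U"
  shows "mor V (\<lambda>x. a (f x))" "(\<lambda>x. a (f x)) ` V = U"
proof -
  have U: "subgroup U S" using mor_image_subgroup f by blast
  have a': "mor U a" "a ` U = U" using a Aut_F_iff[OF U] by auto
  show "mor V (\<lambda>x. a (f x))" using mor_comp[OF f(1) a'(1)] f(2) by blast
  show "(\<lambda>x. a (f x)) ` V = U" using f(2) a'(2) by (metis image_image)
qed

text \<open>The stabilizer H of f R acts on the cosets of Aut_S(U), whose number in Aut_F(U) is
  prime to p, and so has an orbit of size prime to p, through a say. Replacing f by a f turns the
  stabilizer into a H a^-1, and the orbit of a becomes the set of cosets that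
  \<open>stab_good\<close> counts.\<close>

lemma exists_stab_good:
  assumes V: "nice V" and RV: "R \<subseteq> V"
  obtains U \<chi> where "good U" "mor V \<chi>" "\<chi> ` V = U" "stab_good U (\<chi> ` R)"
proof -
  obtain f where f: "mor V f" "good (f ` V)" using V by (auto simp: nice_def)
  define U where "U = f ` V"
  have U: "subgroup U S" and fa: "group.coprime_index (BijGroup U) p (Aut_S S U) (Aut_F F U)"
    using f by (auto simp: good_def U_def fully_automized_iff)
  interpret B: group "BijGroup U" by (rule group_BijGroup)
  let ?X = "Aut_S S U" and ?H = "stab U (f ` R)"
  have RU: "f ` R \<subseteq> U" using RV by (auto simp: U_def)
  have A: "subgroup (Aut_F F U) (BijGroup U)" by (rule Aut_F_subgroup[OF U])
  have H: "subgroup ?H (BijGroup U)" by (rule stab_subgroup[OF U RU])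
  have XC: "?X \<subseteq> carrier (BijGroup U)" using subgroup.subset[OF Aut_S_subgroup[OF U]] .
  have HA: "?H \<subseteq> Aut_F F U" by (auto simp: stab_def)
  obtain a where a: "a \<in> Aut_F F U" "B.coprime_index p ?X ((\<otimes>\<^bsub>BijGroup U\<^esub>) a ` ?H)"
    using B.coprime_index_orbit[OF prime_p XC H subgroup.subset[OF A] fa] subgroup.m_closed[OF A] HA by blast
  have aB: "a \<in> Bij U" using a Aut_F_Bij[OF U] by blast
  have aC: "a \<in> carrier (BijGroup U)" using aB by simp
  have ia: "inv\<^bsub>BijGroup U\<^esub> a \<in> Aut_F F U" using subgroup.m_inv_closed[OF A a(1)] .
  let ?Y = "a ` f ` R"
  have YU: "?Y \<subseteq> U" using RU aB by (auto simp: Bij_def bij_betw_def)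
  have "stab U ?Y \<subseteq> (\<lambda>g. g \<otimes>\<^bsub>BijGroup U\<^esub> inv\<^bsub>BijGroup U\<^esub> a) ` ((\<otimes>\<^bsub>BijGroup U\<^esub>) a ` ?H)"
  proof
    fix \<gamma> assume g: "\<gamma> \<in> stab U ?Y"
    then have gA: "\<gamma> \<in> Aut_F F U" and gY: "\<gamma> ` ?Y = ?Y" by (auto simp: stab_def)
    have gB: "\<gamma> \<in> Bij U" "inv\<^bsub>BijGroup U\<^esub> a \<in> Bij U" using gA ia Aut_F_Bij[OF U] by auto
    let ?h = "inv\<^bsub>BijGroup U\<^esub> a \<otimes>\<^bsub>BijGroup U\<^esub> (\<gamma> \<otimes>\<^bsub>BijGroup U\<^esub> a)"
    have "?h \<in> Aut_F F U" using subgroup.m_closed[OF A] ia gA a by simp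
    moreover have "?h ` f ` R = f ` R"
    proof -
      have gaB: "compose U \<gamma> a \<in> Bij U" using compose_Bij gB aB by blast
      have "?h ` f ` R = (inv\<^bsub>BijGroup U\<^esub> a) ` \<gamma> ` ?Y"
        using gB aB gaB RU by (simp add: compose_image)
      then show ?thesis using gY bij_image_inv[OF aB RU] by simp
    qed
    ultimately have "?h \<in> ?H" by (simp add: stab_def)
    moreover have "\<gamma> = (a \<otimes>\<^bsub>BijGroup U\<^esub> ?h) \<otimes>\<^bsub>BijGroup U\<^esub> inv\<^bsub>BijGroup U\<^esub> a"
    proof -
      have c: "\<gamma> \<in> carrier (BijGroup U)" using gB by simp
      show ?thesis using aC c B.m_assoc B.inv_cancel_left B.r_inv B.r_one B.m_closed B.inv_closed by metis
    qed
    ultimately show "\<gamma> \<in> (\<lambda>g. g \<otimes>\<^bsub>BijGroup U\<^esub> inv\<^bsub>BijGroup U\<^esub> a) ` ((\<otimes>\<^bsub>BijGroup U\<^esub>) a ` ?H)" by blast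
  qed
  moreover have "(\<lambda>g. g \<otimes>\<^bsub>BijGroup U\<^esub> inv\<^bsub>BijGroup U\<^esub> a) ` ((\<otimes>\<^bsub>BijGroup U\<^esub>) a ` ?H) \<subseteq> stab U ?Y"
  proof clarify
    fix h assume h: "h \<in> ?H"
    then have hA: "h \<in> Aut_F F U" and hY: "h ` f ` R = f ` R" by (auto simp: stab_def)
    have hB: "h \<in> Bij U" "inv\<^bsub>BijGroup U\<^esub> a \<in> Bij U" using hA ia Aut_F_Bij[OF U] by auto
    have ahB: "compose U a h \<in> Bij U" using compose_Bij hB aB by blast
    have "((a \<otimes>\<^bsub>BijGroup U\<^esub> h) \<otimes>\<^bsub>BijGroup U\<^esub> inv\<^bsub>BijGroup U\<^esub> a) ` ?Y = a ` h ` (inv\<^bsub>BijGroup U\<^esub> a) ` ?Y"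
      using hB aB ahB YU bij_image_inv[OF aB RU] RU by (simp add: compose_image)
    also have "\<dots> = ?Y" using bij_image_inv[OF aB RU] hY by simp
    finally show "(a \<otimes>\<^bsub>BijGroup U\<^esub> h) \<otimes>\<^bsub>BijGroup U\<^esub> inv\<^bsub>BijGroup U\<^esub> a \<in> stab U ?Y"
      using subgroup.m_closed[OF A] ia hA a by (simp add: stab_def)
  qed
  ultimately have eq: "(\<lambda>g. g \<otimes>\<^bsub>BijGroup U\<^esub> inv\<^bsub>BijGroup U\<^esub> a) ` ((\<otimes>\<^bsub>BijGroup U\<^esub>) a ` ?H) = stab U ?Y" by blast
  have "(\<otimes>\<^bsub>BijGroup U\<^esub>) a ` ?H \<subseteq> carrier (BijGroup U)" using aC subgroup.subset[OF H] B.m_closed by blast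
  then have "stab_good U ?Y"
    using B.coprime_index_translate[OF XC _ B.inv_closed[OF aC] a(2)] eq by (simp add: stab_good_def)
  moreover have "(\<lambda>x. a (f x)) ` R = ?Y" by auto
  ultimately show ?thesis
    using that[of U "\<lambda>x. a (f x)"] f mor_compose_Aut[OF f(1) _ a(1)] by (simp add: U_def)
qed

text \<open>Conjugation by N on V becomes, through f, a p-torsion subgroup of Aut_F(U) that is
  contained in Aut_S(U) D. An element n of the normal subgroup D conjugates it into Aut_S(U), and
  then receptivity of U extends n f to N. The choice of D controls how much f is changed.\<close>

lemma extension_general:
  assumes U: "good U" "stab_good U Y" and f: "mor V f" "f ` V = U" and R: "subgroup R S" "R \<subseteq> V" "f ` R = Y"
    and N: "subgroup N S" "V \<subseteq> N" "N \<subseteq> normalizer S V" "N \<subseteq> normalizer S R"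
    and D: "subgroup D (BijGroup U)" "D \<subseteq> stab U Y"
      "\<And>h n. h \<in> stab U Y \<Longrightarrow> n \<in> D \<Longrightarrow> h \<otimes>\<^bsub>BijGroup U\<^esub> n \<otimes>\<^bsub>BijGroup U\<^esub> inv\<^bsub>BijGroup U\<^esub> h \<in> D"
    and dec: "\<And>g. g \<in> N \<Longrightarrow> \<exists>x\<in>Aut_S S U \<inter> stab U Y. \<exists>n\<in>D. \<forall>v\<in>V. f (g \<rhd> v) = x (n (f v))"
  obtains n \<psi> where "n \<in> D" "mor N \<psi>" "\<And>v. v \<in> V \<Longrightarrow> \<psi> v = n (f v)"
proof -
  interpret B: group "BijGroup U" by (rule group_BijGroup)
  have sU: "subgroup U S" and rec: "receptive S F U" using U by (auto simp: good_def)
  have V: "subgroup V S" by (rule mor_subgroup[OF f(1)])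
  have VC: "\<And>v. v \<in> V \<Longrightarrow> v \<in> carrier S" using subgroup.mem_carrier[OF V] .
  have NC: "\<And>g. g \<in> N \<Longrightarrow> g \<in> carrier S" using subgroup.mem_carrier[OF N(1)] .
  have YU: "Y \<subseteq> U" using R f by auto
  let ?i = "inv_into V f"
  have ii: "?i (f v) = v" if "v \<in> V" for v using mor_inj[OF f(1)] that by simp
  have Uex: "\<exists>v\<in>V. u = f v" if "u \<in> U" for u using that f(2) by auto
  define cw where "cw g = (\<lambda>u\<in>U. f (g \<rhd> ?i u))" for g
  have cwf: "cw g (f v) = f (g \<rhd> v)" if "v \<in> V" for g v using that f(2) ii by (auto simp: cw_def)
  have cl: "g \<rhd> v \<in> V" if "g \<in> N" "v \<in> V" for g v using normalizerD(2)[OF V] N(3) that by blast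
  have cwA: "cw g \<in> Aut_F F U" if g: "g \<in> N" for g
  proof -
    have 1: "mor V (\<lambda>v. g \<rhd> v)" using mor_conj[OF V NC[OF g]] .
    have 2: "mor V (\<lambda>v. f (g \<rhd> v))" using mor_comp[OF 1 f(1)] cl g by blast
    have 3: "mor U ?i" using mor_inv_into[OF f(1)] f(2) by simp
    have "?i ` U \<subseteq> V" using ii f(2) by auto
    then have 4: "mor U (\<lambda>u. f (g \<rhd> ?i u))" using mor_comp[OF 3 2] by blast
    have gV: "(\<lambda>v. g \<rhd> v) ` V = V"
      using g N(3) mem_normalizer_iff subgroup.subset[OF V] by blast
    have "(\<lambda>u. f (g \<rhd> ?i u)) ` U = f ` (\<lambda>v. g \<rhd> v) ` ?i ` f ` V"
      using f(2) by (simp add: image_image)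
    also have "?i ` f ` V = V" using ii by (auto simp: image_image)
    finally have "(\<lambda>u. f (g \<rhd> ?i u)) ` U = U" using gV f(2) by simp
    then show ?thesis unfolding cw_def using restrict_Aut_F[OF 4] by blast
  qed
  have cwB: "cw g \<in> Bij U" if "g \<in> N" for g using cwA[OF that] Aut_F_Bij[OF sU] by blast
  have cwm: "cw (g \<otimes> h) = cw g \<otimes>\<^bsub>BijGroup U\<^esub> cw h" if gh: "g \<in> N" "h \<in> N" for g h
  proof -
    have "cw (g \<otimes> h) u = compose U (cw g) (cw h) u" for u
    proof (cases "u \<in> U")
      case True
      then obtain v where v: "v \<in> V" "u = f v" using Uex by blast
      have "g \<otimes> h \<otimes> v \<otimes> inv (g \<otimes> h) = g \<rhd> (h \<rhd> v)"
        using NC gh VC v by (simp add: m_assoc inv_mult_group)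
      then show ?thesis using True v cwf cl[OF gh(2) v(1)] by (simp add: compose_def)
    qed (simp add: compose_def cw_def)
    then show ?thesis using cwB gh by (simp add: fun_eq_iff)
  qed
  have hom: "group_hom (S\<lparr>carrier := N\<rparr>) (BijGroup U) cw"
    unfolding group_hom_def group_hom_axioms_def
    using N(1) cwB cwm by (auto simp: subgroup_imp_group B.is_group hom_def)
  have L: "subgroup (cw ` N) (BijGroup U)" using group_hom.img_is_subgroup[OF hom] by simp
  have tors: "\<exists>k::nat. y [^]\<^bsub>BijGroup U\<^esub> (p ^ k) = \<one>\<^bsub>BijGroup U\<^esub>" if y: "y \<in> cw ` N" for y
  proof -
    obtain g where g: "g \<in> N" "y = cw g" using y by blast
    obtain k where "g [^] (p ^ k :: nat) = \<one>" using torsion NC g by blast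
    then have "cw g [^]\<^bsub>BijGroup U\<^esub> (p ^ k) = \<one>\<^bsub>BijGroup U\<^esub>"
      using group_hom.hom_nat_pow[OF hom, of g "p ^ k"] group_hom.hom_one[OF hom] g
      by (simp add: nat_pow_consistent[symmetric])
    then show ?thesis using g by blast
  qed
  have dec': "\<exists>x\<in>Aut_S S U \<inter> stab U Y. \<exists>n\<in>D. y = x \<otimes>\<^bsub>BijGroup U\<^esub> n" if y: "y \<in> cw ` N" for y
  proof -
    obtain g where g: "g \<in> N" "y = cw g" using y by blast
    obtain x n where xn: "x \<in> Aut_S S U" "x \<in> stab U Y" "n \<in> D" "\<forall>v\<in>V. f (g \<rhd> v) = x (n (f v))"
      using dec[OF g(1)] by blast
    have B: "x \<in> Bij U" "n \<in> Bij U" using xn subgroup.subset[OF D(1)] subgroup.subset[OF stab_subgroup[OF sU YU]] by auto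
    have "cw g u = compose U x n u" for u
    proof (cases "u \<in> U")
      case True
      then obtain v where v: "v \<in> V" "u = f v" using Uex by blast
      then show ?thesis using cwf xn True by (simp add: compose_def)
    qed (simp add: compose_def cw_def)
    then have "cw g = x \<otimes>\<^bsub>BijGroup U\<^esub> n" using B by (simp add: fun_eq_iff)
    then show ?thesis using xn g by blast
  qed
  obtain n where n: "n \<in> D" "\<And>y. y \<in> cw ` N \<Longrightarrow> n \<otimes>\<^bsub>BijGroup U\<^esub> y \<otimes>\<^bsub>BijGroup U\<^esub> inv\<^bsub>BijGroup U\<^esub> n \<in> Aut_S S U"
    using B.coprime_index_conjugate[OF prime_p Aut_S_subgroup[OF sU] stab_subgroup[OF sU YU] D U(2)[unfolded stab_good_def] L tors dec']
    by blast
  have nA: "n \<in> Aut_F F U" using n D(2) by (auto simp: stab_def)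
  have nB: "n \<in> Bij U" using nA Aut_F_Bij[OF sU] by blast
  note nf = mor_compose_Aut[OF f nA]
  have "\<exists>h\<in>carrier S. \<forall>v\<in>V. n (f (g \<rhd> v)) = h \<rhd> n (f v)" if g: "g \<in> N" for g
  proof -
    have "n \<otimes>\<^bsub>BijGroup U\<^esub> cw g \<otimes>\<^bsub>BijGroup U\<^esub> inv\<^bsub>BijGroup U\<^esub> n \<in> Aut_S S U" using n(2) g by blast
    then obtain h where h: "h \<in> normalizer S U" "n \<otimes>\<^bsub>BijGroup U\<^esub> cw g \<otimes>\<^bsub>BijGroup U\<^esub> inv\<^bsub>BijGroup U\<^esub> n = (\<lambda>u\<in>U. h \<rhd> u)"
      using Aut_S_iff[OF sU] by blast
    let ?c = "\<lambda>u\<in>U. h \<rhd> u"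
    have cB: "?c \<in> Bij U" using conj_Aut_S[OF sU h(1)] Aut_S_subset[OF sU] Aut_F_Bij[OF sU] by blast
    have "n \<otimes>\<^bsub>BijGroup U\<^esub> cw g = ?c \<otimes>\<^bsub>BijGroup U\<^esub> n"
    proof -
      have c: "n \<in> carrier (BijGroup U)" "cw g \<in> carrier (BijGroup U)" using nB cwB[OF g] by auto
      have "?c \<otimes>\<^bsub>BijGroup U\<^esub> n = n \<otimes>\<^bsub>BijGroup U\<^esub> cw g \<otimes>\<^bsub>BijGroup U\<^esub> inv\<^bsub>BijGroup U\<^esub> n \<otimes>\<^bsub>BijGroup U\<^esub> n"
        by (simp only: h(2))
      also have "\<dots> = n \<otimes>\<^bsub>BijGroup U\<^esub> cw g"
        using c by (simp only: B.m_assoc B.l_inv B.r_one B.m_closed B.inv_closed)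
      finally show ?thesis by simp
    qed
    then have eq: "compose U n (cw g) = compose U ?c n" using nB cwB[OF g] cB by simp
    have "n (f (g \<rhd> v)) = h \<rhd> n (f v)" if v: "v \<in> V" for v
    proof -
      have fU: "f v \<in> U" using f(2) v by blast
      have "n (f v) \<in> U" using nB fU Bij_imp_funcset by blast
      then show ?thesis using fun_cong[OF eq, of "f v"] fU cwf[OF v] by (simp add: compose_def)
    qed
    then show ?thesis using normalizerD(1)[OF sU h(1)] by blast
  qed
  then obtain \<psi> where "mor N \<psi>" "\<And>v. v \<in> V \<Longrightarrow> \<psi> v = n (f v)"
    using receptive_extension[OF rec sU nf N(1,3,2)] by blast
  then show ?thesis using that n(1) by blast
qed

text \<open>Takes D to be all of stab U Y, which makes the decomposition required by
  \<open>extension_general\<close> trivial; the price is that f is changed by an automorphism of U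
  preserving Y only as a set.\<close>

lemma extension_stab:
  assumes U: "good U" "stab_good U Y" and f: "mor V f" "f ` V = U" and R: "subgroup R S" "R \<subseteq> V" "f ` R = Y"
    and N: "subgroup N S" "V \<subseteq> N" "N \<subseteq> normalizer S V" "N \<subseteq> normalizer S R"
  obtains \<psi> where "mor N \<psi>" "\<psi> ` V = U" "\<psi> ` R = Y"
proof -
  have sU: "subgroup U S" using U by (simp add: good_def)
  have V: "subgroup V S" by (rule mor_subgroup[OF f(1)])
  have YU: "Y \<subseteq> U" using R f by auto
  interpret B: group "BijGroup U" by (rule group_BijGroup)
  note st = stab_subgroup[OF sU YU]
  have one: "(\<lambda>u\<in>U. u) \<in> Aut_S S U \<inter> stab U Y"
    using subgroup.one_closed[OF st] subgroup.one_closed[OF Aut_S_subgroup[OF sU]] by simp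
  have dec: "\<exists>x\<in>Aut_S S U \<inter> stab U Y. \<exists>n\<in>stab U Y. \<forall>v\<in>V. f (g \<rhd> v) = x (n (f v))" if g: "g \<in> N" for g
  proof -
    let ?i = "inv_into V f"
    have gC: "g \<in> carrier S" using g subgroup.mem_carrier[OF N(1)] by blast
    have ii: "?i (f v) = v" if "v \<in> V" for v using mor_inj[OF f(1)] that by simp
    have gV: "(\<lambda>v. g \<rhd> v) ` V = V" using g N(3) mem_normalizer_iff subgroup.subset[OF V] by blast
    have gR: "(\<lambda>v. g \<rhd> v) ` R = R" using g N(4) mem_normalizer_iff subgroup.subset[OF R(1)] by blast
    have 2: "mor V (\<lambda>v. f (g \<rhd> v))" using mor_comp[OF mor_conj[OF V gC] f(1)] gV by simp
    have 3: "mor U ?i" using mor_inv_into[OF f(1)] f(2) by simp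
    have iU: "?i ` U = V" using ii f(2) by (force simp: image_image)
    have iY: "?i ` Y = R" using ii R by (force simp: image_image)
    have 4: "mor U (\<lambda>u. f (g \<rhd> ?i u))" using mor_comp[OF 3 2] iU by blast
    let ?c = "\<lambda>u\<in>U. f (g \<rhd> ?i u)"
    have im: "(\<lambda>u. f (g \<rhd> ?i u)) ` A = f ` (\<lambda>v. g \<rhd> v) ` ?i ` A" for A by (simp add: image_image)
    have "?c \<in> Aut_F F U" using restrict_Aut_F[OF 4] im[of U] iU gV f(2) by simp
    moreover have "?c ` Y = Y"
    proof -
      have "?c ` Y = (\<lambda>u. f (g \<rhd> ?i u)) ` Y" using YU by (intro image_cong) auto
      then show ?thesis using im[of Y] iY gR R(3) by simp
    qed
    ultimately have c: "?c \<in> stab U Y" by (simp add: stab_def)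
    have cU: "?c u \<in> U" if "u \<in> U" for u using that f(2) iU gV by (auto simp: image_iff)
    have "f (g \<rhd> v) = (\<lambda>u\<in>U. u) (?c (f v))" if v: "v \<in> V" for v
    proof -
      have fv: "f v \<in> U" using f(2) v by blast
      show ?thesis using cU[OF fv] fv ii[OF v] by simp
    qed
    then show ?thesis using one c by blast
  qed
  obtain n \<psi> where n: "n \<in> stab U Y" "mor N \<psi>" "\<And>v. v \<in> V \<Longrightarrow> \<psi> v = n (f v)"
  proof (rule extension_general[OF U f R N st order_refl _ dec])
    show "h \<otimes>\<^bsub>BijGroup U\<^esub> n \<otimes>\<^bsub>BijGroup U\<^esub> inv\<^bsub>BijGroup U\<^esub> h \<in> stab U Y" if "h \<in> stab U Y" "n \<in> stab U Y" for h n
      using that subgroup.m_closed[OF st] subgroup.m_inv_closed[OF st] by simp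
  qed (assumption, blast intro: that)
  have "\<psi> ` V = n ` f ` V" "\<psi> ` R = n ` f ` R"
    unfolding image_image using n(3) R(2) by (auto intro!: image_cong)
  then show ?thesis using that[OF n(2)] n(1) f(2) R(3) Aut_F_iff[OF sU] by (auto simp: stab_def)
qed

text \<open>Takes D to be the automorphisms fixing Y pointwise, so that the values of f on R
  survive. In return the action of N on R must already be induced, through f, by elements of S
  normalizing U and Y; such an element supplies the factor in Aut_S(U).\<close>

lemma extension_fixing:
  assumes U: "good U" "stab_good U Y" and f: "mor V f" "f ` V = U" and R: "subgroup R S" "R \<subseteq> V" "f ` R = Y"
    and N: "subgroup N S" "V \<subseteq> N" "N \<subseteq> normalizer S V" "N \<subseteq> normalizer S R"
    and h: "\<And>g. g \<in> N \<Longrightarrow> \<exists>h\<in>normalizer S U \<inter> normalizer S Y. \<forall>r\<in>R. f (g \<rhd> r) = h \<rhd> f r"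
  obtains \<psi> where "mor N \<psi>" "\<psi> ` V = U" "\<And>r. r \<in> R \<Longrightarrow> \<psi> r = f r"
proof -
  have sU: "subgroup U S" using U by (simp add: good_def)
  have V: "subgroup V S" by (rule mor_subgroup[OF f(1)])
  have YU: "Y \<subseteq> U" using R f by auto
  have YS: "subgroup Y S" using mor_image_subgroup[OF mor_subset[OF f(1) R(1,2)]] R(3) by simp
  interpret B: group "BijGroup U" by (rule group_BijGroup)
  note st = stab_subgroup[OF sU YU]
  have stB: "\<And>\<gamma>. \<gamma> \<in> stab U Y \<Longrightarrow> \<gamma> \<in> Bij U" using subgroup.subset[OF st] by auto
  define D where "D = {\<gamma> \<in> stab U Y. \<forall>y\<in>Y. \<gamma> y = y}"
  have Dst: "D \<subseteq> stab U Y" by (auto simp: D_def)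
  have inv_app: "(inv\<^bsub>BijGroup U\<^esub> \<gamma>) (\<gamma> u) = u" "\<gamma> ((inv\<^bsub>BijGroup U\<^esub> \<gamma>) u) = u" if "\<gamma> \<in> stab U Y" "u \<in> U" for \<gamma> u
  proof -
    have g: "\<gamma> \<in> carrier (BijGroup U)" "inv\<^bsub>BijGroup U\<^esub> \<gamma> \<in> Bij U" "\<gamma> \<in> Bij U"
      using stB[OF that(1)] B.inv_closed[of \<gamma>] by auto
    have "compose U (inv\<^bsub>BijGroup U\<^esub> \<gamma>) \<gamma> = (\<lambda>u\<in>U. u)" "compose U \<gamma> (inv\<^bsub>BijGroup U\<^esub> \<gamma>) = (\<lambda>u\<in>U. u)"
      using B.l_inv[OF g(1)] B.r_inv[OF g(1)] g by auto
    then show "(inv\<^bsub>BijGroup U\<^esub> \<gamma>) (\<gamma> u) = u" "\<gamma> ((inv\<^bsub>BijGroup U\<^esub> \<gamma>) u) = u"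
      using that(2) by (metis compose_eq restrict_apply')+
  qed
  have mulapp: "(\<gamma> \<otimes>\<^bsub>BijGroup U\<^esub> \<delta>) u = \<gamma> (\<delta> u)" if "\<gamma> \<in> stab U Y" "\<delta> \<in> stab U Y" "u \<in> U" for \<gamma> \<delta> u
    using stB that by (simp add: compose_eq)
  have stI: "inv\<^bsub>BijGroup U\<^esub> \<gamma> \<in> stab U Y" if "\<gamma> \<in> stab U Y" for \<gamma> using subgroup.m_inv_closed[OF st that] .
  have stM: "\<gamma> \<otimes>\<^bsub>BijGroup U\<^esub> \<delta> \<in> stab U Y" if "\<gamma> \<in> stab U Y" "\<delta> \<in> stab U Y" for \<gamma> \<delta> using subgroup.m_closed[OF st that] .
  have stY: "\<gamma> y \<in> Y" if "\<gamma> \<in> stab U Y" "y \<in> Y" for \<gamma> y using that by (auto simp: stab_def)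
  have yU: "y \<in> U" if "y \<in> Y" for y using that YU by blast
  have D: "subgroup D (BijGroup U)"
  proof
    show "D \<subseteq> carrier (BijGroup U)" using stB Dst by auto
    show "\<one>\<^bsub>BijGroup U\<^esub> \<in> D" using subgroup.one_closed[OF st] YU by (auto simp: D_def)
    fix \<gamma> assume g: "\<gamma> \<in> D"
    show "inv\<^bsub>BijGroup U\<^esub> \<gamma> \<in> D" unfolding D_def
    proof (intro CollectI conjI ballI)
      show "inv\<^bsub>BijGroup U\<^esub> \<gamma> \<in> stab U Y" using g stI by (simp add: D_def)
      fix y assume "y \<in> Y"
      then show "(inv\<^bsub>BijGroup U\<^esub> \<gamma>) y = y" using g inv_app(1)[of \<gamma> y] yU by (auto simp: D_def)
    qed
    fix \<delta> assume d: "\<delta> \<in> D"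
    show "\<gamma> \<otimes>\<^bsub>BijGroup U\<^esub> \<delta> \<in> D" using g d stM mulapp yU by (auto simp: D_def)
  qed
  have Dn: "\<eta> \<otimes>\<^bsub>BijGroup U\<^esub> n \<otimes>\<^bsub>BijGroup U\<^esub> inv\<^bsub>BijGroup U\<^esub> \<eta> \<in> D" if e: "\<eta> \<in> stab U Y" and n: "n \<in> D" for \<eta> n
  proof -
    have ns: "n \<in> stab U Y" using n Dst by blast
    have "(\<eta> \<otimes>\<^bsub>BijGroup U\<^esub> n \<otimes>\<^bsub>BijGroup U\<^esub> inv\<^bsub>BijGroup U\<^esub> \<eta>) y = y" if y: "y \<in> Y" for y
    proof -
      have "(inv\<^bsub>BijGroup U\<^esub> \<eta>) y \<in> Y" using stY[OF stI[OF e] y] .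
      then have "n ((inv\<^bsub>BijGroup U\<^esub> \<eta>) y) = (inv\<^bsub>BijGroup U\<^esub> \<eta>) y" using n by (simp add: D_def)
      then show ?thesis
        using mulapp[OF stM[OF e ns] stI[OF e] yU[OF y]] mulapp[OF e ns yU[OF \<open>(inv\<^bsub>BijGroup U\<^esub> \<eta>) y \<in> Y\<close>]]
          inv_app(2)[OF e yU[OF y]] by simp
    qed
    then show ?thesis unfolding D_def using stM stI e ns by blast
  qed
  have dec: "\<exists>x\<in>Aut_S S U \<inter> stab U Y. \<exists>n\<in>D. \<forall>v\<in>V. f (g \<rhd> v) = x (n (f v))" if g: "g \<in> N" for g
  proof -
    obtain k where k: "k \<in> normalizer S U" "k \<in> normalizer S Y" "\<forall>r\<in>R. f (g \<rhd> r) = k \<rhd> f r"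
      using h[OF g] by blast
    let ?x = "\<lambda>u\<in>U. k \<rhd> u"
    have xS: "?x \<in> Aut_S S U" using conj_Aut_S[OF sU k(1)] .
    have "?x ` Y = (\<lambda>u. k \<rhd> u) ` Y" using YU by (intro image_cong) auto
    also have "\<dots> = Y" using mem_normalizer_iff[OF subgroup.subset[OF YS]] k(2) by blast
    finally have x: "?x \<in> stab U Y" using xS Aut_S_subset[OF sU] by (auto simp: stab_def)
    let ?i = "inv_into V f"
    have gC: "g \<in> carrier S" using g subgroup.mem_carrier[OF N(1)] by blast
    have ii: "?i (f v) = v" if "v \<in> V" for v using mor_inj[OF f(1)] that by simp
    have gV: "(\<lambda>v. g \<rhd> v) ` V = V" using g N(3) mem_normalizer_iff subgroup.subset[OF V] by blast
    have gR: "(\<lambda>v. g \<rhd> v) ` R = R" using g N(4) mem_normalizer_iff subgroup.subset[OF R(1)] by blast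
    have 2: "mor V (\<lambda>v. f (g \<rhd> v))" using mor_comp[OF mor_conj[OF V gC] f(1)] gV by simp
    have 3: "mor U ?i" using mor_inv_into[OF f(1)] f(2) by simp
    have iU: "?i ` U = V" using ii f(2) by (force simp: image_image)
    have iY: "?i ` Y = R" using ii R by (force simp: image_image)
    have 4: "mor U (\<lambda>u. f (g \<rhd> ?i u))" using mor_comp[OF 3 2] iU by blast
    let ?c = "\<lambda>u\<in>U. f (g \<rhd> ?i u)"
    have im: "(\<lambda>u. f (g \<rhd> ?i u)) ` A = f ` (\<lambda>v. g \<rhd> v) ` ?i ` A" for A by (simp add: image_image)
    have "?c \<in> Aut_F F U" using restrict_Aut_F[OF 4] im[of U] iU gV f(2) by simp
    moreover have "?c ` Y = Y"
    proof -
      have "?c ` Y = (\<lambda>u. f (g \<rhd> ?i u)) ` Y" using YU by (intro image_cong) auto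
      then show ?thesis using im[of Y] iY gR R(3) by simp
    qed
    ultimately have c: "?c \<in> stab U Y" by (simp add: stab_def)
    \<comment> \<open>Conjugation by k and the automorphism induced by g agree on Y, so their
      quotient lies in D.\<close>
    let ?n = "inv\<^bsub>BijGroup U\<^esub> ?x \<otimes>\<^bsub>BijGroup U\<^esub> ?c"
    have ns: "?n \<in> stab U Y" using stM[OF stI[OF x] c] .
    have "?n y = y" if y: "y \<in> Y" for y
    proof -
      obtain r where r: "r \<in> R" "y = f r" using y R(3) by blast
      have "?i y = r" using r R(2) ii by blast
      then have "?c y = f (g \<rhd> r)" using yU[OF y] by simp
      also have "\<dots> = ?x y" using r k(3) yU[OF y] by simp
      finally have "?c y = ?x y" .
      then show ?thesis using mulapp[OF stI[OF x] c yU[OF y]] inv_app(1)[OF x yU[OF y]] by simp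
    qed
    then have nD: "?n \<in> D" using ns by (simp add: D_def)
    have "f (g \<rhd> v) = ?x (?n (f v))" if v: "v \<in> V" for v
    proof -
      have fv: "f v \<in> U" using f(2) v by blast
      have cf: "?c (f v) = f (g \<rhd> v)" using fv ii[OF v] by simp
      have "?c (f v) \<in> U" using stB[OF c] fv Bij_imp_funcset by blast
      then show ?thesis using mulapp[OF stI[OF x] c fv] inv_app(2)[OF x] cf by metis
    qed
    then show ?thesis using xS x nD by blast
  qed
  obtain n \<psi> where n: "n \<in> D" "mor N \<psi>" "\<And>v. v \<in> V \<Longrightarrow> \<psi> v = n (f v)"
    using extension_general[OF U f R N D Dst Dn dec] by blast
  have "\<psi> ` V = n ` f ` V" unfolding image_image using n(3) by (auto intro!: image_cong)
  moreover have "\<psi> r = f r" if "r \<in> R" for r using n that R by (auto simp: D_def)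
  ultimately show ?thesis using that[OF n(2)] n(1) f(2) Aut_F_iff[OF sU] by (auto simp: D_def stab_def)
qed

text \<open>The case V = R = P of \<open>extension_stab\<close>: the normalizers of all conjugates
  of U map into that of U.\<close>

lemma good_normalizer_map:
  assumes U: "good U" and f: "mor P f" "f ` P = U"
  obtains \<psi> where "mor (normalizer S P) \<psi>" "\<psi> ` P = U"
proof -
  have P: "subgroup P S" by (rule mor_subgroup[OF f(1)])
  show ?thesis
    by (rule extension_stab[OF U good_stab_good[OF U] f P order_refl f(2) normalizer_subgroup[OF P] normalizer_contains[OF P] order_refl order_refl])
      (rule that)
qed

lemma mor_normalizer_image:
  assumes "mor N \<psi>" "P \<subseteq> N" "N \<subseteq> normalizer S P" "subgroup P S" shows "\<psi> ` N \<subseteq> normalizer S (\<psi> ` P)"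
proof clarify
  fix g assume g: "g \<in> N"
  have fP: "subgroup (\<psi> ` P) S" using mor_image_subgroup[OF mor_subset[OF assms(1,4,2)]] .
  show "\<psi> g \<in> normalizer S (\<psi> ` P)"
  proof (rule normalizerI[OF fP mor_closed[OF assms(1) g]])
    fix y assume "y \<in> \<psi> ` P"
    then obtain x where x: "x \<in> P" "y = \<psi> x" by blast
    have "g \<rhd> x \<in> P" using normalizerD(2)[OF assms(4)] g assms(3) x by blast
    then show "\<psi> g \<rhd> y \<in> \<psi> ` P" using mor_conj_elem[OF assms(1) g, of x] x assms(2) by (metis image_eqI subsetD)
  qed
qed

lemma mor_centralizer_image:
  assumes "mor N \<psi>" "P \<subseteq> N" "C \<subseteq> N" "C \<subseteq> centralizer S P" "subgroup P S" shows "\<psi> ` C \<subseteq> centralizer S (\<psi> ` P)"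
  unfolding centralizer_iff image_subset_iff
proof (intro ballI conjI)
  fix g assume g: "g \<in> C"
  then show "\<psi> g \<in> carrier S" using mor_closed[OF assms(1)] assms(3) by blast
  have "\<psi> g \<otimes> \<psi> x = \<psi> x \<otimes> \<psi> g" if "x \<in> P" for x
  proof -
    have "g \<otimes> x = x \<otimes> g" using g assms(4) that by (auto simp: centralizer_iff)
    then show ?thesis using mor_mult[OF assms(1), of g x] mor_mult[OF assms(1), of x g] g that assms(2,3) by (metis subsetD)
  qed
  then show "\<psi> g \<otimes> y = y \<otimes> \<psi> g" if "y \<in> \<psi> ` P" for y using that by blast
qed

section \<open>Transport of automorphisms along a morphism\<close>

definition transport :: "'a set \<Rightarrow> ('a \<Rightarrow> 'a) \<Rightarrow> ('a \<Rightarrow> 'a) \<Rightarrow> 'a \<Rightarrow> 'a" where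
  "transport Y f \<gamma> = (\<lambda>r\<in>f ` Y. f (\<gamma> (inv_into Y f r)))"

lemma transport_app: "mor Y f \<Longrightarrow> y \<in> Y \<Longrightarrow> transport Y f \<gamma> (f y) = f (\<gamma> y)"
  using mor_inj by (simp add: transport_def)

lemma transport_Aut:
  assumes f: "mor Y f" and g: "\<gamma> \<in> Aut_F F Y" shows "transport Y f \<gamma> \<in> Aut_F F (f ` Y)"
proof -
  have Y: "subgroup Y S" by (rule mor_subgroup[OF f])
  have g': "mor Y \<gamma>" "\<gamma> ` Y = Y" using g Aut_F_iff[OF Y] by auto
  have iR: "inv_into Y f ` f ` Y = Y" using inv_into_image_cancel[OF mor_inj[OF f] order_refl] .
  have "mor Y (\<lambda>y. f (\<gamma> y))" using mor_comp[OF g'(1) f] g'(2) by simp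
  then have m: "mor (f ` Y) (\<lambda>r. f (\<gamma> (inv_into Y f r)))" using mor_comp[OF mor_inv_into[OF f], of Y "\<lambda>y. f (\<gamma> y)"] iR by simp
  have "(\<lambda>r. f (\<gamma> (inv_into Y f r))) ` f ` Y = f ` \<gamma> ` inv_into Y f ` f ` Y" by (simp only: image_image)
  also have "\<dots> = f ` Y" unfolding iR g'(2) ..
  finally show ?thesis unfolding transport_def using restrict_Aut_F[OF m] by blast
qed

lemma transport_hom:
  assumes f: "mor Y f"
  shows "transport Y f \<in> hom ((BijGroup Y)\<lparr>carrier := Aut_F F Y\<rparr>) (BijGroup (f ` Y))"
proof (rule homI)
  have Y: "subgroup Y S" and R: "subgroup (f ` Y) S" using mor_subgroup[OF f] mor_image_subgroup[OF f] by auto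
  have AY: "\<And>\<gamma>. \<gamma> \<in> Aut_F F Y \<Longrightarrow> \<gamma> \<in> Bij Y" using Aut_F_Bij[OF Y] by blast
  have AR: "\<And>\<gamma>. \<gamma> \<in> Aut_F F Y \<Longrightarrow> transport Y f \<gamma> \<in> Bij (f ` Y)" using transport_Aut[OF f] Aut_F_Bij[OF R] by blast
  fix \<gamma> assume g: "\<gamma> \<in> carrier ((BijGroup Y)\<lparr>carrier := Aut_F F Y\<rparr>)"
  then show "transport Y f \<gamma> \<in> carrier (BijGroup (f ` Y))" using AR by simp
  fix \<delta> assume "\<delta> \<in> carrier ((BijGroup Y)\<lparr>carrier := Aut_F F Y\<rparr>)"
  with g have gd: "\<gamma> \<in> Aut_F F Y" "\<delta> \<in> Aut_F F Y" by auto
  have dY: "\<delta> y \<in> Y" if "y \<in> Y" for y using gd(2) that Aut_F_iff[OF Y] by blast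
  have "transport Y f (compose Y \<gamma> \<delta>) r = compose (f ` Y) (transport Y f \<gamma>) (transport Y f \<delta>) r" for r
  proof (cases "r \<in> f ` Y")
    case True
    then obtain y where "y \<in> Y" "r = f y" by blast
    then show ?thesis using transport_app[OF f] dY by (simp add: compose_def)
  qed (simp add: compose_def transport_def)
  then show "transport Y f (\<gamma> \<otimes>\<^bsub>(BijGroup Y)\<lparr>carrier := Aut_F F Y\<rparr>\<^esub> \<delta>) = transport Y f \<gamma> \<otimes>\<^bsub>BijGroup (f ` Y)\<^esub> transport Y f \<delta>"
    using gd AY AR by (simp add: fun_eq_iff)
qed

lemma transport_surj:
  assumes f: "mor Y f" and d: "\<delta> \<in> Aut_F F (f ` Y)" shows "\<exists>\<gamma>\<in>Aut_F F Y. transport Y f \<gamma> = \<delta>"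
proof -
  have Y: "subgroup Y S" and R: "subgroup (f ` Y) S" using mor_subgroup[OF f] mor_image_subgroup[OF f] by auto
  let ?i = "inv_into Y f"
  have mi: "mor (f ` Y) ?i" by (rule mor_inv_into[OF f])
  have iR: "?i ` f ` Y = Y" using inv_into_image_cancel[OF mor_inj[OF f] order_refl] .
  have d': "mor (f ` Y) \<delta>" "\<delta> ` f ` Y = f ` Y" "\<delta> \<in> extensional (f ` Y)" using d Aut_F_iff[OF R] by auto
  have 1: "mor Y (\<lambda>y. \<delta> (f y))" using mor_comp[OF f d'(1)] by simp
  have 2: "(\<lambda>y. \<delta> (f y)) ` Y = f ` Y" using d'(2) by (simp add: image_image)
  have 3: "mor Y (\<lambda>y. ?i (\<delta> (f y)))" using mor_comp[OF 1 mi] 2 by simp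
  have "(\<lambda>y. ?i (\<delta> (f y))) ` Y = ?i ` (\<lambda>y. \<delta> (f y)) ` Y" by (simp add: image_image)
  then have A: "restrict (\<lambda>y. ?i (\<delta> (f y))) Y \<in> Aut_F F Y" using restrict_Aut_F[OF 3] 2 iR by simp
  have "transport Y f (restrict (\<lambda>y. ?i (\<delta> (f y))) Y) r = \<delta> r" for r
  proof (cases "r \<in> f ` Y")
    case True
    then obtain y where y: "y \<in> Y" "r = f y" by blast
    have "\<delta> r \<in> f ` Y" using d'(2) True by blast
    then have "f (?i (\<delta> r)) = \<delta> r" using f_inv_into_f by metis
    then show ?thesis using y transport_app[OF f] by simp
  qed (use d'(3) in \<open>auto simp: transport_def extensional_def\<close>)
  then show ?thesis using A by blast
qed

lemma transport_conj:
  assumes f: "mor N f" and Y: "subgroup Y S" "Y \<subseteq> N" and g: "g \<in> N" "g \<in> normalizer S Y"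
  shows "transport Y f (\<lambda>y\<in>Y. g \<rhd> y) = (\<lambda>r\<in>f ` Y. f g \<rhd> r)"
proof
  fix r
  have fY: "mor Y f" by (rule mor_subset[OF f Y])
  show "transport Y f (\<lambda>y\<in>Y. g \<rhd> y) r = (\<lambda>r\<in>f ` Y. f g \<rhd> r) r"
  proof (cases "r \<in> f ` Y")
    case True
    then obtain y where y: "y \<in> Y" "r = f y" by blast
    then show ?thesis using transport_app[OF fY] mor_conj_elem[OF f g(1), of y] Y(2) by auto
  qed (simp add: transport_def)
qed

text \<open>Because f is defined on the whole normalizer, it carries Aut_S(Y) into Aut_S(f Y), while
  Aut_F(Y) goes onto Aut_F(f Y); so the index can only drop to a divisor.\<close>

lemma fully_automized_transport:
  assumes Y: "fully_automized p S F Y" and f: "mor (normalizer S Y) f" and sY: "subgroup Y S"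
  shows "fully_automized p S F (f ` Y)"
proof -
  have YN: "Y \<subseteq> normalizer S Y" by (rule normalizer_contains[OF sY])
  have fY: "mor Y f" by (rule mor_subset[OF f sY YN])
  have sR: "subgroup (f ` Y) S" by (rule mor_image_subgroup[OF fY])
  have "transport Y f ` (Aut_S S Y \<inter> Aut_F F Y) \<subseteq> Aut_S S (f ` Y)"
  proof clarify
    fix \<gamma> assume "\<gamma> \<in> Aut_S S Y"
    then obtain g where g: "g \<in> normalizer S Y" "\<gamma> = (\<lambda>y\<in>Y. g \<rhd> y)" using Aut_S_iff[OF sY] by blast
    have "f g \<in> normalizer S (f ` Y)" using mor_normalizer_image[OF f YN order_refl sY] g by blast
    then show "transport Y f \<gamma> \<in> Aut_S S (f ` Y)"
      using transport_conj[OF f sY YN g(1,1)] conj_Aut_S[OF sR] g(2) by simp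
  qed
  moreover have "transport Y f ` Aut_F F Y = Aut_F F (f ` Y)"
    using transport_Aut[OF fY] transport_surj[OF fY] by blast
  ultimately show ?thesis
    using coprime_index_hom[OF group_BijGroup group_BijGroup Aut_S_subgroup[OF sY] Aut_S_subgroup[OF sR] Aut_F_subgroup[OF sY] transport_hom[OF fY]]
      Y by (simp add: fully_automized_iff)
qed

end

context fusion begin

section \<open>Saturation from fully automized, receptive subgroups\<close>

lemma Inn_eq: "Inn S P = {\<lambda>x\<in>P. u \<rhd> x | u. u \<in> P}"
  by (auto simp: Inn_def conj_map_def)

lemma Inn_subset_Aut_S:
  assumes P: "subgroup P S" shows "Inn S P \<subseteq> Aut_S S P"
  using conj_Aut_S[OF P] normalizer_contains[OF P] by (auto simp: Inn_eq)

lemma group_Aut_F_group: "subgroup P S \<Longrightarrow> group (Aut_F_group F P)"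
  unfolding Aut_F_group_def using group.subgroup_imp_group[OF group_BijGroup Aut_F_subgroup] .

lemma Aut_F_group_simps [simp]:
  "carrier (Aut_F_group F P) = Aut_F F P" "mult (Aut_F_group F P) = mult (BijGroup P)"
  "\<one>\<^bsub>Aut_F_group F P\<^esub> = \<one>\<^bsub>BijGroup P\<^esub>" "Z #>\<^bsub>Aut_F_group F P\<^esub> g = Z #>\<^bsub>BijGroup P\<^esub> g"
  by (simp_all add: Aut_F_group_def r_coset_def)

lemma conj_by_Aut:
  assumes P: "subgroup P S" and g: "\<gamma> \<in> Aut_F F P" and u: "u \<in> P"
  shows "\<gamma> \<otimes>\<^bsub>BijGroup P\<^esub> (\<lambda>x\<in>P. u \<rhd> x) = (\<lambda>x\<in>P. \<gamma> u \<rhd> x) \<otimes>\<^bsub>BijGroup P\<^esub> \<gamma>"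
proof -
  have m: "mor P \<gamma>" and im: "\<gamma> ` P = P" using g Aut_F_iff[OF P] by auto
  have B: "\<And>f. f \<in> Aut_F F P \<Longrightarrow> f \<in> Bij P" using Aut_F_Bij[OF P] by blast
  have gu: "\<gamma> u \<in> P" using im u by blast
  have c: "(\<lambda>x\<in>P. u \<rhd> x) \<in> Bij P" "(\<lambda>x\<in>P. \<gamma> u \<rhd> x) \<in> Bij P"
    using Inn_subset_Aut_S[OF P] Aut_S_subset[OF P] B u gu by (auto simp: Inn_eq)
  have "u \<rhd> x \<in> P" if "x \<in> P" for x using normalizerD(2)[OF P _ that] normalizer_contains[OF P] u by blast
  moreover have "\<gamma> x \<in> P" if "x \<in> P" for x using im that by blast
  ultimately show ?thesis
    using B[OF g] c mor_conj_elem[OF m u] by (auto simp: compose_def fun_eq_iff)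
qed

lemma Inn_normal:
  assumes P: "subgroup P S" shows "Inn S P \<lhd> Aut_F_group F P"
proof -
  interpret A: group "Aut_F_group F P" by (rule group_Aut_F_group[OF P])
  interpret B: group "BijGroup P" by (rule group_BijGroup)
  have sub: "Inn S P \<subseteq> Aut_F F P" using Inn_subset_Aut_S[OF P] Aut_S_subset[OF P] by blast
  have N: "P \<subseteq> normalizer S P" by (rule normalizer_contains[OF P])
  have one: "(\<lambda>x\<in>P. \<one> \<rhd> x) = \<one>\<^bsub>BijGroup P\<^esub>" using subgroup.mem_carrier[OF P] by (auto simp: fun_eq_iff)
  have inv_eq: "inv\<^bsub>Aut_F_group F P\<^esub> \<gamma> = inv\<^bsub>BijGroup P\<^esub> \<gamma>" if "\<gamma> \<in> Aut_F F P" for \<gamma>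
    using B.m_inv_consistent[OF Aut_F_subgroup[OF P] that] by (simp add: Aut_F_group_def)
  have "subgroup (Inn S P) (Aut_F_group F P)"
  proof (rule A.subgroupI)
    show "Inn S P \<subseteq> carrier (Aut_F_group F P)" using sub by simp
    show "Inn S P \<noteq> {}" using subgroup.one_closed[OF P] by (auto simp: Inn_def)
    fix f assume "f \<in> Inn S P"
    then obtain u where u: "u \<in> P" "f = (\<lambda>x\<in>P. u \<rhd> x)" by (auto simp: Inn_eq)
    have iu: "inv u \<in> P" "inv u \<in> normalizer S P" "u \<in> normalizer S P" and uC: "u \<in> carrier S"
      using u subgroup.m_inv_closed[OF P] N subgroup.mem_carrier[OF P] by auto
    have "(\<lambda>x\<in>P. inv u \<rhd> x) \<otimes>\<^bsub>Aut_F_group F P\<^esub> f = \<one>\<^bsub>Aut_F_group F P\<^esub>"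
      using conj_compose[OF P iu(2,3)] uC one u(2) by simp
    moreover have ii: "(\<lambda>x\<in>P. inv u \<rhd> x) \<in> Inn S P" using iu(1) unfolding Inn_eq by blast
    moreover have "f \<in> Inn S P" using u unfolding Inn_eq by blast
    ultimately have "inv\<^bsub>Aut_F_group F P\<^esub> f = (\<lambda>x\<in>P. inv u \<rhd> x)"
      using A.inv_equality sub by auto
    then show "inv\<^bsub>Aut_F_group F P\<^esub> f \<in> Inn S P" using ii by simp
    fix f' assume "f' \<in> Inn S P"
    then obtain w where w: "w \<in> P" "f' = (\<lambda>x\<in>P. w \<rhd> x)" by (auto simp: Inn_eq)
    have "f \<otimes>\<^bsub>Aut_F_group F P\<^esub> f' = (\<lambda>x\<in>P. (u \<otimes> w) \<rhd> x)"
      using conj_compose[OF P, of u w] N u w by auto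
    then show "f \<otimes>\<^bsub>Aut_F_group F P\<^esub> f' \<in> Inn S P" using subgroup.m_closed[OF P u(1) w(1)] unfolding Inn_eq by blast
  qed
  then show ?thesis
  proof (rule A.normal_invI)
    fix \<gamma> f assume "\<gamma> \<in> carrier (Aut_F_group F P)" and "f \<in> Inn S P"
    then obtain u where g: "\<gamma> \<in> Aut_F F P" and u: "u \<in> P" "f = (\<lambda>x\<in>P. u \<rhd> x)" by (auto simp: Inn_eq)
    let ?c = "\<lambda>x\<in>P. \<gamma> u \<rhd> x"
    have "\<gamma> u \<in> P" using g u Aut_F_iff[OF P] by blast
    then have c: "?c \<in> Inn S P" unfolding Inn_eq by blast
    have C: "\<gamma> \<in> carrier (BijGroup P)" "?c \<in> carrier (BijGroup P)" using g c sub Aut_F_Bij[OF P] by auto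
    have "\<gamma> \<otimes>\<^bsub>BijGroup P\<^esub> f \<otimes>\<^bsub>BijGroup P\<^esub> inv\<^bsub>BijGroup P\<^esub> \<gamma> = ?c \<otimes>\<^bsub>BijGroup P\<^esub> \<gamma> \<otimes>\<^bsub>BijGroup P\<^esub> inv\<^bsub>BijGroup P\<^esub> \<gamma>"
      by (simp only: u(2) conj_by_Aut[OF P g u(1)])
    also have "\<dots> = ?c" using C by (simp only: B.m_assoc B.r_inv B.r_one B.inv_closed)
    finally show "\<gamma> \<otimes>\<^bsub>Aut_F_group F P\<^esub> f \<otimes>\<^bsub>Aut_F_group F P\<^esub> inv\<^bsub>Aut_F_group F P\<^esub> \<gamma> \<in> Inn S P"
      using c inv_eq[OF g] by simp
  qed
qed

lemma Inn_subgroup_Bij: "subgroup P S \<Longrightarrow> subgroup (Inn S P) (BijGroup P)"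
  using group.incl_subgroup[OF group_BijGroup Aut_F_subgroup] normal_imp_subgroup[OF Inn_normal]
  unfolding Aut_F_group_def by blast

lemma conj_map_hom:
  assumes P: "subgroup P S"
  shows "group_hom (S\<lparr>carrier := normalizer S P\<rparr>) (BijGroup P) (\<lambda>g. \<lambda>x\<in>P. g \<rhd> x)"
proof -
  have "(\<lambda>x\<in>P. g \<rhd> x) \<in> Bij P" if "g \<in> normalizer S P" for g
    using conj_Aut_S[OF P that] Aut_S_subset[OF P] Aut_F_Bij[OF P] by blast
  then show ?thesis
    unfolding group_hom_def group_hom_axioms_def
    using conj_compose[OF P] normalizer_subgroup[OF P] by (auto simp: subgroup_imp_group group_BijGroup hom_def)
qed

lemma Aut_S_image: "subgroup P S \<Longrightarrow> Aut_S S P = (\<lambda>g. \<lambda>x\<in>P. g \<rhd> x) ` normalizer S P"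
  using Aut_S_iff by (auto simp: image_iff)

lemma Aut_S_torsion:
  assumes P: "subgroup P S" and f: "f \<in> Aut_S S P"
  shows "\<exists>n::nat. f [^]\<^bsub>BijGroup P\<^esub> (p ^ n) = \<one>\<^bsub>BijGroup P\<^esub>"
proof -
  interpret h: group_hom "S\<lparr>carrier := normalizer S P\<rparr>" "BijGroup P" "\<lambda>g. \<lambda>x\<in>P. g \<rhd> x"
    by (rule conj_map_hom[OF P])
  obtain g where g: "g \<in> normalizer S P" "f = (\<lambda>x\<in>P. g \<rhd> x)" using f Aut_S_iff[OF P] by blast
  obtain n where "g [^] (p ^ n :: nat) = \<one>" using torsion normalizerD(1)[OF P g(1)] by blast
  then have "(\<lambda>x\<in>P. g \<rhd> x) [^]\<^bsub>BijGroup P\<^esub> (p ^ n) = \<one>\<^bsub>BijGroup P\<^esub>"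
    using h.hom_nat_pow[of g "p ^ n"] h.hom_one g(1) by (simp add: nat_pow_consistent[symmetric])
  then show ?thesis using g by blast
qed

text \<open>By \<open>normalizer_idc_inner\<close> the identity component of N_S(P) acts on P by
  inner automorphisms, so Out_S(P) is a quotient of the finite component group of N_S(P).\<close>

lemma finite_Out_S:
  assumes P: "subgroup P S"
  shows "finite ((\<lambda>g. Inn S P #>\<^bsub>BijGroup P\<^esub> g) ` Aut_S S P)"
proof -
  interpret B: group "BijGroup P" by (rule group_BijGroup)
  let ?N = "normalizer S P" and ?c = "\<lambda>g. \<lambda>x\<in>P. g \<rhd> x"
  interpret h: group_hom "S\<lparr>carrier := ?N\<rparr>" "BijGroup P" ?c by (rule conj_map_hom[OF P])
  have N: "subgroup ?N S" by (rule normalizer_subgroup[OF P])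
  note I = Inn_subgroup_Bij[OF P]
  have cB: "?c g \<in> carrier (BijGroup P)" if "g \<in> ?N" for g using h.hom_closed that by simp
  have eq: "Inn S P #>\<^bsub>BijGroup P\<^esub> ?c g = Inn S P #>\<^bsub>BijGroup P\<^esub> ?c g'"
    if g: "g \<in> ?N" "g' \<in> ?N" and e: "idc ?N #> g = idc ?N #> g'" for g g'
  proof -
    have C: "g \<in> carrier S" "g' \<in> carrier S" using g normalizerD(1)[OF P] by auto
    define t where "t = g \<otimes> inv g'"
    have t: "t \<in> idc ?N" using rcos_eq_iff[OF idc_subgroup[OF N] C] e by (simp add: t_def)
    have tN: "t \<in> ?N" using t idc_subset[OF N] by blast
    obtain u where u: "u \<in> P" "\<And>x. x \<in> P \<Longrightarrow> t \<rhd> x = u \<rhd> x"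
      using normalizer_idc_inner[OF P t] by blast
    have ct: "?c t \<in> Inn S P" using u unfolding Inn_eq by (auto intro!: exI[of _ u] simp: fun_eq_iff)
    have "g = t \<otimes> g'" using C by (simp add: t_def m_assoc)
    then have "?c g = ?c t \<otimes>\<^bsub>BijGroup P\<^esub> ?c g'" using conj_compose[OF P tN g(2)] by simp
    then have "Inn S P #>\<^bsub>BijGroup P\<^esub> ?c g = (Inn S P #>\<^bsub>BijGroup P\<^esub> ?c t) #>\<^bsub>BijGroup P\<^esub> ?c g'"
      using B.coset_mult_assoc[OF subgroup.subset[OF I] cB[OF tN] cB[OF g(2)]] by simp
    then show ?thesis using B.coset_join2[OF cB[OF tN] I ct] by simp
  qed
  define q where "q d = Inn S P #>\<^bsub>BijGroup P\<^esub> ?c (SOME g. g \<in> ?N \<and> idc ?N #> g = d)" for d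
  have "Inn S P #>\<^bsub>BijGroup P\<^esub> ?c g = q (idc ?N #> g)" if g: "g \<in> ?N" for g
  proof -
    let ?s = "SOME g'. g' \<in> ?N \<and> idc ?N #> g' = idc ?N #> g"
    have "?s \<in> ?N \<and> idc ?N #> ?s = idc ?N #> g" by (rule someI[of _ g]) (use g in simp)
    then show ?thesis using eq[of g ?s] g unfolding q_def by simp
  qed
  then have "(\<lambda>g. Inn S P #>\<^bsub>BijGroup P\<^esub> g) ` Aut_S S P \<subseteq> q ` ((\<lambda>g. idc ?N #> g) ` ?N)"
    unfolding Aut_S_image[OF P] by auto
  then show ?thesis using idc_finite_index[OF N] finite_surj by blast
qed

text \<open>Out_F(P) is finite because Out_S(P) is and Aut_S(P) has finite index. The order of
  Out_S(P) is a power of p, and its index, passed to the quotient by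
  \<open>coprime_index_hom\<close>, is prime to p, so this order is the exact power of p.\<close>

lemma fully_automized_sylow:
  assumes P: "subgroup P S" and fa: "fully_automized p S F P"
  shows "finite (carrier (Out_F S F P))" "sylow_subgroup p (Out_F S F P) (carrier (Out_S S P))"
proof -
  interpret B: group "BijGroup P" by (rule group_BijGroup)
  interpret I: normal "Inn S P" "Aut_F_group F P" by (rule Inn_normal[OF P])
  let ?O = "Out_F S F P" and ?q = "\<lambda>g. Inn S P #>\<^bsub>BijGroup P\<^esub> g"
  note A = Aut_F_subgroup[OF P] and AS = Aut_S_subgroup[OF P] and II = Inn_subgroup_Bij[OF P]
  have ci: "B.coprime_index p (Aut_S S P) (Aut_F F P)" using fa by (simp add: fully_automized_iff)
  have gO: "group ?O" unfolding Out_F_def by (rule I.factorgroup_is_group)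
  have cO: "carrier ?O = ?q ` Aut_F F P" by (simp add: Out_F_def carrier_FactGroup)
  have cS: "carrier (Out_S S P) = ?q ` Aut_S S P"
    by (simp add: Out_S_def carrier_FactGroup Aut_S_group_def r_coset_def)
  show fin: "finite (carrier ?O)" unfolding cO
    using B.finite_cosets_trans[OF AS II subgroup.subset[OF A] finite_Out_S[OF P]] ci by (simp add: B.coprime_index_def)
  have q: "?q \<in> hom ((BijGroup P)\<lparr>carrier := Aut_F F P\<rparr>) ?O"
    using I.r_coset_hom_Mod by (simp add: Out_F_def Aut_F_group_def r_coset_def)
  then have qh: "group_hom ((BijGroup P)\<lparr>carrier := Aut_F F P\<rparr>) ?O ?q"
    using B.subgroup_imp_group[OF A] gO by (simp add: group_hom_def group_hom_axioms_def)
  have "subgroup (Aut_S S P) ((BijGroup P)\<lparr>carrier := Aut_F F P\<rparr>)"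
    using B.subgroup_incl[OF AS A Aut_S_subset[OF P]] .
  then have sO: "subgroup (carrier (Out_S S P)) ?O" unfolding cS
    using group_hom.subgroup_img_is_subgroup[OF qh] by blast
  have "Aut_S S P \<inter> Aut_F F P = Aut_S S P" using Aut_S_subset[OF P] by blast
  then have "group.coprime_index ?O p (carrier (Out_S S P)) (?q ` Aut_F F P)"
    using coprime_index_hom[OF group_BijGroup gO AS sO A q _ ci] cS by simp
  then have cop: "coprime p (card (rcosets\<^bsub>?O\<^esub> (carrier (Out_S S P))))"
  proof -
    have "rcosets\<^bsub>?O\<^esub> (carrier (Out_S S P)) = (\<lambda>g. carrier (Out_S S P) #>\<^bsub>?O\<^esub> g) ` carrier ?O"
      by (auto simp: RCOSETS_def)
    moreover assume "group.coprime_index ?O p (carrier (Out_S S P)) (?q ` Aut_F F P)"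
    ultimately show ?thesis unfolding group.coprime_index_def[OF gO] cO by simp
  qed
  have lag: "card (carrier (Out_S S P)) * card (rcosets\<^bsub>?O\<^esub> (carrier (Out_S S P))) = order ?O"
    using group.lagrange[OF gO sO] by (simp add: mult.commute)
  have gS: "group (?O\<lparr>carrier := carrier (Out_S S P)\<rparr>)" using group.subgroup_imp_group[OF gO sO] .
  obtain k where k: "card (carrier (Out_S S P)) = p ^ k"
  proof -
    have "\<exists>k. order (?O\<lparr>carrier := carrier (Out_S S P)\<rparr>) = p ^ k"
    proof (rule finite_p_group_order[OF gS _ prime_p])
      show "finite (carrier (?O\<lparr>carrier := carrier (Out_S S P)\<rparr>))"
        using fin subgroup.subset[OF sO] finite_subset by auto
      fix x assume "x \<in> carrier (?O\<lparr>carrier := carrier (Out_S S P)\<rparr>)"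
      then obtain f where f: "f \<in> Aut_S S P" "x = ?q f" using cS by auto
      obtain n where n: "f [^]\<^bsub>BijGroup P\<^esub> (p ^ n :: nat) = \<one>\<^bsub>BijGroup P\<^esub>" using Aut_S_torsion[OF P f(1)] by blast
      have "x [^]\<^bsub>?O\<^esub> (p ^ n) = \<one>\<^bsub>?O\<^esub>"
        using group_hom.hom_nat_pow[OF qh, of f "p ^ n"] group_hom.hom_one[OF qh] n f Aut_S_subset[OF P]
        by (auto simp: B.nat_pow_consistent[symmetric])
      then show "\<exists>n::nat. x [^]\<^bsub>?O\<lparr>carrier := carrier (Out_S S P)\<rparr>\<^esub> (p ^ n) = \<one>\<^bsub>?O\<lparr>carrier := carrier (Out_S S P)\<rparr>\<^esub>"
        by (auto simp: monoid.nat_pow_consistent[OF group.is_monoid[OF gO], symmetric])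
    qed
    then show ?thesis using that by (auto simp: order_def)
  qed
  have p1: "p \<noteq> 0" "\<not> is_unit p" using prime_p by auto
  let ?m = "card (rcosets\<^bsub>?O\<^esub> (carrier (Out_S S P)))"
  have "order ?O > 0" using fin monoid.order_gt_0_iff_finite[OF group.is_monoid[OF gO]] by simp
  then have m0: "?m \<noteq> 0" using lag by (metis mult_0_right less_numeral_extra(3))
  have "\<not> p dvd ?m" using cop p1 by (metis coprime_absorb_left)
  then have "multiplicity p (p ^ k * ?m) = k"
    using prime_p m0 p1 by (simp add: prime_elem_multiplicity_mult_distrib not_dvd_imp_multiplicity_0 multiplicity_same_power)
  then have "multiplicity p (order ?O) = k" using lag k by simp
  then show "sylow_subgroup p ?O (carrier (Out_S S P))" using sO k by (simp add: sylow_subgroup_def)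
qed

lemma niceE:
  assumes "nice P" obtains \<psi> where "mor (normalizer S P) \<psi>" "good (\<psi> ` P)" "subgroup P S"
proof -
  obtain f where f: "mor P f" "good (f ` P)" using assms by (auto simp: nice_def)
  then show ?thesis using good_normalizer_map[OF f(2) f(1) refl] that mor_subgroup[OF f(1)] by metis
qed

text \<open>P is compared with a good conjugate Q through a map defined on N_S(P). If P is fully
  normalized, this map is onto N_S(Q) by comparison of orders, and its inverse brings the properties
  of Q back to P. In axiom (II) only the centralizers are known to correspond, which is just enough
  to pull an extension back.\<close>

theorem saturatedI:
  assumes all: "\<And>P. subgroup P S \<Longrightarrow> nice P"
    and cont: "\<And>P \<phi>. (\<And>n::nat. subgroup (P n) S \<and> P n \<subseteq> P (Suc n)) \<Longrightarrow>
      \<phi> \<in> Hom_grp S (\<Union>n. P n) (carrier S) \<Longrightarrow> (\<And>n. restrict \<phi> (P n) \<in> F (P n) (carrier S)) \<Longrightarrow>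
      \<phi> \<in> F (\<Union>n. P n) (carrier S)"
  shows "saturated p S F"
proof -
  have I: "fully_centralized p S F P \<and> finite (carrier (Out_F S F P)) \<and> sylow_subgroup p (Out_F S F P) (carrier (Out_S S P))"
    if P: "subgroup P S" and fn: "fully_normalized p S F P" for P
  proof -
    obtain \<psi> where ps: "mor (normalizer S P) \<psi>" "good (\<psi> ` P)" using niceE[OF all[OF P]] by blast
    let ?N = "normalizer S P" and ?Q = "\<psi> ` P"
    have PN: "P \<subseteq> ?N" and N: "subgroup ?N S" using normalizer_contains[OF P] normalizer_subgroup[OF P] by auto
    have mP: "mor P \<psi>" by (rule mor_subset[OF ps(1) P PN])
    have Q: "subgroup ?Q S" by (rule mor_image_subgroup[OF mP])
    have NQ: "subgroup (normalizer S ?Q) S" by (rule normalizer_subgroup[OF Q])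
    have "?Q \<in> conj_class S F P" using conj_class_iff[OF P] mP by blast
    then have "lex_le (tord (normalizer S ?Q)) (tord ?N)" using fn by (simp add: fully_normalized_def)
    then have im: "\<psi> ` ?N = normalizer S ?Q"
      by (rule tord_surj[OF N NQ mor_hom_on[OF ps(1)] mor_inj[OF ps(1)] mor_normalizer_image[OF ps(1) PN order_refl P]])
    let ?i = "inv_into ?N \<psi>"
    have mi: "mor (normalizer S ?Q) ?i" using mor_inv_into[OF ps(1)] im by simp
    have ii: "?i (\<psi> x) = x" if "x \<in> ?N" for x using mor_inj[OF ps(1)] that by simp
    have iQ: "?i ` ?Q = P"
    proof -
      have "?i ` ?Q = (\<lambda>x. x) ` P" unfolding image_image by (rule image_cong) (use ii PN in auto)
      then show ?thesis by simp
    qed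
    have QN: "?Q \<subseteq> normalizer S ?Q" by (rule normalizer_contains[OF Q])
    have "fully_automized p S F (?i ` ?Q)"
      using fully_automized_transport[OF _ mi Q] ps(2) by (simp add: good_def)
    then have fa: "fully_automized p S F P" using iQ by simp
    have CP: "subgroup (centralizer S P) S" by (rule centralizer_subgroup[OF subgroup.subset[OF P]])
    have "fully_centralized p S F P"
      unfolding fully_centralized_def
    proof
      fix Q' assume "Q' \<in> conj_class S F P"
      then obtain f where f: "mor P f" "f ` P = Q'" using conj_class_iff[OF P] by blast
      have Q': "subgroup Q' S" using mor_image_subgroup[OF f(1)] f(2) by simp
      have m1: "mor Q' (inv_into P f)" using mor_inv_into[OF f(1)] f(2) by simp
      have im1: "inv_into P f ` Q' = P" using inv_into_image_cancel[OF mor_inj[OF f(1)] order_refl] f(2) by simp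
      have m2: "mor Q' (\<lambda>x. \<psi> (inv_into P f x))" using mor_comp[OF m1 mP] im1 by simp
      have im2: "(\<lambda>x. \<psi> (inv_into P f x)) ` Q' = ?Q" using im1 by (metis image_image)
      \<comment> \<open>The centralizer of another conjugate Q' is compared with that of P by way of
        Q: C_S(Q') injects into C_S(Q), and the inverse of \<psi> carries C_S(Q) into
        C_S(P).\<close>
      obtain \<xi> where xi: "mor (normalizer S Q') \<xi>" "\<xi> ` Q' = ?Q" using good_normalizer_map[OF ps(2) m2 im2] by blast
      let ?C = "centralizer S Q'"
      have C: "subgroup ?C S" by (rule centralizer_subgroup[OF subgroup.subset[OF Q']])
      have CN: "?C \<subseteq> normalizer S Q'" by (rule centralizer_normalizer[OF Q'])
      have im3: "\<xi> ` ?C \<subseteq> centralizer S ?Q"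
        using mor_centralizer_image[OF xi(1) normalizer_contains[OF Q'] CN order_refl Q'] xi(2) by simp
      have mc: "mor ?C \<xi>" by (rule mor_subset[OF xi(1) C CN])
      have im4: "?i ` \<xi> ` ?C \<subseteq> centralizer S P"
        using mor_centralizer_image[OF mi QN _ im3 Q] iQ im3 centralizer_normalizer[OF Q] by fastforce
      have m4: "mor ?C (\<lambda>x. ?i (\<xi> x))" using mor_comp[OF mc mi] im3 centralizer_normalizer[OF Q] by blast
      show "lex_le (tord ?C) (tord (centralizer S P))"
        using tord_mono[OF C CP mor_hom_on[OF m4] mor_inj[OF m4]] im4 by (simp add: image_image)
    qed
    then show ?thesis using fully_automized_sylow[OF P fa] by blast
  qed
  have II: "\<exists>\<psi>\<in>F (N_ext S P \<phi>) (carrier S). restrict \<psi> P = \<phi>"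
    if P: "subgroup P S" and f: "\<phi> \<in> F P (carrier S)" and fc: "fully_centralized p S F (\<phi> ` P)" for P \<phi>
  proof -
    have ext: "\<phi> \<in> extensional P" and mf: "mor P \<phi>" using f F_mor_iff[OF P subgroup_carrier] by auto
    let ?R = "\<phi> ` P" and ?M = "N_ext S P \<phi>"
    have R: "subgroup ?R S" by (rule mor_image_subgroup[OF mf])
    obtain \<psi> where ps: "mor (normalizer S ?R) \<psi>" "good (\<psi> ` ?R)" using niceE[OF all[OF R]] by blast
    let ?N = "normalizer S ?R" and ?Q = "\<psi> ` ?R"
    have RN: "?R \<subseteq> ?N" and N: "subgroup ?N S" using normalizer_contains[OF R] normalizer_subgroup[OF R] by auto
    have mR: "mor ?R \<psi>" by (rule mor_subset[OF ps(1) R RN])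
    have Q: "subgroup ?Q S" and rec: "receptive S F ?Q" using ps(2) by (auto simp: good_def)
    have CR: "subgroup (centralizer S ?R) S" and CQ: "subgroup (centralizer S ?Q) S"
      using centralizer_subgroup subgroup.subset R Q by blast+
    have CN: "centralizer S ?R \<subseteq> ?N" by (rule centralizer_normalizer[OF R])
    have mC: "mor (centralizer S ?R) \<psi>" by (rule mor_subset[OF ps(1) CR CN])
    have "?Q \<in> conj_class S F ?R" using conj_class_iff[OF R] mR by blast
    then have "lex_le (tord (centralizer S ?Q)) (tord (centralizer S ?R))" using fc by (simp add: fully_centralized_def)
    then have imC: "\<psi> ` centralizer S ?R = centralizer S ?Q"
      by (rule tord_surj[OF CR CQ mor_hom_on[OF mC] mor_inj[OF mC] mor_centralizer_image[OF ps(1) RN CN order_refl R]])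
    have mc: "mor P (\<lambda>x. \<psi> (\<phi> x))" using mor_comp[OF mf mR] by blast
    have imc: "(\<lambda>x. \<psi> (\<phi> x)) ` P = ?Q" by (simp add: image_image)
    have M: "subgroup ?M S" by (rule N_ext_subgroup[OF mf])
    have PM: "P \<subseteq> ?M" and MN: "?M \<subseteq> normalizer S P"
      using mem_N_ext_iff[OF mf] normalizer_contains[OF P] mor_conj_elem[OF mf] mor_closed[OF mf] by blast+
    have hex: "\<exists>h\<in>?N. \<forall>x\<in>P. \<phi> (g \<rhd> x) = h \<rhd> \<phi> x" if g: "g \<in> ?M" for g
    proof -
      have gN: "g \<in> normalizer S P" using g MN by blast
      obtain h where h: "h \<in> carrier S" "\<forall>x\<in>P. \<phi> (g \<rhd> x) = h \<rhd> \<phi> x" using mem_N_ext_iff[OF mf] g by blast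
      have "h \<in> ?N"
      proof (rule normalizerI[OF R h(1)])
        fix y assume "y \<in> ?R"
        then obtain x where x: "x \<in> P" "y = \<phi> x" by blast
        have "h \<rhd> y = \<phi> (g \<rhd> x)" using h(2) x by simp
        then show "h \<rhd> y \<in> ?R" using normalizerD(2)[OF P gN x(1)] by simp
      qed
      then show ?thesis using h(2) by blast
    qed
    have hex2: "\<psi> (\<phi> (g \<rhd> x)) = \<psi> h \<rhd> \<psi> (\<phi> x)"
      if "h \<in> ?N" "\<forall>x\<in>P. \<phi> (g \<rhd> x) = h \<rhd> \<phi> x" "x \<in> P" for g h x
      using that mor_conj_elem[OF ps(1) that(1), of "\<phi> x"] RN by auto
    obtain \<rho> where rho: "mor ?M \<rho>" "\<And>x. x \<in> P \<Longrightarrow> \<rho> x = \<psi> (\<phi> x)"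
    proof (rule receptive_extension[OF rec Q mc imc M MN PM])
      fix g assume "g \<in> ?M"
      then obtain h where h: "h \<in> ?N" "\<forall>x\<in>P. \<phi> (g \<rhd> x) = h \<rhd> \<phi> x" using hex by blast
      then show "\<exists>h\<in>carrier S. \<forall>v\<in>P. \<psi> (\<phi> (g \<rhd> v)) = h \<rhd> \<psi> (\<phi> v)"
        using hex2[OF h] mor_closed[OF ps(1) h(1)] by blast
    qed (blast intro: that)
    \<comment> \<open>The extension \<rho> of \<psi> \<phi> has to be followed by the inverse of
      \<psi>. For g in N_\<phi> the elements \<rho> g and \<psi> h induce the same conjugation on Q,
      so they differ by an element of C_S(Q), which is the image of C_S(R) under \<psi> because R is
      fully centralized.\<close>
    have rim: "\<rho> ` ?M \<subseteq> \<psi> ` ?N"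
    proof clarify
      fix g assume g: "g \<in> ?M"
      then obtain h where h: "h \<in> ?N" "\<forall>x\<in>P. \<phi> (g \<rhd> x) = h \<rhd> \<phi> x" using hex by blast
      have C: "\<psi> h \<in> carrier S" "\<rho> g \<in> carrier S" using mor_closed ps(1) h(1) rho(1) g by blast+
      define z where "z = inv (\<psi> h) \<otimes> \<rho> g"
      have zC: "z \<in> carrier S" using C by (simp add: z_def)
      have "z \<rhd> y = y" if y: "y \<in> ?Q" for y
      proof -
        obtain x where x: "x \<in> P" "y = \<psi> (\<phi> x)" using y by blast
        have yC: "y \<in> carrier S" using y subgroup.mem_carrier[OF Q] by blast
        have gx: "g \<rhd> x \<in> P" using normalizerD(2)[OF P] MN g x by blast
        have "\<rho> g \<rhd> y = \<rho> (g \<rhd> x)"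
          using mor_conj_elem[OF rho(1) g, of x] x PM rho(2) by auto
        also have "\<dots> = \<psi> h \<rhd> y" using rho(2)[OF gx] hex2[OF h x(1)] x by simp
        finally have "inv (\<psi> h) \<otimes> (\<rho> g \<rhd> y) \<otimes> \<psi> h = y" using C yC by (simp add: m_assoc)
        then show ?thesis using C yC by (simp add: z_def m_assoc inv_mult_group)
      qed
      then have "z \<in> centralizer S ?Q" using mem_centralizer_iff[OF subgroup.subset[OF Q]] zC by blast
      then obtain c where c: "c \<in> centralizer S ?R" "z = \<psi> c" using imC by blast
      have cN: "c \<in> ?N" using c CN by blast
      have "\<rho> g = \<psi> h \<otimes> z" using C by (simp add: z_def)
      then have "\<rho> g = \<psi> (h \<otimes> c)" using mor_mult[OF ps(1) h(1) cN] c by simp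
      then show "\<rho> g \<in> \<psi> ` ?N" using subgroup.m_closed[OF N h(1) cN] by blast
    qed
    let ?i = "inv_into ?N \<psi>"
    have mt: "mor ?M (\<lambda>g. ?i (\<rho> g))" using mor_comp[OF rho(1) mor_inv_into[OF ps(1)] rim] .
    have "restrict (\<lambda>g. ?i (\<rho> g)) ?M \<in> F ?M (carrier S)" using mt by (simp add: mor_def)
    moreover have "restrict (restrict (\<lambda>g. ?i (\<rho> g)) ?M) P = \<phi>"
    proof
      fix x show "restrict (restrict (\<lambda>g. ?i (\<rho> g)) ?M) P x = \<phi> x"
      proof (cases "x \<in> P")
        case True
        then have "\<phi> x \<in> ?N" using RN by blast
        then show ?thesis using True PM rho(2)[OF True] mor_inj[OF ps(1)] by auto
      qed (use ext in \<open>auto simp: extensional_def\<close>)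
    qed
    ultimately show ?thesis by blast
  qed
  show ?thesis unfolding saturated_def
    by (intro conjI allI impI ballI) (use I II cont in blast)+
qed

end

section \<open>The bullet construction\<close>

context group begin

lemma set_mult_subgroup:
  assumes P: "subgroup P G" and D: "subgroup D G" and n: "\<And>x d. x \<in> P \<Longrightarrow> d \<in> D \<Longrightarrow> x \<otimes> d \<otimes> inv x \<in> D"
  shows "subgroup (P <#> D) G" "P \<subseteq> P <#> D" "D \<subseteq> P <#> D"
proof -
  have PC: "\<And>x. x \<in> P \<Longrightarrow> x \<in> carrier G" and DC: "\<And>x. x \<in> D \<Longrightarrow> x \<in> carrier G"
    using subgroup.mem_carrier P D by metis+
  have n': "inv x \<otimes> d \<otimes> x \<in> D" if "x \<in> P" "d \<in> D" for x d
    using n[of "inv x" d] subgroup.m_inv_closed[OF P] that PC by simp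
  have mem: "x \<otimes> d \<in> P <#> D" if "x \<in> P" "d \<in> D" for x d using that by (auto simp: set_mult_def)
  have ex: "\<exists>x\<in>P. \<exists>d\<in>D. z = x \<otimes> d" if "z \<in> P <#> D" for z using that by (auto simp: set_mult_def)
  show "P \<subseteq> P <#> D" using mem[OF _ subgroup.one_closed[OF D]] PC by force
  show "D \<subseteq> P <#> D" using mem[OF subgroup.one_closed[OF P]] DC by force
  show "subgroup (P <#> D) G"
  proof
    show "P <#> D \<subseteq> carrier G" using ex PC DC by blast
    show "\<one> \<in> P <#> D" using mem[OF subgroup.one_closed[OF P] subgroup.one_closed[OF D]] by simp
    fix z assume "z \<in> P <#> D"
    then obtain x d where x: "x \<in> P" "d \<in> D" "z = x \<otimes> d" using ex by blast
    have c: "x \<in> carrier G" "d \<in> carrier G" using x PC DC by auto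
    have "inv z = inv x \<otimes> (x \<otimes> inv d \<otimes> inv x)" using x c by (simp add: inv_mult_group m_assoc)
    then show "inv z \<in> P <#> D"
      using mem subgroup.m_inv_closed[OF P x(1)] n[OF x(1) subgroup.m_inv_closed[OF D x(2)]] by simp
    fix w assume "w \<in> P <#> D"
    then obtain y e where y: "y \<in> P" "e \<in> D" "w = y \<otimes> e" using ex by blast
    have c': "y \<in> carrier G" "e \<in> carrier G" using y PC DC by auto
    have "z \<otimes> w = (x \<otimes> y) \<otimes> ((inv y \<otimes> d \<otimes> y) \<otimes> e)" using x y c c' by (simp add: m_assoc)
    then show "z \<otimes> w \<in> P <#> D"
      using mem subgroup.m_closed[OF P x(1) y(1)] subgroup.m_closed[OF D n'[OF y(1) x(2)] y(2)] by simp
  qed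
qed

lemma mem_set_multE:
  assumes "z \<in> P <#> D" obtains x d where "x \<in> P" "d \<in> D" "z = x \<otimes> d"
  using assms by (auto simp: set_mult_def)

end

context fusion begin

lemma nice_image: assumes "nice P" "mor P f" shows "nice (f ` P)"
proof -
  obtain k where k: "mor P k" "good (k ` P)" using assms(1) by (auto simp: nice_def)
  have i: "mor (f ` P) (inv_into P f)" "inv_into P f ` f ` P = P"
    using mor_inv_into[OF assms(2)] inv_into_image_cancel[OF mor_inj[OF assms(2)] order_refl] by auto
  have "mor (f ` P) (\<lambda>x. k (inv_into P f x))" using mor_comp[OF i(1) k(1)] i(2) by simp
  moreover have "(\<lambda>x. k (inv_into P f x)) ` f ` P = k ` P" using i(2) by (metis image_image)
  ultimately show ?thesis unfolding nice_def using k(2) by metis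
qed

abbreviation (input) ex :: nat where "ex \<equiv> group_exponent (S Mod identity_component p S)"
abbreviation pw :: "'a set \<Rightarrow> 'a set" where "pw \<equiv> power_subgroup p S"
abbreviation fixT :: "'a set \<Rightarrow> 'a set" where "fixT \<equiv> I_T p S F"
abbreviation bul :: "'a set \<Rightarrow> 'a set" where "bul \<equiv> bullet p S F"

text \<open>The factor I(P^[m])_0 of the bullet subgroup; it has a name of its own because morphisms
  are analysed on P and on this factor separately.\<close>

definition torus :: "'a set \<Rightarrow> 'a set" where "torus P = idc (fixT (pw P))"

text \<open>The elements of Aut_F(T), as functions whose values outside T are disregarded.\<close>

definition W :: "('a \<Rightarrow> 'a) \<Rightarrow> bool" where "W w \<longleftrightarrow> mor T w \<and> w ` T = T"

lemma bul_eq: "bul P = P <#> torus P"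
  by (simp add: bullet_def torus_def)

lemma WI: "mor T w \<Longrightarrow> w ` T \<subseteq> T \<Longrightarrow> W w"
  using injective_endo_onto[OF T_subgroup mor_hom_on mor_inj] by (simp add: W_def)

lemma W_comp: "W v \<Longrightarrow> W w \<Longrightarrow> W (\<lambda>x. v (w x))"
  using mor_comp[of T w T v] by (intro WI) (auto simp: W_def)

lemma W_id: "W (\<lambda>x. x)" using mor_id[OF T_subgroup] by (simp add: W_def)

lemma W_inv: "W w \<Longrightarrow> W (inv_into T w)"
  using mor_inv_into[of T w] inv_into_image_cancel[OF mor_inj, of T w T] by (auto simp: W_def)

lemma W_inv_app: "W w \<Longrightarrow> x \<in> T \<Longrightarrow> inv_into T w (w x) = x" "W w \<Longrightarrow> x \<in> T \<Longrightarrow> w (inv_into T w x) = x"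
  using mor_inj[of T w] f_inv_into_f[of x w T] by (auto simp: W_def)

lemma W_T: "W w \<Longrightarrow> x \<in> T \<Longrightarrow> w x \<in> T" by (auto simp: W_def)

lemma W_mult: "W w \<Longrightarrow> x \<in> T \<Longrightarrow> y \<in> T \<Longrightarrow> w (x \<otimes> y) = w x \<otimes> w y"
  using mor_mult by (auto simp: W_def)

lemma W_conj: "g \<in> carrier S \<Longrightarrow> W (\<lambda>x. g \<rhd> x)"
  using mor_conj[OF T_subgroup] T_conj by (intro WI) auto

lemma W_Aut: "W w \<Longrightarrow> restrict w T \<in> Aut_F F T" "w \<in> Aut_F F T \<Longrightarrow> W w"
  using restrict_Aut_F Aut_F_iff[OF T_subgroup] by (auto simp: W_def)

lemma fixT_iff: "A \<subseteq> T \<Longrightarrow> t \<in> fixT A \<longleftrightarrow> t \<in> T \<and> (\<forall>w. W w \<longrightarrow> (\<forall>a\<in>A. w a = a) \<longrightarrow> w t = t)"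
proof
  assume A: "A \<subseteq> T" and t: "t \<in> fixT A"
  show "t \<in> T \<and> (\<forall>w. W w \<longrightarrow> (\<forall>a\<in>A. w a = a) \<longrightarrow> w t = t)"
  proof (intro conjI allI impI)
    show tT: "t \<in> T" using t by (simp add: I_T_def T_def)
    fix w assume w: "W w" "\<forall>a\<in>A. w a = a"
    have "restrict w T \<in> C_W p S F A" using W_Aut(1)[OF w(1)] w(2) A by (auto simp: C_W_def T_def)
    moreover have "\<forall>v\<in>C_W p S F A. v t = t" using t by (simp add: I_T_def)
    ultimately have "restrict w T t = t" by blast
    then show "w t = t" using tT by simp
  qed
next
  assume "t \<in> T \<and> (\<forall>w. W w \<longrightarrow> (\<forall>a\<in>A. w a = a) \<longrightarrow> w t = t)"
  then show "t \<in> fixT A" using W_Aut(2) by (auto simp: I_T_def C_W_def T_def)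
qed

lemma fixT_T: "fixT A \<subseteq> T" by (auto simp: I_T_def T_def)
lemma fixT_self: "A \<subseteq> T \<Longrightarrow> A \<subseteq> fixT A" using fixT_iff by auto
lemma fixT_mono:
  assumes AB: "A \<subseteq> B" and B: "B \<subseteq> T" shows "fixT A \<subseteq> fixT B"
proof
  fix t assume "t \<in> fixT A"
  then have "t \<in> T" "\<And>w. W w \<Longrightarrow> \<forall>a\<in>A. w a = a \<Longrightarrow> w t = t" using fixT_iff[of A t] AB B by auto
  then show "t \<in> fixT B" using fixT_iff[OF B] AB by blast
qed

lemma fixT_subgroup:
  assumes "A \<subseteq> T" shows "subgroup (fixT A) S"
proof
  show "fixT A \<subseteq> carrier S" using fixT_T T_subset by blast
  show "\<one> \<in> fixT A" unfolding fixT_iff[OF assms] using subgroup.one_closed[OF T_subgroup] mor_one by (auto simp: W_def)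
  fix x assume x: "x \<in> fixT A"
  then have x': "x \<in> T" "\<And>w. W w \<Longrightarrow> \<forall>a\<in>A. w a = a \<Longrightarrow> w x = x" unfolding fixT_iff[OF assms] by auto
  have "w (inv x) = inv x" if "W w" "\<forall>a\<in>A. w a = a" for w
    using mor_inv_elem[of T w x] that(1) x'(1) x'(2)[OF that] by (simp add: W_def)
  then show "inv x \<in> fixT A" unfolding fixT_iff[OF assms]
    using subgroup.m_inv_closed[OF T_subgroup x'(1)] by blast
  fix y assume "y \<in> fixT A"
  then have y': "y \<in> T" "\<And>w. W w \<Longrightarrow> \<forall>a\<in>A. w a = a \<Longrightarrow> w y = y" unfolding fixT_iff[OF assms] by auto
  have "w (x \<otimes> y) = x \<otimes> y" if "W w" "\<forall>a\<in>A. w a = a" for w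
    using W_mult[OF that(1) x'(1) y'(1)] x'(2)[OF that] y'(2)[OF that] by simp
  then show "x \<otimes> y \<in> fixT A" unfolding fixT_iff[OF assms]
    using subgroup.m_closed[OF T_subgroup x'(1) y'(1)] by blast
qed

text \<open>v^-1 w fixes A pointwise, and I(A) consists of what all such elements fix. Every
  uniqueness statement about bullet subgroups goes back to this.\<close>

lemma W_agree:
  assumes A: "A \<subseteq> T" and v: "W v" and w: "W w" and eq: "\<And>a. a \<in> A \<Longrightarrow> v a = w a" and t: "t \<in> fixT A"
  shows "v t = w t"
proof -
  let ?u = "\<lambda>x. inv_into T v (w x)"
  have "W ?u" by (rule W_comp[OF W_inv[OF v] w])
  moreover have "\<forall>a\<in>A. ?u a = a" using eq W_inv_app(1)[OF v] A by (metis subsetD)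
  ultimately have "?u t = t" using t fixT_iff[OF A] by blast
  moreover have "w t \<in> T" using t fixT_T W_T[OF w] by blast
  ultimately show ?thesis using W_inv_app(2)[OF v] by metis
qed

lemma fixT_image:
  assumes A: "A \<subseteq> T" and w: "W w" shows "w ` fixT A = fixT (w ` A)"
proof -
  have sub: "v ` fixT B \<subseteq> fixT (v ` B)" if B: "B \<subseteq> T" and v: "W v" for v B
  proof clarify
    have vB: "v ` B \<subseteq> T" using B W_T[OF v] by blast
    fix t assume t: "t \<in> fixT B"
    have tT: "t \<in> T" using t fixT_T by blast
    have "u (v t) = v t" if u: "W u" "\<forall>a\<in>v ` B. u a = a" for u
      using W_agree[OF B W_comp[OF u(1) v] v _ t] u(2) by simp
    then show "v t \<in> fixT (v ` B)" unfolding fixT_iff[OF vB] using W_T[OF v tT] by blast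
  qed
  have wA: "w ` A \<subseteq> T" using A W_T[OF w] by blast
  have iw: "inv_into T w ` w ` A = A"
    by (rule inv_into_image_cancel[OF _ A]) (use w mor_inj in \<open>auto simp: W_def\<close>)
  have "fixT (w ` A) \<subseteq> w ` fixT A"
  proof
    fix t assume t: "t \<in> fixT (w ` A)"
    then have "inv_into T w t \<in> fixT A" using sub[OF wA W_inv[OF w]] iw by auto
    moreover have "w (inv_into T w t) = t" using W_inv_app(2)[OF w] t fixT_T by blast
    ultimately show "t \<in> w ` fixT A" by (metis image_eqI)
  qed
  then show ?thesis using sub[OF A w] by blast
qed

subsection \<open>Power subgroups\<close>

lemma exponent_facts:
  shows exponent_T: "g \<in> carrier S \<Longrightarrow> g [^] ex \<in> T" and exponent_p_power: "\<exists>k. ex dvd p ^ k"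
proof -
  obtain s where s: "is_identity_component p (S\<lparr>carrier := carrier S\<rparr>) (idc (carrier S)) s"
    using idc_is_identity_component[OF subgroup_carrier] by blast
  have nT: "T \<lhd> S" using s is_identity_component_iff[OF is_group prime_p] by (simp add: T_def)
  interpret N: normal T S by (rule nT)
  interpret Q: group "S Mod T" by (rule N.factorgroup_is_group)
  obtain k where k: "\<forall>x\<in>carrier S. x [^] (p ^ k) \<in> T" using uniform_power by blast
  have car: "carrier (S Mod T) = (\<lambda>x. T #> x) ` carrier S" by (rule carrier_FactGroup)
  have iff: "(T #> g) [^]\<^bsub>S Mod T\<^esub> n = \<one>\<^bsub>S Mod T\<^esub> \<longleftrightarrow> g [^] n \<in> T" if g: "g \<in> carrier S" for g and n :: nat
  proof -
    have gn: "g [^] n \<in> carrier S" using g by simp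
    have "(T #> g) [^]\<^bsub>S Mod T\<^esub> n = T #> (g [^] n)" by (rule N.FactGroup_pow[OF g])
    moreover have "T #> (g [^] n) = T \<longleftrightarrow> g [^] n \<in> T"
      using coset_join1[OF _ gn T_subgroup] coset_join2[OF gn T_subgroup] by blast
    ultimately show ?thesis by simp
  qed
  have pk: "0 < p ^ k \<and> (\<forall>x\<in>carrier (S Mod T). x [^]\<^bsub>S Mod T\<^esub> (p ^ k) = \<one>\<^bsub>S Mod T\<^esub>)"
    using prime_gt_0_nat[OF prime_p] k iff car by auto
  have e: "0 < ex \<and> (\<forall>x\<in>carrier (S Mod T). x [^]\<^bsub>S Mod T\<^esub> ex = \<one>\<^bsub>S Mod T\<^esub>)"
    unfolding group_exponent_def T_def[symmetric] by (rule LeastI[of _ "p ^ k"]) (rule pk)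
  show "g \<in> carrier S \<Longrightarrow> g [^] ex \<in> T" using e iff car by auto
  \<comment> \<open>The gcd of two exponents of S/T is again one, so the least exponent equals its
    gcd with p^k and divides p^k.\<close>
  let ?d = "gcd ex (p ^ k)"
  have "x [^]\<^bsub>S Mod T\<^esub> ?d = \<one>\<^bsub>S Mod T\<^esub>" if "x \<in> carrier (S Mod T)" for x
    using e pk that Q.pow_eq_id by (metis gcd_greatest)
  then have "ex \<le> ?d" unfolding group_exponent_def T_def[symmetric]
    by (intro Least_le) (use pk in \<open>auto simp: gcd_pos_nat\<close>)
  moreover have "?d dvd ex" by simp
  ultimately have "?d = ex" using e by (metis dvd_imp_le le_antisym)
  then show "\<exists>k. ex dvd p ^ k" by (metis gcd_dvd2)
qed

lemma pw_generate: "pw P = generate S {g [^] ex | g. g \<in> P}"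
  by (simp add: power_subgroup_def)

lemma pw_facts:
  assumes P: "subgroup P S"
  shows pw_subgroup: "subgroup (pw P) S" and pw_T: "pw P \<subseteq> T" and pw_subset: "pw P \<subseteq> P"
    and pw_mem: "g \<in> P \<Longrightarrow> g [^] ex \<in> pw P"
proof -
  have PC: "\<And>x. x \<in> P \<Longrightarrow> x \<in> carrier S" using subgroup.mem_carrier[OF P] .
  have gC: "{g [^] ex | g. g \<in> P} \<subseteq> carrier S" using PC by auto
  show "subgroup (pw P) S" unfolding pw_generate by (rule generate_is_subgroup[OF gC])
  show "pw P \<subseteq> T" unfolding pw_generate
    by (rule generate_subgroup_incl[OF _ T_subgroup]) (use PC exponent_T in auto)
  show "pw P \<subseteq> P" unfolding pw_generate
    by (rule generate_subgroup_incl[OF _ P]) (use subgroup_nat_pow_closed[OF P] in auto)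
  show "g \<in> P \<Longrightarrow> g [^] ex \<in> pw P" unfolding pw_generate by (intro generate.incl) auto
qed

lemma pw_mono: "P \<subseteq> Q \<Longrightarrow> pw P \<subseteq> pw Q"
  unfolding pw_generate by (rule mono_generate) auto

lemma pw_image:
  assumes f: "mor P f" shows "f ` pw P = pw (f ` P)"
proof -
  have P: "subgroup P S" by (rule mor_subgroup[OF f])
  interpret h: group_hom "S\<lparr>carrier := P\<rparr>" S f by (rule hom_on_group_hom[OF mor_hom_on[OF f] P])
  let ?X = "{g [^] ex | g. g \<in> P}"
  have XP: "?X \<subseteq> P" using subgroup_nat_pow_closed[OF P] by auto
  have "f ` generate (S\<lparr>carrier := P\<rparr>) ?X = generate S (f ` ?X)"
    using h.generate_img[of ?X] XP by simp
  moreover have "generate (S\<lparr>carrier := P\<rparr>) ?X = generate S ?X"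
    using generate_consistent[OF XP P] by simp
  moreover have "f ` ?X = {g [^] ex | g. g \<in> f ` P}"
  proof -
    have "f ` ?X = (\<lambda>g. f (g [^] ex)) ` P" by auto
    also have "\<dots> = (\<lambda>g. f g [^] ex) ` P" using mor_pow[OF f] by (intro image_cong) auto
    finally show ?thesis by auto
  qed
  ultimately show ?thesis by (simp add: pw_generate)
qed

lemma torus_facts:
  assumes P: "subgroup P S"
  shows torus_subgroup: "subgroup (torus P) S" and torus_fixT: "torus P \<subseteq> fixT (pw P)" and torus_T: "torus P \<subseteq> T"
    and torus_divisible: "p_divisible p (torus P)"
proof -
  have I: "subgroup (fixT (pw P)) S" by (rule fixT_subgroup[OF pw_T[OF P]])
  show "subgroup (torus P) S" "torus P \<subseteq> fixT (pw P)" "torus P \<subseteq> T" "p_divisible p (torus P)"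
    unfolding torus_def using idc_subgroup[OF I] idc_subset[OF I] idc_subset_T[OF I] idc_divisible[OF I] by auto
qed

lemma torus_mono: "subgroup P S \<Longrightarrow> subgroup Q S \<Longrightarrow> P \<subseteq> Q \<Longrightarrow> torus P \<subseteq> torus Q"
  unfolding torus_def by (rule idc_mono[OF fixT_subgroup fixT_subgroup fixT_mono]) (auto dest: pw_T pw_mono)

lemma torus_image:
  assumes f: "mor P f" and w: "W w" and eq: "\<And>x. x \<in> pw P \<Longrightarrow> w x = f x"
  shows "torus (f ` P) = w ` torus P"
proof -
  have P: "subgroup P S" by (rule mor_subgroup[OF f])
  have "w ` pw P = f ` pw P" using eq by (intro image_cong) auto
  also have "\<dots> = pw (f ` P)" by (rule pw_image[OF f])
  finally have 1: "fixT (pw (f ` P)) = w ` fixT (pw P)" using fixT_image[OF pw_T[OF P] w] by simp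
  have m: "mor (fixT (pw P)) w" using mor_subset[OF _ fixT_subgroup[OF pw_T[OF P]] fixT_T] w by (auto simp: W_def)
  show ?thesis unfolding torus_def 1
    using idc_image[OF fixT_subgroup[OF pw_T[OF P]] mor_hom_on[OF m] mor_inj[OF m]] .
qed

lemma torus_conj:
  assumes P: "subgroup P S" and y: "y \<in> P" and a: "a \<in> torus P" shows "y \<rhd> a \<in> torus P"
proof -
  have yC: "y \<in> carrier S" using y subgroup.mem_carrier[OF P] by blast
  have "(\<lambda>x. y \<rhd> x) ` P = P"
    using mem_normalizer_iff[OF subgroup.subset[OF P]] normalizer_contains[OF P] y by blast
  then have "torus P = (\<lambda>x. y \<rhd> x) ` torus P"
    using torus_image[OF mor_conj[OF P yC] W_conj[OF yC] refl] by simp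
  then show ?thesis using a by blast
qed

lemma bul_subgroup: "subgroup P S \<Longrightarrow> subgroup (bul P) S"
  and bul_contains: "subgroup P S \<Longrightarrow> P \<subseteq> bul P"
  and bul_torus: "subgroup P S \<Longrightarrow> torus P \<subseteq> bul P"
  unfolding bul_eq using set_mult_subgroup[OF _ torus_subgroup torus_conj] by auto

lemma bul_mono: "subgroup P S \<Longrightarrow> subgroup Q S \<Longrightarrow> P \<subseteq> Q \<Longrightarrow> bul P \<subseteq> bul Q"
  unfolding bul_eq using torus_mono[of P Q] unfolding set_mult_def by blast

text \<open>For x in P and a in torus P, the n-th power of x a is x^n b with b in torus P, since P
  normalizes its torus. So the generators of (P^\<bullet>)^[m] are fixed by every w that fixes
  P^[m], and passing to P^\<bullet> does not enlarge I. This makes the bullet operation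
  idempotent.\<close>

lemma fixT_bul:
  assumes P: "subgroup P S" shows "fixT (pw (bul P)) \<subseteq> fixT (pw P)"
proof
  fix t assume t: "t \<in> fixT (pw (bul P))"
  note B = bul_subgroup[OF P]
  have PC: "\<And>x. x \<in> P \<Longrightarrow> x \<in> carrier S" using subgroup.mem_carrier[OF P] .
  have TS: "\<And>x. x \<in> torus P \<Longrightarrow> x \<in> carrier S" using subgroup.mem_carrier[OF torus_subgroup[OF P]] .
  have pow: "\<exists>b\<in>torus P. (x \<otimes> a) [^] n = x [^] n \<otimes> b" if x: "x \<in> P" and a: "a \<in> torus P" for x a and n :: nat
  proof (induction n)
    case 0 then show ?case using subgroup.one_closed[OF torus_subgroup[OF P]] by force
  next
    case (Suc n)
    then obtain b where b: "b \<in> torus P" "(x \<otimes> a) [^] n = x [^] n \<otimes> b" by blast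
    have c: "x \<in> carrier S" "a \<in> carrier S" "b \<in> carrier S" using x a b PC TS by auto
    have ix: "inv x \<in> P" using x subgroup.m_inv_closed[OF P] by blast
    have "inv x \<otimes> b \<otimes> x \<in> torus P" using torus_conj[OF P ix b(1)] c by simp
    then have "inv x \<otimes> b \<otimes> x \<otimes> a \<in> torus P" using subgroup.m_closed[OF torus_subgroup[OF P]] a by blast
    moreover have "(x \<otimes> a) [^] Suc n = x [^] Suc n \<otimes> (inv x \<otimes> b \<otimes> x \<otimes> a)" using b c by (simp add: m_assoc)
    ultimately show ?case by blast
  qed
  have tT: "t \<in> T" using t fixT_T by blast
  show "t \<in> fixT (pw P)" unfolding fixT_iff[OF pw_T[OF P]]
  proof (intro conjI allI impI)
    show "t \<in> T" by (rule tT)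
    fix w assume w: "W w" and fx: "\<forall>a\<in>pw P. w a = a"
    let ?X = "{x \<in> T. w x = x}"
    have X: "subgroup ?X S"
    proof
      show "?X \<subseteq> carrier S" using T_subset by blast
      show "\<one> \<in> ?X" using subgroup.one_closed[OF T_subgroup] mor_one w by (auto simp: W_def)
      show "x \<otimes> y \<in> ?X" if "x \<in> ?X" "y \<in> ?X" for x y
        using that W_mult[OF w] subgroup.m_closed[OF T_subgroup] by auto
      show "inv x \<in> ?X" if "x \<in> ?X" for x
        using that mor_inv_elem[of T w x] w subgroup.m_inv_closed[OF T_subgroup] by (auto simp: W_def)
    qed
    have "pw (bul P) \<subseteq> ?X" unfolding pw_generate
    proof (rule generate_subgroup_incl[OF _ X], clarify)
      fix g assume "g \<in> bul P"
      then obtain x a where xa: "x \<in> P" "a \<in> torus P" "g = x \<otimes> a" unfolding bul_eq by (rule mem_set_multE)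
      then obtain b where b: "b \<in> torus P" "g [^] ex = x [^] ex \<otimes> b" using pow by blast
      have xT: "x [^] ex \<in> pw P" using pw_mem[OF P xa(1)] .
      have "w b = b" using fx b torus_fixT[OF P] fixT_iff[OF pw_T[OF P]] w by blast
      then have "b \<in> ?X" using b torus_T[OF P] by blast
      moreover have "x [^] ex \<in> ?X" using xT fx pw_T[OF P] by blast
      ultimately have "g [^] ex \<in> ?X" unfolding b(2) by (rule subgroup.m_closed[OF X, rotated])
      then show "g [^] ex \<in> T \<and> w (g [^] ex) = g [^] ex" by blast
    qed
    then show "w t = t" using t fixT_iff[OF pw_T[OF B]] w by blast
  qed
qed

lemma torus_bul:
  assumes P: "subgroup P S" shows "torus (bul P) = torus P"
proof
  show "torus P \<subseteq> torus (bul P)" by (rule torus_mono[OF P bul_subgroup[OF P] bul_contains[OF P]])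
  show "torus (bul P) \<subseteq> torus P" unfolding torus_def
    by (rule idc_mono[OF fixT_subgroup fixT_subgroup fixT_bul]) (use pw_T P bul_subgroup in auto)
qed

lemma bul_idem: assumes P: "subgroup P S" shows "bul (bul P) = bul P"
proof
  show "bul P \<subseteq> bul (bul P)" using bul_contains[OF bul_subgroup[OF P]] .
  show "bul (bul P) \<subseteq> bul P"
    unfolding bul_eq[of "bul P"] torus_bul[OF P]
    using subgroup.m_closed[OF bul_subgroup[OF P]] bul_torus[OF P] by (auto simp: set_mult_def)
qed

end

section \<open>Rigidity of morphisms on the torus, from the extension hypothesis\<close>

locale bullet_system = fusion S p F for S :: "('a, 'b) monoid_scheme" (structure) and p F +
  assumes fin_W: "finite (Aut_F F (identity_component p S))"
    and star: "\<forall>P. subgroup P S \<longrightarrow>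
           (\<forall>\<phi>\<in>F P (identity_component p S).
              \<exists>\<psi>\<in>F (P <#>\<^bsub>S\<^esub> identity_component p (S\<lparr>carrier := centralizer S P\<rparr>))
                      (identity_component p S).
                restrict \<psi> P = \<phi>)"
begin

lemma idc_centralizer_mult:
  assumes P: "subgroup P S"
  shows "subgroup (P <#> idc (centralizer S P)) S" "P \<subseteq> P <#> idc (centralizer S P)"
    "idc (centralizer S P) \<subseteq> P <#> idc (centralizer S P)"
proof -
  have C: "subgroup (centralizer S P) S" by (rule centralizer_subgroup[OF subgroup.subset[OF P]])
  have "x \<rhd> d \<in> idc (centralizer S P)" if "x \<in> P" "d \<in> idc (centralizer S P)" for x d
  proof -
    have d: "d \<in> centralizer S P" using that idc_subset[OF C] by blast
    then have "x \<otimes> d = d \<otimes> x" using that by (auto simp: centralizer_iff)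
    moreover have "d \<in> carrier S" "x \<in> carrier S" using d that subgroup.mem_carrier[OF P] by (auto simp: centralizer_iff)
    ultimately have "x \<rhd> d = d" by (simp only:) (simp add: m_assoc)
    then show ?thesis using that by simp
  qed
  then show "subgroup (P <#> idc (centralizer S P)) S" "P \<subseteq> P <#> idc (centralizer S P)"
    "idc (centralizer S P) \<subseteq> P <#> idc (centralizer S P)"
    using set_mult_subgroup[OF P idc_subgroup[OF C]] by auto
qed

lemma star_mor:
  assumes f: "mor P f" "f ` P \<subseteq> T"
  obtains \<psi> where "mor (P <#> idc (centralizer S P)) \<psi>" "\<psi> ` (P <#> idc (centralizer S P)) \<subseteq> T" "\<And>x. x \<in> P \<Longrightarrow> \<psi> x = f x"
proof -
  have P: "subgroup P S" by (rule mor_subgroup[OF f(1)])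
  have "restrict f P \<in> F P T" by (rule mor_F[OF f(1) T_subgroup f(2)])
  then obtain \<psi> where ps: "\<psi> \<in> F (P <#> idc (centralizer S P)) T" "restrict \<psi> P = restrict f P"
    using star P unfolding T_def[symmetric] by blast
  have "\<psi> x = f x" if "x \<in> P" for x using fun_cong[OF ps(2), of x] that by simp
  then show ?thesis using that ps(1) F_mor_iff[OF idc_centralizer_mult(1)[OF P] T_subgroup] by blast
qed

text \<open>T is abelian and divisible, hence contained in the identity component of C_S(B); so the
  extension hypothesis yields a map defined on all of T.\<close>

lemma W_extension:
  assumes f: "mor B f" "B \<subseteq> T" "f ` B \<subseteq> T"
  obtains w where "W w" "\<And>b. b \<in> B \<Longrightarrow> w b = f b"
proof -
  have B: "subgroup B S" by (rule mor_subgroup[OF f(1)])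
  have C: "subgroup (centralizer S B) S" by (rule centralizer_subgroup[OF subgroup.subset[OF B]])
  have "T \<subseteq> centralizer S B" using T_comm T_subset f(2) unfolding centralizer_iff subset_iff by blast
  then have "T \<subseteq> idc (centralizer S B)" using idc_largest[OF C _ T_divisible] by blast
  then have TD: "T \<subseteq> B <#> idc (centralizer S B)" using idc_centralizer_mult(3)[OF B] by blast
  obtain \<psi> where ps: "mor (B <#> idc (centralizer S B)) \<psi>" "\<psi> ` (B <#> idc (centralizer S B)) \<subseteq> T" "\<And>x. x \<in> B \<Longrightarrow> \<psi> x = f x"
    using star_mor[OF f(1,3)] by blast
  have "W \<psi>" using WI[OF mor_subset[OF ps(1) T_subgroup TD]] ps(2) TD by blast
  then show ?thesis using that ps(3) by blast
qed

text \<open>f need not map P \<inter> T into T, but it takes P^[m] to the power subgroup of f P, and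
  power subgroups lie in T.\<close>

lemma W_exists:
  assumes f: "mor P f" obtains w where "W w" "\<And>x. x \<in> pw P \<Longrightarrow> w x = f x"
proof -
  have P: "subgroup P S" by (rule mor_subgroup[OF f])
  have "mor (pw P) f" by (rule mor_subset[OF f pw_subgroup[OF P] pw_subset[OF P]])
  moreover have "f ` pw P \<subseteq> T" using pw_image[OF f] pw_T[OF mor_image_subgroup[OF f]] by simp
  ultimately show ?thesis using W_extension[OF _ pw_T[OF P]] that by blast
qed

text \<open>Although \<open>f\<close> need not map \<open>P \<inter> T\<close> into \<open>T\<close>, it agrees with \<open>w\<close> on
  \<open>P \<inter> torus P\<close>. The extension hypothesis is applied to the inverse of \<open>f\<close>, which does take
  values in \<open>T\<close>.\<close>

lemma torus_agree:
  assumes f: "mor P f" and w: "W w" and eq: "\<And>x. x \<in> pw P \<Longrightarrow> w x = f x"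
    and a: "a \<in> P" "a \<in> torus P"
  shows "f a = w a"
proof -
  have P: "subgroup P S" by (rule mor_subgroup[OF f])
  let ?I = "fixT (pw P)"
  \<comment> \<open>The inverse of f on f B takes values in B \<subseteq> T, as the extension
    hypothesis requires, and B contains both P^[m] and a.\<close>
  define B where "B = P \<inter> ?I"
  have B: "subgroup B S" unfolding B_def by (rule subgroups_Inter_pair[OF P fixT_subgroup[OF pw_T[OF P]]])
  have BP: "B \<subseteq> P" and BT: "B \<subseteq> T" using fixT_T by (auto simp: B_def)
  have pB: "pw P \<subseteq> B" using pw_subset[OF P] fixT_self[OF pw_T[OF P]] by (auto simp: B_def)
  have aB: "a \<in> B" using a torus_fixT[OF P] by (auto simp: B_def)
  have mB: "mor B f" by (rule mor_subset[OF f B BP])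
  let ?R = "f ` B" and ?g = "inv_into B f"
  have R: "subgroup ?R S" by (rule mor_image_subgroup[OF mB])
  have gi: "?g (f x) = x" if "x \<in> B" for x using mor_inj[OF mB] that by simp
  have gT: "?g ` ?R \<subseteq> T" using gi BT by auto
  let ?D = "idc (centralizer S ?R)" and ?E = "?R <#> idc (centralizer S ?R)"
  obtain \<psi> where ps: "mor ?E \<psi>" "\<psi> ` ?E \<subseteq> T" "\<And>x. x \<in> ?R \<Longrightarrow> \<psi> x = ?g x"
    using star_mor[OF mor_inv_into[OF mB] gT] by blast
  have C: "subgroup (centralizer S ?R) S" by (rule centralizer_subgroup[OF subgroup.subset[OF R]])
  have TR: "subgroup (torus P) S" and TT: "torus P \<subseteq> T" by (rule torus_subgroup[OF P], rule torus_T[OF P])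
  \<comment> \<open>Conjugation by an element of f B fixes w x for x in P^[m], hence, by
    \<open>W_agree\<close>, for all x in I(P^[m]). So the divisible group w(torus P) lies in the
    domain to which the inverse of f gets extended.\<close>
  have wC: "w ` torus P \<subseteq> centralizer S ?R"
  proof clarify
    fix c assume c: "c \<in> torus P"
    have wcT: "w c \<in> T" using c TT W_T[OF w] by blast
    show "w c \<in> centralizer S ?R" unfolding centralizer_iff
    proof (intro conjI ballI)
      show wcC: "w c \<in> carrier S" using wcT T_subset by blast
      fix y assume "y \<in> ?R"
      then obtain b where b: "b \<in> B" "y = f b" by blast
      have yC: "y \<in> carrier S" using b mor_closed[OF mB] by blast
      have bP: "b \<in> P" using b BP by blast
      have "y \<rhd> w x = w x" if x: "x \<in> pw P" for x
      proof -
        have xP: "x \<in> P" and xT: "x \<in> T" using x pw_subset[OF P] pw_T[OF P] by auto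
        have "b \<otimes> x = x \<otimes> b" using T_comm xT b BT by blast
        then have "b \<rhd> x = x" using bP xP subgroup.mem_carrier[OF P] by (simp add: m_assoc)
        then show ?thesis using mor_conj_elem[OF f bP xP] eq[OF x] b by simp
      qed
      then have "y \<rhd> w c = w c"
        using W_agree[OF pw_T[OF P] W_comp[OF W_conj[OF yC] w] w] c torus_fixT[OF P] by blast
      then have "y \<otimes> w c = w c \<otimes> y" using yC wcC by (metis inv_solve_right' m_closed)
      then show "w c \<otimes> y = y \<otimes> w c" by simp
    qed
  qed
  have mT: "mor (torus P) w" using mor_subset[OF _ TR TT] w by (auto simp: W_def)
  have "p_divisible p (w ` torus P)" by (rule p_divisible_image[OF mor_hom_on[OF mT] TR order_refl torus_divisible[OF P]])
  then have wD: "w ` torus P \<subseteq> ?D" using idc_largest[OF C wC] by blast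
  note E = idc_centralizer_mult[OF R]
  define K where "K = ?E \<inter> T"
  have K: "subgroup K S" unfolding K_def by (rule subgroups_Inter_pair[OF E(1) T_subgroup])
  have mK: "mor K \<psi>" by (rule mor_subset[OF ps(1) K]) (auto simp: K_def)
  have "\<psi> ` K \<subseteq> T" using ps(2) by (auto simp: K_def)
  \<comment> \<open>On the part of its domain inside T, \<psi> is given by some v in W, and v w is
    the identity on P^[m], hence at a. Thus \<psi> takes both w a and f a to a, and it is
    injective.\<close>
  then obtain v where v: "W v" "\<And>x. x \<in> K \<Longrightarrow> v x = \<psi> x" using W_extension[OF mK] by (auto simp: K_def)
  have "v (w x) = x" if x: "x \<in> pw P" for x
  proof -
    have xB: "x \<in> B" using x pB by blast
    have "w x \<in> T" using x pw_T[OF P] W_T[OF w] by blast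
    moreover have "w x \<in> ?R" using eq[OF x] xB by auto
    ultimately have "w x \<in> K" using E(2) by (auto simp: K_def)
    then show ?thesis using v(2) ps(3)[OF \<open>w x \<in> ?R\<close>] gi[OF xB] eq[OF x] by simp
  qed
  then have va: "v (w a) = a"
    using W_agree[OF pw_T[OF P] W_comp[OF v(1) w] W_id] a torus_fixT[OF P] by blast
  have waE: "w a \<in> ?E" using wD a E(3) by blast
  moreover have "w a \<in> T" using a TT W_T[OF w] by blast
  ultimately have "\<psi> (w a) = a" using v(2)[of "w a"] va by (auto simp: K_def)
  moreover have "\<psi> (f a) = a" using ps(3)[of "f a"] gi[OF aB] aB by simp
  moreover have "f a \<in> ?E" using aB E(2) by blast
  ultimately show ?thesis using inj_onD[OF mor_inj[OF ps(1)]] waE by metis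
qed

text \<open>As functions of a, both sides are elements of W, and they agree on P^[m].\<close>

lemma torus_equivariant:
  assumes f: "mor P f" and w: "W w" and eq: "\<And>x. x \<in> pw P \<Longrightarrow> w x = f x"
    and y: "y \<in> P" and a: "a \<in> torus P"
  shows "w (y \<rhd> a) = f y \<rhd> w a"
proof -
  have P: "subgroup P S" by (rule mor_subgroup[OF f])
  have yC: "y \<in> carrier S" "f y \<in> carrier S" using y subgroup.mem_carrier[OF P] mor_closed[OF f] by auto
  have "w (y \<rhd> x) = f y \<rhd> w x" if x: "x \<in> pw P" for x
  proof -
    have "(\<lambda>x. y \<rhd> x) ` P = P"
      using mem_normalizer_iff[OF subgroup.subset[OF P]] normalizer_contains[OF P] y by blast
    then have "y \<rhd> x \<in> pw P" using pw_image[OF mor_conj[OF P yC(1)]] x by auto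
    then show ?thesis using eq x mor_conj_elem[OF f y] pw_subset[OF P] by auto
  qed
  then show ?thesis
    using W_agree[OF pw_T[OF P] W_comp[OF w W_conj[OF yC(1)]] W_comp[OF W_conj[OF yC(2)] w]] a torus_fixT[OF P] by blast
qed

text \<open>\<open>torus_agree\<close> is applied to Q, whose torus contains torus P; the element of
  W attached to Q agrees with w on P^[m], hence on torus P.\<close>

lemma torus_unique:
  assumes psi: "mor Q \<psi>" and P: "subgroup P S" "P \<subseteq> Q" and w: "W w" and eq: "\<And>x. x \<in> pw P \<Longrightarrow> w x = \<psi> x"
    and a: "a \<in> Q" "a \<in> torus P"
  shows "\<psi> a = w a"
proof -
  have Q: "subgroup Q S" by (rule mor_subgroup[OF psi])
  obtain v where v: "W v" "\<And>x. x \<in> pw Q \<Longrightarrow> v x = \<psi> x" using W_exists[OF psi] by blast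
  have "\<psi> a = v a" using torus_agree[OF psi v a(1)] torus_mono[OF P(1) Q P(2)] a(2) by blast
  also have "v a = w a"
    using W_agree[OF pw_T[OF P(1)] v(1) w] v(2) eq pw_mono[OF P(2)] a(2) torus_fixT[OF P(1)] by (metis subsetD)
  finally show ?thesis .
qed

text \<open>An element of Q is x a with x in P and a in torus P, and the value at a is forced by the
  values on P^[m].\<close>

lemma bul_unique:
  assumes g: "mor Q g" and h: "mor Q h" and P: "subgroup P S" "P \<subseteq> Q" "Q \<subseteq> bul P"
    and eq: "\<And>x. x \<in> P \<Longrightarrow> g x = h x" and z: "z \<in> Q"
  shows "g z = h z"
proof -
  have Q: "subgroup Q S" by (rule mor_subgroup[OF g])
  obtain w where w: "W w" "\<And>x. x \<in> pw P \<Longrightarrow> w x = g x" using W_exists[OF mor_subset[OF g P(1,2)]] by blast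
  have w': "\<And>x. x \<in> pw P \<Longrightarrow> w x = h x" using w(2) eq pw_subset[OF P(1)] by auto
  obtain x a where xa: "x \<in> P" "a \<in> torus P" "z = x \<otimes> a" using z P(3) unfolding bul_eq by (blast elim: mem_set_multE)
  have c: "x \<in> carrier S" "a \<in> carrier S"
    using xa subgroup.mem_carrier[OF P(1)] subgroup.mem_carrier[OF torus_subgroup[OF P(1)]] by auto
  have xQ: "x \<in> Q" using xa P(2) by blast
  have "inv x \<otimes> z \<in> Q" using xQ z subgroup.m_closed[OF Q] subgroup.m_inv_closed[OF Q] by blast
  then have aQ: "a \<in> Q" using xa c by simp
  show ?thesis
    using mor_mult[OF g xQ aQ] mor_mult[OF h xQ aQ] torus_unique[OF g P(1,2) w aQ xa(2)]
      torus_unique[OF h P(1,2) w(1) w' aQ xa(2)] eq[OF xa(1)] xa(3) by simp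
qed

text \<open>On torus P the map g is given by an element w of W, and the torus of g P is w(torus
  P).\<close>

lemma bul_image:
  assumes g: "mor (bul P) g" and P: "subgroup P S" shows "g ` bul P = bul (g ` P)"
proof -
  have PB: "P \<subseteq> bul P" by (rule bul_contains[OF P])
  have gP: "mor P g" by (rule mor_subset[OF g P PB])
  obtain w where w: "W w" "\<And>x. x \<in> pw P \<Longrightarrow> w x = g x" using W_exists[OF gP] by blast
  have t: "torus (g ` P) = w ` torus P" by (rule torus_image[OF gP w])
  have val: "g (x \<otimes> a) = g x \<otimes> w a" if "x \<in> P" "a \<in> torus P" for x a
    using mor_mult[OF g, of x a] torus_unique[OF g P PB w, of a] that bul_torus[OF P] PB by auto
  show ?thesis
  proof
    show "g ` bul P \<subseteq> bul (g ` P)"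
    proof clarify
      fix z assume "z \<in> bul P"
      then obtain x a where "x \<in> P" "a \<in> torus P" "z = x \<otimes> a" unfolding bul_eq by (rule mem_set_multE)
      then show "g z \<in> bul (g ` P)" unfolding bul_eq t set_mult_def using val by auto
    qed
    show "bul (g ` P) \<subseteq> g ` bul P"
    proof
      fix z assume "z \<in> bul (g ` P)"
      then obtain y b where "y \<in> g ` P" "b \<in> w ` torus P" "z = y \<otimes> b" unfolding bul_eq t by (rule mem_set_multE)
      then obtain x a where xa: "x \<in> P" "a \<in> torus P" "z = g x \<otimes> w a" by blast
      then have "z = g (x \<otimes> a)" using val by simp
      moreover have "x \<otimes> a \<in> bul P" unfolding bul_eq set_mult_def using xa by blast
      ultimately show "z \<in> g ` bul P" by blast
    qed
  qed
qed

end

context bullet_system begin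

subsection \<open>Boundedness of bullet subgroups\<close>

text \<open>I(A) is determined by C_W(A), and the finite group W has finitely many subsets.\<close>

lemma finite_fixT_range: "finite (range fixT)"
proof -
  have "range fixT \<subseteq> (\<lambda>C. {t \<in> T. \<forall>w\<in>C. w t = t}) ` Pow (Aut_F F T)"
  proof
    fix X assume "X \<in> range fixT"
    then obtain A where "X = fixT A" by blast
    then have "X = {t \<in> T. \<forall>w\<in>C_W p S F A. w t = t}" by (simp add: I_T_def T_def)
    moreover have "C_W p S F A \<in> Pow (Aut_F F T)" by (auto simp: C_W_def T_def)
    ultimately show "X \<in> (\<lambda>C. {t \<in> T. \<forall>w\<in>C. w t = t}) ` Pow (Aut_F F T)" by (rule image_eqI)
  qed
  moreover have "finite (Pow (Aut_F F T))" using fin_W by (simp add: T_def)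
  ultimately show ?thesis by (rule finite_subset[OF _ finite_imageI])
qed

text \<open>Let Q = P^\<bullet> and I = I(P^[m]). Cosets are counted in two stages. The image of Q
  in S/T is bounded by |S/T|. By \<open>fixT_bul\<close>, Q \<inter> T lies in J(I), the elements of
  T whose power by the exponent of S/T is in I, and J(I) meets only finitely many cosets of I_0,
  which is contained in the identity component of Q. Finally, only finitely many I occur.\<close>

lemma bul_components_bounded:
  "\<exists>N. \<forall>P. subgroup P S \<longrightarrow> card ((\<lambda>h. idc (bul P) #> h) ` bul P) \<le> N"
proof -
  define J where "J I = {t \<in> T. t [^] ex \<in> I}" for I
  define nI where "nI I = card ((\<lambda>t. idc I #> t) ` J I)" for I
  let ?c = "card ((\<lambda>g. T #> g) ` carrier S)"
  have fc: "finite ((\<lambda>g. T #> g) ` carrier S)"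
    using idc_finite_index[OF subgroup_carrier] unfolding idc_carrier .
  have Jfin: "finite ((\<lambda>t. idc I #> t) ` J I)" if I: "subgroup I S" "I \<subseteq> T" for I
  proof -
    have JT: "J I \<subseteq> T" by (auto simp: J_def)
    have sJ: "subgroup (J I) S"
    proof
      show "J I \<subseteq> carrier S" using JT T_subset by blast
      show "\<one> \<in> J I" using subgroup.one_closed[OF T_subgroup] subgroup.one_closed[OF I(1)] by (simp add: J_def)
      show "x \<otimes> y \<in> J I" if "x \<in> J I" "y \<in> J I" for x y
        using that T_pow subgroup.m_closed[OF T_subgroup] subgroup.m_closed[OF I(1)] by (auto simp: J_def)
      show "inv x \<in> J I" if "x \<in> J I" for x
      proof -
        have "x \<in> carrier S" using that JT T_subset by blast
        then show ?thesis
          using that subgroup.m_inv_closed[OF T_subgroup] subgroup.m_inv_closed[OF I(1)] by (auto simp: J_def nat_pow_inv)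
      qed
    qed
    obtain k where k: "ex dvd p ^ k" using exponent_p_power by blast
    then obtain m where m: "p ^ k = m * ex" by (metis dvdE mult.commute)
    have C: "idc (J I) \<subseteq> J I" and sC: "subgroup (idc (J I)) S" and dC: "p_divisible p (idc (J I))"
      using idc_subset[OF sJ] idc_subgroup[OF sJ] idc_divisible[OF sJ] by auto
    \<comment> \<open>Every element of a divisible group is a p^k-th power in it; the exponent
      divides p^k, and powers by the exponent take J(I) into I.\<close>
    have "idc (J I) \<subseteq> I"
    proof
      fix c assume "c \<in> idc (J I)"
      then obtain d where d: "d \<in> idc (J I)" "d [^] (p ^ k) = c"
        using p_divisible_pow[OF dC _ subgroup.subset[OF sC]] by blast
      have "d [^] m \<in> J I" using subgroup_nat_pow_closed[OF sC d(1)] C by blast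
      then have "(d [^] m) [^] ex \<in> I" by (simp add: J_def)
      moreover have "(d [^] m) [^] ex = c" using d m subgroup.mem_carrier[OF sC d(1)] by (simp add: nat_pow_pow)
      ultimately show "c \<in> I" by simp
    qed
    then have sub: "idc (J I) \<subseteq> idc I" using idc_largest[OF I(1) _ dC] by blast
    have sI: "subgroup (idc I) S" by (rule idc_subgroup[OF I(1)])
    have "finite ((\<lambda>t. idc I #> t) ` idc (J I))"
    proof -
      have "(\<lambda>t. idc I #> t) ` idc (J I) \<subseteq> {idc I}"
        using coset_join2[OF subgroup.mem_carrier[OF sC] sI] sub by blast
      then show ?thesis using finite_subset by blast
    qed
    then show ?thesis using finite_cosets_trans[OF sC sI subgroup.subset[OF sJ] _ idc_finite_index[OF sJ]] by blast
  qed
  define N where "N = ?c * (\<Sum>I\<in>range fixT. nI I)"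
  have "card ((\<lambda>h. idc (bul P) #> h) ` bul P) \<le> N" if P: "subgroup P S" for P
  proof -
    let ?Q = "bul P" and ?A = "torus P" and ?I = "fixT (pw P)"
    have I: "subgroup ?I S" "?I \<subseteq> T" using fixT_subgroup[OF pw_T[OF P]] fixT_T by auto
    have Q: "subgroup ?Q S" by (rule bul_subgroup[OF P])
    have A: "subgroup ?A S" by (rule torus_subgroup[OF P])
    have QC: "\<And>x. x \<in> ?Q \<Longrightarrow> x \<in> carrier S" using subgroup.mem_carrier[OF Q] .
    have AQ: "?A \<subseteq> idc ?Q" using idc_largest[OF Q bul_torus[OF P] torus_divisible[OF P]] .
    have QJ: "x \<in> J ?I" if "x \<in> ?Q" "x \<in> T" for x
    proof -
      have "x [^] ex \<in> pw ?Q" by (rule pw_mem[OF Q that(1)])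
      also have "pw ?Q \<subseteq> fixT (pw ?Q)" by (rule fixT_self[OF pw_T[OF Q]])
      also have "\<dots> \<subseteq> ?I" by (rule fixT_bul[OF P])
      finally show ?thesis using that by (simp add: J_def)
    qed
    define rep where "rep c = (SOME h. h \<in> ?Q \<and> T #> h = c)" for c
    have rep: "rep (T #> h) \<in> ?Q \<and> T #> rep (T #> h) = T #> h" if "h \<in> ?Q" for h
      unfolding rep_def by (rule someI[of _ h]) (use that in simp)
    let ?K = "((\<lambda>g. T #> g) ` carrier S) \<times> ((\<lambda>t. ?A #> t) ` J ?I)"
    have fK: "finite ?K" using fc Jfin[OF I] by (simp add: torus_def)
    have "idc ?Q #> h \<in> (\<lambda>(c, D). idc ?Q <#> (D #> rep c)) ` ?K" if h: "h \<in> ?Q" for h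
    proof -
      let ?r = "rep (T #> h)"
      have r: "?r \<in> ?Q" "T #> ?r = T #> h" using rep h by auto
      have C: "h \<in> carrier S" "?r \<in> carrier S" using h r QC by auto
      define x where "x = h \<otimes> inv ?r"
      have "x \<in> T" using rcos_eq_iff[OF T_subgroup C] r(2) by (simp add: x_def)
      moreover have "x \<in> ?Q" using h r subgroup.m_closed[OF Q] subgroup.m_inv_closed[OF Q] by (simp add: x_def)
      ultimately have xJ: "x \<in> J ?I" and xC: "x \<in> carrier S" using QJ QC by auto
      have iQ: "idc ?Q \<subseteq> carrier S" "?A \<subseteq> carrier S" using subgroup.subset[OF idc_subgroup[OF Q]] subgroup.subset[OF A] by auto
      have hx: "h = x \<otimes> ?r" using C by (simp add: x_def m_assoc)
      have "idc ?Q <#> ?A = idc ?Q"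
      proof
        show "idc ?Q <#> ?A \<subseteq> idc ?Q" using AQ subgroup.m_closed[OF idc_subgroup[OF Q]] by (auto simp: set_mult_def)
        show "idc ?Q \<subseteq> idc ?Q <#> ?A"
          using subgroup.one_closed[OF A] iQ unfolding set_mult_def by force
      qed
      then have "idc ?Q <#> ((?A #> x) #> ?r) = idc ?Q #> h"
        using coset_mult_assoc[OF iQ(2) xC C(2)] setmult_rcos_assoc[OF iQ(1,2) C(1)] hx by simp
      then show ?thesis using xJ C by (intro image_eqI[of _ _ "(T #> h, ?A #> x)"]) auto
    qed
    then have "(\<lambda>h. idc ?Q #> h) ` ?Q \<subseteq> (\<lambda>(c, D). idc ?Q <#> (D #> rep c)) ` ?K" by blast
    then have "card ((\<lambda>h. idc ?Q #> h) ` ?Q) \<le> card ?K"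
      using surj_card_le[OF fK] by blast
    also have "\<dots> = ?c * nI ?I" by (simp add: card_cartesian_product nI_def torus_def)
    also have "nI ?I \<le> (\<Sum>I\<in>range fixT. nI I)" using finite_fixT_range by (intro member_le_sum) auto
    finally show ?thesis by (simp add: N_def)
  qed
  then show ?thesis by blast
qed

definition bound :: nat where
  "bound = (SOME N. \<forall>P. subgroup P S \<longrightarrow> card ((\<lambda>h. idc (bul P) #> h) ` bul P) \<le> N)"

text \<open>The lexicographic order of \<open>tord (bul P)\<close>, encoded in a natural number.\<close>

definition depth :: "'a set \<Rightarrow> nat" where
  "depth P = fst (tord (bul P)) * (bound + 1) + snd (tord (bul P))"

lemma snd_tord_bul: assumes P: "subgroup P S" shows "snd (tord (bul P)) \<le> bound"
proof -
  have "\<forall>P. subgroup P S \<longrightarrow> card ((\<lambda>h. idc (bul P) #> h) ` bul P) \<le> bound"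
    unfolding bound_def by (rule someI_ex[OF bul_components_bounded])
  moreover obtain s where "tord (bul P) = (s, card ((\<lambda>h. idc (bul P) #> h) ` bul P))"
    using tord_eq[OF bul_subgroup[OF P]] by blast
  ultimately show ?thesis using P by auto
qed

text \<open>Second components are at most \<open>bound\<close>, so in base \<open>bound + 1\<close>
  no carry occurs and the natural order is the lexicographic one.\<close>

lemma depth_le_iff:
  assumes "subgroup P S" "subgroup Q S"
  shows "depth P \<le> depth Q \<longleftrightarrow> lex_le (tord (bul P)) (tord (bul Q))"
proof -
  obtain a b c d where e: "tord (bul P) = (a, b)" "tord (bul Q) = (c, d)" by (metis surj_pair)
  have bd: "b \<le> bound" "d \<le> bound" using snd_tord_bul[OF assms(1)] snd_tord_bul[OF assms(2)] e by auto
  have "a * (bound + 1) + b \<le> c * (bound + 1) + d \<longleftrightarrow> a < c \<or> a = c \<and> b \<le> d"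
  proof (cases a c rule: linorder_cases)
    case less
    then have "(a + 1) * (bound + 1) \<le> c * (bound + 1)" by (intro mult_right_mono) auto
    then show ?thesis using less bd by simp
  next
    case greater
    then have "(c + 1) * (bound + 1) \<le> a * (bound + 1)" by (intro mult_right_mono) auto
    then show ?thesis using greater bd by simp
  qed simp
  then show ?thesis by (auto simp: depth_def e lex_le_def)
qed

lemma depth_bounded: "\<exists>D. \<forall>P. subgroup P S \<longrightarrow> depth P \<le> D"
proof -
  have "depth P \<le> fst (tord (carrier S)) * (bound + 1) + bound" if P: "subgroup P S" for P
  proof -
    have B: "subgroup (bul P) S" by (rule bul_subgroup[OF P])
    have i: "hom_on (bul P) (\<lambda>x. x)" using subgroup.mem_carrier[OF B] by (auto simp: hom_on_def)
    have "lex_le (tord (bul P)) (tord (carrier S))"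
      by (rule tord_mono[OF B subgroup_carrier i]) (use subgroup.subset[OF B] in auto)
    then have "fst (tord (bul P)) \<le> fst (tord (carrier S))"
      unfolding lex_le_def by (cases "tord (bul P)", cases "tord (carrier S)") auto
    then have "fst (tord (bul P)) * (bound + 1) \<le> fst (tord (carrier S)) * (bound + 1)" by (rule mult_right_mono) simp
    then show ?thesis using snd_tord_bul[OF P] by (simp add: depth_def)
  qed
  then show ?thesis by blast
qed

lemma depth_mono:
  assumes P: "subgroup P S" and Q: "subgroup Q S" and g: "mor (bul P) g" "g ` bul P \<subseteq> bul Q"
  shows "depth P \<le> depth Q" and "depth Q \<le> depth P \<Longrightarrow> g ` bul P = bul Q"
proof -
  note t = bul_subgroup[OF P] bul_subgroup[OF Q] mor_hom_on[OF g(1)] mor_inj[OF g(1)] g(2)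
  show "depth P \<le> depth Q" using tord_mono[OF t] depth_le_iff[OF P Q] by simp
  show "depth Q \<le> depth P \<Longrightarrow> g ` bul P = bul Q" using tord_surj[OF t] depth_le_iff[OF Q P] by simp
qed

lemma depth_subset:
  assumes P: "subgroup P S" and Q: "subgroup Q S" and PQ: "P \<subseteq> Q"
  shows "depth P \<le> depth Q" and "depth Q \<le> depth P \<Longrightarrow> bul P = bul Q"
  using depth_mono[OF P Q mor_id[OF bul_subgroup[OF P]]] bul_mono[OF P Q PQ] by auto

end

section \<open>Extension of morphisms to bullet subgroups\<close>

locale bullet_family = bullet_system S p F for S :: "('a, 'b) monoid_scheme" (structure) and p F +
  fixes HH :: "'a set set"
  assumes HH_sub: "\<forall>P\<in>HH. subgroup P S"
    and HH_conj: "\<forall>P\<in>HH. \<forall>Q\<in>conj_class S F P. Q \<in> HH"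
    and HH_gen: "family_generated S F HH"
    and HH_sat: "family_saturated p S F HH"
    and HH_up: "\<forall>P\<in>HH. \<forall>Q. subgroup Q S \<longrightarrow> P \<subseteq> Q \<longrightarrow> Q \<subseteq> bullet p S F P \<longrightarrow> Q \<in> HH"
begin

lemma HH_nice: assumes "P \<in> HH" shows "nice P"
proof -
  obtain Q where Q: "Q \<in> conj_class S F P" "fully_automized p S F Q" "receptive S F Q"
    using HH_sat assms by (auto simp: family_saturated_def)
  have P: "subgroup P S" using HH_sub assms by blast
  then show ?thesis using Q conj_class_iff[OF P] mor_image_subgroup by (auto simp: nice_def good_def)
qed

text \<open>\<open>family_closed\<close> speaks of strictly increasing sequences; a weakly
  increasing one is eventually constant or has a strictly increasing subsequence with the same
  union.\<close>

lemma HH_union: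
  assumes Pn: "\<And>n::nat. P n \<in> HH" "\<And>n. P n \<subseteq> P (Suc n)" and g: "\<And>n. mor (P n) g"
    and U: "subgroup (\<Union>n. P n) S"
  shows "mor (\<Union>n. P n) g"
proof (cases "\<exists>N. \<forall>n\<ge>N. P n = P N")
  case True
  then obtain N where N: "\<And>n. n \<ge> N \<Longrightarrow> P n = P N" by blast
  have "P n \<subseteq> P N" for n
    using lift_Suc_mono_le[of P n "max n N"] Pn(2) N[of "max n N"] by auto
  then have "(\<Union>n. P n) = P N" by blast
  then show ?thesis using g by simp
next
  case False
  have mono: "P m \<subseteq> P n" if "m \<le> n" for m n using lift_Suc_mono_le[of P m n] Pn(2) that by blast
  have "\<exists>n>N. P N \<subset> P n" for N
  proof -
    obtain n where n: "n \<ge> N" "P n \<noteq> P N" using False by blast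
    then have "n > N" by (metis le_neq_implies_less)
    then show ?thesis using n mono[of N n] by blast
  qed
  then obtain s where s: "\<And>N. s N > N \<and> P N \<subset> P (s N)" by metis
  define r where "r = rec_nat 0 (\<lambda>_. s)"
  have r: "r (Suc k) = s (r k)" for k by (simp add: r_def)
  have rk: "k \<le> r k" for k
  proof (induction k)
    case (Suc k)
    then show ?case using s[of "r k"] by (simp add: r)
  qed simp
  have Ur: "(\<Union>k. P (r k)) = (\<Union>n. P n)" using mono[OF rk] by blast
  have str: "P (r k) \<subset> P (r (Suc k))" for k unfolding r using s by blast
  let ?U = "\<Union>n. P n"
  have "x \<in> ?U \<Longrightarrow> g x \<in> carrier S" for x using g mor_closed by blast
  moreover have "g (x \<otimes> y) = g x \<otimes> g y" if xy: "x \<in> ?U" "y \<in> ?U" for x y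
  proof -
    obtain m n where mn: "x \<in> P m" "y \<in> P n" using xy by blast
    have "x \<in> P (max m n)" "y \<in> P (max m n)" using mn mono[of m "max m n"] mono[of n "max m n"] by auto
    then show ?thesis using mor_mult[OF g] by blast
  qed
  ultimately have "restrict g ?U \<in> Hom_grp S (\<Union>k. P (r k)) (carrier S)"
  proof -
    assume c: "\<And>x. x \<in> ?U \<Longrightarrow> g x \<in> carrier S" and m: "\<And>x y. x \<in> ?U \<Longrightarrow> y \<in> ?U \<Longrightarrow> g (x \<otimes> y) = g x \<otimes> g y"
    have "restrict g ?U \<in> hom (S\<lparr>carrier := ?U\<rparr>) (S\<lparr>carrier := carrier S\<rparr>)"
    proof (rule homI)
      fix x y assume "x \<in> carrier (S\<lparr>carrier := ?U\<rparr>)" "y \<in> carrier (S\<lparr>carrier := ?U\<rparr>)"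
      then have xy: "x \<in> ?U" "y \<in> ?U" by simp_all
      then show "restrict g ?U (x \<otimes>\<^bsub>S\<lparr>carrier := ?U\<rparr>\<^esub> y) = restrict g ?U x \<otimes>\<^bsub>S\<lparr>carrier := carrier S\<rparr>\<^esub> restrict g ?U y"
        using m[OF xy] subgroup.m_closed[OF U xy] by (simp del: UN_iff)
    qed (use c in auto)
    then show ?thesis unfolding Ur Hom_grp_def by simp
  qed
  moreover have "restrict (restrict g ?U) (P (r k)) \<in> F (P (r k)) (carrier S)" for k
  proof -
    have "restrict (restrict g ?U) (P (r k)) = restrict g (P (r k))" by (auto simp: fun_eq_iff)
    then show ?thesis using g[of "r k"] by (simp add: mor_def)
  qed
  ultimately have "restrict g ?U \<in> F ?U (carrier S)"
    using HH_sat Pn(1) str unfolding family_saturated_def family_closed_def Ur[symmetric] by (metis Ur)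
  then show ?thesis using U by (simp add: mor_def)
qed

text \<open>Elements of N are x a with x in P and a in N \<inter> torus P. Conjugation by a
  corresponds under \<psi> to conjugation by w a, where w in W continues f on P^[m]; so all of N
  satisfies the condition for an extension. As \<psi> Q need not be receptive, one moves by \<chi>
  to a good conjugate, extends there, and returns by the inverse of \<chi>, which is defined on all
  of N_S(\<psi> Q).\<close>

lemma extension_step:
  assumes P: "subgroup P S" and f: "mor P f" and Q: "Q \<in> HH" "P \<subseteq> Q" "Q \<subseteq> bul P"
    and psi: "mor Q \<psi>" "\<And>x. x \<in> P \<Longrightarrow> \<psi> x = f x"
    and N: "subgroup N S" "N \<subseteq> bul P" "Q \<subseteq> N" "N \<subseteq> normalizer S Q"
  shows "\<exists>\<theta>. mor N \<theta> \<and> (\<forall>x\<in>P. \<theta> x = f x)"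
proof -
  have sQ: "subgroup Q S" using mor_subgroup[OF psi(1)] .
  have QC: "\<And>x. x \<in> Q \<Longrightarrow> x \<in> carrier S" using subgroup.mem_carrier[OF sQ] .
  have AC: "\<And>x. x \<in> torus P \<Longrightarrow> x \<in> carrier S" using subgroup.mem_carrier[OF torus_subgroup[OF P]] .
  have PN: "P \<subseteq> N" using Q N by blast
  let ?R = "\<psi> ` Q"
  have R: "subgroup ?R S" by (rule mor_image_subgroup[OF psi(1)])
  obtain \<chi> where chi: "mor (normalizer S ?R) \<chi>" "good (\<chi> ` ?R)"
    using niceE[OF nice_image[OF HH_nice[OF Q(1)] psi(1)]] by blast
  let ?M = "normalizer S ?R"
  have RM: "?R \<subseteq> ?M" and M: "subgroup ?M S" using normalizer_contains[OF R] normalizer_subgroup[OF R] by auto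
  have mR: "mor ?R \<chi>" by (rule mor_subset[OF chi(1) R RM])
  have mc: "mor Q (\<lambda>x. \<chi> (\<psi> x))" using mor_comp[OF psi(1) mR] by blast
  have imc: "(\<lambda>x. \<chi> (\<psi> x)) ` Q = \<chi> ` ?R" by (simp add: image_image)
  obtain w where w: "W w" "\<And>x. x \<in> pw P \<Longrightarrow> w x = f x" using W_exists[OF f] by blast
  obtain v where v: "W v" "\<And>x. x \<in> pw Q \<Longrightarrow> v x = \<psi> x" using W_exists[OF psi(1)] by blast
  \<comment> \<open>On torus P the elements of W attached to \<psi> and to f agree, so
    \<open>torus_equivariant\<close> for \<psi> can be used with w.\<close>
  have vw: "v a = w a" if "a \<in> torus P" for a
  proof (rule W_agree[OF pw_T[OF P] v(1) w(1)])
    show "a \<in> fixT (pw P)" using that torus_fixT[OF P] by blast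
    fix x assume "x \<in> pw P"
    then have "x \<in> pw Q" "x \<in> P" using pw_mono[OF Q(2)] pw_subset[OF P] by blast+
    then show "v x = w x" using v(2)[of x] w(2)[of x] psi(2)[of x] \<open>x \<in> pw P\<close> by simp
  qed
  have wpsi: "\<And>x. x \<in> pw P \<Longrightarrow> w x = \<psi> x" using w(2) psi(2) pw_subset[OF P] by auto
  have wC: "w a \<in> carrier S" if "a \<in> torus P" for a using that torus_T[OF P] W_T[OF w(1)] T_subset by blast
  have decomp: "\<exists>x\<in>P. \<exists>a\<in>torus P. a \<in> N \<and> g = x \<otimes> a" if g: "g \<in> N" for g
  proof -
    obtain x a where xa: "x \<in> P" "a \<in> torus P" "g = x \<otimes> a" using g N(2) unfolding bul_eq by (blast elim: mem_set_multE)
    have C: "x \<in> carrier S" "a \<in> carrier S" using xa AC QC Q(2) by auto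
    have "inv x \<otimes> g \<in> N" using xa(1) g PN subgroup.m_closed[OF N(1)] subgroup.m_inv_closed[OF N(1)] by blast
    then show ?thesis using xa C by auto
  qed
  have aconj: "\<psi> (a \<rhd> y) = w a \<rhd> \<psi> y" if a: "a \<in> torus P" "a \<in> N" and y: "y \<in> Q" for a y
  proof -
    have C: "a \<in> carrier S" "y \<in> carrier S" using a y AC QC by auto
    have yB: "y \<in> bul P" using y Q(3) by blast
    have ia: "inv a \<in> torus P" using a subgroup.m_inv_closed[OF torus_subgroup[OF P]] by blast
    have ya: "y \<rhd> inv a \<in> torus P"
      using torus_conj[OF bul_subgroup[OF P] yB, of "inv a"] torus_bul[OF P] ia by simp
    \<comment> \<open>The commutator of a and y lies both in Q and in torus P, so \<psi> z = w z is
      known, and a y a^-1 = z y.\<close>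
    define z where "z = a \<otimes> (y \<rhd> inv a)"
    have zt: "z \<in> torus P" using a ya subgroup.m_closed[OF torus_subgroup[OF P]] by (simp add: z_def)
    have zy: "a \<rhd> y = z \<otimes> y" using C by (simp add: z_def m_assoc)
    have ayQ: "a \<rhd> y \<in> Q" using normalizerD(2)[OF sQ] a N(4) y by blast
    have "z = (a \<rhd> y) \<otimes> inv y" using C by (simp add: z_def m_assoc)
    then have zQ: "z \<in> Q" using ayQ y subgroup.m_closed[OF sQ] subgroup.m_inv_closed[OF sQ] by simp
    have pyC: "\<psi> y \<in> carrier S" using mor_closed[OF psi(1) y] .
    have iaQ: "inv a \<in> torus Q" using torus_mono[OF P sQ Q(2)] ia by blast
    have "\<psi> z = w z" by (rule torus_unique[OF psi(1) P Q(2) w(1) wpsi zQ zt])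
    also have "\<dots> = w a \<otimes> w (y \<rhd> inv a)"
      unfolding z_def using W_mult[OF w(1)] a ya torus_T[OF P] by blast
    also have "w (y \<rhd> inv a) = v (y \<rhd> inv a)" using vw[OF ya] by simp
    also have "\<dots> = \<psi> y \<rhd> v (inv a)" by (rule torus_equivariant[OF psi(1) v y iaQ])
    also have "v (inv a) = inv (w a)" using vw[OF ia] mor_inv_elem[of T w a] w(1) a torus_T[OF P] by (auto simp: W_def)
    finally have "\<psi> z = w a \<otimes> (\<psi> y \<rhd> inv (w a))" .
    then have "\<psi> (z \<otimes> y) = w a \<rhd> \<psi> y"
      using mor_mult[OF psi(1) zQ y] wC[OF a(1)] pyC by (simp add: m_assoc)
    then show ?thesis using zy by simp
  qed
  have wM: "w a \<in> ?M" if a: "a \<in> torus P" "a \<in> N" for a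
  proof (rule normalizerI[OF R wC[OF a(1)]])
    fix r assume "r \<in> ?R"
    then obtain y where y: "y \<in> Q" "r = \<psi> y" by blast
    have "a \<rhd> y \<in> Q" using normalizerD(2)[OF sQ] a N(4) y by blast
    then show "w a \<rhd> r \<in> ?R" using aconj[OF a y(1)] y by (metis image_eqI)
  qed
  obtain \<eta> where eta: "mor N \<eta>" "\<And>x. x \<in> Q \<Longrightarrow> \<eta> x = \<chi> (\<psi> x)"
  proof (rule receptive_extension[OF _ _ mc imc N(1,4,3)])
    show "receptive S F (\<chi> ` ?R)" "subgroup (\<chi> ` ?R) S" using chi(2) by (auto simp: good_def)
    fix g assume "g \<in> N"
    then obtain x a where xa: "x \<in> P" "a \<in> torus P" "a \<in> N" "g = x \<otimes> a" using decomp by blast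
    have xQ: "x \<in> Q" using xa Q(2) by blast
    have C: "x \<in> carrier S" "a \<in> carrier S" using xQ xa AC QC by auto
    let ?h = "\<psi> x \<otimes> w a"
    have hM: "?h \<in> ?M" using RM xQ wM[OF xa(2,3)] subgroup.m_closed[OF M] by blast
    have "\<chi> (\<psi> (g \<rhd> y)) = \<chi> ?h \<rhd> \<chi> (\<psi> y)" if y: "y \<in> Q" for y
    proof -
      have ay: "a \<rhd> y \<in> Q" using normalizerD(2)[OF sQ] xa(3) N(4) y by blast
      have "g \<rhd> y = x \<rhd> (a \<rhd> y)"
        using xa(4) C QC[OF y] by (simp add: m_assoc inv_mult_group)
      then have "\<psi> (g \<rhd> y) = \<psi> x \<rhd> (w a \<rhd> \<psi> y)"
        using mor_conj_elem[OF psi(1) xQ ay] aconj[OF xa(2,3) y] by simp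
      also have "\<dots> = ?h \<rhd> \<psi> y"
        using mor_closed[OF psi(1)] xQ y wC[OF xa(2)] by (simp add: m_assoc inv_mult_group)
      finally show ?thesis using mor_conj_elem[OF chi(1) hM, of "\<psi> y"] y RM by auto
    qed
    then show "\<exists>h\<in>carrier S. \<forall>v\<in>Q. \<chi> (\<psi> (g \<rhd> v)) = h \<rhd> \<chi> (\<psi> v)"
      using mor_closed[OF chi(1) hM] by blast
  qed (blast intro: that)
  \<comment> \<open>Shows that \<eta> lands in the image of \<chi>: on torus P both \<eta> and
    \<chi> w are given by elements of W that agree on P^[m].\<close>
  have eta_a: "\<eta> a = \<chi> (w a)" if a: "a \<in> torus P" "a \<in> N" for a
  proof -
    obtain w1 where w1: "W w1" "\<And>x. x \<in> pw P \<Longrightarrow> w1 x = \<eta> x"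
      using W_exists[OF mor_subset[OF eta(1) P PN]] by blast
    have fP: "subgroup (f ` P) S" by (rule mor_image_subgroup[OF f])
    have fPM: "f ` P \<subseteq> ?M"
    proof -
      have "f ` P \<subseteq> ?R" using psi(2) Q(2) by (metis image_eqI image_subsetI subsetD)
      then show ?thesis using RM by blast
    qed
    obtain w2 where w2: "W w2" "\<And>x. x \<in> pw (f ` P) \<Longrightarrow> w2 x = \<chi> x"
      using W_exists[OF mor_subset[OF chi(1) fP fPM]] by blast
    have "\<eta> a = w1 a" by (rule torus_unique[OF eta(1) P PN w1 a(2,1)])
    moreover have "\<chi> (w a) = w2 (w a)"
      by (rule torus_unique[OF chi(1) fP fPM w2 wM[OF a]]) (use torus_image[OF f w] a in auto)
    moreover have "w1 a = w2 (w a)"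
    proof (rule W_agree[OF pw_T[OF P] w1(1) W_comp[OF w2(1) w(1)]])
      show "a \<in> fixT (pw P)" using a torus_fixT[OF P] by blast
      fix x assume x: "x \<in> pw P"
      then have xP: "x \<in> P" using pw_subset[OF P] by blast
      have "f x \<in> pw (f ` P)" using pw_image[OF f] x by blast
      then show "w1 x = w2 (w x)" using w1(2)[OF x] w2(2)[of "f x"] w(2)[OF x] eta(2)[of x] psi(2)[OF xP] xP Q(2) by auto
    qed
    ultimately show ?thesis by simp
  qed
  have im: "\<eta> ` N \<subseteq> \<chi> ` ?M"
  proof clarify
    fix g assume "g \<in> N"
    then obtain x a where xa: "x \<in> P" "a \<in> torus P" "a \<in> N" "g = x \<otimes> a" using decomp by blast
    have xQ: "x \<in> Q" using xa Q(2) by blast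
    have rM: "\<psi> x \<in> ?M" using RM xQ by blast
    have "\<eta> g = \<chi> (\<psi> x) \<otimes> \<chi> (w a)"
      using mor_mult[OF eta(1), of x a] xa PN eta(2)[OF xQ] eta_a[OF xa(2,3)] by auto
    also have "\<dots> = \<chi> (\<psi> x \<otimes> w a)" using mor_mult[OF chi(1) rM wM[OF xa(2,3)]] by simp
    finally show "\<eta> g \<in> \<chi> ` ?M" using subgroup.m_closed[OF M rM wM[OF xa(2,3)]] by blast
  qed
  let ?\<theta> = "\<lambda>g. inv_into ?M \<chi> (\<eta> g)"
  have "mor N ?\<theta>" by (rule mor_comp[OF eta(1) mor_inv_into[OF chi(1)] im])
  moreover have "?\<theta> x = f x" if x: "x \<in> P" for x
  proof -
    have xQ: "x \<in> Q" using x Q(2) by blast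
    have "\<psi> x \<in> ?M" using RM xQ by blast
    then show ?thesis using eta(2)[OF xQ] psi(2)[OF x] mor_inj[OF chi(1)] by simp
  qed
  ultimately show ?thesis by blast
qed

text \<open>torus P is the union of the finite groups \<Omega> n of its elements killed by p^n.
  Inside P \<Omega> n a maximal subgroup to which f extends is everything: otherwise its normalizer
  is bigger and \<open>extension_step\<close> goes further, since subgroups between P and
  P^\<bullet> belong to the family. The extensions for different n agree by uniqueness and are glued
  by closedness.\<close>

lemma HH_bul_extension:
  assumes P: "P \<in> HH" and f: "mor P f"
  shows "\<exists>g. mor (bul P) g \<and> (\<forall>x\<in>P. g x = f x)"
proof -
  have sP: "subgroup P S" by (rule mor_subgroup[OF f])
  note A = torus_subgroup[OF sP]
  have AT: "torus P \<subseteq> T" by (rule torus_T[OF sP])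
  define \<Omega> where "\<Omega> n = {a \<in> torus P. a [^] (p ^ n :: nat) = \<one>}" for n
  have AC: "\<And>a. a \<in> torus P \<Longrightarrow> a \<in> carrier S" using AT T_subset by blast
  have PC: "\<And>x. x \<in> P \<Longrightarrow> x \<in> carrier S" using subgroup.mem_carrier[OF sP] .
  have fin: "finite (\<Omega> n)" for n by (rule finite_subset[OF _ finite_omega[of n]]) (use AT in \<open>auto simp: \<Omega>_def\<close>)
  have sO: "subgroup (\<Omega> n) S" for n
  proof
    show "\<Omega> n \<subseteq> carrier S" using AC by (auto simp: \<Omega>_def)
    show "\<one> \<in> \<Omega> n" using subgroup.one_closed[OF A] by (simp add: \<Omega>_def)
    show "x \<otimes> y \<in> \<Omega> n" if "x \<in> \<Omega> n" "y \<in> \<Omega> n" for x y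
      using that T_pow[of x y "p ^ n"] AT subgroup.m_closed[OF A] by (auto simp: \<Omega>_def)
    show "inv x \<in> \<Omega> n" if "x \<in> \<Omega> n" for x
      using that AC subgroup.m_inv_closed[OF A] by (auto simp: \<Omega>_def nat_pow_inv)
  qed
  have cO: "x \<rhd> a \<in> \<Omega> n" if "x \<in> P" "a \<in> \<Omega> n" for x a n
    using that torus_conj[OF sP, of x a] hom_on_pow[OF conj_hom_on[OF PC[OF that(1)] order_refl] subgroup_carrier, of a "p ^ n"] AC PC
    by (auto simp: \<Omega>_def)
  define Pn where "Pn n = P <#> \<Omega> n" for n
  have Pn: "subgroup (Pn n) S" "P \<subseteq> Pn n" "\<Omega> n \<subseteq> Pn n" for n
    unfolding Pn_def using set_mult_subgroup[OF sP sO cO] by auto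
  have PnB: "Pn n \<subseteq> bul P" for n unfolding Pn_def bul_eq by (auto simp: set_mult_def \<Omega>_def)
  have ext: "\<exists>\<psi>. mor (Pn n) \<psi> \<and> (\<forall>x\<in>P. \<psi> x = f x)" for n
  proof -
    \<comment> \<open>Maximality is measured by the intersection with \<Omega> n, which is finite
      while the subgroups need not be; as they contain P, any growth inside P \<Omega> n shows up
      there.\<close>
    define E where "E Q \<longleftrightarrow> P \<subseteq> Q \<and> Q \<subseteq> Pn n \<and> (\<exists>\<psi>. mor Q \<psi> \<and> (\<forall>x\<in>P. \<psi> x = f x))" for Q
    have "E P" using f Pn(2) by (auto simp: E_def)
    moreover have "\<forall>Q. E Q \<longrightarrow> card (Q \<inter> \<Omega> n) < Suc (card (\<Omega> n))"
      using fin by (simp add: less_Suc_eq_le card_mono)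
    ultimately obtain Q where Q: "E Q" and max: "\<And>R. E R \<Longrightarrow> card (R \<inter> \<Omega> n) \<le> card (Q \<inter> \<Omega> n)"
      using ex_has_greatest_nat[of E P "\<lambda>Q. card (Q \<inter> \<Omega> n)" "Suc (card (\<Omega> n))"] by auto
    obtain \<psi> where psi: "mor Q \<psi>" "\<And>x. x \<in> P \<Longrightarrow> \<psi> x = f x" using Q by (auto simp: E_def)
    have PQ: "P \<subseteq> Q" and QPn: "Q \<subseteq> Pn n" using Q by (auto simp: E_def)
    have sQ: "subgroup Q S" by (rule mor_subgroup[OF psi(1)])
    have QB: "Q \<subseteq> bul P" using QPn PnB by blast
    have QH: "Q \<in> HH" using HH_up P sQ PQ QB by blast
    have "Q = Pn n"
    proof (rule ccontr)
      assume "Q \<noteq> Pn n"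
      then obtain g where g: "g \<in> Pn n" "g \<notin> Q" "g \<in> normalizer S Q"
        using normalizer_growth[OF sQ Pn(1)] QPn by blast
      define N where "N = normalizer S Q \<inter> Pn n"
      have N: "subgroup N S" unfolding N_def by (rule subgroups_Inter_pair[OF normalizer_subgroup[OF sQ] Pn(1)])
      have QN: "Q \<subseteq> N" using normalizer_contains[OF sQ] QPn by (auto simp: N_def)
      have "\<exists>\<theta>. mor N \<theta> \<and> (\<forall>x\<in>P. \<theta> x = f x)"
        by (rule extension_step[OF sP f QH PQ QB psi N _ QN]) (use PnB in \<open>auto simp: N_def\<close>)
      then have EN: "E N" using QN PQ by (auto simp: E_def N_def)
      have gN: "g \<in> N" using g by (simp add: N_def)
      obtain x a where xa: "x \<in> P" "a \<in> \<Omega> n" "g = x \<otimes> a" using g(1) unfolding Pn_def by (rule mem_set_multE)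
      have aC: "a \<in> carrier S" using xa AC by (auto simp: \<Omega>_def)
      have "inv x \<otimes> g \<in> N" using xa(1) gN PQ QN subgroup.m_closed[OF N] subgroup.m_inv_closed[OF N] by blast
      then have "a \<in> N" using xa PC aC by simp
      moreover have "a \<notin> Q" using g(2) xa PQ subgroup.m_closed[OF sQ] by blast
      ultimately have "Q \<inter> \<Omega> n \<subset> N \<inter> \<Omega> n" using xa QN by blast
      then have "card (Q \<inter> \<Omega> n) < card (N \<inter> \<Omega> n)" using fin by (intro psubset_card_mono) auto
      then show False using max[OF EN] by simp
    qed
    then show ?thesis using psi by blast
  qed
  then obtain \<psi> where psi: "\<And>n. mor (Pn n) (\<psi> n)" "\<And>n x. x \<in> P \<Longrightarrow> \<psi> n x = f x" by metis
  have OS: "\<Omega> n \<subseteq> \<Omega> (Suc n)" for n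
    using AC by (auto simp: \<Omega>_def nat_pow_pow[symmetric] mult.commute[of p])
  have PS: "Pn n \<subseteq> Pn (Suc n)" for n unfolding Pn_def set_mult_def using OS[of n] by blast
  have mono: "Pn m \<subseteq> Pn n" if "m \<le> n" for m n using lift_Suc_mono_le[of Pn m n] PS that by blast
  have U: "(\<Union>n. Pn n) = bul P"
  proof
    show "(\<Union>n. Pn n) \<subseteq> bul P" using PnB by blast
    show "bul P \<subseteq> (\<Union>n. Pn n)"
    proof
      fix z assume "z \<in> bul P"
      then obtain x a where xa: "x \<in> P" "a \<in> torus P" "z = x \<otimes> a" unfolding bul_eq by (rule mem_set_multE)
      obtain n where "a [^] (p ^ n :: nat) = \<one>" using torsion AC xa by blast
      then have "z \<in> Pn n" using xa by (auto simp: Pn_def set_mult_def \<Omega>_def)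
      then show "z \<in> (\<Union>n. Pn n)" by blast
    qed
  qed
  have compat: "\<psi> m z = \<psi> n z" if "z \<in> Pn m" "m \<le> n" for m n z
    by (rule bul_unique[OF psi(1) mor_subset[OF psi(1) Pn(1) mono[OF that(2)]] sP Pn(2) PnB _ that(1)])
      (simp add: psi(2))
  define g where "g z = \<psi> (LEAST n. z \<in> Pn n) z" for z
  have gn: "g z = \<psi> n z" if z: "z \<in> Pn n" for z n
  proof -
    have "z \<in> Pn (LEAST n. z \<in> Pn n)" by (rule LeastI) (rule z)
    moreover have "(LEAST n. z \<in> Pn n) \<le> n" by (rule Least_le) (rule z)
    ultimately show ?thesis using compat by (simp add: g_def)
  qed
  have "mor (Pn n) g" for n using psi(1)[of n] mor_cong[of "Pn n" g "\<psi> n"] gn by blast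
  moreover have "Pn n \<in> HH" for n using HH_up P Pn(1,2) PnB by blast
  ultimately have "mor (\<Union>n. Pn n) g" using HH_union[of Pn g] PS U bul_subgroup[OF sP] by simp
  moreover have "g x = f x" if "x \<in> P" for x using gn[of x 0] psi(2)[OF that] Pn(2) that by auto
  ultimately show ?thesis unfolding U by blast
qed

text \<open>Having an extension to the bullet passes to restrictions, since the bullet is monotone,
  and to composites, since a map on P^\<bullet> takes it onto the bullet of the image of P. So
  generation reduces the claim to morphisms between members of the family.\<close>

lemma bul_extension:
  assumes f: "mor P f"
  obtains g where "mor (bul P) g" "\<And>x. x \<in> P \<Longrightarrow> g x = f x"
proof -
  have P: "subgroup P S" by (rule mor_subgroup[OF f])
  have *: "subgroup A S \<and> mor A \<phi> \<and> \<phi> ` A \<subseteq> B \<and> (\<exists>g. mor (bul A) g \<and> (\<forall>x\<in>A. g x = \<phi> x)) \<and> subgroup B S"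
    if "composite_of_restrictions S F HH A B \<phi>" for A B \<phi>
    using that
  proof (induction rule: composite_of_restrictions.induct)
    case (restriction P Q \<phi> P' Q')
    have sP: "subgroup P S" and sQ: "subgroup Q S" using HH_sub restriction by auto
    have m: "mor P \<phi>" using F_mor_iff[OF sP sQ] restriction by blast
    obtain g where g: "mor (bul P) g" "\<forall>x\<in>P. g x = \<phi> x" using HH_bul_extension[OF _ m] restriction by blast
    have "mor (bul P') g"
      using mor_subset[OF g(1) bul_subgroup bul_mono[OF _ sP]] restriction by blast
    moreover have "mor P' (restrict \<phi> P')"
      using mor_subset[OF m] restriction mor_cong[of P' "restrict \<phi> P'" \<phi>] by simp
    moreover have "\<forall>x\<in>P'. g x = restrict \<phi> P' x" using g(2) restriction by auto
    moreover have "restrict \<phi> P' ` P' \<subseteq> Q'" using restriction by auto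
    ultimately show ?case using restriction by blast
  next
    case (composition P Q \<phi> R \<psi>)
    then obtain g h where g: "mor (bul P) g" "\<forall>x\<in>P. g x = \<phi> x" and h: "mor (bul Q) h" "\<forall>x\<in>Q. h x = \<psi> x" by blast
    have sP: "subgroup P S" and sQ: "subgroup Q S" and im: "\<phi> ` P \<subseteq> Q" using composition by auto
    have "g ` P = \<phi> ` P" using g(2) by (intro image_cong) auto
    moreover have "subgroup (\<phi> ` P) S" using mor_image_subgroup composition by blast
    ultimately have "g ` bul P \<subseteq> bul Q" using bul_image[OF g(1) sP] bul_mono[OF _ sQ im] by simp
    then have "mor (bul P) (\<lambda>x. h (g x))" by (rule mor_comp[OF g(1) h(1)])
    moreover have "\<forall>x\<in>P. h (g x) = compose P \<psi> \<phi> x" using g(2) h(2) im by (auto simp: compose_def)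
    moreover have "mor P (\<lambda>x. \<psi> (\<phi> x))" using mor_comp[of P \<phi> Q \<psi>] composition by blast
    then have "mor P (compose P \<psi> \<phi>)" using mor_cong[of P "compose P \<psi> \<phi>" "\<lambda>x. \<psi> (\<phi> x)"] by (simp add: compose_def)
    moreover have "compose P \<psi> \<phi> ` P \<subseteq> R" using composition by (auto simp: compose_def)
    ultimately show ?case using composition by blast
  qed
  have "restrict f P \<in> F P (carrier S)" using f by (simp add: mor_def)
  then have "composite_of_restrictions S F HH P (carrier S) (restrict f P)"
    using HH_gen P subgroup_carrier by (simp add: family_generated_def)
  then obtain g where "mor (bul P) g" "\<forall>x\<in>P. g x = restrict f P x" using * by blast
  then show ?thesis using that by simp
qed

text \<open>Extension to bullets turns any morphism into an injection of bullets; in particular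
  depth is constant on conjugacy classes.\<close>

lemma depth_mor:
  assumes f: "mor P f" and Q: "subgroup Q S" "f ` P \<subseteq> Q"
  shows "depth P \<le> depth Q"
proof -
  have P: "subgroup P S" by (rule mor_subgroup[OF f])
  obtain g where g: "mor (bul P) g" "\<And>x. x \<in> P \<Longrightarrow> g x = f x" using bul_extension[OF f] by blast
  have "g ` P = f ` P" using g(2) by (intro image_cong) auto
  then have "g ` bul P \<subseteq> bul Q" using bul_image[OF g(1) P] bul_mono[OF mor_image_subgroup[OF f] Q] by simp
  then show ?thesis using depth_mono[OF P Q(1) g(1)] by blast
qed

lemma depth_image:
  assumes f: "mor P f" shows "depth (f ` P) = depth P"
proof (rule antisym)
  show "depth P \<le> depth (f ` P)" by (rule depth_mor[OF f mor_image_subgroup[OF f] order_refl])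
  show "depth (f ` P) \<le> depth P"
    by (rule depth_mor[OF mor_inv_into[OF f] mor_subgroup[OF f]]) (simp add: inv_into_image_cancel[OF mor_inj[OF f] order_refl])
qed

text \<open>Depths are bounded, so from some N on all P n have the same bullet. The extension of
  \<phi> from P N to this common bullet agrees with \<phi> on every later P n by uniqueness.\<close>

lemma continuity:
  assumes Pn: "\<And>n::nat. subgroup (P n) S \<and> P n \<subseteq> P (Suc n)" and phi: "\<phi> \<in> Hom_grp S (\<Union>n. P n) (carrier S)"
    and res: "\<And>n. restrict \<phi> (P n) \<in> F (P n) (carrier S)"
  shows "\<phi> \<in> F (\<Union>n. P n) (carrier S)"
proof -
  have mono: "P m \<subseteq> P n" if "m \<le> n" for m n by (rule lift_Suc_mono_le[OF _ that]) (use Pn in blast)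
  have m: "mor (P n) \<phi>" for n using Pn res by (simp add: mor_def)
  obtain D where D: "\<forall>P. subgroup P S \<longrightarrow> depth P \<le> D" using depth_bounded by blast
  obtain N where N: "\<And>n. depth (P n) \<le> depth (P N)"
    using ex_has_greatest_nat[of "\<lambda>_. True" 0 "\<lambda>n. depth (P n)" "Suc D"] D Pn by (auto simp: less_Suc_eq_le)
  have stable: "bul (P n) = bul (P N)" if "n \<ge> N" for n
    using depth_subset(2)[of "P N" "P n"] Pn mono[OF that] N by metis
  obtain g where g: "mor (bul (P N)) g" "\<And>x. x \<in> P N \<Longrightarrow> g x = \<phi> x" using bul_extension[OF m] by blast
  have eq: "g x = \<phi> x" if n: "n \<ge> N" and x: "x \<in> P n" for n x
  proof -
    obtain h where h: "mor (bul (P n)) h" "\<And>x. x \<in> P n \<Longrightarrow> h x = \<phi> x" using bul_extension[OF m] by blast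
    have xB: "x \<in> bul (P N)" using bul_contains[of "P n"] Pn x stable[OF n] by blast
    have "g x = h x"
    proof (rule bul_unique[OF g(1) _ _ bul_contains order_refl _ xB])
      show "mor (bul (P N)) h" using h(1) stable[OF n] by simp
      show "g y = h y" if "y \<in> P N" for y using g(2)[OF that] h(2)[of y] mono[OF n] that by auto
    qed (use Pn in auto)
    then show ?thesis using h(2)[OF x] by simp
  qed
  have ex: "\<exists>n\<ge>N. x \<in> P n" if x: "x \<in> (\<Union>n. P n)" for x
  proof -
    obtain k where "x \<in> P k" using x by blast
    then show ?thesis using mono[of k "max k N"] by (intro exI[of _ "max k N"]) auto
  qed
  have sU: "subgroup (\<Union>n. P n) S"
  proof
    show "(\<Union>n. P n) \<subseteq> carrier S" using Pn subgroup.subset by blast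
    show "\<one> \<in> (\<Union>n. P n)" using subgroup.one_closed Pn by blast
    fix x assume "x \<in> (\<Union>n. P n)"
    then obtain k where k: "x \<in> P k" by blast
    then have "inv x \<in> P k" using subgroup.m_inv_closed[of "P k" S x] Pn by blast
    then show "inv x \<in> (\<Union>n. P n)" by blast
    fix y assume "y \<in> (\<Union>n. P n)"
    then obtain l where l: "y \<in> P l" by blast
    have "x \<in> P (max k l)" "y \<in> P (max k l)" using k l mono[of k "max k l"] mono[of l "max k l"] by auto
    then have "x \<otimes> y \<in> P (max k l)" using subgroup.m_closed[of "P (max k l)" S] Pn by blast
    then show "x \<otimes> y \<in> (\<Union>n. P n)" by blast
  qed
  have "(\<Union>n. P n) \<subseteq> bul (P N)"
  proof
    fix x assume "x \<in> (\<Union>n. P n)"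
    then obtain n where "n \<ge> N" "x \<in> P n" using ex by blast
    then show "x \<in> bul (P N)" using bul_contains[of "P n"] Pn stable by blast
  qed
  then have "mor (\<Union>n. P n) g" by (rule mor_subset[OF g(1) sU])
  then have "mor (\<Union>n. P n) \<phi>" using mor_cong[of "\<Union>n. P n" g \<phi>] ex eq by blast
  moreover have "\<phi> \<in> extensional (\<Union>n. P n)" using phi by (simp add: Hom_grp_def)
  ultimately show ?thesis unfolding mor_def by (simp add: extensional_restrict)
qed

end

section \<open>Stabilizers and normal p-subgroups of automorphism groups\<close>

context fusion begin

lemma stab_restrict:
  assumes U: "subgroup U S" and Y: "subgroup Y S" "Y \<subseteq> U"
  shows "\<gamma> \<in> stab U Y \<Longrightarrow> restrict \<gamma> Y \<in> Aut_F F Y"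
    and "(\<lambda>\<gamma>. restrict \<gamma> Y) \<in> hom ((BijGroup U)\<lparr>carrier := stab U Y\<rparr>) (BijGroup Y)"
proof -
  let ?r = "\<lambda>\<gamma>. restrict \<gamma> Y"
  show rA: "?r \<gamma> \<in> Aut_F F Y" if "\<gamma> \<in> stab U Y" for \<gamma>
    using that mor_subset[OF _ Y] Aut_F_iff[OF U] restrict_Aut_F by (auto simp: stab_def)
  have stB: "\<And>\<gamma>. \<gamma> \<in> stab U Y \<Longrightarrow> \<gamma> \<in> Bij U" using Aut_F_Bij[OF U] by (auto simp: stab_def)
  have rB: "\<And>\<gamma>. \<gamma> \<in> stab U Y \<Longrightarrow> ?r \<gamma> \<in> Bij Y" using rA Aut_F_Bij[OF Y(1)] by blast
  show "?r \<in> hom ((BijGroup U)\<lparr>carrier := stab U Y\<rparr>) (BijGroup Y)"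
  proof (rule homI)
    fix \<gamma> assume g: "\<gamma> \<in> carrier ((BijGroup U)\<lparr>carrier := stab U Y\<rparr>)"
    then show "?r \<gamma> \<in> carrier (BijGroup Y)" using rB by simp
    fix \<delta> assume "\<delta> \<in> carrier ((BijGroup U)\<lparr>carrier := stab U Y\<rparr>)"
    with g have gd: "\<gamma> \<in> stab U Y" "\<delta> \<in> stab U Y" by auto
    have "\<delta> y \<in> Y" if "y \<in> Y" for y using gd(2) that by (auto simp: stab_def)
    then have "?r (compose U \<gamma> \<delta>) = compose Y (?r \<gamma>) (?r \<delta>)" using Y(2) by (auto simp: compose_def fun_eq_iff)
    then show "?r (\<gamma> \<otimes>\<^bsub>(BijGroup U)\<lparr>carrier := stab U Y\<rparr>\<^esub> \<delta>) = ?r \<gamma> \<otimes>\<^bsub>BijGroup Y\<^esub> ?r \<delta>"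
      using gd stB rB by simp
  qed
qed

text \<open>By the extension assumption, restriction to Y maps stab U Y onto Aut_F(Y); it takes the
  part in Aut_S(U) into Aut_S(Y), so the index can only drop to a divisor.\<close>

lemma stab_fully_automized:
  assumes U: "subgroup U S" and sg: "stab_good U Y" and Y: "subgroup Y S" "Y \<subseteq> U"
    and ext: "\<And>\<alpha>. mor Y \<alpha> \<Longrightarrow> \<alpha> ` Y = Y \<Longrightarrow> \<exists>g. mor U g \<and> g ` U = U \<and> (\<forall>y\<in>Y. g y = \<alpha> y)"
  shows "fully_automized p S F Y"
proof -
  let ?r = "\<lambda>\<gamma>. restrict \<gamma> Y"
  have st: "subgroup (stab U Y) (BijGroup U)" by (rule stab_subgroup[OF U Y(2)])
  note rA = stab_restrict(1)[OF U Y] and hom = stab_restrict(2)[OF U Y]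
  have rS: "?r ` (Aut_S S U \<inter> stab U Y) \<subseteq> Aut_S S Y"
  proof clarify
    fix \<gamma> assume g: "\<gamma> \<in> Aut_S S U" "\<gamma> \<in> stab U Y"
    then obtain h where h: "h \<in> normalizer S U" "\<gamma> = (\<lambda>u\<in>U. h \<rhd> u)" using Aut_S_iff[OF U] by blast
    have hY: "h \<rhd> y \<in> Y" if y: "y \<in> Y" for y
    proof -
      have "\<gamma> y \<in> Y" using g(2) y by (auto simp: stab_def)
      then show ?thesis using h(2) y Y(2) by auto
    qed
    have "h \<in> normalizer S Y" by (rule normalizerI[OF Y(1) normalizerD(1)[OF U h(1)] hY])
    moreover have "?r \<gamma> = (\<lambda>y\<in>Y. h \<rhd> y)" using h(2) Y(2) by (auto simp: fun_eq_iff)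
    ultimately show "?r \<gamma> \<in> Aut_S S Y" using conj_Aut_S[OF Y(1)] by simp
  qed
  have "?r ` stab U Y = Aut_F F Y"
  proof
    show "?r ` stab U Y \<subseteq> Aut_F F Y" using rA by blast
    show "Aut_F F Y \<subseteq> ?r ` stab U Y"
    proof
      fix \<alpha> assume "\<alpha> \<in> Aut_F F Y"
      then have a: "mor Y \<alpha>" "\<alpha> ` Y = Y" "\<alpha> \<in> extensional Y" using Aut_F_iff[OF Y(1)] by auto
      obtain g where g: "mor U g" "g ` U = U" "\<forall>y\<in>Y. g y = \<alpha> y" using ext[OF a(1,2)] by blast
      have "restrict g U ` Y = \<alpha> ` Y" using g(3) Y(2) by (intro image_cong) auto
      then have "restrict g U \<in> stab U Y" using restrict_Aut_F[OF g(1,2)] a(2) by (simp add: stab_def)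
      moreover have "?r (restrict g U) = \<alpha>" using g(3) Y(2) a(3) by (auto simp: fun_eq_iff extensional_def)
      ultimately show "\<alpha> \<in> ?r ` stab U Y" by blast
    qed
  qed
  then show ?thesis
    using coprime_index_hom[OF group_BijGroup group_BijGroup Aut_S_subgroup[OF U] Aut_S_subgroup[OF Y(1)] st hom rS]
      sg by (simp add: fully_automized_iff stab_good_def)
qed

text \<open>Torsion is asked in place of finiteness because K is meant to contain Inn(R), which is
  infinite in general.\<close>

definition normal_p_aut :: "'a set \<Rightarrow> ('a \<Rightarrow> 'a) set \<Rightarrow> bool" where
  "normal_p_aut R K \<longleftrightarrow> subgroup K (BijGroup R) \<and> K \<subseteq> Aut_F F R \<and>
     (\<forall>\<alpha>\<in>Aut_F F R. \<forall>\<kappa>\<in>K. \<alpha> \<otimes>\<^bsub>BijGroup R\<^esub> \<kappa> \<otimes>\<^bsub>BijGroup R\<^esub> inv\<^bsub>BijGroup R\<^esub> \<alpha> \<in> K) \<and>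
     (\<forall>\<kappa>\<in>K. \<exists>n::nat. \<kappa> [^]\<^bsub>BijGroup R\<^esub> (p ^ n) = \<one>\<^bsub>BijGroup R\<^esub>)"

lemma normal_p_aut_transport:
  assumes K: "normal_p_aut R K" and f: "mor R f"
  shows "normal_p_aut (f ` R) (transport R f ` K)"
proof -
  interpret B: group "BijGroup R" by (rule group_BijGroup)
  interpret C: group "BijGroup (f ` R)" by (rule group_BijGroup)
  have R: "subgroup R S" by (rule mor_subgroup[OF f])
  note A = Aut_F_subgroup[OF R]
  let ?t = "transport R f"
  interpret h: group_hom "(BijGroup R)\<lparr>carrier := Aut_F F R\<rparr>" "BijGroup (f ` R)" ?t
    using transport_hom[OF f] B.subgroup_imp_group[OF A] C.is_group by (simp add: group_hom_def group_hom_axioms_def)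
  have sK: "subgroup K (BijGroup R)" and KA: "K \<subseteq> Aut_F F R" using K by (auto simp: normal_p_aut_def)
  show ?thesis unfolding normal_p_aut_def
  proof (intro conjI ballI)
    show "subgroup (?t ` K) (BijGroup (f ` R))"
      using h.subgroup_img_is_subgroup B.subgroup_incl[OF sK A KA] by blast
    show "?t ` K \<subseteq> Aut_F F (f ` R)" using transport_Aut[OF f] KA by blast
    fix \<kappa> assume "\<kappa> \<in> ?t ` K"
    then obtain k where k: "k \<in> K" "\<kappa> = ?t k" by blast
    obtain n where "k [^]\<^bsub>BijGroup R\<^esub> (p ^ n :: nat) = \<one>\<^bsub>BijGroup R\<^esub>" using K k by (auto simp: normal_p_aut_def)
    moreover have "k \<in> Aut_F F R" using k KA by blast
    ultimately have "\<kappa> [^]\<^bsub>BijGroup (f ` R)\<^esub> (p ^ n) = \<one>\<^bsub>BijGroup (f ` R)\<^esub>"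
      using h.hom_nat_pow[of k "p ^ n"] h.hom_one k by (simp add: B.nat_pow_consistent[symmetric])
    then show "\<exists>n::nat. \<kappa> [^]\<^bsub>BijGroup (f ` R)\<^esub> (p ^ n) = \<one>\<^bsub>BijGroup (f ` R)\<^esub>" by blast
    fix \<alpha> assume "\<alpha> \<in> Aut_F F (f ` R)"
    then obtain a where a: "a \<in> Aut_F F R" "\<alpha> = ?t a" using transport_surj[OF f] by blast
    have ia: "inv\<^bsub>BijGroup R\<^esub> a \<in> Aut_F F R" using subgroup.m_inv_closed[OF A a(1)] .
    have "inv\<^bsub>(BijGroup R)\<lparr>carrier := Aut_F F R\<rparr>\<^esub> a = inv\<^bsub>BijGroup R\<^esub> a" using B.m_inv_consistent[OF A a(1)] .
    then have ti: "?t (inv\<^bsub>BijGroup R\<^esub> a) = inv\<^bsub>BijGroup (f ` R)\<^esub> \<alpha>" using h.hom_inv[of a] a by simp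
    have kA: "k \<in> Aut_F F R" using k KA by blast
    have akA: "a \<otimes>\<^bsub>BijGroup R\<^esub> k \<in> Aut_F F R" using subgroup.m_closed[OF A a(1) kA] .
    have "?t (a \<otimes>\<^bsub>BijGroup R\<^esub> k \<otimes>\<^bsub>BijGroup R\<^esub> inv\<^bsub>BijGroup R\<^esub> a) = \<alpha> \<otimes>\<^bsub>BijGroup (f ` R)\<^esub> \<kappa> \<otimes>\<^bsub>BijGroup (f ` R)\<^esub> inv\<^bsub>BijGroup (f ` R)\<^esub> \<alpha>"
      using h.hom_mult[of "a \<otimes>\<^bsub>BijGroup R\<^esub> k" "inv\<^bsub>BijGroup R\<^esub> a"] h.hom_mult[of a k] akA ia a kA k ti by simp
    moreover have "a \<otimes>\<^bsub>BijGroup R\<^esub> k \<otimes>\<^bsub>BijGroup R\<^esub> inv\<^bsub>BijGroup R\<^esub> a \<in> K" using K a k by (auto simp: normal_p_aut_def)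
    ultimately show "\<alpha> \<otimes>\<^bsub>BijGroup (f ` R)\<^esub> \<kappa> \<otimes>\<^bsub>BijGroup (f ` R)\<^esub> inv\<^bsub>BijGroup (f ` R)\<^esub> \<alpha> \<in> ?t ` K" by (metis image_eqI)
  qed
qed

text \<open>Restriction maps \<open>Aut\<^sub>S(U) \<inter> stab U Y\<close> onto a subgroup of index prime to \<open>p\<close> in the image
  of \<open>stab U Y\<close>, which therefore contains every normal \<open>p\<close>-subgroup of that image.\<close>

lemma normal_p_aut_realized:
  assumes U: "subgroup U S" and sg: "stab_good U Y" and Y: "subgroup Y S" "Y \<subseteq> U"
    and K: "normal_p_aut Y K" and g: "\<gamma> \<in> stab U Y" "restrict \<gamma> Y \<in> K"
  obtains h where "h \<in> normalizer S U \<inter> normalizer S Y" "\<And>y. y \<in> Y \<Longrightarrow> \<gamma> y = h \<rhd> y"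
proof -
  interpret B: group "BijGroup U" by (rule group_BijGroup)
  interpret C: group "BijGroup Y" by (rule group_BijGroup)
  let ?r = "\<lambda>\<gamma>. restrict \<gamma> Y"
  have st: "subgroup (stab U Y) (BijGroup U)" by (rule stab_subgroup[OF U Y(2)])
  note rA = stab_restrict(1)[OF U Y] and hom = stab_restrict(2)[OF U Y]
  interpret h: group_hom "(BijGroup U)\<lparr>carrier := stab U Y\<rparr>" "BijGroup Y" ?r
    using hom B.subgroup_imp_group[OF st] C.is_group by (simp add: group_hom_def group_hom_axioms_def)
  define H where "H = ?r ` stab U Y"
  define X where "X = ?r ` (Aut_S S U \<inter> stab U Y)"
  have sH: "subgroup H (BijGroup Y)" unfolding H_def using h.img_is_subgroup by simp
  have "subgroup (Aut_S S U \<inter> stab U Y) (BijGroup U)"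
    by (rule B.subgroups_Inter_pair[OF Aut_S_subgroup[OF U] st])
  then have "subgroup (Aut_S S U \<inter> stab U Y) ((BijGroup U)\<lparr>carrier := stab U Y\<rparr>)"
    using B.subgroup_incl[OF _ st] by blast
  then have sX: "subgroup X (BijGroup Y)" unfolding X_def using h.subgroup_img_is_subgroup by blast
  have ci: "C.coprime_index p X H" unfolding H_def
    by (rule coprime_index_hom[OF group_BijGroup group_BijGroup Aut_S_subgroup[OF U] sX st hom])
      (use sg in \<open>auto simp: stab_good_def X_def\<close>)
  have sK: "subgroup K (BijGroup Y)" using K by (simp add: normal_p_aut_def)
  define L where "L = K \<inter> H"
  have sL: "subgroup L (BijGroup Y)" unfolding L_def by (rule C.subgroups_Inter_pair[OF sK sH])
  have HM: "\<And>x y. x \<in> H \<Longrightarrow> y \<in> H \<Longrightarrow> x \<otimes>\<^bsub>BijGroup Y\<^esub> y \<in> H" and HI: "\<And>x. x \<in> H \<Longrightarrow> inv\<^bsub>BijGroup Y\<^esub> x \<in> H"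
    using subgroup.m_closed[OF sH] subgroup.m_inv_closed[OF sH] by auto
  have HA: "H \<subseteq> Aut_F F Y" using rA by (auto simp: H_def)
  have HC: "\<And>x. x \<in> H \<Longrightarrow> x \<in> carrier (BijGroup Y)" using subgroup.mem_carrier[OF sH] .
  have Lnorm: "x \<otimes>\<^bsub>BijGroup Y\<^esub> l \<otimes>\<^bsub>BijGroup Y\<^esub> inv\<^bsub>BijGroup Y\<^esub> x \<in> L" if "x \<in> H" "l \<in> L" for x l
    using that K HA HM HI by (auto simp: normal_p_aut_def L_def)
  obtain n where n: "n \<in> H" "\<And>y. y \<in> L \<Longrightarrow> n \<otimes>\<^bsub>BijGroup Y\<^esub> y \<otimes>\<^bsub>BijGroup Y\<^esub> inv\<^bsub>BijGroup Y\<^esub> n \<in> X"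
  proof (rule C.coprime_index_conjugate[OF prime_p sX sH sH order_refl _ ci sL])
    show "h \<otimes>\<^bsub>BijGroup Y\<^esub> n \<otimes>\<^bsub>BijGroup Y\<^esub> inv\<^bsub>BijGroup Y\<^esub> h \<in> H" if "h \<in> H" "n \<in> H" for h n using that HM HI by simp
    show "\<exists>n::nat. y [^]\<^bsub>BijGroup Y\<^esub> (p ^ n) = \<one>\<^bsub>BijGroup Y\<^esub>" if "y \<in> L" for y
      using that K by (auto simp: normal_p_aut_def L_def)
    show "\<exists>x\<in>X \<inter> H. \<exists>n\<in>H. y = x \<otimes>\<^bsub>BijGroup Y\<^esub> n" if "y \<in> L" for y
    proof (intro bexI)
      show "y \<in> H" using that by (simp add: L_def)
      then show "y = \<one>\<^bsub>BijGroup Y\<^esub> \<otimes>\<^bsub>BijGroup Y\<^esub> y" using C.l_one HC by metis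
      show "\<one>\<^bsub>BijGroup Y\<^esub> \<in> X \<inter> H" using subgroup.one_closed[OF sX] subgroup.one_closed[OF sH] by blast
    qed
  qed (blast intro: that)
  let ?y = "?r \<gamma>"
  \<comment> \<open>n conjugates L into X, and L is normal in H; applied to n^-1 y n this shows that
    y itself lies in X.\<close>
  have yL: "?y \<in> L" using g by (auto simp: L_def H_def)
  have c: "n \<in> carrier (BijGroup Y)" "?y \<in> carrier (BijGroup Y)" using HC n(1) yL by (auto simp: L_def)
  have "inv\<^bsub>BijGroup Y\<^esub> n \<otimes>\<^bsub>BijGroup Y\<^esub> ?y \<otimes>\<^bsub>BijGroup Y\<^esub> inv\<^bsub>BijGroup Y\<^esub> (inv\<^bsub>BijGroup Y\<^esub> n) \<in> L"
    by (rule Lnorm[OF HI[OF n(1)] yL])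
  then have "n \<otimes>\<^bsub>BijGroup Y\<^esub> (inv\<^bsub>BijGroup Y\<^esub> n \<otimes>\<^bsub>BijGroup Y\<^esub> ?y \<otimes>\<^bsub>BijGroup Y\<^esub> inv\<^bsub>BijGroup Y\<^esub> (inv\<^bsub>BijGroup Y\<^esub> n)) \<otimes>\<^bsub>BijGroup Y\<^esub> inv\<^bsub>BijGroup Y\<^esub> n \<in> X"
    by (rule n(2))
  moreover have "n \<otimes>\<^bsub>BijGroup Y\<^esub> (inv\<^bsub>BijGroup Y\<^esub> n \<otimes>\<^bsub>BijGroup Y\<^esub> ?y \<otimes>\<^bsub>BijGroup Y\<^esub> inv\<^bsub>BijGroup Y\<^esub> (inv\<^bsub>BijGroup Y\<^esub> n)) \<otimes>\<^bsub>BijGroup Y\<^esub> inv\<^bsub>BijGroup Y\<^esub> n = ?y"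
    using c by (simp only: C.inv_inv C.m_assoc C.inv_closed C.m_closed C.inv_cancel_left C.r_inv C.r_one)
  ultimately have "?y \<in> X" by simp
  then obtain x where x: "x \<in> Aut_S S U" "x \<in> stab U Y" "?y = ?r x" by (auto simp: X_def)
  obtain h where h: "h \<in> normalizer S U" "x = (\<lambda>u\<in>U. h \<rhd> u)" using x(1) Aut_S_iff[OF U] by blast
  have eq: "\<gamma> y = h \<rhd> y" if y: "y \<in> Y" for y
    using fun_cong[OF x(3), of y] y h(2) Y(2) by auto
  have "h \<rhd> y \<in> Y" if y: "y \<in> Y" for y
  proof -
    have "\<gamma> y \<in> Y" using g(1) y by (auto simp: stab_def)
    then show ?thesis using eq[OF y] by simp
  qed
  then have "h \<in> normalizer S Y" by (rule normalizerI[OF Y(1) normalizerD(1)[OF U h(1)]])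
  then show ?thesis using that[of h] h(1) eq by blast
qed

lemma normalizer_pullback:
  assumes g: "mor B g" and Q: "subgroup Q S" "Q \<subseteq> B" and z: "z \<in> B" "g z \<in> normalizer S (g ` Q)"
  shows "z \<in> normalizer S Q"
proof (rule normalizerI[OF Q(1)])
  have B: "subgroup B S" by (rule mor_subgroup[OF g])
  show "z \<in> carrier S" using z(1) subgroup.mem_carrier[OF B] by blast
  fix x assume x: "x \<in> Q"
  have gQ: "subgroup (g ` Q) S" using mor_image_subgroup[OF mor_subset[OF g Q]] .
  have zx: "z \<rhd> x \<in> B" using z(1) x Q(2) subgroup.m_closed[OF B] subgroup.m_inv_closed[OF B] by blast
  have "g (z \<rhd> x) = g z \<rhd> g x" using mor_conj_elem[OF g z(1)] x Q(2) by blast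
  also have "\<dots> \<in> g ` Q" using normalizerD(2)[OF gQ z(2)] x by blast
  finally obtain x' where "x' \<in> Q" "g (z \<rhd> x) = g x'" by blast
  then show "z \<rhd> x \<in> Q" using inj_onD[OF mor_inj[OF g], of "z \<rhd> x" x'] zx Q(2) by auto
qed

lemma mor_image_cancel: "mor B g \<Longrightarrow> A \<subseteq> B \<Longrightarrow> inv_into B g ` g ` A = A"
  using inv_into_image_cancel[OF mor_inj] .

lemma mor_inv_into_app: "mor B g \<Longrightarrow> x \<in> B \<Longrightarrow> inv_into B g (g x) = x"
  using mor_inj by simp

end

section \<open>Reduction from a subgroup to its bullet\<close>

context bullet_family begin

text \<open>Choose a good conjugate U of P^\<bullet> in which the image R of P satisfies
  \<open>stab_good\<close>; then U = R^\<bullet>. Automorphisms of R extend to U. For f from Q onto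
  R with extension g to Q^\<bullet>, the group N_f lies in N_g, because an equation between
  morphisms on Q persists on Q^\<bullet>. So R inherits both properties from U.\<close>

lemma nice_of_bul:
  assumes P: "subgroup P S" and nb: "nice (bul P)" shows "nice P"
proof -
  obtain U \<chi> where U: "good U" and chi: "mor (bul P) \<chi>" "\<chi> ` bul P = U" and sg: "stab_good U (\<chi> ` P)"
    using exists_stab_good[OF nb bul_contains[OF P]] by blast
  let ?R = "\<chi> ` P"
  have mP: "mor P \<chi>" by (rule mor_subset[OF chi(1) P bul_contains[OF P]])
  have R: "subgroup ?R S" by (rule mor_image_subgroup[OF mP])
  have UR: "U = bul ?R" using bul_image[OF chi(1) P] chi(2) by simp
  have sU: "subgroup U S" and rec: "receptive S F U" using U by (auto simp: good_def)
  have RU: "?R \<subseteq> U" unfolding UR by (rule bul_contains[OF R])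
  have "fully_automized p S F ?R"
  proof (rule stab_fully_automized[OF sU sg R RU])
    fix \<alpha> assume a: "mor ?R \<alpha>" "\<alpha> ` ?R = ?R"
    obtain g where g: "mor U g" "\<And>x. x \<in> ?R \<Longrightarrow> g x = \<alpha> x" using bul_extension[OF a(1)] unfolding UR by blast
    have "g ` ?R = \<alpha> ` ?R" using g(2) by (intro image_cong) auto
    then have "g ` U = U" using bul_image[of ?R g] g(1) R a(2) unfolding UR by simp
    then show "\<exists>g. mor U g \<and> g ` U = U \<and> (\<forall>y\<in>?R. g y = \<alpha> y)" using g by blast
  qed
  moreover have "receptive S F ?R"
  proof (rule receptiveI[OF R])
    fix Q f assume f: "mor Q f" "f ` Q = ?R"
    have Q: "subgroup Q S" by (rule mor_subgroup[OF f(1)])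
    obtain g where g: "mor (bul Q) g" "\<And>x. x \<in> Q \<Longrightarrow> g x = f x" using bul_extension[OF f(1)] by blast
    have "g ` Q = f ` Q" using g(2) by (intro image_cong) auto
    then have gU: "g ` bul Q = U" using bul_image[OF g(1) Q] f(2) UR by simp
    have B: "subgroup (bul Q) S" by (rule bul_subgroup[OF Q])
    have QB: "Q \<subseteq> bul Q" by (rule bul_contains[OF Q])
    have NE: "subgroup (N_ext S Q f) S" "subgroup (N_ext S (bul Q) g) S"
      using N_ext_subgroup f(1) g(1) by auto
    have sub: "N_ext S Q f \<subseteq> N_ext S (bul Q) g"
    proof
      fix k assume "k \<in> N_ext S Q f"
      then obtain h where k: "k \<in> normalizer S Q" and h: "h \<in> carrier S" "\<forall>x\<in>Q. f (k \<rhd> x) = h \<rhd> f x"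
        using mem_N_ext_iff[OF f(1)] by blast
      have kC: "k \<in> carrier S" using normalizerD(1)[OF Q k] .
      have m1: "mor (bul Q) (\<lambda>x. k \<rhd> x)" by (rule mor_conj[OF B kC])
      have im1: "(\<lambda>x. k \<rhd> x) ` bul Q = bul Q"
        using bul_image[OF m1 Q] k mem_normalizer_iff[OF subgroup.subset[OF Q]] by simp
      then have kB: "k \<in> normalizer S (bul Q)" using mem_normalizer_iff[OF subgroup.subset[OF B]] kC by blast
      have m2: "mor (bul Q) (\<lambda>x. g (k \<rhd> x))" using mor_comp[OF m1 g(1)] im1 by simp
      have m3: "mor (bul Q) (\<lambda>x. h \<rhd> g x)" using mor_comp[OF g(1) mor_conj[OF sU h(1)]] gU by simp
      have "g (k \<rhd> z) = h \<rhd> g z" if "z \<in> bul Q" for z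
      proof (rule bul_unique[OF m2 m3 Q QB order_refl _ that])
        fix x assume x: "x \<in> Q"
        then show "g (k \<rhd> x) = h \<rhd> g x"
          using g(2)[OF x] g(2)[OF normalizerD(2)[OF Q k x]] h(2) by simp
      qed
      then show "k \<in> N_ext S (bul Q) g" using mem_N_ext_iff[OF g(1)] kB h(1) by blast
    qed
    have 1: "N_ext S (bul Q) g \<subseteq> normalizer S (bul Q)" using mem_N_ext_iff[OF g(1)] by blast
    have 2: "bul Q \<subseteq> N_ext S (bul Q) g"
      using mem_N_ext_iff[OF g(1)] normalizer_contains[OF B] mor_conj_elem[OF g(1)] mor_closed[OF g(1)] by blast
    obtain \<psi> where psi: "mor (N_ext S (bul Q) g) \<psi>" "\<And>v. v \<in> bul Q \<Longrightarrow> \<psi> v = g v"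
      using receptive_extension[OF rec sU g(1) gU NE(2) 1 2] mem_N_ext_iff[OF g(1)] by blast
    have "mor (N_ext S Q f) \<psi>" by (rule mor_subset[OF psi(1) NE(1) sub])
    moreover have "\<forall>x\<in>Q. \<psi> x = f x" using psi(2) g(2) QB by auto
    ultimately show "\<exists>\<psi>. mor (N_ext S Q f) \<psi> \<and> (\<forall>x\<in>Q. \<psi> x = f x)" by blast
  qed
  ultimately show ?thesis using R mP by (auto simp: nice_def good_def)
qed

text \<open>Subtracting depths from this constant turns an induction from large to small subgroups
  into \<open>less_induct\<close>.\<close>

definition max_depth :: nat where "max_depth = (SOME D. \<forall>P. subgroup P S \<longrightarrow> depth P \<le> D)"

lemma depth_le_max: "subgroup P S \<Longrightarrow> depth P \<le> max_depth"
  using someI_ex[OF depth_bounded] unfolding max_depth_def by blast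

end

section \<open>A class of subgroups outside the family\<close>

text \<open>One step of the induction from large to small: a conjugacy class outside the family, all
  of whose proper overgroups are already known to be nice.\<close>

locale minimal_class = bullet_family S p F HH for S :: "('a, 'b) monoid_scheme" (structure) and p F HH +
  fixes PP :: "'a set set"
  assumes PP_sub: "Q \<in> PP \<Longrightarrow> subgroup Q S"
    and PP_conj: "Q \<in> PP \<Longrightarrow> mor Q f \<Longrightarrow> f ` Q \<in> PP"
    and PP_iso: "Q \<in> PP \<Longrightarrow> R \<in> PP \<Longrightarrow> \<exists>f. mor Q f \<and> f ` Q = R"
    and PP_big: "Q \<in> PP \<Longrightarrow> subgroup U S \<Longrightarrow> Q \<subset> U \<Longrightarrow> nice U"
    and PP_HH: "Q \<in> PP \<Longrightarrow> Q \<notin> HH"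
begin

text \<open>Such a map automatically takes N_S(Q) into N_S(R).\<close>

definition dominates :: "'a set \<Rightarrow> 'a set \<Rightarrow> bool" where
  "dominates R Q \<longleftrightarrow> (\<exists>\<chi>. mor (normalizer S Q) \<chi> \<and> \<chi> ` Q = R)"

text \<open>A weak form of Alperin's fusion theorem. A member of the class is not in the family, so
  whenever it lies in the domain of a morphism between members of the family, it is a proper
  subgroup there. Hence every morphism on it is a composite of morphisms that extend to proper
  overgroups.\<close>

lemma class_generation:
  assumes base: "\<And>Q U f. Q \<in> PP \<Longrightarrow> subgroup U S \<Longrightarrow> Q \<subset> U \<Longrightarrow> mor U f \<Longrightarrow> Z Q f"
    and comp: "\<And>Q f g. Q \<in> PP \<Longrightarrow> mor Q f \<Longrightarrow> mor (f ` Q) g \<Longrightarrow> Z Q f \<Longrightarrow> Z (f ` Q) g \<Longrightarrow> Z Q (\<lambda>x. g (f x))"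
    and cong: "\<And>Q f g. Q \<in> PP \<Longrightarrow> (\<And>x. x \<in> Q \<Longrightarrow> f x = g x) \<Longrightarrow> Z Q f \<Longrightarrow> Z Q g"
    and Q: "Q \<in> PP" and f: "mor Q f"
  shows "Z Q f"
proof -
  have *: "subgroup A S \<and> subgroup B S \<and> mor A \<phi> \<and> \<phi> ` A \<subseteq> B \<and> (\<forall>Q\<in>PP. Q \<subseteq> A \<longrightarrow> Z Q \<phi>)"
    if "composite_of_restrictions S F HH A B \<phi>" for A B \<phi>
    using that
  proof (induction rule: composite_of_restrictions.induct)
    case (restriction P Q \<phi> P' Q')
    have sP: "subgroup P S" and sQ: "subgroup Q S" using HH_sub restriction by auto
    have m: "mor P \<phi>" using F_mor_iff[OF sP sQ] restriction by blast
    have m': "mor P' (restrict \<phi> P')"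
      using mor_subset[OF m] restriction mor_cong[of P' "restrict \<phi> P'" \<phi>] by simp
    have "Z C (restrict \<phi> P')" if C: "C \<in> PP" "C \<subseteq> P'" for C
    proof -
      have "C \<noteq> P" using PP_HH C restriction by blast
      then have "C \<subset> P" using C restriction by blast
      then have "Z C \<phi>" using base[OF C(1) sP _ m] by blast
      then show ?thesis using cong[OF C(1), of \<phi> "restrict \<phi> P'"] C(2) by (auto simp: subset_iff)
    qed
    moreover have "restrict \<phi> P' ` P' \<subseteq> Q'" using restriction by auto
    ultimately show ?case using restriction m' by blast
  next
    case (composition P Q \<phi> R \<psi>)
    then have a: "subgroup P S" "subgroup Q S" "mor P \<phi>" "\<phi> ` P \<subseteq> Q" "\<forall>C\<in>PP. C \<subseteq> P \<longrightarrow> Z C \<phi>"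
      and b: "subgroup R S" "mor Q \<psi>" "\<psi> ` Q \<subseteq> R" "\<forall>C\<in>PP. C \<subseteq> Q \<longrightarrow> Z C \<psi>" by auto
    have "mor P (\<lambda>x. \<psi> (\<phi> x))" by (rule mor_comp[OF a(3) b(2) a(4)])
    then have "mor P (compose P \<psi> \<phi>)" using mor_cong[of P "compose P \<psi> \<phi>" "\<lambda>x. \<psi> (\<phi> x)"] by (simp add: compose_def)
    moreover have "compose P \<psi> \<phi> ` P \<subseteq> R" using a(4) b(3) by (auto simp: compose_def)
    moreover have "Z C (compose P \<psi> \<phi>)" if C: "C \<in> PP" "C \<subseteq> P" for C
    proof -
      have mC: "mor C \<phi>" by (rule mor_subset[OF a(3) PP_sub[OF C(1)] C(2)])
      have pC: "\<phi> ` C \<in> PP" by (rule PP_conj[OF C(1) mC])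
      have sub: "\<phi> ` C \<subseteq> Q" using C(2) a(4) by blast
      have "mor (\<phi> ` C) \<psi>" by (rule mor_subset[OF b(2) PP_sub[OF pC] sub])
      then have "Z C (\<lambda>x. \<psi> (\<phi> x))" using comp[OF C(1) mC] a(5) b(4) C pC sub by blast
      then show ?thesis using cong[OF C(1), of "\<lambda>x. \<psi> (\<phi> x)" "compose P \<psi> \<phi>"] C(2) by (auto simp: compose_def subset_iff)
    qed
    ultimately show ?case using a b by blast
  qed
  have "restrict f Q \<in> F Q (carrier S)" using f by (simp add: mor_def)
  then have "composite_of_restrictions S F HH Q (carrier S) (restrict f Q)"
    using HH_gen PP_sub[OF Q] subgroup_carrier by (simp add: family_generated_def)
  then have "Z Q (restrict f Q)" using * Q by blast
  then show ?thesis using cong[OF Q, of "restrict f Q" f] by simp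
qed

end

section \<open>A member R whose normalizer is deepest\<close>

locale maximal_member = minimal_class S p F HH PP for S :: "('a, 'b) monoid_scheme" (structure) and p F HH PP +
  fixes R :: "'a set"
  assumes R_PP: "R \<in> PP" and R_max: "\<And>Q. Q \<in> PP \<Longrightarrow> depth (normalizer S Q) \<le> depth (normalizer S R)"
begin

lemma R_sub: "subgroup R S" by (rule PP_sub[OF R_PP])

text \<open>Maximality of the depth makes the extension of \<chi> to the bullets of the normalizers
  onto. An element of the bullet of N_S(R) that maps into the normalizer of the image must normalize
  R, by injectivity, which gives surjectivity on the normalizers themselves.\<close>

lemma maximal_onto:
  assumes c: "mor (normalizer S R) \<chi>"
  shows "\<chi> ` normalizer S R = normalizer S (\<chi> ` R)"
proof
  let ?N = "normalizer S R" and ?X = "\<chi> ` R"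
  have N: "subgroup ?N S" and RN: "R \<subseteq> ?N" using normalizer_subgroup[OF R_sub] normalizer_contains[OF R_sub] by auto
  show sub: "\<chi> ` ?N \<subseteq> normalizer S ?X" by (rule mor_normalizer_image[OF c RN order_refl R_sub])
  have mR: "mor R \<chi>" by (rule mor_subset[OF c R_sub RN])
  have X: "?X \<in> PP" by (rule PP_conj[OF R_PP mR])
  have NX: "subgroup (normalizer S ?X) S" by (rule normalizer_subgroup[OF PP_sub[OF X]])
  obtain g where g: "mor (bul ?N) g" "\<And>x. x \<in> ?N \<Longrightarrow> g x = \<chi> x" using bul_extension[OF c] by blast
  have gN: "g ` ?N = \<chi> ` ?N" using g(2) by (intro image_cong) auto
  have gR: "g ` R = ?X" using g(2) RN by (intro image_cong) auto
  have "g ` bul ?N \<subseteq> bul (normalizer S ?X)"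
    using bul_image[OF g(1) N] gN bul_mono[OF mor_image_subgroup[OF c] NX sub] by simp
  then have gb: "g ` bul ?N = bul (normalizer S ?X)" by (rule depth_mono(2)[OF N NX g(1) _ R_max[OF X]])
  show "normalizer S ?X \<subseteq> \<chi> ` ?N"
  proof
    fix y assume y: "y \<in> normalizer S ?X"
    then obtain z where z: "z \<in> bul ?N" "y = g z" using bul_contains[OF NX] gb by blast
    have RB: "R \<subseteq> bul ?N" using RN bul_contains[OF N] by blast
    have "z \<in> ?N" by (rule normalizer_pullback[OF g(1) R_sub RB z(1)]) (use y z gR in simp)
    then show "y \<in> \<chi> ` ?N" using z g(2) by blast
  qed
qed

text \<open>Enlarging \<open>U\<close> to \<open>bul U \<inter> normalizer S Q\<close> makes every strictly larger subgroup of the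
  normalizer strictly deeper, so that the depth can serve as an induction measure.\<close>

lemma enlarge:
  assumes Q: "Q \<in> PP" and U: "subgroup U S" "Q \<subset> U" "U \<subseteq> normalizer S Q" and f: "mor U f"
  obtains V g where "subgroup V S" "U \<subseteq> V" "V \<subseteq> normalizer S Q" "mor V g" "\<And>x. x \<in> U \<Longrightarrow> g x = f x"
    "depth V = depth U" "g ` V \<subseteq> normalizer S (f ` Q)"
    "\<And>X. subgroup X S \<Longrightarrow> V \<subset> X \<Longrightarrow> X \<subseteq> normalizer S Q \<Longrightarrow> depth U < depth X"
    "\<And>X. subgroup X S \<Longrightarrow> g ` V \<subset> X \<Longrightarrow> X \<subseteq> normalizer S (f ` Q) \<Longrightarrow> depth U < depth X"
proof -
  have sQ: "subgroup Q S" by (rule PP_sub[OF Q])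
  have N: "subgroup (normalizer S Q) S" by (rule normalizer_subgroup[OF sQ])
  obtain g where g: "mor (bul U) g" "\<And>x. x \<in> U \<Longrightarrow> g x = f x" using bul_extension[OF f] by blast
  have B: "subgroup (bul U) S" and UB: "U \<subseteq> bul U" using bul_subgroup[OF U(1)] bul_contains[OF U(1)] by auto
  define V where "V = bul U \<inter> normalizer S Q"
  have V: "subgroup V S" unfolding V_def by (rule subgroups_Inter_pair[OF B N])
  have UV: "U \<subseteq> V" and VB: "V \<subseteq> bul U" and VN: "V \<subseteq> normalizer S Q" using UB U(3) by (auto simp: V_def)
  have gV: "mor V g" by (rule mor_subset[OF g(1) V VB])
  have QV: "Q \<subseteq> V" using U(2) UV by blast
  have gQ: "g ` Q = f ` Q" using g(2) U(2) by (intro image_cong) auto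
  have bV: "bul V = bul U"
    using bul_mono[OF U(1) V UV] bul_mono[OF V B VB] bul_idem[OF U(1)] by blast
  have dV: "depth V = depth U" by (simp add: depth_def bV)
  have gVN: "g ` V \<subseteq> normalizer S (f ` Q)" using mor_normalizer_image[OF gV QV VN sQ] gQ by simp
  have sgV: "subgroup (g ` V) S" by (rule mor_image_subgroup[OF gV])
  have bgV: "bul (g ` V) = g ` bul U" using bul_image[of V g] g(1) V by (simp add: bV)
  show ?thesis
  proof (rule that[OF V UV VN gV g(2) dV gVN])
    fix X assume X: "subgroup X S" "V \<subset> X" "X \<subseteq> normalizer S Q"
    show "depth U < depth X"
    proof (rule ccontr)
      assume "\<not> depth U < depth X"
      then have "bul V = bul X" using depth_subset(2)[OF V X(1)] X(2) dV by auto
      then have "X \<subseteq> V" using bul_contains[OF X(1)] X(3) bV by (auto simp: V_def)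
      then show False using X(2) by blast
    qed
  next
    fix X assume X: "subgroup X S" "g ` V \<subset> X" "X \<subseteq> normalizer S (f ` Q)"
    show "depth U < depth X"
    proof (rule ccontr)
      assume "\<not> depth U < depth X"
      then have "bul (g ` V) = bul X" using depth_subset(2)[OF sgV X(1)] X(2) dV depth_image[OF gV] by auto
      then have "X \<subseteq> g ` bul U" using bul_contains[OF X(1)] bgV by simp
      have "X \<subseteq> g ` V"
      proof
        fix y assume y: "y \<in> X"
        then obtain z where z: "z \<in> bul U" "y = g z" using \<open>X \<subseteq> g ` bul U\<close> by blast
        have "z \<in> normalizer S Q"
          by (rule normalizer_pullback[OF g(1) sQ _ z(1)]) (use QV VB gQ y z X(3) in auto)
        then show "y \<in> g ` V" using z by (auto simp: V_def)
      qed
      then show False using X(2) by blast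
    qed
  qed
qed

text \<open>Induction on depth, from large to small. V is nice, so V and V' = g V both map onto one
  good subgroup W, with Q and R going to the same Y, and these maps extend to N1 and N2 in the
  normalizers of Q and R. Reversing the second map shows that R dominates Y; following the first by
  N_S(Y) -> N_S(R) then handles Q. Each appeal to the induction hypothesis is at greater
  depth.\<close>

lemma dominated_step:
  "Q \<in> PP \<Longrightarrow> subgroup U S \<Longrightarrow> Q \<subset> U \<Longrightarrow> U \<subseteq> normalizer S Q \<Longrightarrow> mor U f \<Longrightarrow> f ` Q = R \<Longrightarrow> dominates R Q"
proof (induction "max_depth - depth U" arbitrary: Q U f rule: less_induct)
  case less
  have IH: "dominates R Q'" if "Q' \<in> PP" "subgroup U' S" "Q' \<subset> U'" "U' \<subseteq> normalizer S Q'" "mor U' f'" "f' ` Q' = R" "depth U < depth U'" for Q' U' f'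
    by (rule less.hyps[OF _ that(1-6)]) (use that(7) depth_le_max[OF that(2)] in linarith)
  note Q = less.prems(1)
  have sQ: "subgroup Q S" by (rule PP_sub[OF Q])
  obtain V g where V: "subgroup V S" "U \<subseteq> V" "V \<subseteq> normalizer S Q" and g: "mor V g" "\<And>x. x \<in> U \<Longrightarrow> g x = f x"
    and gVN: "g ` V \<subseteq> normalizer S (f ` Q)"
    and d1: "\<And>X. subgroup X S \<Longrightarrow> V \<subset> X \<Longrightarrow> X \<subseteq> normalizer S Q \<Longrightarrow> depth U < depth X"
    and d2: "\<And>X. subgroup X S \<Longrightarrow> g ` V \<subset> X \<Longrightarrow> X \<subseteq> normalizer S (f ` Q) \<Longrightarrow> depth U < depth X"
    using enlarge[OF Q less.prems(2-5)] by metis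
  have QV: "Q \<subset> V" using less.prems(3) V(2) by blast
  have gQ: "g ` Q = R"
  proof -
    have "g ` Q = f ` Q" using g(2) less.prems(3) by (intro image_cong) auto
    then show ?thesis using less.prems(6) by simp
  qed
  let ?V' = "g ` V"
  have V': "subgroup ?V' S" by (rule mor_image_subgroup[OF g(1)])
  have RV': "R \<subseteq> ?V'" using gQ QV by blast
  obtain W \<chi> where W: "good W" and chi: "mor V \<chi>" "\<chi> ` V = W" and sg: "stab_good W (\<chi> ` Q)"
    using exists_stab_good[OF PP_big[OF Q V(1) QV]] QV by blast
  let ?Y = "\<chi> ` Q"
  have Y: "?Y \<in> PP" using PP_conj[OF Q mor_subset[OF chi(1) sQ]] QV by blast
  define N1 where "N1 = normalizer S V \<inter> normalizer S Q"
  have N1: "subgroup N1 S" unfolding N1_def by (rule subgroups_Inter_pair[OF normalizer_subgroup[OF V(1)] normalizer_subgroup[OF sQ]])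
  have VN1: "V \<subseteq> N1" using normalizer_contains[OF V(1)] V(3) by (auto simp: N1_def)
  obtain \<psi>1 where p1: "mor N1 \<psi>1" "\<psi>1 ` V = W" "\<psi>1 ` Q = ?Y"
    using extension_stab[OF W sg chi sQ _ refl N1 VN1] QV by (auto simp: N1_def)
  define N2 where "N2 = normalizer S ?V' \<inter> normalizer S R"
  have N2: "subgroup N2 S" unfolding N2_def by (rule subgroups_Inter_pair[OF normalizer_subgroup[OF V'] normalizer_subgroup[OF R_sub]])
  have VN2: "?V' \<subseteq> N2" using normalizer_contains[OF V'] gVN less.prems(6) by (auto simp: N2_def)
  let ?i = "inv_into V g"
  have mi: "mor ?V' ?i" and iV: "?i ` ?V' = V" using mor_inv_into[OF g(1)] mor_image_cancel[OF g(1) order_refl] by auto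
  have iR: "?i ` R = Q" using mor_image_cancel[OF g(1), of Q] QV gQ by simp
  have mci: "mor ?V' (\<lambda>x. \<chi> (?i x))" using mor_comp[OF mi chi(1)] iV by simp
  have ci: "(\<lambda>x. \<chi> (?i x)) ` ?V' = W" "(\<lambda>x. \<chi> (?i x)) ` R = ?Y" using iV iR chi(2) by (metis image_image)+
  obtain \<psi>2 where p2: "mor N2 \<psi>2" "\<psi>2 ` ?V' = W" "\<psi>2 ` R = ?Y"
    using extension_stab[OF W sg mci ci(1) R_sub RV' ci(2) N2 VN2] by (auto simp: N2_def)
  have RN2: "R \<subseteq> N2" using RV' VN2 by blast
  have "dominates R ?Y"
  \<comment> \<open>If V' is all of N_S(R), maximality of R makes the map onto N_S(Y), so it can be
    inverted. Otherwise N2 is strictly larger than V', its image is deeper than U, and the induction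
    hypothesis applies to Y.\<close>
  proof (cases "?V' = normalizer S R")
    case True
    then have eq: "N2 = normalizer S R" using VN2 by (auto simp: N2_def)
    have m: "mor (normalizer S R) \<psi>2" using p2(1) eq by simp
    have "\<psi>2 ` normalizer S R = normalizer S ?Y" using maximal_onto[OF m] p2(3) by simp
    then have "mor (normalizer S ?Y) (inv_into N2 \<psi>2)" using mor_inv_into[OF p2(1)] eq by simp
    moreover have "inv_into N2 \<psi>2 ` ?Y = R" using mor_image_cancel[OF p2(1) RN2] p2(3) by simp
    ultimately show ?thesis by (auto simp: dominates_def)
  next
    case False
    then have "?V' \<subset> normalizer S R" using gVN less.prems(6) by blast
    then obtain z where z: "z \<in> normalizer S R" "z \<notin> ?V'" "z \<in> normalizer S ?V'"
      using normalizer_growth[OF V' normalizer_subgroup[OF R_sub]] by blast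
    then have lt: "?V' \<subset> N2" using VN2 by (auto simp: N2_def)
    let ?X = "\<psi>2 ` N2"
    have X: "subgroup ?X S" by (rule mor_image_subgroup[OF p2(1)])
    have "depth U < depth N2" using d2[OF N2 lt] less.prems(6) by (auto simp: N2_def)
    then have dX: "depth U < depth ?X" using depth_image[OF p2(1)] by simp
    have "?X \<subseteq> normalizer S ?Y" using mor_normalizer_image[OF p2(1) RN2 _ R_sub] p2(3) by (auto simp: N2_def)
    moreover have "?Y \<subset> ?X"
    proof -
      have "?Y \<subseteq> ?X" using p2(3) RN2 by blast
      moreover have "?Y \<noteq> ?X"
      proof
        assume "?Y = ?X"
        then have "inv_into N2 \<psi>2 ` ?Y = N2" using mor_image_cancel[OF p2(1) order_refl] by simp
        then have "R = N2" using mor_image_cancel[OF p2(1) RN2] p2(3) by simp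
        then show False using lt RV' by blast
      qed
      ultimately show ?thesis by blast
    qed
    moreover have "inv_into N2 \<psi>2 ` ?Y = R" using mor_image_cancel[OF p2(1) RN2] p2(3) by simp
    ultimately show ?thesis using IH[OF Y X _ _ mor_inv_into[OF p2(1)] _ dX] by blast
  qed
  then obtain \<kappa> where k: "mor (normalizer S ?Y) \<kappa>" "\<kappa> ` ?Y = R" by (auto simp: dominates_def)
  have QN1: "Q \<subseteq> N1" using QV VN1 by blast
  have "\<psi>1 ` N1 \<subseteq> normalizer S ?Y" using mor_normalizer_image[OF p1(1) QN1 _ sQ] p1(3) by (auto simp: N1_def)
  then have mk: "mor N1 (\<lambda>x. \<kappa> (\<psi>1 x))" by (rule mor_comp[OF p1(1) k(1)])
  have kQ: "(\<lambda>x. \<kappa> (\<psi>1 x)) ` Q = R" using p1(3) k(2) by (metis image_image)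
  show "dominates R Q"
  proof (cases "V = normalizer S Q")
    case True
    then have "N1 = normalizer S Q" using VN1 by (auto simp: N1_def)
    then show ?thesis using mk kQ by (auto simp: dominates_def)
  next
    case False
    then have "V \<subset> normalizer S Q" using V(3) by blast
    then obtain z where z: "z \<in> normalizer S Q" "z \<notin> V" "z \<in> normalizer S V"
      using normalizer_growth[OF V(1) normalizer_subgroup[OF sQ]] by blast
    then have lt: "V \<subset> N1" using VN1 by (auto simp: N1_def)
    have "depth U < depth N1" using d1[OF N1 lt] by (auto simp: N1_def)
    then show ?thesis using IH[OF Q N1 _ _ mk kQ] lt QV by (auto simp: N1_def)
  qed
qed

text \<open>Domination is pulled back from f Q to Q along a morphism f that extends to a proper
  overgroup U: following f on U \<inter> N_S(Q) by N_S(f Q) -> N_S(R) gives the input of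
  \<open>dominated_step\<close>. By \<open>class_generation\<close> such morphisms suffice.\<close>

lemma dominated: assumes Q: "Q \<in> PP" shows "dominates R Q"
proof -
  obtain f where f: "mor Q f" "f ` Q = R" using PP_iso[OF Q R_PP] by blast
  have "dominates R (f ` Q) \<longrightarrow> dominates R Q"
  proof (rule class_generation[where Z = "\<lambda>Q f. dominates R (f ` Q) \<longrightarrow> dominates R Q", OF _ _ _ Q f(1)])
    fix Q U f assume Q: "Q \<in> PP" and U: "subgroup U S" "Q \<subset> U" and f: "mor U f"
    show "dominates R (f ` Q) \<longrightarrow> dominates R Q"
    proof
      assume "dominates R (f ` Q)"
      then obtain \<kappa> where k: "mor (normalizer S (f ` Q)) \<kappa>" "\<kappa> ` f ` Q = R" by (auto simp: dominates_def)
      have sQ: "subgroup Q S" by (rule PP_sub[OF Q])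
      define U' where "U' = U \<inter> normalizer S Q"
      have U': "subgroup U' S" unfolding U'_def by (rule subgroups_Inter_pair[OF U(1) normalizer_subgroup[OF sQ]])
      have mU': "mor U' f" by (rule mor_subset[OF f U']) (auto simp: U'_def)
      obtain z where "z \<in> U" "z \<notin> Q" "z \<in> normalizer S Q" using normalizer_growth[OF sQ U] by blast
      then have QU': "Q \<subset> U'" using U(2) normalizer_contains[OF sQ] by (auto simp: U'_def)
      have U'N: "U' \<subseteq> normalizer S Q" by (auto simp: U'_def)
      have "f ` U' \<subseteq> normalizer S (f ` Q)" using mor_normalizer_image[OF mU' _ U'N sQ] QU' by blast
      then have "mor U' (\<lambda>x. \<kappa> (f x))" by (rule mor_comp[OF mU' k(1)])
      moreover have "(\<lambda>x. \<kappa> (f x)) ` Q = R" using k(2) by (simp add: image_image)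
      ultimately show "dominates R Q" using dominated_step[OF Q U' QU' U'N] by blast
    qed
  next
    fix Q f g assume "Q \<in> PP" and "dominates R (f ` Q) \<longrightarrow> dominates R Q" "dominates R (g ` f ` Q) \<longrightarrow> dominates R (f ` Q)"
    then show "dominates R ((\<lambda>x. g (f x)) ` Q) \<longrightarrow> dominates R Q" by (simp add: image_image)
  next
    fix Q and f g :: "'a \<Rightarrow> 'a" assume "\<And>x. x \<in> Q \<Longrightarrow> f x = g x" and "dominates R (f ` Q) \<longrightarrow> dominates R Q"
    then show "dominates R (g ` Q) \<longrightarrow> dominates R Q" by (metis image_cong)
  qed
  moreover have "dominates R R"
    unfolding dominates_def using mor_id[OF normalizer_subgroup[OF R_sub]] by force
  ultimately show ?thesis using f(2) by simp
qed

end

text \<open>\<open>M\<close> is the group written \<open>N\<^sub>S\<^sup>K(R)\<close> in the literature. All \<open>\<F>\<close>-automorphisms of \<open>R\<close> extend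
  to \<open>M\<close>, and this makes \<open>R\<close> fully automized and receptive.\<close>

locale p_normalized_member = maximal_member S p F HH PP R
  for S :: "('a, 'b) monoid_scheme" (structure) and p F HH PP R +
  fixes K :: "('a \<Rightarrow> 'a) set" and M :: "'a set"
  assumes K: "normal_p_aut R K" and Inn_K: "Inn S R \<subseteq> K"
    and M_def: "M = {g \<in> normalizer S R. (\<lambda>x\<in>R. g \<rhd> x) \<in> K}"
    and M_ne: "M \<noteq> R"
begin

lemma R_M: "R \<subseteq> M"
  using normalizer_contains[OF R_sub] Inn_K unfolding M_def Inn_eq by blast

lemma M_N: "M \<subseteq> normalizer S R" by (auto simp: M_def)

lemma M_sub: "subgroup M S"
proof -
  interpret h: group_hom "S\<lparr>carrier := normalizer S R\<rparr>" "BijGroup R" "\<lambda>g. \<lambda>x\<in>R. g \<rhd> x"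
    by (rule conj_map_hom[OF R_sub])
  have N: "subgroup (normalizer S R) S" by (rule normalizer_subgroup[OF R_sub])
  have sK: "subgroup K (BijGroup R)" using K by (simp add: normal_p_aut_def)
  show ?thesis
  proof
    show "M \<subseteq> carrier S" using M_N subgroup.subset[OF N] by blast
    show "\<one> \<in> M" using R_M subgroup.one_closed[OF R_sub] by blast
    fix x assume x: "x \<in> M"
    then have xN: "x \<in> normalizer S R" and xK: "(\<lambda>y\<in>R. x \<rhd> y) \<in> K" by (auto simp: M_def)
    have "inv\<^bsub>S\<lparr>carrier := normalizer S R\<rparr>\<^esub> x = inv x" by (rule m_inv_consistent[OF N xN])
    then have "(\<lambda>y\<in>R. inv x \<rhd> y) \<in> K"
      using h.hom_inv[of x] xN subgroup.m_inv_closed[OF sK xK] by simp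
    then show "inv x \<in> M" using subgroup.m_inv_closed[OF N xN] by (simp add: M_def)
    fix y assume "y \<in> M"
    then have yN: "y \<in> normalizer S R" and yK: "(\<lambda>z\<in>R. y \<rhd> z) \<in> K" by (auto simp: M_def)
    have "(\<lambda>z\<in>R. (x \<otimes> y) \<rhd> z) \<in> K"
      using conj_compose[OF R_sub xN yN] subgroup.m_closed[OF sK xK yK] by simp
    then show "x \<otimes> y \<in> M" using subgroup.m_closed[OF N xN yN] by (simp add: M_def)
  qed
qed

lemma R_less_M: "R \<subset> M" using R_M M_ne by blast

text \<open>On R, conjugation by e m is the conjugate under e of conjugation by m, and K is normal
  in Aut_F(R). Taking conjugations for e, it follows that N_S(R) normalizes M.\<close>

lemma M_map:
  assumes e: "mor B e" and RB: "R \<subseteq> B" and eR: "e ` R = R" and m: "m \<in> B" "m \<in> M"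
  shows "e m \<in> M"
proof -
  interpret B: group "BijGroup R" by (rule group_BijGroup)
  have mN: "m \<in> normalizer S R" using m M_N by blast
  have emN: "e m \<in> normalizer S R"
  proof (rule normalizerI[OF R_sub mor_closed[OF e m(1)]])
    fix x assume "x \<in> R"
    then obtain y where y: "y \<in> R" "x = e y" using eR by blast
    then have "e m \<rhd> x = e (m \<rhd> y)" using mor_conj_elem[OF e m(1), of y] RB by auto
    then show "e m \<rhd> x \<in> R" using normalizerD(2)[OF R_sub mN y(1)] eR by auto
  qed
  have me: "mor R e" by (rule mor_subset[OF e R_sub RB])
  let ?a = "restrict e R" and ?c = "\<lambda>x\<in>R. m \<rhd> x" and ?d = "\<lambda>x\<in>R. e m \<rhd> x"
  have aA: "?a \<in> Aut_F F R" by (rule restrict_Aut_F[OF me eR])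
  have cK: "?c \<in> K" using m by (simp add: M_def)
  have A: "Aut_F F R \<subseteq> Bij R" by (rule Aut_F_Bij[OF R_sub])
  have aB: "?a \<in> Bij R" and cB: "?c \<in> Bij R" and dB: "?d \<in> Bij R"
    using aA conj_Aut_S[OF R_sub] mN emN Aut_S_subset[OF R_sub] A by blast+
  have "compose R ?a ?c = compose R ?d ?a"
  proof
    fix x show "compose R ?a ?c x = compose R ?d ?a x"
    proof (cases "x \<in> R")
      case True
      have "m \<rhd> x \<in> R" using normalizerD(2)[OF R_sub mN True] .
      moreover have "e x \<in> R" using eR True by blast
      ultimately show ?thesis using True mor_conj_elem[OF e m(1), of x] RB by (auto simp: compose_def)
    qed (simp add: compose_def)
  qed
  then have "?a \<otimes>\<^bsub>BijGroup R\<^esub> ?c = ?d \<otimes>\<^bsub>BijGroup R\<^esub> ?a" using aB cB dB by simp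
  then have "?a \<otimes>\<^bsub>BijGroup R\<^esub> ?c \<otimes>\<^bsub>BijGroup R\<^esub> inv\<^bsub>BijGroup R\<^esub> ?a = ?d \<otimes>\<^bsub>BijGroup R\<^esub> ?a \<otimes>\<^bsub>BijGroup R\<^esub> inv\<^bsub>BijGroup R\<^esub> ?a"
    by (simp only:)
  also have "\<dots> = ?d"
  proof -
    have "?a \<in> carrier (BijGroup R)" "?d \<in> carrier (BijGroup R)" using aB dB by auto
    then show ?thesis by (simp only: B.m_assoc B.r_inv B.r_one B.inv_closed)
  qed
  finally have ad: "?a \<otimes>\<^bsub>BijGroup R\<^esub> ?c \<otimes>\<^bsub>BijGroup R\<^esub> inv\<^bsub>BijGroup R\<^esub> ?a = ?d" .
  have "\<forall>\<alpha>\<in>Aut_F F R. \<forall>\<kappa>\<in>K. \<alpha> \<otimes>\<^bsub>BijGroup R\<^esub> \<kappa> \<otimes>\<^bsub>BijGroup R\<^esub> inv\<^bsub>BijGroup R\<^esub> \<alpha> \<in> K"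
    using K by (simp add: normal_p_aut_def)
  from this[rule_format, OF aA cK] have "?d \<in> K" by (simp only: ad)
  then show ?thesis using emN by (simp add: M_def)
qed

lemma M_onto: assumes e: "mor M e" and eR: "e ` R = R" shows "e ` M = M"
  by (rule injective_endo_onto[OF M_sub mor_hom_on[OF e] mor_inj[OF e]]) (use M_map[OF e R_M eR] in blast)

lemma N_normalizes_M: "normalizer S R \<subseteq> normalizer S M"
proof
  fix g assume g: "g \<in> normalizer S R"
  have gC: "g \<in> carrier S" using normalizerD(1)[OF R_sub g] .
  have im: "(\<lambda>x. g \<rhd> x) ` R = R" using g mem_normalizer_iff[OF subgroup.subset[OF R_sub]] by blast
  show "g \<in> normalizer S M"
    by (rule normalizerI[OF M_sub gC]) (rule M_map[OF mor_conj[OF M_sub gC] R_M im])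
qed

text \<open>Induction on depth again. Unless V already contains M, the map f on R is written as
  e2^-1 e1 with two automorphisms of R that extend to groups N1 and N2 deeper than U. They arise
  from maps satisfying \<psi>2 f = \<psi>1 on R, so \<psi>2 has to keep prescribed values on R,
  which normality of K permits on V' M.\<close>

lemma automorphism_extension_step:
  "subgroup U S \<Longrightarrow> R \<subset> U \<Longrightarrow> U \<subseteq> normalizer S R \<Longrightarrow> mor U f \<Longrightarrow> f ` R = R \<Longrightarrow> \<exists>e. mor M e \<and> (\<forall>x\<in>R. e x = f x)"
proof (induction "max_depth - depth U" arbitrary: U f rule: less_induct)
  case less
  have IH: "\<exists>e. mor M e \<and> (\<forall>x\<in>R. e x = f' x)" if "subgroup U' S" "R \<subset> U'" "U' \<subseteq> normalizer S R" "mor U' f'" "f' ` R = R" "depth U < depth U'" for U' f'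
    by (rule less.hyps[OF _ that(1-5)]) (use that(6) depth_le_max[OF that(1)] in linarith)
  obtain V g where V: "subgroup V S" "U \<subseteq> V" "V \<subseteq> normalizer S R" and g: "mor V g" "\<And>x. x \<in> U \<Longrightarrow> g x = f x"
    and gVN: "g ` V \<subseteq> normalizer S (f ` R)"
    and d1: "\<And>X. subgroup X S \<Longrightarrow> V \<subset> X \<Longrightarrow> X \<subseteq> normalizer S R \<Longrightarrow> depth U < depth X"
    and d2: "\<And>X. subgroup X S \<Longrightarrow> g ` V \<subset> X \<Longrightarrow> X \<subseteq> normalizer S (f ` R) \<Longrightarrow> depth U < depth X"
    using enlarge[OF R_PP less.prems(1-4)] by metis
  note fR = less.prems(5)
  have RV: "R \<subset> V" using less.prems(2) V(2) by blast
  have gf: "g x = f x" if "x \<in> R" for x using g(2) less.prems(2) that by blast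
  have gR: "g ` R = R" using gf fR by (metis image_cong)
  show ?case
  proof (cases "M \<subseteq> V")
    case True
    then show ?thesis using mor_subset[OF g(1) M_sub True] gf by blast
  next
    case False
    let ?V' = "g ` V"
    have V': "subgroup ?V' S" by (rule mor_image_subgroup[OF g(1)])
    have V'N: "?V' \<subseteq> normalizer S R" using gVN fR by simp
    have RV': "R \<subseteq> ?V'" using gR RV by blast
    obtain W \<chi> where W: "good W" and chi: "mor V \<chi>" "\<chi> ` V = W" and sg: "stab_good W (\<chi> ` R)"
      using exists_stab_good[OF PP_big[OF R_PP V(1) RV]] RV by blast
    let ?Y = "\<chi> ` R"
    have sW: "subgroup W S" using W by (simp add: good_def)
    have Y: "?Y \<in> PP" using PP_conj[OF R_PP mor_subset[OF chi(1) R_sub]] RV by blast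
    have sY: "subgroup ?Y S" by (rule PP_sub[OF Y])
    have YW: "?Y \<subseteq> W" using chi(2) RV by blast
    define N1 where "N1 = normalizer S V \<inter> normalizer S R"
    have N1: "subgroup N1 S" unfolding N1_def by (rule subgroups_Inter_pair[OF normalizer_subgroup[OF V(1)] normalizer_subgroup[OF R_sub]])
    have VN1: "V \<subseteq> N1" using normalizer_contains[OF V(1)] V(3) by (auto simp: N1_def)
    obtain \<psi>1 where p1: "mor N1 \<psi>1" "\<psi>1 ` V = W" "\<psi>1 ` R = ?Y"
      using extension_stab[OF W sg chi R_sub _ refl N1 VN1] RV by (auto simp: N1_def)
    have mV: "mor V \<psi>1" by (rule mor_subset[OF p1(1) V(1) VN1])
    let ?i = "inv_into V g"
    have mi: "mor ?V' ?i" and iV: "?i ` ?V' = V" using mor_inv_into[OF g(1)] mor_image_cancel[OF g(1) order_refl] by auto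
    have iR: "?i ` R = R" using mor_image_cancel[OF g(1), of R] RV gR by simp
    \<comment> \<open>Chosen so that \<beta> f = \<psi>1 on R.\<close>
    define \<beta> where "\<beta> x = \<psi>1 (?i x)" for x
    have mb: "mor ?V' \<beta>" unfolding \<beta>_def using mor_comp[OF mi mV] iV by simp
    have bV: "\<beta> ` ?V' = W" and bR: "\<beta> ` R = ?Y" unfolding \<beta>_def using iV iR p1 by (metis image_image)+
    have sVM: "subgroup (?V' <#> M) S" "?V' \<subseteq> ?V' <#> M" "M \<subseteq> ?V' <#> M"
    proof -
      have "x \<rhd> d \<in> M" if "x \<in> ?V'" "d \<in> M" for x d
        using normalizerD(2)[OF M_sub _ that(2)] N_normalizes_M V'N that(1) by blast
      then show "subgroup (?V' <#> M) S" "?V' \<subseteq> ?V' <#> M" "M \<subseteq> ?V' <#> M"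
        using set_mult_subgroup[OF V' M_sub] by auto
    qed
    have N: "subgroup (normalizer S R) S" by (rule normalizer_subgroup[OF R_sub])
    have VMN: "?V' <#> M \<subseteq> normalizer S R"
      using V'N M_N subgroup.m_closed[OF N] by (auto simp: set_mult_def)
    define N2 where "N2 = normalizer S ?V' \<inter> (?V' <#> M)"
    have N2: "subgroup N2 S" unfolding N2_def by (rule subgroups_Inter_pair[OF normalizer_subgroup[OF V'] sVM(1)])
    have VN2: "?V' \<subseteq> N2" using normalizer_contains[OF V'] sVM(2) by (auto simp: N2_def)
    have N2N: "N2 \<subseteq> normalizer S ?V'" "N2 \<subseteq> normalizer S R" using VMN by (auto simp: N2_def)
    let ?NN = "normalizer S W \<inter> normalizer S ?Y"
    have sNN: "subgroup ?NN S" by (rule subgroups_Inter_pair[OF normalizer_subgroup[OF sW] normalizer_subgroup[OF sY]])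
    have mbR: "mor R \<beta>" by (rule mor_subset[OF mb R_sub RV'])
    have KY: "normal_p_aut ?Y (transport R \<beta> ` K)" using normal_p_aut_transport[OF K mbR] bR by simp
    have cond: "\<exists>h\<in>?NN. \<forall>r\<in>R. \<beta> (z \<rhd> r) = h \<rhd> \<beta> r" if z: "z \<in> N2" for z
    proof -
      obtain v m where vm: "v \<in> ?V'" "m \<in> M" "z = v \<otimes> m" using z unfolding N2_def by (blast elim: mem_set_multE)
      have c: "v \<in> carrier S" "m \<in> carrier S" using vm subgroup.mem_carrier[OF V'] subgroup.mem_carrier[OF M_sub] by auto
      have vN2: "v \<in> N2" using vm VN2 by blast
      have "inv v \<otimes> z \<in> N2" using vN2 z subgroup.m_closed[OF N2] subgroup.m_inv_closed[OF N2] by blast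
      then have mN2: "m \<in> N2" using vm c by simp
      have mV': "m \<in> normalizer S ?V'" and mR: "m \<in> normalizer S R" using mN2 N2N by auto
      have mcl: "m \<rhd> x \<in> ?V'" if "x \<in> ?V'" for x using normalizerD(2)[OF V' mV' that] .
      let ?j = "inv_into ?V' \<beta>"
      have j: "?j (\<beta> x) = x" if "x \<in> ?V'" for x by (rule mor_inv_into_app[OF mb that])
      have mj: "mor W ?j" and jW: "?j ` W = ?V'" using mor_inv_into[OF mb] mor_image_cancel[OF mb order_refl] bV by auto
      define \<gamma> where "\<gamma> = (\<lambda>u\<in>W. \<beta> (m \<rhd> ?j u))"
      have gb: "\<gamma> (\<beta> x) = \<beta> (m \<rhd> x)" if "x \<in> ?V'" for x
        using that bV j[OF that] by (auto simp: \<gamma>_def)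
      have m1: "mor ?V' (\<lambda>x. \<beta> (m \<rhd> x))" using mor_comp[OF mor_conj[OF V' c(2)] mb] mcl by blast
      have m2: "mor W (\<lambda>u. \<beta> (m \<rhd> ?j u))" using mor_comp[OF mj m1] jW by simp
      have cim: "(\<lambda>x. m \<rhd> x) ` ?V' = ?V'" "(\<lambda>x. m \<rhd> x) ` R = R"
        using mV' mR mem_normalizer_iff subgroup.subset[OF V'] subgroup.subset[OF R_sub] by blast+
      have "(\<lambda>u. \<beta> (m \<rhd> ?j u)) ` W = \<beta> ` (\<lambda>x. m \<rhd> x) ` ?j ` W" by (simp only: image_image)
      also have "\<dots> = W" unfolding jW cim bV ..
      finally have gA: "\<gamma> \<in> Aut_F F W" unfolding \<gamma>_def by (rule restrict_Aut_F[OF m2])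
      have "\<gamma> ` \<beta> ` R = (\<lambda>x. \<beta> (m \<rhd> x)) ` R" unfolding image_image using gb RV' by (intro image_cong) auto
      also have "\<dots> = \<beta> ` (\<lambda>x. m \<rhd> x) ` R" by (simp only: image_image)
      finally have gst: "\<gamma> \<in> stab W ?Y" using gA bR cim(2) by (simp add: stab_def)
      have "restrict \<gamma> ?Y = transport R \<beta> (\<lambda>x\<in>R. m \<rhd> x)"
      proof
        fix y show "restrict \<gamma> ?Y y = transport R \<beta> (\<lambda>x\<in>R. m \<rhd> x) y"
        proof (cases "y \<in> ?Y")
          case True
          then obtain r where r: "r \<in> R" "y = \<beta> r" using bR by blast
          then show ?thesis using True gb[of r] RV' transport_app[OF mbR r(1)] by auto
        qed (simp add: transport_def bR)
      qed
      moreover have "(\<lambda>x\<in>R. m \<rhd> x) \<in> K" using vm(2) by (simp add: M_def)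
      ultimately have "restrict \<gamma> ?Y \<in> transport R \<beta> ` K" by blast
      then obtain h where h: "h \<in> ?NN" "\<And>y. y \<in> ?Y \<Longrightarrow> \<gamma> y = h \<rhd> y"
        using normal_p_aut_realized[OF sW sg sY YW KY gst] by blast
      have bvN: "\<beta> v \<in> ?NN"
      proof
        show "\<beta> v \<in> normalizer S W" using normalizer_contains[OF sW] bV vm(1) by blast
        show "\<beta> v \<in> normalizer S ?Y" using mor_normalizer_image[OF mb RV' V'N R_sub] bR vm(1) by auto
      qed
      have hb: "\<beta> v \<otimes> h \<in> ?NN" by (rule subgroup.m_closed[OF sNN bvN h(1)])
      have "\<beta> (z \<rhd> r) = (\<beta> v \<otimes> h) \<rhd> \<beta> r" if r: "r \<in> R" for r
      proof -
        have rV: "r \<in> ?V'" and rC: "r \<in> carrier S" using r RV' subgroup.mem_carrier[OF R_sub] by auto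
        have C: "h \<in> carrier S" "\<beta> v \<in> carrier S" "\<beta> r \<in> carrier S"
          using subgroup.mem_carrier[OF sNN h(1)] mor_closed[OF mb vm(1)] mor_closed[OF mb rV] by auto
        have "z \<rhd> r = v \<rhd> (m \<rhd> r)"
          using vm(3) c rC by (simp add: m_assoc inv_mult_group)
        then have "\<beta> (z \<rhd> r) = \<beta> v \<rhd> \<beta> (m \<rhd> r)"
          using mor_conj_elem[OF mb vm(1) mcl[OF rV]] by simp
        also have "\<beta> (m \<rhd> r) = h \<rhd> \<beta> r"
          using gb[OF rV] h(2)[of "\<beta> r"] bR r by auto
        finally show ?thesis using C by (simp add: m_assoc inv_mult_group)
      qed
      then show ?thesis using hb by blast
    qed
    obtain \<psi>2 where p2: "mor N2 \<psi>2" "\<psi>2 ` ?V' = W" "\<And>r. r \<in> R \<Longrightarrow> \<psi>2 r = \<beta> r"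
      using extension_fixing[OF W sg mb bV R_sub RV' bR N2 VN2 N2N cond] by blast
    obtain \<kappa> where k: "mor (normalizer S ?Y) \<kappa>" "\<kappa> ` ?Y = R" using dominated[OF Y] by (auto simp: dominates_def)
    have RN1: "R \<subseteq> N1" and RN2: "R \<subseteq> N2" using RV VN1 RV' VN2 by auto
    have p2R: "\<psi>2 ` R = ?Y" using p2(3) bR by (metis image_cong)
    have "\<psi>1 ` N1 \<subseteq> normalizer S ?Y" using mor_normalizer_image[OF p1(1) RN1 _ R_sub] p1(3) by (auto simp: N1_def)
    then have m1: "mor N1 (\<lambda>x. \<kappa> (\<psi>1 x))" by (rule mor_comp[OF p1(1) k(1)])
    have "\<psi>2 ` N2 \<subseteq> normalizer S ?Y" using mor_normalizer_image[OF p2(1) RN2 N2N(2) R_sub] p2R by simp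
    then have m2: "mor N2 (\<lambda>x. \<kappa> (\<psi>2 x))" by (rule mor_comp[OF p2(1) k(1)])
    have i1: "(\<lambda>x. \<kappa> (\<psi>1 x)) ` R = R" and i2: "(\<lambda>x. \<kappa> (\<psi>2 x)) ` R = R" using p1(3) p2R k(2) by (metis image_image)+
    have "V \<subset> normalizer S R" using V(3) False M_N by blast
    then obtain z where "z \<in> normalizer S R" "z \<notin> V" "z \<in> normalizer S V" using normalizer_growth[OF V(1) N] by blast
    then have lt1: "V \<subset> N1" using VN1 by (auto simp: N1_def)
    have dd1: "depth U < depth N1" using d1[OF N1 lt1] by (auto simp: N1_def)
    obtain e1 where e1: "mor M e1" "\<forall>x\<in>R. e1 x = \<kappa> (\<psi>1 x)"
      using IH[OF N1 _ _ m1 i1 dd1] RV lt1 by (auto simp: N1_def)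
    \<comment> \<open>Otherwise the inverse of g would map M onto itself, by \<open>M_onto\<close>,
      and M would lie in V. This makes V' M, and hence N2, strictly larger than V'.\<close>
    have "\<not> M \<subseteq> ?V'"
    proof
      assume MV': "M \<subseteq> ?V'"
      have miM: "mor M ?i" by (rule mor_subset[OF mi M_sub MV'])
      have "M = ?i ` M" using M_onto[OF miM iR] by simp
      also have "\<dots> \<subseteq> V" using MV' iV by blast
      finally show False using False by blast
    qed
    then have "?V' \<subset> ?V' <#> M" using sVM by blast
    then obtain z where "z \<in> ?V' <#> M" "z \<notin> ?V'" "z \<in> normalizer S ?V'" using normalizer_growth[OF V' sVM(1)] by blast
    then have lt2: "?V' \<subset> N2" using VN2 by (auto simp: N2_def)
    have dd2: "depth U < depth N2" using d2[OF N2 lt2] N2N(2) fR by simp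
    obtain e2 where e2: "mor M e2" "\<forall>x\<in>R. e2 x = \<kappa> (\<psi>2 x)"
      using IH[OF N2 _ N2N(2) m2 i2 dd2] RV' lt2 by blast
    have e1R: "e1 ` R = R" and e2R: "e2 ` R = R" using e1(2) e2(2) i1 i2 by (metis (no_types, lifting) image_cong)+
    have e2M: "e2 ` M = M" by (rule M_onto[OF e2(1) e2R])
    have mi2: "mor M (inv_into M e2)" using mor_inv_into[OF e2(1)] e2M by simp
    have "mor M (\<lambda>x. inv_into M e2 (e1 x))" using mor_comp[OF e1(1) mi2] M_onto[OF e1(1) e1R] by simp
    moreover have "inv_into M e2 (e1 x) = f x" if x: "x \<in> R" for x
    proof -
      have fx: "f x \<in> R" using fR x by blast
      have "?i (f x) = x" using mor_inv_into_app[OF g(1), of x] gf[OF x] x RV by auto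
      then have "\<psi>2 (f x) = \<psi>1 x" using p2(3)[OF fx] by (simp add: \<beta>_def)
      then have "e1 x = e2 (f x)" using e1(2) e2(2) x fx by simp
      then show ?thesis using mor_inv_into_app[OF e2(1), of "f x"] fx R_M by auto
    qed
    ultimately show ?thesis by blast
  qed
qed

text \<open>The generating morphisms run between different members of the class, so the claim is
  transported to R on both sides. Quantifying over all \<chi> and \<chi>' makes it stable under
  composition, where \<open>dominated\<close> supplies a map for the intermediate subgroup.\<close>

lemma automorphism_extension:
  assumes a: "mor R \<alpha>" "\<alpha> ` R = R"
  obtains e where "mor M e" "e ` M = M" "\<And>x. x \<in> R \<Longrightarrow> e x = \<alpha> x"
proof -
  let ?Z = "\<lambda>Q f. \<forall>\<chi> \<chi>'. mor (normalizer S Q) \<chi> \<longrightarrow> \<chi> ` Q = R \<longrightarrow> mor (normalizer S (f ` Q)) \<chi>' \<longrightarrow> \<chi>' ` f ` Q = R \<longrightarrow>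
      (\<exists>e. mor M e \<and> (\<forall>x\<in>Q. e (\<chi> x) = \<chi>' (f x)))"
  have "?Z R \<alpha>"
  proof (rule class_generation[where Z = ?Z, OF _ _ _ R_PP a(1)])
    fix Q U f assume Q: "Q \<in> PP" and U: "subgroup U S" "Q \<subset> U" and f: "mor U f"
    show "?Z Q f"
    proof (intro allI impI)
      fix \<chi> \<chi>' assume c: "mor (normalizer S Q) \<chi>" "\<chi> ` Q = R" and c': "mor (normalizer S (f ` Q)) \<chi>'" "\<chi>' ` f ` Q = R"
      have sQ: "subgroup Q S" by (rule PP_sub[OF Q])
      define U' where "U' = U \<inter> normalizer S Q"
      have U': "subgroup U' S" unfolding U'_def by (rule subgroups_Inter_pair[OF U(1) normalizer_subgroup[OF sQ]])
      have mU': "mor U' f" by (rule mor_subset[OF f U']) (auto simp: U'_def)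
      obtain z where "z \<in> U" "z \<notin> Q" "z \<in> normalizer S Q" using normalizer_growth[OF sQ U] by blast
      then have QU': "Q \<subset> U'" using U(2) normalizer_contains[OF sQ] by (auto simp: U'_def)
      have U'N: "U' \<subseteq> normalizer S Q" by (auto simp: U'_def)
      have "f ` U' \<subseteq> normalizer S (f ` Q)" using mor_normalizer_image[OF mU' _ U'N sQ] QU' by blast
      then have m: "mor U' (\<lambda>x. \<chi>' (f x))" by (rule mor_comp[OF mU' c'(1)])
      have mc: "mor U' \<chi>" by (rule mor_subset[OF c(1) U' U'N])
      let ?i = "inv_into U' \<chi>" and ?V = "\<chi> ` U'"
      have i: "?i (\<chi> x) = x" if "x \<in> U'" for x by (rule mor_inv_into_app[OF mc that])
      have iV: "?i ` ?V = U'" "?i ` R = Q" using mor_image_cancel[OF mc order_refl] mor_image_cancel[OF mc, of Q] QU' c(2) by auto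
      have m': "mor ?V (\<lambda>v. \<chi>' (f (?i v)))" using mor_comp[OF mor_inv_into[OF mc] m] iV by simp
      have R': "(\<lambda>v. \<chi>' (f (?i v))) ` R = R"
      proof -
        have "(\<lambda>v. \<chi>' (f (?i v))) ` R = \<chi>' ` f ` ?i ` R" by (simp only: image_image)
        then show ?thesis using iV c'(2) by simp
      qed
      have "R \<subseteq> ?V" using c(2) QU' by blast
      moreover have "R \<noteq> ?V" using iV QU' by auto
      moreover have "?V \<subseteq> normalizer S R" using mor_normalizer_image[OF mc _ U'N sQ] QU' c(2) by auto
      ultimately obtain e where e: "mor M e" "\<forall>x\<in>R. e x = \<chi>' (f (?i x))"
        using automorphism_extension_step[OF mor_image_subgroup[OF mc] _ _ m' R'] by blast
      have "e (\<chi> x) = \<chi>' (f x)" if "x \<in> Q" for x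
      proof -
        have "\<chi> x \<in> R" using c(2) that by blast
        then show ?thesis using e(2) i[of x] that QU' by auto
      qed
      then show "\<exists>e. mor M e \<and> (\<forall>x\<in>Q. e (\<chi> x) = \<chi>' (f x))" using e(1) by blast
    qed
  next
    fix Q f g assume Q: "Q \<in> PP" and f: "mor Q f" and g: "mor (f ` Q) g" and Zf: "?Z Q f" and Zg: "?Z (f ` Q) g"
    show "?Z Q (\<lambda>x. g (f x))"
    proof (intro allI impI)
      fix \<chi> \<chi>' assume c: "mor (normalizer S Q) \<chi>" "\<chi> ` Q = R"
        and c': "mor (normalizer S ((\<lambda>x. g (f x)) ` Q)) \<chi>'" "\<chi>' ` (\<lambda>x. g (f x)) ` Q = R"
      have gf: "(\<lambda>x. g (f x)) ` Q = g ` f ` Q" by (simp add: image_image)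
      obtain \<xi> where xi: "mor (normalizer S (f ` Q)) \<xi>" "\<xi> ` f ` Q = R"
        using dominated[OF PP_conj[OF Q f]] by (auto simp: dominates_def)
      obtain e1 where e1: "mor M e1" "\<forall>x\<in>Q. e1 (\<chi> x) = \<xi> (f x)" using Zf c xi by blast
      have "\<exists>e. mor M e \<and> (\<forall>y\<in>f ` Q. e (\<xi> y) = \<chi>' (g y))"
        using Zg[rule_format, OF xi] c' unfolding gf by simp
      then obtain e2 where e2: "mor M e2" "\<forall>y\<in>f ` Q. e2 (\<xi> y) = \<chi>' (g y)" by blast
      have "e1 ` R = (\<lambda>x. e1 (\<chi> x)) ` Q" using c(2) by (metis image_image)
      also have "\<dots> = (\<lambda>x. \<xi> (f x)) ` Q" using e1(2) by (intro image_cong) auto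
      also have "\<dots> = R" using xi(2) by (simp add: image_image)
      finally have "e1 ` M = M" by (rule M_onto[OF e1(1)])
      then have "mor M (\<lambda>x. e2 (e1 x))" using mor_comp[OF e1(1) e2(1)] by simp
      moreover have "\<forall>x\<in>Q. e2 (e1 (\<chi> x)) = \<chi>' (g (f x))" using e1(2) e2(2) by simp
      ultimately show "\<exists>e. mor M e \<and> (\<forall>x\<in>Q. e (\<chi> x) = \<chi>' (g (f x)))" by blast
    qed
  next
    fix Q and f g :: "'a \<Rightarrow> 'a" assume eq: "\<And>x. x \<in> Q \<Longrightarrow> f x = g x" and Zf: "?Z Q f"
    have im: "g ` Q = f ` Q" using eq by (metis image_cong)
    show "?Z Q g" using Zf eq unfolding im by simp
  qed
  moreover have "mor (normalizer S R) (\<lambda>x. x)" by (rule mor_id[OF normalizer_subgroup[OF R_sub]])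
  ultimately obtain e where e: "mor M e" "\<forall>x\<in>R. e x = \<alpha> x" using a(2) by force
  have "e ` R = R" using e(2) a(2) by (metis image_cong)
  then show ?thesis using that[OF e(1) M_onto[OF e(1)]] e(2) by blast
qed

text \<open>M properly contains R, so it is nice and maps onto a good W. Automorphisms of R extend
  to M, so those of the image Y extend to W and Y is fully automized; domination carries this to R.
  For receptivity, automorphisms of R come first, starting from their extension to M; an isomorphism
  from another member Q is reduced to one by a map N_S(Q) -> N_S(R).\<close>

lemma R_good: "good R"
proof -
  have N: "subgroup (normalizer S R) S" by (rule normalizer_subgroup[OF R_sub])
  obtain W \<chi> where W: "good W" and chi: "mor M \<chi>" "\<chi> ` M = W" and sg: "stab_good W (\<chi> ` R)"
    using exists_stab_good[OF PP_big[OF R_PP M_sub R_less_M] R_M] by blast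
  let ?Y = "\<chi> ` R"
  have sW: "subgroup W S" using W by (simp add: good_def)
  have mR: "mor R \<chi>" by (rule mor_subset[OF chi(1) R_sub R_M])
  have Y: "?Y \<in> PP" by (rule PP_conj[OF R_PP mR])
  have sY: "subgroup ?Y S" by (rule PP_sub[OF Y])
  have YW: "?Y \<subseteq> W" using chi(2) R_M by blast
  let ?i = "inv_into M \<chi>"
  have mi: "mor W ?i" and iW: "?i ` W = M" and iY: "?i ` ?Y = R"
    using mor_inv_into[OF chi(1)] mor_image_cancel[OF chi(1) order_refl] mor_image_cancel[OF chi(1) R_M] chi(2) by auto
  have "fully_automized p S F ?Y"
  proof (rule stab_fully_automized[OF sW sg sY YW])
    fix \<alpha> assume a: "mor ?Y \<alpha>" "\<alpha> ` ?Y = ?Y"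
    have m1: "mor R (\<lambda>x. \<alpha> (\<chi> x))" using mor_comp[OF mR a(1)] by simp
    have im1: "(\<lambda>x. \<alpha> (\<chi> x)) ` R = ?Y" using a(2) by (simp add: image_image)
    have m2: "mor R (\<lambda>x. ?i (\<alpha> (\<chi> x)))" using mor_comp[OF m1 mor_subset[OF mi sY YW]] im1 by simp
    have im2: "(\<lambda>x. ?i (\<alpha> (\<chi> x))) ` R = R"
    proof -
      have "(\<lambda>x. ?i (\<alpha> (\<chi> x))) ` R = ?i ` (\<lambda>x. \<alpha> (\<chi> x)) ` R" by (simp only: image_image)
      then show ?thesis using im1 iY by simp
    qed
    obtain e where e: "mor M e" "e ` M = M" "\<And>x. x \<in> R \<Longrightarrow> e x = ?i (\<alpha> (\<chi> x))"
      using automorphism_extension[OF m2 im2] by blast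
    have m3: "mor W (\<lambda>u. e (?i u))" using mor_comp[OF mi e(1)] iW by simp
    have im3: "(\<lambda>u. e (?i u)) ` W = M" using iW e(2) by (metis image_image)
    have m4: "mor W (\<lambda>u. \<chi> (e (?i u)))" using mor_comp[OF m3 chi(1)] im3 by simp
    have im4: "(\<lambda>u. \<chi> (e (?i u))) ` W = W" using im3 chi(2) by (metis image_image)
    have "\<chi> (e (?i y)) = \<alpha> y" if y: "y \<in> ?Y" for y
    proof -
      obtain r where r: "r \<in> R" "y = \<chi> r" using y by blast
      have "?i y = r" using mor_inv_into_app[OF chi(1), of r] r R_M by auto
      moreover have "\<alpha> y \<in> \<chi> ` M" using a(2) y YW chi(2) by blast
      ultimately show ?thesis using e(3)[OF r(1)] r f_inv_into_f by metis
    qed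
    then show "\<exists>g. mor W g \<and> g ` W = W \<and> (\<forall>y\<in>?Y. g y = \<alpha> y)" using m4 im4 by blast
  qed
  moreover obtain \<kappa> where k: "mor (normalizer S ?Y) \<kappa>" "\<kappa> ` ?Y = R" using dominated[OF Y] by (auto simp: dominates_def)
  ultimately have fa: "fully_automized p S F R" using fully_automized_transport[OF _ k(1) sY] by simp
  obtain \<chi>1 where c1: "mor (normalizer S R) \<chi>1" "\<chi>1 ` M = W" "\<chi>1 ` R = ?Y"
    using extension_stab[OF W sg chi R_sub R_M refl N M_N N_normalizes_M order_refl] by blast
  have RN: "R \<subseteq> normalizer S R" by (rule normalizer_contains[OF R_sub])
  \<comment> \<open>By maximality of R the map \<chi>1 can be inverted on N_S(Y), so an extension of
    \<chi>1 \<alpha> can be brought back to one of \<alpha>.\<close>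
  have onto: "\<chi>1 ` normalizer S R = normalizer S ?Y" using maximal_onto[OF c1(1)] c1(3) by simp
  have ext: "\<exists>E. mor (N_ext S R \<alpha>) E \<and> (\<forall>x\<in>R. E x = \<alpha> x)" if a: "mor R \<alpha>" "\<alpha> ` R = R" for \<alpha>
  proof -
    let ?A = "N_ext S R \<alpha>"
    note iff = mem_N_ext_iff[OF a(1)]
    obtain e where e: "mor M e" "e ` M = M" "\<And>x. x \<in> R \<Longrightarrow> e x = \<alpha> x" using automorphism_extension[OF a] by blast
    have A: "subgroup ?A S" by (rule N_ext_subgroup[OF a(1)])
    have AN: "?A \<subseteq> normalizer S R" using iff by blast
    have MA: "M \<subseteq> ?A"
    proof
      fix m assume m: "m \<in> M"
      have mN: "m \<in> normalizer S R" using m M_N by blast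
      have "\<alpha> (m \<rhd> x) = e m \<rhd> \<alpha> x" if x: "x \<in> R" for x
        using mor_conj_elem[OF e(1) m, of x] e(3)[OF x] e(3)[OF normalizerD(2)[OF R_sub mN x]] x R_M by auto
      then show "m \<in> ?A" using iff mN mor_closed[OF e(1) m] by blast
    qed
    have mM: "mor M \<chi>1" by (rule mor_subset[OF c1(1) M_sub M_N])
    have mb: "mor M (\<lambda>x. \<chi>1 (e x))" using mor_comp[OF e(1) mM] e(2) by simp
    have bM: "(\<lambda>x. \<chi>1 (e x)) ` M = W" using e(2) c1(2) by (metis image_image)
    have eR: "e ` R = R" using e(3) a(2) by (metis image_cong)
    have bR: "(\<lambda>x. \<chi>1 (e x)) ` R = ?Y" using eR c1(3) by (metis image_image)
    have cond: "\<exists>h\<in>normalizer S W \<inter> normalizer S ?Y. \<forall>r\<in>R. \<chi>1 (e (g \<rhd> r)) = h \<rhd> \<chi>1 (e r)" if g: "g \<in> ?A" for g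
    proof -
      have gN: "g \<in> normalizer S R" using g AN by blast
      obtain h where h: "h \<in> carrier S" "\<forall>x\<in>R. \<alpha> (g \<rhd> x) = h \<rhd> \<alpha> x" using iff g by blast
      have hN: "h \<in> normalizer S R"
      proof (rule normalizerI[OF R_sub h(1)])
        fix y assume "y \<in> R"
        then obtain x where x: "x \<in> R" "y = \<alpha> x" using a(2) by blast
        have "g \<rhd> x \<in> R" using normalizerD(2)[OF R_sub gN x(1)] .
        then have "\<alpha> (g \<rhd> x) \<in> R" using a(2) by blast
        then show "h \<rhd> y \<in> R" using h(2) x by simp
      qed
      have "\<chi>1 (e (g \<rhd> r)) = \<chi>1 h \<rhd> \<chi>1 (e r)" if r: "r \<in> R" for r
      proof -
        have ar: "\<alpha> r \<in> normalizer S R" using a(2) r RN by blast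
        have "e (g \<rhd> r) = h \<rhd> \<alpha> r" using e(3)[OF normalizerD(2)[OF R_sub gN r]] h(2) r by simp
        then show ?thesis using mor_conj_elem[OF c1(1) hN ar] e(3)[OF r] by simp
      qed
      moreover have "\<chi>1 h \<in> normalizer S ?Y" using onto hN by blast
      moreover have "\<chi>1 h \<in> normalizer S W"
        using mor_normalizer_image[OF c1(1) M_N N_normalizes_M M_sub] c1(2) hN by auto
      ultimately show ?thesis by blast
    qed
    obtain \<psi> where psi: "mor ?A \<psi>" "\<psi> ` M = W" "\<And>r. r \<in> R \<Longrightarrow> \<psi> r = \<chi>1 (e r)"
      using extension_fixing[OF W sg mb bM R_sub R_M bR A MA _ AN cond] AN N_normalizes_M by blast
    have "\<psi> ` R = ?Y" using psi(3) bR by (metis image_cong)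
    then have "\<psi> ` ?A \<subseteq> \<chi>1 ` normalizer S R"
      using mor_normalizer_image[OF psi(1) _ AN R_sub] R_M MA onto by auto
    then have "mor ?A (\<lambda>x. inv_into (normalizer S R) \<chi>1 (\<psi> x))" by (rule mor_comp[OF psi(1) mor_inv_into[OF c1(1)]])
    moreover have "inv_into (normalizer S R) \<chi>1 (\<psi> x) = \<alpha> x" if x: "x \<in> R" for x
    proof -
      have "\<alpha> x \<in> normalizer S R" using a(2) x RN by blast
      then show ?thesis using psi(3)[OF x] e(3)[OF x] mor_inv_into_app[OF c1(1)] by simp
    qed
    ultimately show ?thesis by blast
  qed
  have "receptive S F R"
  proof (rule receptiveI[OF R_sub])
    fix Q f assume f: "mor Q f" "f ` Q = R"
    have Q: "Q \<in> PP" using PP_conj[OF R_PP mor_inv_into[OF f(1), unfolded f(2)]] mor_image_cancel[OF f(1) order_refl] f(2) by simp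
    have sQ: "subgroup Q S" by (rule PP_sub[OF Q])
    obtain \<xi> where xi: "mor (normalizer S Q) \<xi>" "\<xi> ` Q = R" using dominated[OF Q] by (auto simp: dominates_def)
    have QN: "Q \<subseteq> normalizer S Q" by (rule normalizer_contains[OF sQ])
    have mx: "mor Q \<xi>" by (rule mor_subset[OF xi(1) sQ QN])
    have i: "inv_into Q \<xi> (\<xi> x) = x" if "x \<in> Q" for x by (rule mor_inv_into_app[OF mx that])
    have iR: "inv_into Q \<xi> ` R = Q" using mor_image_cancel[OF mx order_refl] xi(2) by simp
    \<comment> \<open>On Q this factors f as \<alpha> \<xi>, with \<alpha> an automorphism of R and
      \<xi> defined on all of N_S(Q).\<close>
    define \<alpha> where "\<alpha> y = f (inv_into Q \<xi> y)" for y
    have a: "mor R \<alpha>" unfolding \<alpha>_def using mor_comp[OF mor_inv_into[OF mx] f(1)] iR xi(2) by simp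
    have aR: "\<alpha> ` R = R" unfolding \<alpha>_def using iR f(2) by (metis image_image)
    have ax: "\<alpha> (\<xi> x) = f x" if "x \<in> Q" for x using i[OF that] by (simp add: \<alpha>_def)
    obtain E where E: "mor (N_ext S R \<alpha>) E" "\<forall>x\<in>R. E x = \<alpha> x" using ext[OF a aR] by blast
    let ?A = "N_ext S Q f"
    have A: "subgroup ?A S" by (rule N_ext_subgroup[OF f(1)])
    have AN: "?A \<subseteq> normalizer S Q" using mem_N_ext_iff[OF f(1)] by blast
    have "\<xi> ` ?A \<subseteq> N_ext S R \<alpha>"
    proof clarify
      fix g assume g: "g \<in> ?A"
      then have gN: "g \<in> normalizer S Q" using AN by blast
      obtain h where h: "h \<in> carrier S" "\<forall>x\<in>Q. f (g \<rhd> x) = h \<rhd> f x" using mem_N_ext_iff[OF f(1)] g by blast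
      have "\<alpha> (\<xi> g \<rhd> y) = h \<rhd> \<alpha> y" if y: "y \<in> R" for y
      proof -
        obtain x where x: "x \<in> Q" "y = \<xi> x" using y xi(2) by blast
        have "\<xi> g \<rhd> y = \<xi> (g \<rhd> x)" using mor_conj_elem[OF xi(1) gN, of x] x QN by auto
        then show ?thesis using ax[OF normalizerD(2)[OF sQ gN x(1)]] ax[OF x(1)] h(2) x by simp
      qed
      moreover have "\<xi> g \<in> normalizer S R" using mor_normalizer_image[OF xi(1) QN order_refl sQ] xi(2) gN by auto
      ultimately show "\<xi> g \<in> N_ext S R \<alpha>" using mem_N_ext_iff[OF a] h(1) by blast
    qed
    then have "mor ?A (\<lambda>x. E (\<xi> x))" by (rule mor_comp[OF mor_subset[OF xi(1) A AN] E(1)])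
    moreover have "E (\<xi> x) = f x" if "x \<in> Q" for x
    proof -
      have "\<xi> x \<in> R" using xi(2) that by blast
      then show ?thesis using E(2) ax[OF that] by simp
    qed
    ultimately show "\<exists>\<psi>. mor (N_ext S Q f) \<psi> \<and> (\<forall>x\<in>Q. \<psi> x = f x)" by blast
  qed
  then show ?thesis using fa R_sub by (simp add: good_def)
qed

end

section \<open>The largest normal p-subgroup\<close>

context group begin

lemma normal_quotient_torsion:
  assumes N: "N \<lhd> G" and tN: "\<And>x. x \<in> N \<Longrightarrow> \<exists>n::nat. x [^] (p ^ n) = \<one>"
    and x: "x \<in> carrier G" and q: "\<exists>n::nat. (N #> x) [^]\<^bsub>G Mod N\<^esub> (p ^ n) = \<one>\<^bsub>G Mod N\<^esub>"
  shows "\<exists>n::nat. x [^] ((p::nat) ^ n) = \<one>"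
proof -
  interpret N: normal N G by (rule N)
  interpret h: group_hom G "G Mod N" "\<lambda>a. N #> a"
    using N.factorgroup_is_group N.r_coset_hom_Mod is_group by (simp add: group_hom_def group_hom_axioms_def)
  obtain n where n: "(N #> x) [^]\<^bsub>G Mod N\<^esub> (p ^ n) = \<one>\<^bsub>G Mod N\<^esub>" using q by blast
  have "N #> x [^] (p ^ n) = N" using h.hom_nat_pow[OF x, of "p ^ n"] n by simp
  then have "x [^] (p ^ n) \<in> N" using coset_join1[OF _ _ N.subgroup_axioms] x by simp
  then obtain m where "(x [^] (p ^ n)) [^] (p ^ m) = \<one>" using tN by blast
  then have "x [^] (p ^ (n + m)) = \<one>" using x by (simp add: nat_pow_pow power_add)
  then show ?thesis by blast
qed

definition normal_p :: "nat \<Rightarrow> 'a set \<Rightarrow> bool" where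
  "normal_p p N \<longleftrightarrow> N \<lhd> G \<and> (\<forall>x\<in>N. \<exists>n::nat. x [^] (p ^ n) = \<one>)"

lemma normal_p_iff: "normal_p p N \<longleftrightarrow> N \<lhd> G \<and> p_group p (G\<lparr>carrier := N\<rparr>)"
  using subgroup_imp_group[OF normal_imp_subgroup]
  by (auto simp: normal_p_def p_group_def nat_pow_consistent[symmetric])

text \<open>The product N M serves: modulo N its elements are images of elements of M, so they have
  p-power order there, and N is p-torsion.\<close>

lemma normal_p_mult:
  assumes N: "normal_p p N" and M: "normal_p p M" and x: "x \<in> N" "y \<in> M"
  shows "\<exists>L. normal_p p L \<and> x \<otimes> y \<in> L"
proof (intro exI conjI)
  have nN: "N \<lhd> G" and nM: "M \<lhd> G" using N M by (auto simp: normal_p_def)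
  interpret N: normal N G by (rule nN)
  interpret M: normal M G by (rule nM)
  interpret h: group_hom G "G Mod N" "\<lambda>a. N #> a"
    using N.factorgroup_is_group N.r_coset_hom_Mod is_group by (simp add: group_hom_def group_hom_axioms_def)
  show "x \<otimes> y \<in> N <#> M" using x by (auto simp: set_mult_def)
  have "subgroup (N <#> M) G"
    by (rule set_mult_subgroup[OF N.subgroup_axioms M.subgroup_axioms]) (use M.inv_op_closed2 in auto)
  then have "N <#> M \<lhd> G"
  proof (rule normal_invI)
    fix g z assume g: "g \<in> carrier G" and "z \<in> N <#> M"
    then obtain a b where ab: "a \<in> N" "b \<in> M" "z = a \<otimes> b" using mem_set_multE by metis
    have c: "a \<in> carrier G" "b \<in> carrier G" using ab by auto
    have "g \<otimes> z \<otimes> inv g = (g \<otimes> a \<otimes> inv g) \<otimes> (g \<otimes> b \<otimes> inv g)"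
      using c g ab(3) by (simp add: m_assoc)
    moreover have "g \<otimes> a \<otimes> inv g \<in> N" "g \<otimes> b \<otimes> inv g \<in> M"
      using N.inv_op_closed2[OF g ab(1)] M.inv_op_closed2[OF g ab(2)] by auto
    ultimately show "g \<otimes> z \<otimes> inv g \<in> N <#> M" by (auto simp: set_mult_def)
  qed
  moreover have "\<exists>n::nat. z [^] (p ^ n) = \<one>" if z: "z \<in> N <#> M" for z
  proof -
    obtain a b where ab: "a \<in> N" "b \<in> M" "z = a \<otimes> b" using mem_set_multE[OF z] by metis
    have c: "a \<in> carrier G" "b \<in> carrier G" using ab by auto
    obtain n where n: "b [^] (p ^ n) = \<one>" using M ab by (auto simp: normal_p_def)
    have "N #> z = (N #> a) \<otimes>\<^bsub>G Mod N\<^esub> (N #> b)" unfolding ab(3) by (rule h.hom_mult[OF c])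
    also have "N #> a = \<one>\<^bsub>G Mod N\<^esub>" using N.rcos_const[OF is_group ab(1)] by simp
    finally have "N #> z = N #> b" using h.H.l_one[OF h.hom_closed[OF c(2)]] by simp
    moreover have "(N #> b) [^]\<^bsub>G Mod N\<^esub> (p ^ n) = \<one>\<^bsub>G Mod N\<^esub>"
      using h.hom_nat_pow[OF c(2), of "p ^ n"] n h.hom_one by simp
    ultimately show ?thesis
      using normal_quotient_torsion[OF nN _ _ exI[of _ n], where x = z] N c ab(3) by (auto simp: normal_p_def)
  qed
  ultimately show "normal_p p (N <#> M)" by (simp add: normal_p_def)
qed

lemma normal_p_core: "normal_p p (p_core p G)"
proof -
  define U where "U = {x. \<exists>N. normal_p p N \<and> x \<in> N}"
  have "subgroup U G"
  proof
    show "U \<subseteq> carrier G" using normal_imp_subgroup subgroup.subset by (force simp: U_def normal_p_def)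
    have "normal_p p {\<one>}" using one_is_normal nat_pow_one by (auto simp: normal_p_def)
    then show "\<one> \<in> U" by (auto simp: U_def)
    fix x assume "x \<in> U"
    then obtain N where N: "normal_p p N" "x \<in> N" by (auto simp: U_def)
    then have "inv x \<in> N" using subgroup.m_inv_closed[OF normal_imp_subgroup] by (auto simp: normal_p_def)
    then show "inv x \<in> U" using N by (auto simp: U_def)
    fix y assume "y \<in> U"
    then show "x \<otimes> y \<in> U" using normal_p_mult[OF N(1) _ N(2)] by (auto simp: U_def)
  qed
  then have "U \<lhd> G"
  proof (rule normal_invI)
    fix g x assume g: "g \<in> carrier G" and "x \<in> U"
    then obtain N where N: "normal_p p N" "x \<in> N" by (auto simp: U_def)
    then have "g \<otimes> x \<otimes> inv g \<in> N" using normal.inv_op_closed2[OF _ g] by (auto simp: normal_p_def)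
    then show "g \<otimes> x \<otimes> inv g \<in> U" using N by (auto simp: U_def)
  qed
  then have U: "normal_p p U" by (auto simp: normal_p_def U_def)
  have "p_core p G = U" unfolding p_core_def normal_p_iff[symmetric]
    by (rule Greatest_equality) (use U in \<open>auto simp: U_def\<close>)
  then show ?thesis using U by simp
qed

end

section \<open>Origin of the normal p-subgroup of automorphisms\<close>

context fusion begin

lemma normal_p_aut_Inn: assumes Q: "subgroup Q S" shows "normal_p_aut Q (Inn S Q)"
proof -
  interpret B: group "BijGroup Q" by (rule group_BijGroup)
  interpret I: normal "Inn S Q" "Aut_F_group F Q" by (rule Inn_normal[OF Q])
  have "\<alpha> \<otimes>\<^bsub>BijGroup Q\<^esub> \<kappa> \<otimes>\<^bsub>BijGroup Q\<^esub> inv\<^bsub>BijGroup Q\<^esub> \<alpha> \<in> Inn S Q" if "\<alpha> \<in> Aut_F F Q" "\<kappa> \<in> Inn S Q" for \<alpha> \<kappa>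
    using I.inv_op_closed2[of \<alpha> \<kappa>] that B.m_inv_consistent[OF Aut_F_subgroup[OF Q] that(1)]
    by (simp add: Aut_F_group_def)
  then show ?thesis
    unfolding normal_p_aut_def
    using Inn_subgroup_Bij[OF Q] Inn_subset_Aut_S[OF Q] Aut_S_subset[OF Q] Aut_S_torsion[OF Q] by blast
qed

text \<open>K is an extension of a subgroup of the p-torsion group C by Inn(Q), which is p-torsion
  too.\<close>

lemma normal_p_aut_preimage:
  assumes Q: "subgroup Q S" and C: "group.normal_p (Out_F S F Q) p C"
  defines "K \<equiv> {\<gamma> \<in> Aut_F F Q. Inn S Q #>\<^bsub>BijGroup Q\<^esub> \<gamma> \<in> C}"
  shows "normal_p_aut Q K" "Inn S Q \<subseteq> K"
proof -
  interpret B: group "BijGroup Q" by (rule group_BijGroup)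
  interpret A: group "Aut_F_group F Q" by (rule group_Aut_F_group[OF Q])
  interpret I: normal "Inn S Q" "Aut_F_group F Q" by (rule Inn_normal[OF Q])
  interpret O: group "Out_F S F Q" unfolding Out_F_def by (rule I.factorgroup_is_group)
  let ?q = "\<lambda>g. Inn S Q #>\<^bsub>BijGroup Q\<^esub> g"
  interpret h: group_hom "Aut_F_group F Q" "Out_F S F Q" ?q
    using I.r_coset_hom_Mod A.is_group O.is_group by (simp add: Out_F_def group_hom_def group_hom_axioms_def)
  have nC: "C \<lhd> Out_F S F Q" using C by (simp add: O.normal_p_def)
  interpret C: normal C "Out_F S F Q" by (rule nC)
  have inv: "inv\<^bsub>Aut_F_group F Q\<^esub> \<gamma> = inv\<^bsub>BijGroup Q\<^esub> \<gamma>" if "\<gamma> \<in> Aut_F F Q" for \<gamma>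
    using B.m_inv_consistent[OF Aut_F_subgroup[OF Q] that] by (simp add: Aut_F_group_def)
  note A = Aut_F_subgroup[OF Q]
  have q1: "?q \<gamma> = \<one>\<^bsub>Out_F S F Q\<^esub>" if "\<gamma> \<in> Inn S Q" for \<gamma>
    using I.rcos_const[OF A.is_group that] by (simp add: Out_F_def)
  show "Inn S Q \<subseteq> K" using q1 I.subset C.one_closed by (auto simp: K_def)
  have qm: "?q (\<gamma> \<otimes>\<^bsub>BijGroup Q\<^esub> \<delta>) = ?q \<gamma> \<otimes>\<^bsub>Out_F S F Q\<^esub> ?q \<delta>" if "\<gamma> \<in> Aut_F F Q" "\<delta> \<in> Aut_F F Q" for \<gamma> \<delta>
    using h.hom_mult[of \<gamma> \<delta>] that by simp
  have qi: "?q (inv\<^bsub>BijGroup Q\<^esub> \<gamma>) = inv\<^bsub>Out_F S F Q\<^esub> ?q \<gamma>" if "\<gamma> \<in> Aut_F F Q" for \<gamma>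
    using h.hom_inv[of \<gamma>] inv that by simp
  have qC: "?q \<gamma> \<in> carrier (Out_F S F Q)" if "\<gamma> \<in> Aut_F F Q" for \<gamma> using h.hom_closed that by simp
  show "normal_p_aut Q K"
    unfolding normal_p_aut_def
  proof (intro conjI ballI)
    show KA: "K \<subseteq> Aut_F F Q" by (auto simp: K_def)
    show "subgroup K (BijGroup Q)"
    proof
      show "K \<subseteq> carrier (BijGroup Q)" using KA subgroup.subset[OF A] by blast
      show "\<one>\<^bsub>BijGroup Q\<^esub> \<in> K"
        using \<open>Inn S Q \<subseteq> K\<close> subgroup.one_closed[OF Inn_subgroup_Bij[OF Q]] by blast
      fix f assume f: "f \<in> K"
      then show "inv\<^bsub>BijGroup Q\<^esub> f \<in> K" using subgroup.m_inv_closed[OF A] qi C.m_inv_closed by (auto simp: K_def)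
      fix g assume "g \<in> K"
      then show "f \<otimes>\<^bsub>BijGroup Q\<^esub> g \<in> K" using f subgroup.m_closed[OF A] qm C.m_closed by (auto simp: K_def)
    qed
    fix \<kappa> assume k: "\<kappa> \<in> K"
    then have kA: "\<kappa> \<in> Aut_F F Q" and kC: "?q \<kappa> \<in> C" by (auto simp: K_def)
    have "\<exists>n::nat. \<kappa> [^]\<^bsub>Aut_F_group F Q\<^esub> (p ^ n) = \<one>\<^bsub>Aut_F_group F Q\<^esub>"
    proof (rule A.normal_quotient_torsion[OF I.normal_axioms])
      show "\<exists>n::nat. x [^]\<^bsub>Aut_F_group F Q\<^esub> (p ^ n) = \<one>\<^bsub>Aut_F_group F Q\<^esub>" if "x \<in> Inn S Q" for x
        using that Aut_S_torsion[OF Q] Inn_subset_Aut_S[OF Q] by (auto simp: Aut_F_group_def B.nat_pow_consistent[symmetric])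
      show "\<kappa> \<in> carrier (Aut_F_group F Q)" using kA by simp
      show "\<exists>n::nat. (Inn S Q #>\<^bsub>Aut_F_group F Q\<^esub> \<kappa>) [^]\<^bsub>Aut_F_group F Q Mod Inn S Q\<^esub> (p ^ n) = \<one>\<^bsub>Aut_F_group F Q Mod Inn S Q\<^esub>"
        using C kC unfolding O.normal_p_def unfolding Out_F_def by simp
    qed
    then show "\<exists>n::nat. \<kappa> [^]\<^bsub>BijGroup Q\<^esub> (p ^ n) = \<one>\<^bsub>BijGroup Q\<^esub>"
      by (auto simp: Aut_F_group_def B.nat_pow_consistent[symmetric])
    fix \<alpha> assume a: "\<alpha> \<in> Aut_F F Q"
    have ak: "\<alpha> \<otimes>\<^bsub>BijGroup Q\<^esub> \<kappa> \<in> Aut_F F Q" using subgroup.m_closed[OF A a kA] .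
    have ia: "inv\<^bsub>BijGroup Q\<^esub> \<alpha> \<in> Aut_F F Q" using subgroup.m_inv_closed[OF A a] .
    have "?q (\<alpha> \<otimes>\<^bsub>BijGroup Q\<^esub> \<kappa> \<otimes>\<^bsub>BijGroup Q\<^esub> inv\<^bsub>BijGroup Q\<^esub> \<alpha>) = ?q \<alpha> \<otimes>\<^bsub>Out_F S F Q\<^esub> ?q \<kappa> \<otimes>\<^bsub>Out_F S F Q\<^esub> inv\<^bsub>Out_F S F Q\<^esub> ?q \<alpha>"
      using qm[OF ak ia] qm[OF a kA] qi[OF a] by simp
    also have "\<dots> \<in> C" using C.inv_op_closed2[OF qC[OF a] kC] .
    finally show "\<alpha> \<otimes>\<^bsub>BijGroup Q\<^esub> \<kappa> \<otimes>\<^bsub>BijGroup Q\<^esub> inv\<^bsub>BijGroup Q\<^esub> \<alpha> \<in> K"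
      using subgroup.m_closed[OF A ak ia] by (simp add: K_def)
  qed
qed

text \<open>For some admissible K the group N_S^K(Q) is strictly larger than Q.\<close>

definition p_normalized :: "'a set \<Rightarrow> bool" where
  "p_normalized Q \<longleftrightarrow> (\<exists>K g. normal_p_aut Q K \<and> Inn S Q \<subseteq> K \<and> g \<in> normalizer S Q \<and> g \<notin> Q \<and>
     (\<lambda>x\<in>Q. g \<rhd> x) \<in> K)"

text \<open>A nontrivial element of the intersection is the class of conjugation by some g in
  N_S(Q), and g cannot lie in Q; K is the preimage of the p-core.\<close>

lemma p_normalized_core:
  assumes Q: "subgroup Q S"
    and ne: "p_core p (Out_F S F Q) \<inter> carrier (Out_S S Q) \<noteq> {\<one>\<^bsub>Out_F S F Q\<^esub>}"
  shows "p_normalized Q"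
proof -
  interpret I: normal "Inn S Q" "Aut_F_group F Q" by (rule Inn_normal[OF Q])
  interpret O: group "Out_F S F Q" unfolding Out_F_def by (rule I.factorgroup_is_group)
  let ?q = "\<lambda>g. Inn S Q #>\<^bsub>BijGroup Q\<^esub> g"
  have C: "O.normal_p p (p_core p (Out_F S F Q))" by (rule O.normal_p_core)
  have cS: "carrier (Out_S S Q) = ?q ` Aut_S S Q"
    by (simp add: Out_S_def carrier_FactGroup Aut_S_group_def r_coset_def)
  have q1: "?q f = \<one>\<^bsub>Out_F S F Q\<^esub>" if "f \<in> Inn S Q" for f
    using I.rcos_const[OF I.is_group that] by (simp add: Out_F_def)
  have "\<one>\<^bsub>BijGroup Q\<^esub> \<in> Inn S Q" using subgroup.one_closed[OF Inn_subgroup_Bij[OF Q]] .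
  then have "\<one>\<^bsub>Out_F S F Q\<^esub> \<in> carrier (Out_S S Q)"
    using q1 Inn_subset_Aut_S[OF Q] unfolding cS by (metis image_eqI subsetD)
  moreover have "\<one>\<^bsub>Out_F S F Q\<^esub> \<in> p_core p (Out_F S F Q)"
    using C subgroup.one_closed[OF normal_imp_subgroup] by (auto simp: O.normal_p_def)
  ultimately obtain c where c: "c \<in> p_core p (Out_F S F Q)" "c \<in> carrier (Out_S S Q)" "c \<noteq> \<one>\<^bsub>Out_F S F Q\<^esub>"
    using ne by blast
  then obtain f where f: "f \<in> Aut_S S Q" "c = ?q f" unfolding cS by blast
  then obtain g where g: "g \<in> normalizer S Q" "f = (\<lambda>x\<in>Q. g \<rhd> x)" using Aut_S_iff[OF Q] by blast
  have "f \<notin> Inn S Q" using q1 c f by blast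
  then have "g \<notin> Q" using g unfolding Inn_eq by blast
  moreover have "f \<in> {\<gamma> \<in> Aut_F F Q. ?q \<gamma> \<in> p_core p (Out_F S F Q)}" using f c Aut_S_subset[OF Q] by blast
  ultimately show ?thesis
    unfolding p_normalized_def using normal_p_aut_preimage[OF Q C] g by blast
qed

text \<open>K = Inn(Q) works: g acts trivially on Q, hence as an inner automorphism, without lying
  in Q.\<close>

lemma p_normalized_noncentric:
  assumes Q: "subgroup Q S" and g: "g \<in> centralizer S Q" "g \<notin> Q"
  shows "p_normalized Q"
proof -
  have gC: "g \<in> carrier S" and c: "\<And>x. x \<in> Q \<Longrightarrow> g \<otimes> x = x \<otimes> g" using g by (auto simp: centralizer_iff)
  have QC: "\<And>x. x \<in> Q \<Longrightarrow> x \<in> carrier S" using subgroup.mem_carrier[OF Q] .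
  have fix_: "g \<rhd> x = x" if "x \<in> Q" for x using c[OF that] QC[OF that] gC by (simp add: m_assoc)
  have "(\<lambda>x\<in>Q. g \<rhd> x) = (\<lambda>x\<in>Q. \<one> \<rhd> x)" using fix_ QC by (auto simp: fun_eq_iff)
  also have "\<dots> \<in> Inn S Q" using subgroup.one_closed[OF Q] unfolding Inn_eq by blast
  finally show ?thesis
    unfolding p_normalized_def using normal_p_aut_Inn[OF Q] g(2) normalizerI[OF Q gC] fix_ by (metis order_refl)
qed

text \<open>f is injective on all of N_S(Q), so an element of N_S(Q) outside Q stays outside f
  Q.\<close>

lemma p_normalized_transport:
  assumes Q: "subgroup Q S" and pn: "p_normalized Q" and f: "mor (normalizer S Q) f"
  shows "p_normalized (f ` Q)"
proof -
  obtain K g where K: "normal_p_aut Q K" "Inn S Q \<subseteq> K" and g: "g \<in> normalizer S Q" "g \<notin> Q"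
    "(\<lambda>x\<in>Q. g \<rhd> x) \<in> K" using pn by (auto simp: p_normalized_def)
  have QN: "Q \<subseteq> normalizer S Q" by (rule normalizer_contains[OF Q])
  have mQ: "mor Q f" by (rule mor_subset[OF f Q QN])
  note t = transport_conj[OF f Q QN]
  have "normal_p_aut (f ` Q) (transport Q f ` K)" by (rule normal_p_aut_transport[OF K(1) mQ])
  moreover have "Inn S (f ` Q) \<subseteq> transport Q f ` K"
  proof
    fix c assume "c \<in> Inn S (f ` Q)"
    then obtain u where u: "u \<in> Q" "c = (\<lambda>r\<in>f ` Q. f u \<rhd> r)" unfolding Inn_eq by blast
    have "(\<lambda>x\<in>Q. u \<rhd> x) \<in> K" using u(1) K(2) unfolding Inn_eq by blast
    moreover have "c = transport Q f (\<lambda>x\<in>Q. u \<rhd> x)" using t[of u] u QN by auto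
    ultimately show "c \<in> transport Q f ` K" by blast
  qed
  moreover have "f g \<in> normalizer S (f ` Q)" using mor_normalizer_image[OF f QN order_refl Q] g(1) by blast
  moreover have "f g \<notin> f ` Q" using mor_inj[OF f] g QN by (auto simp: inj_on_def)
  moreover have "(\<lambda>r\<in>f ` Q. f g \<rhd> r) \<in> transport Q f ` K" using t[OF g(1) g(1)] g(3) by (metis image_eqI)
  ultimately show ?thesis unfolding p_normalized_def by blast
qed

end

text \<open>The property is given at some member Q, whereas the construction needs K at the member R
  with deepest normalizer; domination moves K from Q to R.\<close>

lemma (in minimal_class) class_nice:
  assumes Q: "Q \<in> PP" and pn: "p_normalized Q" and P: "P \<in> PP"
  shows "nice P"
proof -
  obtain R where R: "R \<in> PP" "\<And>X. X \<in> PP \<Longrightarrow> depth (normalizer S X) \<le> depth (normalizer S R)"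
    using ex_has_greatest_nat[of "\<lambda>X. X \<in> PP" Q "\<lambda>X. depth (normalizer S X)" "Suc max_depth"]
      Q depth_le_max[OF normalizer_subgroup[OF PP_sub]] by (metis le_imp_less_Suc)
  interpret maximal_member S p F HH PP R by unfold_locales (use R in auto)
  obtain \<chi> where chi: "mor (normalizer S Q) \<chi>" "\<chi> ` Q = R" using dominated[OF Q] by (auto simp: dominates_def)
  have "p_normalized R" using p_normalized_transport[OF PP_sub[OF Q] pn chi(1)] chi(2) by simp
  then obtain K g where K: "normal_p_aut R K" "Inn S R \<subseteq> K" and g: "g \<in> normalizer S R" "g \<notin> R"
    "(\<lambda>x\<in>R. g \<rhd> x) \<in> K" by (auto simp: p_normalized_def)
  interpret p_normalized_member S p F HH PP R K "{g \<in> normalizer S R. (\<lambda>x\<in>R. g \<rhd> x) \<in> K}"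
    by unfold_locales (use K g in auto)
  have "good R" by (rule R_good)
  moreover obtain f where "mor P f" "f ` P = R" using PP_iso[OF P R(1)] by blast
  ultimately show ?thesis unfolding nice_def by blast
qed

section \<open>The induction over all subgroups\<close>

context bullet_family begin

text \<open>Induction on depth, from large to small, where P may be replaced by P^\<bullet>. A
  subgroup properly containing a conjugate Q of P^\<bullet> is strictly deeper than Q: equal depths
  would give equal bullets, but Q is its own bullet.\<close>

lemma all_nice:
  assumes iv: "\<And>B. B \<in> F_bullet p S F \<Longrightarrow> F_centric S F B \<Longrightarrow> B \<notin> HH \<Longrightarrow>
      \<exists>Q\<in>conj_class S F B. p_core p (Out_F S F Q) \<inter> carrier (Out_S S Q) \<noteq> {\<one>\<^bsub>Out_F S F Q\<^esub>}"
  shows "subgroup P S \<Longrightarrow> nice P"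
proof (induction "max_depth - depth P" arbitrary: P rule: less_induct)
  case less
  note P = less.prems
  let ?B = "bul P"
  have B: "subgroup ?B S" by (rule bul_subgroup[OF P])
  have dB: "depth ?B = depth P" using bul_idem[OF P] by (simp add: depth_def)
  have "nice ?B"
  proof (cases "?B \<in> HH")
    case False
    let ?PP = "conj_class S F ?B"
    have PPD: "subgroup Q S" "Q \<notin> HH" "\<And>h. mor Q h \<Longrightarrow> h ` Q \<in> ?PP"
      "\<And>R. R \<in> ?PP \<Longrightarrow> \<exists>h. mor Q h \<and> h ` Q = R" "\<And>U. subgroup U S \<Longrightarrow> Q \<subset> U \<Longrightarrow> nice U"
      if "Q \<in> ?PP" for Q
    proof -
      obtain f where f: "mor ?B f" "Q = f ` ?B" using \<open>Q \<in> ?PP\<close> unfolding conj_class_iff[OF B] by blast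
      show sQ: "subgroup Q S" using mor_image_subgroup[OF f(1)] f(2) by simp
      have mi: "mor Q (inv_into ?B f)" and iQ: "inv_into ?B f ` Q = ?B"
        using mor_inv_into[OF f(1)] mor_image_cancel[OF f(1) order_refl] f(2) by auto
      show "Q \<notin> HH"
      proof
        assume "Q \<in> HH"
        moreover have "?B \<in> conj_class S F Q" using conj_class_iff[OF sQ] mi iQ by blast
        ultimately show False using HH_conj False by blast
      qed
      show "h ` Q \<in> ?PP" if h: "mor Q h" for h
      proof -
        have "mor ?B (\<lambda>x. h (f x))" using mor_comp[OF f(1) h] f(2) by simp
        moreover have "(\<lambda>x. h (f x)) ` ?B = h ` Q" using f(2) by (simp add: image_image)
        ultimately show ?thesis unfolding conj_class_iff[OF B] by blast
      qed
      show "\<exists>h. mor Q h \<and> h ` Q = R" if R: "R \<in> ?PP" for R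
      proof -
        obtain k where k: "mor ?B k" "R = k ` ?B" using R unfolding conj_class_iff[OF B] by blast
        have "mor Q (\<lambda>x. k (inv_into ?B f x))" using mor_comp[OF mi k(1)] iQ by simp
        moreover have "(\<lambda>x. k (inv_into ?B f x)) ` Q = k ` inv_into ?B f ` Q" by (simp only: image_image)
        ultimately show ?thesis using iQ k(2) by metis
      qed
      show "nice U" if U: "subgroup U S" "Q \<subset> U" for U
      proof (rule less.hyps[OF _ U(1)])
        have dQ: "depth Q = depth P" using depth_image[OF f(1)] dB f(2) by simp
        have QU: "Q \<subseteq> U" using U(2) by blast
        have bQ: "bul Q = Q" using bul_image[of ?B f] bul_idem[OF P] f B by simp
        have "\<not> depth U \<le> depth Q"
        proof
          assume "depth U \<le> depth Q"
          then have "bul Q = bul U" by (rule depth_subset(2)[OF sQ U(1) QU])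
          then show False using bul_contains[OF U(1)] bQ U(2) by blast
        qed
        then show "max_depth - depth U < max_depth - depth P" using depth_le_max[OF U(1)] dQ by linarith
      qed
    qed
    interpret minimal_class S p F HH ?PP
      using bullet_family_axioms PPD
      by (intro minimal_class.intro minimal_class_axioms.intro)
    have BB: "?B \<in> ?PP" unfolding conj_class_iff[OF B] using mor_id[OF B] by (intro exI[of _ "\<lambda>x. x"]) simp
    have "\<exists>Q\<in>?PP. p_normalized Q"
    \<comment> \<open>Condition (iv) speaks of centric subgroups; otherwise some member has
      centralizing elements outside itself, and inner automorphisms serve as K.\<close>
    proof (cases "F_centric S F ?B")
      case True
      have "?B \<in> F_bullet p S F" using P by (auto simp: F_bullet_def)
      then obtain Q where Q: "Q \<in> conj_class S F ?B"
        "p_core p (Out_F S F Q) \<inter> carrier (Out_S S Q) \<noteq> {\<one>\<^bsub>Out_F S F Q\<^esub>}" using iv True False by blast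
      then show ?thesis using p_normalized_core[OF PP_sub Q(2)] by blast
    next
      case False
      then obtain Q where Q: "Q \<in> ?PP" "centralizer S Q \<noteq> centralizer (S\<lparr>carrier := Q\<rparr>) Q"
        by (auto simp: F_centric_def)
      have "Q \<subseteq> carrier S" using subgroup.subset[OF PP_sub[OF Q(1)]] .
      then have "\<exists>g. g \<in> centralizer S Q \<and> g \<notin> Q" using Q(2) by (auto simp: centralizer_def)
      then show ?thesis using p_normalized_noncentric[OF PP_sub[OF Q(1)]] Q(1) by blast
    qed
    then show ?thesis using class_nice BB by blast
  qed (rule HH_nice)
  then show ?case by (rule nice_of_bul[OF P])
qed

end

theorem theorem4p2:
  fixes p :: nat
    and S :: "('a, 'b) monoid_scheme"
    and F :: "'a set \<Rightarrow> 'a set \<Rightarrow> ('a \<Rightarrow> 'a) set"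
    and \<H> :: "'a set set"
  assumes "Factorial_Ring.prime p"
    and "fusion_system p S F"
    and "finite (Aut_F F (identity_component p S))"
    and "\<forall>P. subgroup P S \<longrightarrow>
           (\<forall>\<phi>\<in>F P (identity_component p S).
              \<exists>\<psi>\<in>F (P <#>\<^bsub>S\<^esub> identity_component p (S\<lparr>carrier := centralizer S P\<rparr>))
                      (identity_component p S).
                restrict \<psi> P = \<phi>)"
    and "\<forall>P\<in>\<H>. subgroup P S"
    and "\<forall>P\<in>\<H>. \<forall>Q\<in>conj_class S F P. Q \<in> \<H>"
    and "closed_family \<H>"
    and "family_generated S F \<H>"
    and "family_saturated p S F \<H>"
    and "\<forall>P\<in>\<H>. \<forall>Q. subgroup Q S \<longrightarrow> P \<subseteq> Q \<longrightarrow> Q \<subseteq> bullet p S F P \<longrightarrow> Q \<in> \<H>"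
    and "\<forall>P\<in>F_bullet p S F. F_centric S F P \<longrightarrow> P \<notin> \<H> \<longrightarrow>
           (\<exists>Q\<in>conj_class S F P.
              p_core p (Out_F S F Q) \<inter> carrier (Out_S S Q) \<noteq> {\<one>\<^bsub>Out_F S F Q\<^esub>})"
  shows "saturated p S F"
proof -
  have toral_S: "discrete_p_toral p S" using assms(2) by (simp add: fusion_system_def)
  then interpret group S by (simp add: discrete_p_toral_def)
  interpret bullet_family S p F \<H>
    by unfold_locales (fact assms toral_S)+
  have "nice P" if P: "subgroup P S" for P
    by (rule all_nice[OF assms(11)[rule_format] P])
  then show ?thesis using continuity by (rule saturatedI)
qed

end
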